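(* Let $n\ge2$, let $\Omega\subset\mathbb{R}^n$ be a bounded Lipschitz domain, let $\frac12<s<1$, $\phi\in H^{-s+\frac12}(\partial\Omega)$ and $u=\mathcal{S}_s\phi$. Then $\Delta^s u=0$ in $\mathbb{R}^n\setminus\partial\Omega$.
   Context: $\partial\Omega$ carries surface measure $dQ$. $\Gamma_{2s}(x)=c(n,s)|x|^{-(n-2s)}$ is the Riesz kernel of order $2s$, with $c(n,s)>0$ chosen so that its Fourier transform is $|\xi|^{-2s}$. For $0<\alpha<1$, $H^\alpha(\partial\Omega)$ is the space of $\phi\in L^2(\partial\Omega)$ with $\int_{\partial\Omega}\int_{\partial\Omega}\frac{|\phi(P)-\phi(Q)|^2}{|P-Q|^{n-1+2\alpha}}dPdQ<\infty$, and $H^{-\alpha}(\partial\Omega)=(H^\alpha(\partial\Omega))^*$ with pairing $\langle\cdot,\cdot\rangle$. $\mathcal{S}_s\phi(x)=\langle\phi,\Gamma_{2s}(x-\cdot)\rangle$ for $x\in\mathbb{R}^n\setminus\partial\Omega$; this function lies in $\dot H^s(\mathbb{R}^n)=\{v\in L^2_{loc}:\int|\xi|^{2s}|\hat v|^2d\xi<\infty\}$. $\Delta^s$ is the fractional Laplacian, the Fourier multiplier with symbol $-(2\pi|\xi|)^{2s}$; "$\Delta^s u=0$ in $\mathbb{R}^n\setminus\partial\Omega$" means $\int_{\mathbb{R}^n}|\xi|^{2s}\hat u(\xi)\overline{\hat\psi(\xi)}\,d\xi=0$ for every $\psi\in C_c^\infty(\mathbb{R}^n\setminus\partial\Omega)$.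 *)

theory Defs
  imports "HOL-Analysis.Analysis"
begin

text \<open>A Lipschitz domain: a nonempty open connected set which, near every boundary point p,
  is (in a suitable rotated coordinate system with vertical unit direction e) the region below
  the graph of a Lipschitz function gamma defined on the hyperplane orthogonal to e.\<close>
definition lipschitz_domain :: "'a::euclidean_space set \<Rightarrow> bool" where
  "lipschitz_domain \<Omega> \<longleftrightarrow> open \<Omega> \<and> connected \<Omega> \<and> \<Omega> \<noteq> {} \<and>
     (\<forall>p\<in>frontier \<Omega>. \<exists>r>0. \<exists>e. norm e = 1 \<and>
        (\<exists>L (\<gamma>::'a \<Rightarrow> real). lipschitz_on L {y. y \<bullet> e = 0} \<gamma> \<and>
           (\<forall>x\<in>ball p r. x \<in> \<Omega> \<longleftrightarrow> x \<bullet> e < \<gamma> (x - (x \<bullet> e) *\<^sub>R e))))"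

definition bounded_lipschitz_domain :: "'a::euclidean_space set \<Rightarrow> bool" where
  "bounded_lipschitz_domain \<Omega> \<longleftrightarrow> bounded \<Omega> \<and> lipschitz_domain \<Omega>"

definition hausdorff_pre :: "real \<Rightarrow> real \<Rightarrow> 'a::euclidean_space set \<Rightarrow> ennreal" where
  "hausdorff_pre d \<delta> A =
     (INF C \<in> {C :: nat \<Rightarrow> 'a set. A \<subseteq> (\<Union>i. C i) \<and> (\<forall>i. bounded (C i) \<and> diameter (C i) \<le> \<delta>)}.
        (\<Sum>i. ennreal (unit_ball_vol d * (diameter (C i) / 2) powr d)))"

definition hausdorff_outer :: "real \<Rightarrow> 'a::euclidean_space set \<Rightarrow> ennreal" where
  "hausdorff_outer d A = (SUP \<delta>\<in>{0<..}. hausdorff_pre d \<delta> A)"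

definition hausdorff_measure :: "real \<Rightarrow> 'a::euclidean_space measure" where
  "hausdorff_measure d = measure_of UNIV (sets borel) (hausdorff_outer d)"

definition surf :: "'a::euclidean_space set \<Rightarrow> 'a measure" where
  "surf \<Omega> = restrict_space (hausdorff_measure (real DIM('a) - 1)) (frontier \<Omega>)"

definition bdry_L2sq :: "'a::euclidean_space set \<Rightarrow> ('a \<Rightarrow> real) \<Rightarrow> ennreal" where
  "bdry_L2sq \<Omega> f = (\<integral>\<^sup>+ Q. ennreal ((f Q)\<^sup>2) \<partial>surf \<Omega>)"

definition bdry_seminormsq :: "real \<Rightarrow> 'a::euclidean_space set \<Rightarrow> ('a \<Rightarrow> real) \<Rightarrow> ennreal" where
  "bdry_seminormsq \<alpha> \<Omega> f =
     (\<integral>\<^sup>+ P. \<integral>\<^sup>+ Q. ennreal ((f P - f Q)\<^sup>2 / norm (P - Q) powr (real DIM('a) - 1 + 2 * \<alpha>)) \<partial>surf \<Omega> \<partial>surf \<Omega>)"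

definition Hspace :: "real \<Rightarrow> 'a::euclidean_space set \<Rightarrow> ('a \<Rightarrow> real) set" where
  "Hspace \<alpha> \<Omega> = {f. f \<in> borel_measurable (surf \<Omega>) \<and> bdry_L2sq \<Omega> f < \<infinity> \<and> bdry_seminormsq \<alpha> \<Omega> f < \<infinity>}"

definition Hnorm :: "real \<Rightarrow> 'a::euclidean_space set \<Rightarrow> ('a \<Rightarrow> real) \<Rightarrow> real" where
  "Hnorm \<alpha> \<Omega> f = sqrt (enn2real (bdry_L2sq \<Omega> f) + enn2real (bdry_seminormsq \<alpha> \<Omega> f))"

definition Hdual :: "real \<Rightarrow> 'a::euclidean_space set \<Rightarrow> (('a \<Rightarrow> real) \<Rightarrow> real) set" where
  "Hdual \<alpha> \<Omega> = {T. (\<forall>f\<in>Hspace \<alpha> \<Omega>. \<forall>g\<in>Hspace \<alpha> \<Omega>. T (\<lambda>x. f x + g x) = T f + T g) \<and>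
                     (\<forall>f\<in>Hspace \<alpha> \<Omega>. \<forall>c. T (\<lambda>x. c * f x) = c * T f) \<and>
                     (\<exists>C. \<forall>f\<in>Hspace \<alpha> \<Omega>. \<bar>T f\<bar> \<le> C * Hnorm \<alpha> \<Omega> f)}"

text \<open>c(n,s) such that the Fourier transform (convention exp(-2 pi i x.xi)) of
  c(n,s) |x|^{-(n-2s)} is |xi|^{-2s}.\<close>
definition riesz_const :: "nat \<Rightarrow> real \<Rightarrow> real" where
  "riesz_const n s = Gamma (real n / 2 - s) / (pi powr (real n / 2 - 2 * s) * Gamma s)"

definition riesz_kernel :: "real \<Rightarrow> 'a::euclidean_space \<Rightarrow> real" where
  "riesz_kernel s x = riesz_const DIM('a) s * norm x powr (- (real DIM('a) - 2 * s))"

definition fourier :: "('a::euclidean_space \<Rightarrow> complex) \<Rightarrow> 'a \<Rightarrow> complex" where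
  "fourier f \<xi> = (LINT x|lebesgue. f x * cis (- 2 * pi * (x \<bullet> \<xi>)))"

text \<open>C-infinity: all iterated directional (Frechet) derivatives exist everywhere.\<close>
definition smooth_fun :: "('a::euclidean_space \<Rightarrow> real) \<Rightarrow> bool" where
  "smooth_fun f \<longleftrightarrow> (\<exists>S. f \<in> S \<and> (\<forall>g\<in>S. \<forall>x. g differentiable (at x)) \<and>
                         (\<forall>g\<in>S. \<forall>v. (\<lambda>x. frechet_derivative g (at x) v) \<in> S))"

definition tsupport :: "('a::euclidean_space \<Rightarrow> real) \<Rightarrow> 'a set" where
  "tsupport f = closure {x. f x \<noteq> 0}"

definition test_fun :: "'a::euclidean_space set \<Rightarrow> ('a \<Rightarrow> real) \<Rightarrow> bool" where
  "test_fun U \<psi> \<longleftrightarrow> smooth_fun \<psi> \<and> compact (tsupport \<psi>) \<and> tsupport \<psi> \<subseteq> U"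

definition is_fourier_of :: "('a::euclidean_space \<Rightarrow> real) \<Rightarrow> ('a \<Rightarrow> complex) \<Rightarrow> bool" where
  "is_fourier_of u w \<longleftrightarrow> w \<in> borel_measurable lebesgue \<and>
     (\<forall>\<psi>. test_fun UNIV \<psi> \<longrightarrow>
        integrable lebesgue (\<lambda>x. complex_of_real (u x) * fourier (\<lambda>y. complex_of_real (\<psi> y)) x) \<and>
        integrable lebesgue (\<lambda>\<xi>. w \<xi> * complex_of_real (\<psi> \<xi>)) \<and>
        (LINT x|lebesgue. complex_of_real (u x) * fourier (\<lambda>y. complex_of_real (\<psi> y)) x)
          = (LINT \<xi>|lebesgue. w \<xi> * complex_of_real (\<psi> \<xi>)))"

definition Hdot :: "real \<Rightarrow> ('a::euclidean_space \<Rightarrow> real) \<Rightarrow> ('a \<Rightarrow> complex) \<Rightarrow> bool" where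
  "Hdot s u w \<longleftrightarrow> u \<in> borel_measurable lebesgue \<and>
     (\<forall>K. compact K \<longrightarrow> (\<integral>\<^sup>+ x. ennreal ((u x)\<^sup>2 * indicator K x) \<partial>lebesgue) < \<infinity>) \<and>
     is_fourier_of u w \<and>
     (\<integral>\<^sup>+ \<xi>. ennreal (norm \<xi> powr (2 * s) * (cmod (w \<xi>))\<^sup>2) \<partial>lebesgue) < \<infinity>"

definition frac_harmonic_in :: "real \<Rightarrow> ('a::euclidean_space \<Rightarrow> real) \<Rightarrow> 'a set \<Rightarrow> bool" where
  "frac_harmonic_in s u U \<longleftrightarrow> (\<exists>w. Hdot s u w \<and>
     (\<forall>\<psi>. test_fun U \<psi> \<longrightarrow>
        (LINT \<xi>|lebesgue. complex_of_real (norm \<xi> powr (2 * s)) * w \<xi>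
                          * cnj (fourier (\<lambda>y. complex_of_real (\<psi> y)) \<xi>)) = 0))"

end

theory Submission
  imports Defs "HOL-Probability.Characteristic_Functions"
begin

text \<open>
  Write \<open>F\<close> for the boundary, \<open>e\<^sub>\<xi>\<close> for the character \<open>Q \<mapsto> exp (-2 \<pi> i Q \<bullet> \<xi>)\<close> and \<open>hat \<xi> = \<phi> e\<^sub>\<xi>\<close>, so that up to a
  constant the Fourier transform of \<open>u\<close> is \<open>w \<xi> = |\<xi>|\<^bsup>-2s\<^esup> hat \<xi>\<close>. For a test function \<open>\<psi>\<close> supported off \<open>F\<close>,
  moving \<open>\<phi>\<close> through the integral and inverting the Fourier transform gives
  \<open>\<integral> |\<xi>|\<^bsup>2s\<^esup> w \<xi> \<psi>\<^sup>\<or> \<xi> d\<xi> = \<integral> hat \<xi> \<psi>\<^sup>\<or> \<xi> d\<xi> = \<phi> (\<psi> on F) = 0\<close>.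

  That \<open>u\<close> lies in the homogeneous space amounts to the finiteness of the energy \<open>\<integral> |\<xi>|\<^bsup>-2s\<^esup> |hat \<xi>|\<^sup>2 d\<xi>\<close>, where only
  \<open>|\<xi>| \<ge> 1\<close> matters. The boundary satisfies \<open>\<sigma> (ball x r) \<le> C r\<^bsup>n-1\<^esup>\<close>, and this alone yields a trace inequality: if
  \<open>W\<close> is supported in \<open>1 \<le> |\<xi>| < 2\<^sup>J\<close>, its inverse transform has norm at most
  \<open>C (\<integral> |\<xi>|\<^bsup>2s\<^esup> |W \<xi>|\<^sup>2 d\<xi>)\<^bsup>1/2\<^esup>\<close> in the space of order \<open>s - 1/2\<close> on \<open>F\<close>, with \<open>C\<close> independent of \<open>J\<close>. Taking for \<open>W\<close> the
  conjugate of \<open>w\<close> on that shell, \<open>\<phi>\<close> returns the truncated energy \<open>E\<close>, so \<open>E \<le> C' E\<^bsup>1/2\<^esup>\<close> uniformly in \<open>J\<close>.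

  To identify \<open>w\<close> as the transform of \<open>u\<close>, the kernel is written as an integral of Gaussians over all scales. Truncating
  the scales gives smooth kernels with integrable transforms that increase to \<open>|\<xi>|\<^bsup>-2s\<^esup>\<close>; the corresponding
  potentials converge to \<open>u\<close> off \<open>F\<close>, which is a Lebesgue null set.
\<close>

section \<open>Fourier inversion\<close>

text \<open>\<open>E \<le> C' sqrt E\<close> bounds \<open>E\<close> only if \<open>E\<close> is
  finite beforehand; hence the cut to a bounded shell and a constant uniform in the shell. That
  uniformity is the obstacle: adding \<open>J\<close> dyadic blocks by the triangle inequality would
  cost a factor growing with \<open>J\<close>. The blocks are combined instead by Cauchy-Schwarz
  with weights \<open>min (\<rho> * r) (1 / (\<rho> * r)) powr \<alpha>\<close>, where
  \<open>\<rho>\<close> is the frequency and \<open>r\<close> the distance of two boundary points.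
  Their sum over dyadic \<open>\<rho>\<close> is bounded, and a block can afford the division by its
  weight because it has decay to spare on both sides of \<open>\<rho> * r = 1\<close>. The order
  \<open>\<alpha> = s - 1/2\<close> enters through \<open>1 + 2 * \<alpha> = 2 * s\<close>: this
  frequency weight makes the squared norm of the test function equal to the energy. The functional
  is applied only to functions that are bounded and Lipschitz on the boundary, such as characters,
  their superpositions, and the kernel seen from a point off the boundary.\<close>

definition ift :: "('a::euclidean_space \<Rightarrow> complex) \<Rightarrow> 'a \<Rightarrow> complex" where
  "ift V x = (LINT \<xi>|lborel. V \<xi> * cis (2 * pi * (x \<bullet> \<xi>)))"

text \<open>The characteristic function of the standard normal law, rescaled: \<open>c\<close> is
  chosen so that \<open>(c * x)\<^sup>2 / 2\<close> becomes
  \<open>pi * a\<^sup>2 * x\<^sup>2\<close>, and \<open>t\<close> so that \<open>t * (c * x)\<close>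
  becomes \<open>2 * pi * (x * k)\<close>.\<close>

lemma gaussian_fourier_real:
  fixes a k :: real assumes "a > 0"
  shows "has_bochner_integral lborel (\<lambda>x. complex_of_real (exp (- (pi * a\<^sup>2 * x\<^sup>2))) * cis (2 * pi * (x * k)))
           (complex_of_real (exp (- (pi * k\<^sup>2 / a\<^sup>2)) / a))"
proof -
  define c where "c = sqrt (2 * pi) * a"
  have c: "c > 0" using assms by (simp add: c_def)
  define t where "t = sqrt (2 * pi) * k / a"
  define f where "f = (\<lambda>x. complex_of_real (std_normal_density x) * cis (t * x))"
  have int: "integrable lborel f"
    unfolding f_def
    by (rule Bochner_Integration.integrable_bound[OF integrable_std_normal_moment[of 0]])
       (auto simp: norm_mult cis_conv_exp)
  have val: "integral\<^sup>L lborel f = complex_of_real (exp (- t\<^sup>2 / 2))"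
  proof -
    have "integral\<^sup>L lborel f = char std_normal_distribution t"
      unfolding char_def f_def cis_conv_exp
      apply (subst integral_density)
         apply measurable
       apply simp
      apply (rule Bochner_Integration.integral_cong[OF refl])
      apply (simp only: scaleR_conv_of_real)
      done
    then show ?thesis by (simp only: char_std_normal_distribution)
  qed
  have h: "has_bochner_integral lborel f (complex_of_real (exp (- t\<^sup>2 / 2)))"
    using int val by (simp add: has_bochner_integral_iff)
  have "has_bochner_integral lborel (\<lambda>x. f (0 + c * x)) (complex_of_real (exp (- t\<^sup>2 / 2)) /\<^sub>R \<bar>c\<bar>)"
    using lborel_has_bochner_integral_real_affine_iff[of c f _ 0] h c by simp
  then have "has_bochner_integral lborel (\<lambda>x. complex_of_real (sqrt (2*pi)) * f (0 + c * x))
      (complex_of_real (sqrt (2*pi)) * (complex_of_real (exp (- t\<^sup>2 / 2)) /\<^sub>R \<bar>c\<bar>))"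
    by (rule has_bochner_integral_mult_right)
  moreover have "complex_of_real (sqrt (2*pi)) * f (0 + c * x) =
      complex_of_real (exp (- (pi * a\<^sup>2 * x\<^sup>2))) * cis (2 * pi * (x * k))" for x
  proof -
    have "t * (c * x) = 2 * pi * (x * k)"
      using assms by (simp add: t_def c_def field_simps)
    moreover have "(c * x)\<^sup>2 / 2 = pi * a\<^sup>2 * x\<^sup>2" by (simp add: c_def power_mult_distrib)
    ultimately have "f (c * x) = complex_of_real (1 / sqrt (2 * pi) * exp (- (pi * a\<^sup>2 * x\<^sup>2))) * cis (2 * pi * (x * k))"
      by (simp only: f_def std_normal_density_def minus_divide_left[symmetric])
    then show ?thesis by simp
  qed
  moreover have "complex_of_real (sqrt (2*pi)) * (complex_of_real (exp (- t\<^sup>2 / 2)) /\<^sub>R \<bar>c\<bar>)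
     = complex_of_real (exp (- (pi * k\<^sup>2 / a\<^sup>2)) / a)"
  proof -
    have "t\<^sup>2 / 2 = pi * k\<^sup>2 / a\<^sup>2" by (simp add: t_def power_mult_distrib power_divide)
    then show ?thesis using assms c by (simp add: c_def scaleR_conv_of_real field_simps)
  qed
  ultimately show ?thesis by simp
qed

text \<open>Gaussian and character both factor over the coordinates, so the integral is a product of
  one-dimensional ones.\<close>

lemma gaussian_fourier:
  fixes \<xi> :: "'a::euclidean_space" assumes "a > 0"
  shows "has_bochner_integral lborel
     (\<lambda>x. complex_of_real (exp (- (pi * a\<^sup>2 * (norm x)\<^sup>2))) * cis (2 * pi * (x \<bullet> \<xi>)))
           (complex_of_real (exp (- (pi * (norm \<xi>)\<^sup>2 / a\<^sup>2)) / a ^ DIM('a)))"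
proof -
  interpret product_sigma_finite "\<lambda>b::'a. (lborel::real measure)" by standard
  define g where "g = (\<lambda>b x. complex_of_real (exp (- (pi * a\<^sup>2 * x\<^sup>2))) * cis (2 * pi * (x * (\<xi> \<bullet> b))))"
  have g: "has_bochner_integral lborel (g b) (complex_of_real (exp (- (pi * (\<xi> \<bullet> b)\<^sup>2 / a\<^sup>2)) / a))" for b
    unfolding g_def by (rule gaussian_fourier_real[OF assms])
  have gi: "integrable lborel (g b)" for b using g[of b] by (simp add: has_bochner_integral_iff)
  define F where "F = (\<lambda>x. complex_of_real (exp (- (pi * a\<^sup>2 * (norm x)\<^sup>2))) * cis (2 * pi * (x \<bullet> \<xi>)))"
  have n2: "(norm x)\<^sup>2 = (\<Sum>b\<in>Basis. (x \<bullet> b)\<^sup>2)" for x :: 'a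
    by (subst power2_norm_eq_inner, subst euclidean_inner) (simp add: power2_eq_square)
  have F: "F x = (\<Prod>b\<in>Basis. g b (x \<bullet> b))" for x
  proof -
    \<comment> \<open>Written as one complex exponential, the product over the basis becomes a sum
      in the exponent.\<close>
    have e: "complex_of_real (exp r) * cis t = exp (Complex r t)" for r t
      by (simp add: exp_eq_polar)
    have "(\<Prod>b\<in>Basis. g b (x \<bullet> b)) =
        exp (\<Sum>b\<in>Basis. Complex (- (pi * a\<^sup>2 * (x \<bullet> b)\<^sup>2)) (2 * pi * ((x \<bullet> b) * (\<xi> \<bullet> b))))"
      unfolding g_def e by (rule exp_sum[symmetric]) simp
    also have "(\<Sum>b\<in>Basis. Complex (- (pi * a\<^sup>2 * (x \<bullet> b)\<^sup>2)) (2 * pi * ((x \<bullet> b) * (\<xi> \<bullet> b)))) =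
        Complex (- (pi * a\<^sup>2 * (norm x)\<^sup>2)) (2 * pi * (x \<bullet> \<xi>))"
      unfolding n2 euclidean_inner[of x \<xi>]
      by (simp add: complex_eq_iff sum_distrib_left sum_negf)
    finally show ?thesis by (simp only: F_def e)
  qed
  have Fm: "F \<in> borel_measurable borel"
    unfolding F_def cis_conv_exp by measurable
  have coord: "(\<Sum>b\<in>Basis. f b *\<^sub>R b) \<bullet> c = f c" if "c \<in> Basis" for f and c :: 'a
    using that by simp
  have I: "integrable (Pi\<^sub>M Basis (\<lambda>b. lborel)) (\<lambda>x. \<Prod>b\<in>Basis. g b (x b))"
    by (rule product_integrable_prod) (auto intro: gi)
  have V: "(\<integral>x. (\<Prod>b\<in>Basis. g b (x b)) \<partial>Pi\<^sub>M Basis (\<lambda>b. lborel)) = (\<Prod>b\<in>Basis. integral\<^sup>L lborel (g b))"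
    by (rule product_integral_prod) (auto intro: gi)
  have Feq: "F (\<Sum>b\<in>Basis. f b *\<^sub>R b) = (\<Prod>b\<in>Basis. g b (f b))" for f
    unfolding F by (intro prod.cong refl) simp
  have "integrable lborel F"
    using Fm I by (subst lborel_eq, subst integrable_distr_eq) (auto simp: Feq)
  moreover have "integral\<^sup>L lborel F = complex_of_real (exp (- (pi * (norm \<xi>)\<^sup>2 / a\<^sup>2)) / a ^ DIM('a))"
  proof -
    have "integral\<^sup>L lborel F = (\<Prod>b\<in>Basis. integral\<^sup>L lborel (g b))"
      using Fm V by (subst lborel_eq, subst integral_distr) (auto simp: Feq)
    also have "\<dots> = (\<Prod>b\<in>Basis. complex_of_real (exp (- (pi * (\<xi> \<bullet> b)\<^sup>2 / a\<^sup>2)) / a))"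
      using g by (intro prod.cong refl) (auto simp: has_bochner_integral_iff)
    also have "\<dots> = complex_of_real (exp (- (pi * (norm \<xi>)\<^sup>2 / a\<^sup>2)) / a ^ DIM('a))"
    proof -
      have "- (pi * (norm \<xi>)\<^sup>2 / a\<^sup>2) = (\<Sum>b\<in>Basis. - (pi * (\<xi> \<bullet> b)\<^sup>2 / a\<^sup>2))"
        unfolding n2 sum_distrib_left sum_divide_distrib sum_negf by (rule refl)
      then show ?thesis
        by (simp only: exp_sum[OF finite_Basis] of_real_prod[symmetric] prod_dividef prod_constant)
    qed
    finally show ?thesis .
  qed
  ultimately show ?thesis unfolding F_def by (simp add: has_bochner_integral_iff)
qed

lemma gaussian_integral:
  assumes "c > 0"
  shows "has_bochner_integral lborel (\<lambda>x::'a::euclidean_space. exp (- (c * (norm x)\<^sup>2))) (sqrt (pi / c) ^ DIM('a))"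
proof -
  define a where "a = sqrt (c / pi)"
  have a: "a > 0" "pi * a\<^sup>2 = c" using assms by (auto simp: a_def)
  have "has_bochner_integral lborel (\<lambda>x::'a. complex_of_real (exp (- (c * (norm x)\<^sup>2)))) (complex_of_real (1 / a ^ DIM('a)))"
    using gaussian_fourier[OF a(1), of "0::'a"] a(2) by (simp add: mult.commute)
  then have "has_bochner_integral lborel (\<lambda>x::'a. exp (- (c * (norm x)\<^sup>2))) (1 / a ^ DIM('a))"
    using has_bochner_integral_Re by fastforce
  moreover have "1 / a = sqrt (pi / c)" by (simp add: a_def real_sqrt_divide)
  ultimately show ?thesis by (metis power_one_over)
qed

section \<open>Affine changes of variable, the multiplication formula and inversion\<close>

lemma borel_measurable_cis [measurable]: "cis \<in> borel_measurable borel"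
  unfolding cis_conv_exp by measurable

lemma nn_integral_lborel_affine:
  fixes f :: "'a::euclidean_space \<Rightarrow> ennreal"
  assumes [measurable]: "f \<in> borel_measurable borel" and "c \<noteq> 0"
  shows "(\<integral>\<^sup>+x. f x \<partial>lborel) = ennreal (\<bar>c\<bar> ^ DIM('a)) * (\<integral>\<^sup>+x. f (t + c *\<^sub>R x) \<partial>lborel)"
  by (subst lborel_affine[OF assms(2), of t])
     (simp add: nn_integral_density nn_integral_distr nn_integral_cmult)

lemma nn_integral_lborel_shift:
  fixes f :: "'a::euclidean_space \<Rightarrow> ennreal"
  assumes [measurable]: "f \<in> borel_measurable borel"
  shows "(\<integral>\<^sup>+x. f (x - t) \<partial>lborel) = (\<integral>\<^sup>+x. f x \<partial>lborel)"
    and "(\<integral>\<^sup>+x. f (t - x) \<partial>lborel) = (\<integral>\<^sup>+x. f x \<partial>lborel)"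
  using nn_integral_lborel_affine[OF assms, of 1 "- t"] nn_integral_lborel_affine[OF assms, of "-1" t]
  by (simp_all add: algebra_simps)

lemma lborel_integral_affine:
  fixes f :: "'a::euclidean_space \<Rightarrow> 'b::{banach, second_countable_topology}"
  assumes [measurable]: "f \<in> borel_measurable borel" and "c \<noteq> 0"
  shows "(LINT x|lborel. f x) = \<bar>c\<bar> ^ DIM('a) *\<^sub>R (LINT x|lborel. f (t + c *\<^sub>R x))"
  by (subst lborel_affine[OF assms(2), of t])
     (simp add: integral_density integral_distr)

lemma lborel_integrable_affine:
  fixes f :: "'a::euclidean_space \<Rightarrow> 'b::{banach, second_countable_topology}"
  assumes f: "integrable lborel f" and "c \<noteq> 0"
  shows "integrable lborel (\<lambda>x. f (t + c *\<^sub>R x))"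
proof -
  have [measurable]: "f \<in> borel_measurable borel" using f by auto
  have "(\<integral>\<^sup>+x. norm (f x) \<partial>lborel) = ennreal (\<bar>c\<bar> ^ DIM('a)) * (\<integral>\<^sup>+x. norm (f (t + c *\<^sub>R x)) \<partial>lborel)"
    by (rule nn_integral_lborel_affine) (use assms(2) in auto)
  then have "(\<integral>\<^sup>+x. norm (f (t + c *\<^sub>R x)) \<partial>lborel) < \<infinity>"
    using f assms(2) by (auto simp: integrable_iff_bounded ennreal_mult_less_top)
  then show ?thesis by (simp add: integrable_iff_bounded)
qed

lemma integrable_mult_cis:
  fixes V :: "'b \<Rightarrow> complex"
  assumes "integrable M V" and [measurable]: "h \<in> borel_measurable M"
  shows "integrable M (\<lambda>x. V x * cis (h x))"
  by (rule Bochner_Integration.integrable_bound[OF assms(1)])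
     (use assms(1) in \<open>auto simp: norm_mult\<close>)

lemma integrable_mult_bounded:
  fixes V :: "'b \<Rightarrow> complex"
  assumes "integrable M V" and [measurable]: "h \<in> borel_measurable M" and "\<And>x. norm (h x) \<le> B"
  shows "integrable M (\<lambda>x. V x * h x)"
proof (rule Bochner_Integration.integrable_bound[where g="\<lambda>x. V x * h x" and f="\<lambda>x. B * cmod (V x)"])
  show "integrable M (\<lambda>x. B * cmod (V x))" using assms(1) by auto
  show "(\<lambda>x. V x * h x) \<in> borel_measurable M" using assms(1) by auto
  show "AE x in M. cmod (V x * h x) \<le> norm (B * cmod (V x))"
  proof (rule AE_I2)
    fix x show "cmod (V x * h x) \<le> norm (B * cmod (V x))"
      using mult_right_mono[OF assms(3)[of x], of "cmod (V x)"] norm_ge_zero[of "h x"] assms(3)[of x]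
      by (simp add: norm_mult mult.commute)
  qed
qed

lemma ift_norm_le:
  assumes "integrable lborel V"
  shows "cmod (ift V x) \<le> (LINT \<xi>|lborel. cmod (V \<xi>))"
  unfolding ift_def
  using integral_norm_bound[of lborel "\<lambda>\<xi>. V \<xi> * cis (2 * pi * (x \<bullet> \<xi>))"] by (simp add: norm_mult)

lemma borel_measurable_ift [measurable]:
  assumes [measurable]: "V \<in> borel_measurable borel"
  shows "ift V \<in> borel_measurable borel"
  unfolding ift_def[abs_def] by measurable

lemma integrable_product_mult:
  fixes f :: "'b::euclidean_space \<Rightarrow> complex" and g :: "'c::euclidean_space \<Rightarrow> complex"
  assumes f: "integrable lborel f" and g: "integrable lborel g"
  shows "integrable (lborel \<Otimes>\<^sub>M lborel) (\<lambda>(x, y). f x * g y)"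
proof (rule lborel_pair.Fubini_integrable)
  have [measurable]: "f \<in> borel_measurable borel" "g \<in> borel_measurable borel" using f g by auto
  show "(\<lambda>(x, y). f x * g y) \<in> borel_measurable (lborel \<Otimes>\<^sub>M lborel)" by measurable
qed (use f g in \<open>auto simp: norm_mult\<close>)

lemma borel_measurable_cnj [measurable (raw)]:
  "f \<in> borel_measurable M \<Longrightarrow> (\<lambda>x. cnj (f x)) \<in> borel_measurable M"
  by (rule borel_measurable_continuous_on[OF continuous_on_cnj[OF continuous_on_id]])

text \<open>Fubini for the bounded kernel \<open>cis (2 * pi * (x \<bullet> \<xi>))\<close>, which
  is symmetric in its two arguments. Inversion, the square norm inequality and the identification of
  transforms are all drawn from this form of Parseval's identity.\<close>

lemma ift_multiplication:
  fixes U V :: "'a::euclidean_space \<Rightarrow> complex"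
  assumes U: "integrable lborel U" and V: "integrable lborel V"
  shows "(LINT x|lborel. U x * ift V x) = (LINT \<xi>|lborel. V \<xi> * ift U \<xi>)"
proof -
  have [measurable]: "U \<in> borel_measurable borel" "V \<in> borel_measurable borel" using U V by auto
  have "integrable (lborel \<Otimes>\<^sub>M lborel) (\<lambda>(x, \<xi>). U x * V \<xi>)"
    using U V by (rule integrable_product_mult)
  then have I: "integrable (lborel \<Otimes>\<^sub>M lborel) (\<lambda>(x, \<xi>). U x * (V \<xi> * cis (2 * pi * (x \<bullet> \<xi>))))"
    by (rule Bochner_Integration.integrable_bound) (auto simp: norm_mult)
  have "(LINT x|lborel. U x * ift V x) =
      (LINT x|lborel. (LINT \<xi>|lborel. U x * (V \<xi> * cis (2 * pi * (x \<bullet> \<xi>)))))"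
    unfolding ift_def by simp
  also have "\<dots> = (LINT \<xi>|lborel. (LINT x|lborel. U x * (V \<xi> * cis (2 * pi * (x \<bullet> \<xi>)))))"
    using lborel_pair.Fubini_integral[OF I] by simp
  also have "\<dots> = (LINT \<xi>|lborel. V \<xi> * ift U \<xi>)"
    unfolding ift_def
    by (intro Bochner_Integration.integral_cong refl, subst integral_mult_right_zero[symmetric])
       (auto intro!: Bochner_Integration.integral_cong simp: inner_commute mult_ac)
  finally show ?thesis .
qed

text \<open>Centre \<open>y\<close> and modulation \<open>\<zeta>\<close> both occur later: the
  modulated Gaussian at the origin gives inversion, the unmodulated one at \<open>y\<close> gives
  averages at a fixed scale.\<close>

lemma ift_gaussian:
  fixes \<xi> y :: "'a::euclidean_space"
  assumes "a > 0"
  shows "integrable lborel (\<lambda>x. complex_of_real (exp (- (pi * a\<^sup>2 * (norm (x - y))\<^sup>2))) * cis (2 * pi * (x \<bullet> \<zeta>)))"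
    and "ift (\<lambda>x. complex_of_real (exp (- (pi * a\<^sup>2 * (norm (x - y))\<^sup>2))) * cis (2 * pi * (x \<bullet> \<zeta>))) \<xi> =
      cis (2 * pi * (y \<bullet> (\<xi> + \<zeta>))) * complex_of_real (exp (- (pi * (norm (\<xi> + \<zeta>))\<^sup>2 / a\<^sup>2)) / a ^ DIM('a))"
proof -
  define f where "f \<xi> = (\<lambda>x::'a. complex_of_real (exp (- (pi * a\<^sup>2 * (norm x)\<^sup>2))) * cis (2 * pi * (x \<bullet> \<xi>)))" for \<xi> :: 'a
  have [measurable]: "f \<xi> \<in> borel_measurable borel" for \<xi> unfolding f_def by measurable
  have f: "integrable lborel (f \<xi>)"
     "integral\<^sup>L lborel (f \<xi>) = complex_of_real (exp (- (pi * (norm \<xi>)\<^sup>2 / a\<^sup>2)) / a ^ DIM('a))" for \<xi>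
    using gaussian_fourier[OF assms, of \<xi>] unfolding f_def by (auto simp: has_bochner_integral_iff)
  have fs: "integrable lborel (\<lambda>x. f \<xi> (x - y))" "integral\<^sup>L lborel (\<lambda>x. f \<xi> (x - y)) = integral\<^sup>L lborel (f \<xi>)" for \<xi>
    using lborel_integrable_affine[OF f(1)[of \<xi>], of 1 "- y"] lborel_integral_affine[of "f \<xi>" 1 "- y"] by auto
  have eq: "f \<xi> (x - y) * cis (2 * pi * (y \<bullet> \<xi>)) =
      complex_of_real (exp (- (pi * a\<^sup>2 * (norm (x - y))\<^sup>2))) * cis (2 * pi * (x \<bullet> \<xi>))" for x \<xi>
    unfolding f_def mult.assoc cis_mult by (simp add: algebra_simps)
  show "integrable lborel (\<lambda>x. complex_of_real (exp (- (pi * a\<^sup>2 * (norm (x - y))\<^sup>2))) * cis (2 * pi * (x \<bullet> \<zeta>)))"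
    using integrable_mult_left[OF fs(1)] unfolding eq[symmetric] by blast
  have "ift (\<lambda>x. complex_of_real (exp (- (pi * a\<^sup>2 * (norm (x - y))\<^sup>2))) * cis (2 * pi * (x \<bullet> \<zeta>))) \<xi>
     = (LINT x|lborel. f (\<xi> + \<zeta>) (x - y) * cis (2 * pi * (y \<bullet> (\<xi> + \<zeta>))))"
    unfolding ift_def eq
    by (intro Bochner_Integration.integral_cong refl) (simp only: mult.assoc cis_mult, simp add: algebra_simps inner_commute)
  also have "\<dots> = cis (2 * pi * (y \<bullet> (\<xi> + \<zeta>))) * complex_of_real (exp (- (pi * (norm (\<xi> + \<zeta>))\<^sup>2 / a\<^sup>2)) / a ^ DIM('a))"
    by (simp add: fs f)
  finally show "ift (\<lambda>x. complex_of_real (exp (- (pi * a\<^sup>2 * (norm (x - y))\<^sup>2))) * cis (2 * pi * (x \<bullet> \<zeta>))) \<xi> = \<dots>" .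
qed

text \<open>The multiplication formula moves the Gaussian cutoff from the space side to the
  frequency side, where it becomes an approximate identity of width \<open>a\<close> around
  \<open>\<xi>\<close>.\<close>

lemma gaussian_regularized_inversion:
  fixes \<xi> :: "'a::euclidean_space"
  assumes "a > 0" and V: "integrable lborel V"
  shows "(LINT x|lborel. complex_of_real (exp (- (pi * a\<^sup>2 * (norm x)\<^sup>2))) * cis (- (2 * pi * (x \<bullet> \<xi>))) * ift V x)
     = (LINT \<eta>|lborel. V \<eta> * complex_of_real (exp (- (pi * (norm (\<eta> - \<xi>))\<^sup>2 / a\<^sup>2)) / a ^ DIM('a)))"
  using ift_multiplication[OF ift_gaussian(1)[OF assms(1), of 0 "- \<xi>"] V]
  unfolding ift_gaussian(2)[OF assms(1)] by simp

text \<open>The cutoff is removed by letting \<open>a\<close> tend to 0. On the left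
  \<open>cmod (ift V x)\<close> dominates; on the right the bound on \<open>V\<close> gives a
  Gaussian majorant and continuity at \<open>\<xi>\<close> the limit.\<close>

lemma ift_inversion:
  fixes \<xi> :: "'a::euclidean_space"
  assumes V: "integrable lborel V" and iV: "integrable lborel (ift V)"
    and cont: "isCont V \<xi>" and bdd: "\<And>x. cmod (V x) \<le> B"
  shows "(LINT x|lborel. cis (- (2 * pi * (x \<bullet> \<xi>))) * ift V x) = V \<xi>"
proof -
  have [measurable]: "V \<in> borel_measurable borel" using V by auto
  define a where "a = (\<lambda>k. 1 / real (Suc k))"
  have a: "a k > 0" "a k \<le> 1" for k by (auto simp: a_def)
  have a0: "a \<longlonglongrightarrow> 0" unfolding a_def by (rule LIMSEQ_Suc[OF lim_1_over_n])
  let ?L = "\<lambda>k. LINT x|lborel. complex_of_real (exp (- (pi * (a k)\<^sup>2 * (norm x)\<^sup>2))) * cis (- (2 * pi * (x \<bullet> \<xi>))) * ift V x"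
  let ?g = "\<lambda>z::'a. complex_of_real (exp (- (pi * (norm z)\<^sup>2)))"
  have L: "?L k = (LINT z|lborel. V (\<xi> + a k *\<^sub>R z) * ?g z)" for k
  proof -
    have "?L k = (LINT \<eta>|lborel. V \<eta> * complex_of_real (exp (- (pi * (norm (\<eta> - \<xi>))\<^sup>2 / (a k)\<^sup>2)) / a k ^ DIM('a)))"
      by (rule gaussian_regularized_inversion[OF a(1) V])
    \<comment> \<open>The substitution \<open>\<eta> = \<xi> + a k *\<^sub>R z\<close> makes the
      Gaussian independent of \<open>k\<close> and moves \<open>k\<close> into the argument of
      \<open>V\<close>.\<close>
    also have "\<dots> = \<bar>a k\<bar> ^ DIM('a) *\<^sub>R (LINT z|lborel. V (\<xi> + a k *\<^sub>R z) *
         complex_of_real (exp (- (pi * (norm ((\<xi> + a k *\<^sub>R z) - \<xi>))\<^sup>2 / (a k)\<^sup>2)) / a k ^ DIM('a)))"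
      by (rule lborel_integral_affine) (use a(1)[of k] in auto)
    also have "\<dots> = (LINT z|lborel. V (\<xi> + a k *\<^sub>R z) * ?g z)"
      using a(1)[of k]
      by (subst integral_scaleR_right[symmetric])
         (auto simp: power_mult_distrib scaleR_conv_of_real intro!: Bochner_Integration.integral_cong)
    finally show ?thesis .
  qed
  have "?L \<longlonglongrightarrow> (LINT x|lborel. complex_of_real 1 * cis (- (2 * pi * (x \<bullet> \<xi>))) * ift V x)"
  proof (rule integral_dominated_convergence[where w="\<lambda>x. cmod (ift V x)"])
    show "AE x in lborel. (\<lambda>k. complex_of_real (exp (- (pi * (a k)\<^sup>2 * (norm x)\<^sup>2))) * cis (- (2 * pi * (x \<bullet> \<xi>))) * ift V x)
        \<longlonglongrightarrow> complex_of_real 1 * cis (- (2 * pi * (x \<bullet> \<xi>))) * ift V x"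
    proof (rule AE_I2)
      fix x :: 'a
      have "(\<lambda>k. exp (- (pi * (a k)\<^sup>2 * (norm x)\<^sup>2))) \<longlonglongrightarrow> exp (- (pi * 0\<^sup>2 * (norm x)\<^sup>2))"
        by (intro tendsto_intros a0)
      then show "(\<lambda>k. complex_of_real (exp (- (pi * (a k)\<^sup>2 * (norm x)\<^sup>2))) * cis (- (2 * pi * (x \<bullet> \<xi>))) * ift V x)
        \<longlonglongrightarrow> complex_of_real 1 * cis (- (2 * pi * (x \<bullet> \<xi>))) * ift V x"
        by (intro tendsto_intros) simp
    qed
  qed (use iV in \<open>auto simp: norm_mult mult_left_le_one_le\<close>)
  moreover have "(\<lambda>k. LINT z|lborel. V (\<xi> + a k *\<^sub>R z) * ?g z) \<longlonglongrightarrow> (LINT z|lborel. V \<xi> * ?g z)"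
  proof (rule integral_dominated_convergence[where w="\<lambda>z. B * exp (- (pi * (norm z)\<^sup>2))"])
    show "integrable lborel (\<lambda>z::'a. B * exp (- (pi * (norm z)\<^sup>2)))"
      using gaussian_integral[of pi, where 'a='a] by (auto simp: has_bochner_integral_iff)
    show "AE z in lborel. (\<lambda>k. V (\<xi> + a k *\<^sub>R z) * ?g z) \<longlonglongrightarrow> V \<xi> * ?g z"
    proof (rule AE_I2)
      fix z
      have "(\<lambda>k. \<xi> + a k *\<^sub>R z) \<longlonglongrightarrow> \<xi> + 0 *\<^sub>R z" by (intro tendsto_intros a0)
      then have "(\<lambda>k. V (\<xi> + a k *\<^sub>R z)) \<longlonglongrightarrow> V \<xi>"
        using isCont_tendsto_compose[OF cont] by simp
      then show "(\<lambda>k. V (\<xi> + a k *\<^sub>R z) * ?g z) \<longlonglongrightarrow> V \<xi> * ?g z" by (intro tendsto_intros)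
    qed
  qed (auto simp: norm_mult bdd mult_right_mono)
  moreover have "(LINT z|lborel. V \<xi> * ?g z) = V \<xi>"
  proof -
    have "(LINT z|lborel. ?g z) = complex_of_real (LINT z|lborel. exp (- (pi * (norm (z::'a))\<^sup>2)))"
      by (rule integral_complex_of_real)
    also have "\<dots> = 1"
      using gaussian_integral[of pi, where 'a='a] by (simp add: has_bochner_integral_iff)
    finally show ?thesis by simp
  qed
  ultimately show ?thesis unfolding L using LIMSEQ_unique by fastforce
qed

lemma nn_integral_gaussian:
  fixes y :: "'a::euclidean_space"
  assumes "c > 0"
  shows "(\<integral>\<^sup>+z. ennreal (exp (- (c * (norm (z - y))\<^sup>2))) \<partial>lborel) = ennreal (sqrt (pi / c) ^ DIM('a))"
    and "(\<integral>\<^sup>+z. ennreal (exp (- (c * (norm (y - z))\<^sup>2))) \<partial>lborel) = ennreal (sqrt (pi / c) ^ DIM('a))"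
proof -
  have "(\<integral>\<^sup>+(z::'a). ennreal (exp (- (c * (norm z)\<^sup>2))) \<partial>lborel) = ennreal (sqrt (pi / c) ^ DIM('a))"
    using gaussian_integral[OF assms, where 'a='a]
    by (subst nn_integral_eq_integral) (auto simp: has_bochner_integral_iff)
  then show "(\<integral>\<^sup>+(z::'a). ennreal (exp (- (c * (norm (z - y))\<^sup>2))) \<partial>lborel) = ennreal (sqrt (pi / c) ^ DIM('a))"
    "(\<integral>\<^sup>+(z::'a). ennreal (exp (- (c * (norm (y - z))\<^sup>2))) \<partial>lborel) = ennreal (sqrt (pi / c) ^ DIM('a))"
    using nn_integral_lborel_shift[of "\<lambda>z. ennreal (exp (- (c * (norm z)\<^sup>2)))" y] by auto
qed

text \<open>A Gaussian factor makes the double integral absolutely convergent; the factor is removed by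
  Fatou's lemma, which is why only the inequality half of Plancherel's identity is obtained.\<close>

lemma ift_L2_le:
  fixes V :: "'a::euclidean_space \<Rightarrow> complex"
  assumes V: "integrable lborel V"
  shows "(\<integral>\<^sup>+x. ennreal ((cmod (ift V x))\<^sup>2) \<partial>lborel) \<le> (\<integral>\<^sup>+\<xi>. ennreal ((cmod (V \<xi>))\<^sup>2) \<partial>lborel)"
proof -
  have [measurable]: "V \<in> borel_measurable borel" using V by auto
  define a where "a = (\<lambda>k. 1 / real (Suc k))"
  have a: "a k > 0" for k by (auto simp: a_def)
  have a0: "a \<longlonglongrightarrow> 0" unfolding a_def by (rule LIMSEQ_Suc[OF lim_1_over_n])
  define e where "e k x = exp (- (pi * (a k)\<^sup>2 * (norm (x::'a))\<^sup>2))" for k x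
  have [measurable]: "e k \<in> borel_measurable borel" for k unfolding e_def by measurable
  have e0: "e k x \<ge> 0" for k x by (simp add: e_def)
  define g where "g k z = exp (- (pi * (norm (z::'a))\<^sup>2 / (a k)\<^sup>2)) / a k ^ DIM('a)" for k z
  have [measurable]: "g k \<in> borel_measurable borel" for k unfolding g_def by measurable
  have g0: "g k x \<ge> 0" for k x using a[of k] by (simp add: g_def)
  have gI: "(\<integral>\<^sup>+z. ennreal (g k (z - y)) \<partial>lborel) = 1" "(\<integral>\<^sup>+z. ennreal (g k (y - z)) \<partial>lborel) = 1" for k y
  proof -
    have p: "pi / (a k)\<^sup>2 > 0" using a[of k] by simp
    have q: "sqrt (pi / (pi / (a k)\<^sup>2)) = a k" using a[of k] by simp
    have r: "ennreal (g k z) = ennreal (1 / a k ^ DIM('a)) * ennreal (exp (- (pi / (a k)\<^sup>2 * (norm z)\<^sup>2)))" for z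
      using a[of k] by (simp add: g_def flip: ennreal_mult)
    show "(\<integral>\<^sup>+z. ennreal (g k (z - y)) \<partial>lborel) = 1" "(\<integral>\<^sup>+z. ennreal (g k (y - z)) \<partial>lborel) = 1"
      unfolding r using a[of k]
      by (subst nn_integral_cmult, measurable, subst nn_integral_gaussian[OF p], subst q, simp flip: ennreal_mult)+
  qed
  define N where "N = (\<integral>\<^sup>+\<xi>. ennreal ((cmod (V \<xi>))\<^sup>2) \<partial>lborel)"
  have bound: "(\<integral>\<^sup>+x. ennreal (e k x * (cmod (ift V x))\<^sup>2) \<partial>lborel) \<le> N" for k
  proof -
    define B where "B = (LINT \<xi>|lborel. cmod (V \<xi>))"
    have B: "cmod (ift V x) \<le> B" for x unfolding B_def by (rule ift_norm_le[OF V])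
    have B0: "B \<ge> 0" using B[of 0] norm_ge_zero order_trans by blast
    have eint: "integrable lborel (e k)"
    proof -
      have "pi * (a k)\<^sup>2 > 0" using a[of k] by simp
      from gaussian_integral[OF this, where 'a='a] show ?thesis
        unfolding e_def by (simp add: has_bochner_integral_iff)
    qed
    \<comment> \<open>Pairing \<open>U\<close> with \<open>ift V\<close> gives the damped squared
      norm. Since \<open>ift U\<close> is the conjugate of \<open>V\<close> averaged with the unit
      mass \<open>g k\<close>, the multiplication formula turns the damped norm into a double
      integral in \<open>V\<close>.\<close>
    define U where "U x = complex_of_real (e k x) * cnj (ift V x)" for x
    have [measurable]: "U \<in> borel_measurable borel" unfolding U_def by measurable
    have Uint: "integrable lborel U"
      unfolding U_def by (rule integrable_mult_bounded[where B=B]) (use eint B in auto)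
    have eqr: "U x * ift V x = complex_of_real (e k x * (cmod (ift V x))\<^sup>2)" for x
      by (simp add: U_def complex_norm_square[symmetric] mult_ac flip: of_real_power)
    have rint: "integrable lborel (\<lambda>x. e k x * (cmod (ift V x))\<^sup>2)"
    proof -
      have "integrable lborel (\<lambda>x. U x * ift V x)"
        by (rule integrable_mult_bounded[where B=B]) (use Uint B in auto)
      then show ?thesis unfolding eqr by (rule complex_of_real_integrable_eq[THEN iffD1])
    qed
    have iU: "ift U \<xi> = cnj (LINT \<eta>|lborel. V \<eta> * complex_of_real (g k (\<eta> - \<xi>)))" for \<xi>
    proof -
      have "ift U \<xi> = (LINT x|lborel. cnj (complex_of_real (exp (- (pi * (a k)\<^sup>2 * (norm x)\<^sup>2))) * cis (- (2 * pi * (x \<bullet> \<xi>))) * ift V x))"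
        unfolding ift_def[of U] U_def e_def
        by (intro Bochner_Integration.integral_cong refl) (simp add: cis_cnj inner_commute mult_ac)
      also have "\<dots> = cnj (LINT x|lborel. complex_of_real (exp (- (pi * (a k)\<^sup>2 * (norm x)\<^sup>2))) * cis (- (2 * pi * (x \<bullet> \<xi>))) * ift V x)"
        by (rule Bochner_Integration.integral_cnj)
      also have "\<dots> = cnj (LINT \<eta>|lborel. V \<eta> * complex_of_real (g k (\<eta> - \<xi>)))"
        unfolding g_def by (subst gaussian_regularized_inversion[OF a V]) simp
      finally show ?thesis .
    qed
    have "(\<integral>\<^sup>+x. ennreal (e k x * (cmod (ift V x))\<^sup>2) \<partial>lborel) = ennreal (LINT x|lborel. e k x * (cmod (ift V x))\<^sup>2)"
      by (rule nn_integral_eq_integral[OF rint]) (simp add: e0)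
    also have "(LINT x|lborel. e k x * (cmod (ift V x))\<^sup>2) \<le> cmod (complex_of_real (LINT x|lborel. e k x * (cmod (ift V x))\<^sup>2))"
      by simp
    also have "complex_of_real (LINT x|lborel. e k x * (cmod (ift V x))\<^sup>2) = (LINT x|lborel. U x * ift V x)"
      unfolding eqr by (rule integral_complex_of_real[symmetric])
    also have "\<dots> = (LINT \<xi>|lborel. V \<xi> * ift U \<xi>)"
      by (rule ift_multiplication[OF Uint V])
    also have "ennreal (cmod (LINT \<xi>|lborel. V \<xi> * ift U \<xi>)) \<le> (\<integral>\<^sup>+\<xi>. ennreal (cmod (V \<xi> * ift U \<xi>)) \<partial>lborel)"
      by (rule integral_norm_bound_ennreal)
        (rule integrable_mult_bounded[OF V _ ift_norm_le[OF Uint]], measurable)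
    also have "\<dots> \<le> (\<integral>\<^sup>+\<xi>. (\<integral>\<^sup>+\<eta>. ennreal (cmod (V \<xi>) * cmod (V \<eta>) * g k (\<eta> - \<xi>)) \<partial>lborel) \<partial>lborel)"
    proof (rule nn_integral_mono)
      fix \<xi>
      have "ennreal (cmod (ift U \<xi>)) \<le> (\<integral>\<^sup>+\<eta>. ennreal (cmod (V \<eta> * complex_of_real (g k (\<eta> - \<xi>)))) \<partial>lborel)"
        unfolding iU complex_mod_cnj
      proof (rule integral_norm_bound_ennreal, rule integrable_mult_bounded[OF V, where B="1 / a k ^ DIM('a)"])
        show "cmod (complex_of_real (g k (x - \<xi>))) \<le> 1 / a k ^ DIM('a)" for x
          using a[of k] by (simp add: g_def divide_right_mono norm_divide norm_power)
      qed measurable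
      then have "ennreal (cmod (V \<xi>)) * ennreal (cmod (ift U \<xi>)) \<le>
          ennreal (cmod (V \<xi>)) * (\<integral>\<^sup>+\<eta>. ennreal (cmod (V \<eta> * complex_of_real (g k (\<eta> - \<xi>)))) \<partial>lborel)"
        by (rule mult_left_mono) simp
      then show "ennreal (cmod (V \<xi> * ift U \<xi>)) \<le> (\<integral>\<^sup>+\<eta>. ennreal (cmod (V \<xi>) * cmod (V \<eta>) * g k (\<eta> - \<xi>)) \<partial>lborel)"
        by (simp add: norm_mult ennreal_mult g0 nn_integral_cmult[symmetric] mult.assoc)
    qed
    \<comment> \<open>Splitting the product into half squares is the Schur test: each half
      integrates the kernel in the other variable, where its mass is 1, and contributes
      \<open>N / 2\<close>.\<close>
    also have "\<dots> \<le> (\<integral>\<^sup>+\<xi>. (\<integral>\<^sup>+\<eta>. ennreal ((cmod (V \<xi>))\<^sup>2 / 2 * g k (\<eta> - \<xi>)) + ennreal ((cmod (V \<eta>))\<^sup>2 / 2 * g k (\<eta> - \<xi>)) \<partial>lborel) \<partial>lborel)"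
    proof (intro nn_integral_mono)
      fix \<xi> \<eta>
      have "cmod (V \<xi>) * cmod (V \<eta>) \<le> (cmod (V \<xi>))\<^sup>2 / 2 + (cmod (V \<eta>))\<^sup>2 / 2"
        using sum_squares_bound[of "cmod (V \<xi>)" "cmod (V \<eta>)"] by simp
      from mult_right_mono[OF this g0[of k "\<eta> - \<xi>"]]
      have "cmod (V \<xi>) * cmod (V \<eta>) * g k (\<eta> - \<xi>) \<le>
          (cmod (V \<xi>))\<^sup>2 / 2 * g k (\<eta> - \<xi>) + (cmod (V \<eta>))\<^sup>2 / 2 * g k (\<eta> - \<xi>)"
        by (simp add: algebra_simps)
      then show "ennreal (cmod (V \<xi>) * cmod (V \<eta>) * g k (\<eta> - \<xi>)) \<le>
          ennreal ((cmod (V \<xi>))\<^sup>2 / 2 * g k (\<eta> - \<xi>)) + ennreal ((cmod (V \<eta>))\<^sup>2 / 2 * g k (\<eta> - \<xi>))"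
        using g0[of k "\<eta> - \<xi>"] by (subst ennreal_plus[symmetric]) (auto intro!: ennreal_leI simp del: ennreal_plus)
    qed
    also have "\<dots> = (\<integral>\<^sup>+\<xi>. (\<integral>\<^sup>+\<eta>. ennreal ((cmod (V \<xi>))\<^sup>2 / 2 * g k (\<eta> - \<xi>)) \<partial>lborel) \<partial>lborel)
       + (\<integral>\<^sup>+\<xi>. (\<integral>\<^sup>+\<eta>. ennreal ((cmod (V \<eta>))\<^sup>2 / 2 * g k (\<eta> - \<xi>)) \<partial>lborel) \<partial>lborel)"
      by (simp add: nn_integral_add)
    also have "(\<integral>\<^sup>+\<xi>. (\<integral>\<^sup>+\<eta>. ennreal ((cmod (V \<eta>))\<^sup>2 / 2 * g k (\<eta> - \<xi>)) \<partial>lborel) \<partial>lborel)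
       = (\<integral>\<^sup>+\<eta>. (\<integral>\<^sup>+\<xi>. ennreal ((cmod (V \<eta>))\<^sup>2 / 2 * g k (\<eta> - \<xi>)) \<partial>lborel) \<partial>lborel)"
      by (rule lborel_pair.Fubini') measurable
    also have "(\<integral>\<^sup>+\<xi>. (\<integral>\<^sup>+\<eta>. ennreal ((cmod (V \<xi>))\<^sup>2 / 2 * g k (\<eta> - \<xi>)) \<partial>lborel) \<partial>lborel) = N / 2"
      by (simp add: ennreal_mult g0 nn_integral_cmult gI N_def nn_integral_divide flip: divide_ennreal)
    also have "(\<integral>\<^sup>+\<eta>. (\<integral>\<^sup>+\<xi>. ennreal ((cmod (V \<eta>))\<^sup>2 / 2 * g k (\<eta> - \<xi>)) \<partial>lborel) \<partial>lborel) = N / 2"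
      by (simp add: ennreal_mult g0 nn_integral_cmult gI N_def nn_integral_divide flip: divide_ennreal)
    also have "N / 2 + N / 2 = N" by (simp add: divide_ennreal_def flip: distrib_left ennreal_half ennreal_plus)
    finally show ?thesis by (auto simp: ennreal_leI)
  qed
  have lim: "(\<lambda>k. ennreal (e k x * (cmod (ift V x))\<^sup>2)) \<longlonglongrightarrow> ennreal ((cmod (ift V x))\<^sup>2)" for x
  proof -
    have "(\<lambda>k. e k x * (cmod (ift V x))\<^sup>2) \<longlonglongrightarrow> exp (- (pi * 0\<^sup>2 * (norm x)\<^sup>2)) * (cmod (ift V x))\<^sup>2"
      unfolding e_def by (intro tendsto_intros a0)
    then show ?thesis by (intro tendsto_ennrealI) simp
  qed
  have "(\<integral>\<^sup>+x. ennreal ((cmod (ift V x))\<^sup>2) \<partial>lborel) = (\<integral>\<^sup>+x. liminf (\<lambda>k. ennreal (e k x * (cmod (ift V x))\<^sup>2)) \<partial>lborel)"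
    using lim_imp_Liminf[OF _ lim] by (intro nn_integral_cong) simp
  also have "\<dots> \<le> liminf (\<lambda>k. \<integral>\<^sup>+x. ennreal (e k x * (cmod (ift V x))\<^sup>2) \<partial>lborel)"
    by (rule nn_integral_liminf) measurable
  also have "\<dots> \<le> N"
    using bound by (intro Liminf_le) auto
  finally show ?thesis unfolding N_def .
qed

text \<open>Mean value theorem. The factor \<open>z\<close> from the derivative is absorbed by
  \<open>z \<le> exp (z\<^sup>2)\<close>, and \<open>pi - 1 \<ge> 2\<close> leaves the decay
  \<open>exp (- (2 * m\<^sup>2))\<close> at any common lower bound \<open>m\<close> of the two
  points.\<close>

lemma exp_neg_sq_diff_le:
  fixes a b m :: real
  assumes "0 \<le> m" "m \<le> a" "m \<le> b"
  shows "\<bar>exp (- (pi * a\<^sup>2)) - exp (- (pi * b\<^sup>2))\<bar> \<le> 2 * pi * \<bar>a - b\<bar> * exp (- (2 * m\<^sup>2))"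
proof -
  have *: "\<bar>exp (- (pi * a\<^sup>2)) - exp (- (pi * b\<^sup>2))\<bar> \<le> 2 * pi * \<bar>a - b\<bar> * exp (- (2 * m\<^sup>2))"
    if "m \<le> a" "a < b" for a b :: real
  proof -
    have "\<exists>z>a. z < b \<and> exp (- (pi * b\<^sup>2)) - exp (- (pi * a\<^sup>2)) = (b - a) * (exp (- (pi * z\<^sup>2)) * (- (pi * (2 * z))))"
      by (rule MVT2[OF that(2)]) (auto intro!: derivative_eq_intros)
    then obtain z where z: "a < z" "z < b" and
      eq: "exp (- (pi * b\<^sup>2)) - exp (- (pi * a\<^sup>2)) = (b - a) * (exp (- (pi * z\<^sup>2)) * (- (pi * (2 * z))))"
      by blast
    have z0: "z > 0" "m \<le> z" using z that assms(1) by auto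
    have "z \<le> 1 + z\<^sup>2" using sum_squares_ge_zero[of "z - 1/2" 0] by (simp add: power2_eq_square algebra_simps)
    also have "\<dots> \<le> exp (z\<^sup>2)" by (rule exp_ge_add_one_self)
    finally have "z * exp (- (pi * z\<^sup>2)) \<le> exp (z\<^sup>2) * exp (- (pi * z\<^sup>2))" by (intro mult_right_mono) auto
    also have "\<dots> = exp (- ((pi - 1) * z\<^sup>2))" by (simp add: algebra_simps flip: exp_add)
    also have "\<dots> \<le> exp (- (2 * m\<^sup>2))"
    proof -
      have "2 * m\<^sup>2 \<le> (pi - 1) * z\<^sup>2"
        using pi_gt3 z0 assms(1) by (intro mult_mono power_mono) auto
      then show ?thesis by simp
    qed
    finally have zz: "z * exp (- (pi * z\<^sup>2)) \<le> exp (- (2 * m\<^sup>2))" .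
    have "\<bar>exp (- (pi * a\<^sup>2)) - exp (- (pi * b\<^sup>2))\<bar> = \<bar>(b - a) * (exp (- (pi * z\<^sup>2)) * (- (pi * (2 * z))))\<bar>"
      unfolding eq[symmetric] by (rule abs_minus_commute)
    also have "\<dots> = 2 * pi * \<bar>a - b\<bar> * (z * exp (- (pi * z\<^sup>2)))"
      using z0 by (simp add: abs_mult abs_minus_commute)
    also have "\<dots> \<le> 2 * pi * \<bar>a - b\<bar> * exp (- (2 * m\<^sup>2))"
      using zz by (intro mult_left_mono) auto
    finally show ?thesis .
  qed
  show ?thesis
  proof (cases a b rule: linorder_cases)
    case less
    then show ?thesis using * assms by blast
  next
    case greater
    then show ?thesis using *[of b a] assms by (simp add: abs_minus_commute)
  qed simp
qed

text \<open>To be usable as an averaging kernel, the difference must keep a Gaussian tail besides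
  the small factor; the tail is wider than the original one, with 1 in place of \<open>pi\<close> in
  the exponent.\<close>

lemma gaussian_diff_le:
  fixes x y z :: "'a::euclidean_space"
  assumes "\<rho> > 0" "\<rho> * norm (x - y) \<le> 1"
  shows "\<bar>exp (- (pi * \<rho>\<^sup>2 * (norm (z - x))\<^sup>2)) - exp (- (pi * \<rho>\<^sup>2 * (norm (z - y))\<^sup>2))\<bar>
     \<le> 2 * pi * exp 2 * (\<rho> * norm (x - y)) * exp (- (\<rho>\<^sup>2 * (norm (x - z))\<^sup>2))"
proof -
  define a b where "a = \<rho> * norm (z - x)" and "b = \<rho> * norm (z - y)"
  have ab: "\<bar>a - b\<bar> \<le> \<rho> * norm (x - y)"
  proof -
    have "\<bar>norm (z - x) - norm (z - y)\<bar> \<le> norm (x - y)"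
      using norm_triangle_ineq3[of "z - x" "z - y"] by (simp add: norm_minus_commute)
    then show ?thesis using assms(1) by (simp add: a_def b_def abs_mult flip: right_diff_distrib)
  qed
  \<comment> \<open>The two scaled distances differ by at most 1, so \<open>a - 1\<close>, cut at 0,
    lies below both.\<close>
  define m where "m = max 0 (a - 1)"
  have m: "0 \<le> m" "m \<le> a" "m \<le> b"
    using ab assms unfolding m_def by (auto simp: a_def b_def)
  \<comment> \<open>Completing the square:
    \<open>2 * (a - 1)\<^sup>2 - (a\<^sup>2 - 2) = (a - 2)\<^sup>2\<close>. The 2 lost here is the
    origin of the factor \<open>exp 2\<close>.\<close>
  have "2 * m\<^sup>2 \<ge> a\<^sup>2 - 2"
  proof (cases "a \<ge> 1")
    case True
    then have "2 * m\<^sup>2 - (a\<^sup>2 - 2) = (a - 2)\<^sup>2" by (simp add: m_def power2_eq_square algebra_simps)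
    then show ?thesis using zero_le_power2[of "a - 2"] by linarith
  next
    case False
    then have "a\<^sup>2 \<le> 1" using m power_mono[of a 1 2] by auto
    then show ?thesis using zero_le_power2[of m] by linarith
  qed
  then have "exp (- (2 * m\<^sup>2)) \<le> exp 2 * exp (- a\<^sup>2)" by (simp flip: exp_add)
  then have "2 * pi * \<bar>a - b\<bar> * exp (- (2 * m\<^sup>2)) \<le> 2 * pi * (\<rho> * norm (x - y)) * (exp 2 * exp (- a\<^sup>2))"
    using ab by (intro mult_mono) auto
  with exp_neg_sq_diff_le[OF m]
  have "\<bar>exp (- (pi * a\<^sup>2)) - exp (- (pi * b\<^sup>2))\<bar> \<le> 2 * pi * (\<rho> * norm (x - y)) * (exp 2 * exp (- a\<^sup>2))"
    by (rule order_trans)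
  then show ?thesis by (simp add: a_def b_def power_mult_distrib norm_minus_commute mult_ac)
qed

lemma weighted_Cauchy_Schwarz:
  assumes [measurable]: "H \<in> borel_measurable M" "v \<in> borel_measurable M"
    and H: "\<And>z. H z \<ge> 0" and v: "\<And>z. v z \<ge> 0"
  shows "(\<integral>\<^sup>+z. ennreal (H z * v z) \<partial>M)\<^sup>2 \<le>
     (\<integral>\<^sup>+z. ennreal (H z) \<partial>M) * (\<integral>\<^sup>+z. ennreal (H z * (v z)\<^sup>2) \<partial>M)"
proof -
  have "(\<integral>\<^sup>+z. ennreal (sqrt (H z)) * ennreal (sqrt (H z) * v z) \<partial>M)\<^sup>2 \<le>
     (\<integral>\<^sup>+z. (ennreal (sqrt (H z)))\<^sup>2 \<partial>M) * (\<integral>\<^sup>+z. (ennreal (sqrt (H z) * v z))\<^sup>2 \<partial>M)"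
    by (rule Cauchy_Schwarz_nn_integral) measurable
  moreover have "ennreal (sqrt (H z)) * ennreal (sqrt (H z) * v z) = ennreal (H z * v z)" for z
    using H[of z] v[of z] by (simp add: mult.assoc[symmetric] flip: ennreal_mult)
  moreover have "(ennreal (sqrt (H z)))\<^sup>2 = ennreal (H z)" for z
    using H[of z] by (simp add: ennreal_power)
  moreover have "(ennreal (sqrt (H z) * v z))\<^sup>2 = ennreal (H z * (v z)\<^sup>2)" for z
    using H[of z] v[of z] by (simp add: ennreal_power power_mult_distrib)
  ultimately show ?thesis by simp
qed

text \<open>A frequency-localised function is a Gaussian average at its own scale of another square integrable
  function: the exponential growth of the symbol needed to undo the average is harmless on the ball of radius \<open>\<rho>\<close>.\<close>

lemma frequency_block:
  fixes V :: "'a::euclidean_space \<Rightarrow> complex"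
  assumes V: "integrable lborel V" and supp: "\<And>\<xi>. norm \<xi> > \<rho> \<Longrightarrow> V \<xi> = 0" and \<rho>: "\<rho> > 0"
    and sf: "sigma_finite_measure \<mu>" and sets: "sets \<mu> = sets borel"
    and B: "\<And>y. (\<integral>\<^sup>+x. ennreal (\<rho> ^ DIM('a) * exp (- (\<rho>\<^sup>2 * (norm (x - y))\<^sup>2))) \<partial>\<mu>) \<le> B"
  obtains M where "M \<in> borel_measurable borel"
    "\<And>x. ennreal ((cmod (ift V x))\<^sup>2) \<le> M x"
    "\<And>x y. \<rho> * norm (x - y) \<le> 1 \<Longrightarrow> ennreal ((cmod (ift V x - ift V y))\<^sup>2) \<le> ennreal ((\<rho> * norm (x - y))\<^sup>2) * M x"
    "(\<integral>\<^sup>+x. M x \<partial>\<mu>) \<le> ennreal ((2 * pi * exp 2)\<^sup>2 * sqrt pi ^ DIM('a) * exp (2 * pi)) * B * (\<integral>\<^sup>+\<xi>. ennreal ((cmod (V \<xi>))\<^sup>2) \<partial>lborel)"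
proof -
  interpret sigma_finite_measure \<mu> by fact
  interpret P: pair_sigma_finite \<mu> "lborel :: 'a measure" ..
  note sets[measurable_cong]
  have [measurable]: "V \<in> borel_measurable borel" using V by auto
  \<comment> \<open>Division by the transform of the Gaussian \<open>G\<close>, cut to the ball of
    radius \<open>\<rho>\<close>, where the reciprocal is at most \<open>exp pi\<close>.\<close>
  define V' where "V' \<xi> = V \<xi> * complex_of_real (if norm \<xi> \<le> \<rho> then exp (pi * (norm \<xi>)\<^sup>2 / \<rho>\<^sup>2) else 0)" for \<xi>
  have [measurable]: "V' \<in> borel_measurable borel" unfolding V'_def by measurable
  have e: "\<bar>if norm \<xi> \<le> \<rho> then exp (pi * (norm \<xi>)\<^sup>2 / \<rho>\<^sup>2) else 0\<bar> \<le> exp pi" for \<xi> :: 'a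
    using \<rho> power_mono[of "norm \<xi>" \<rho> 2] by (auto simp: divide_simps)
  have V': "integrable lborel V'"
    unfolding V'_def
    by (rule integrable_mult_bounded[OF V, where B="exp pi"], measurable) (use e in \<open>simp del: abs_if\<close>)
  have V'2: "(\<integral>\<^sup>+\<xi>. ennreal ((cmod (V' \<xi>))\<^sup>2) \<partial>lborel) \<le> ennreal (exp (2 * pi)) * (\<integral>\<^sup>+\<xi>. ennreal ((cmod (V \<xi>))\<^sup>2) \<partial>lborel)"
  proof (subst nn_integral_cmult[symmetric])
    show "(\<integral>\<^sup>+\<xi>. ennreal ((cmod (V' \<xi>))\<^sup>2) \<partial>lborel) \<le> (\<integral>\<^sup>+\<xi>. ennreal (exp (2 * pi)) * ennreal ((cmod (V \<xi>))\<^sup>2) \<partial>lborel)"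
    proof (rule nn_integral_mono)
      fix \<xi>
      have "cmod (V' \<xi>) \<le> cmod (V \<xi>) * exp pi"
        unfolding V'_def norm_mult norm_of_real by (intro mult_left_mono e) auto
      then have "(cmod (V' \<xi>))\<^sup>2 \<le> (cmod (V \<xi>) * exp pi)\<^sup>2" by (intro power_mono) auto
      also have "\<dots> = exp (2 * pi) * (cmod (V \<xi>))\<^sup>2"
        by (simp add: power_mult_distrib exp_double)
      finally show "ennreal ((cmod (V' \<xi>))\<^sup>2) \<le> ennreal (exp (2 * pi)) * ennreal ((cmod (V \<xi>))\<^sup>2)"
        by (simp add: ennreal_leI flip: ennreal_mult)
    qed
  qed measurable
  define v where "v = ift V'"
  have [measurable]: "v \<in> borel_measurable borel" unfolding v_def by measurable
  \<comment> \<open>\<open>G\<close> is the averaging kernel. The wider \<open>H\<close> dominates,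
    up to constants, both \<open>G\<close> and the differences of \<open>G\<close> at nearby
    centres, so one majorant serves both estimates.\<close>
  define G where "G x z = \<rho> ^ DIM('a) * exp (- (pi * \<rho>\<^sup>2 * (norm (z - x))\<^sup>2))" for x z :: 'a
  define H where "H x z = \<rho> ^ DIM('a) * exp (- (\<rho>\<^sup>2 * (norm (x - z))\<^sup>2))" for x z :: 'a
  have H0: "H x z \<ge> 0" for x z using \<rho> by (simp add: H_def)
  have [measurable]: "case_prod H \<in> borel_measurable (borel \<Otimes>\<^sub>M borel)"
    unfolding H_def by measurable
  have [measurable]: "H x \<in> borel_measurable borel" "G x \<in> borel_measurable borel" for x
    unfolding H_def G_def by measurable
  have HI: "(\<integral>\<^sup>+z. ennreal (H x z) \<partial>lborel) = ennreal (sqrt pi ^ DIM('a))" for x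
  proof -
    have "(\<integral>\<^sup>+z. ennreal (H x z) \<partial>lborel) =
        (\<integral>\<^sup>+z. ennreal (\<rho> ^ DIM('a)) * ennreal (exp (- (\<rho>\<^sup>2 * (norm (x - z))\<^sup>2))) \<partial>lborel)"
      using \<rho> by (simp add: H_def ennreal_mult)
    also have "\<dots> = ennreal (\<rho> ^ DIM('a)) * ennreal (sqrt (pi / \<rho>\<^sup>2) ^ DIM('a))"
      using \<rho> by (subst nn_integral_cmult, measurable, subst nn_integral_gaussian(2)) auto
    also have "\<dots> = ennreal (sqrt pi ^ DIM('a))"
      using \<rho> by (simp add: real_sqrt_divide power_divide flip: ennreal_mult)
    finally show ?thesis .
  qed
  have Gint: "integrable lborel (\<lambda>z. complex_of_real (G x z))" for x
    using integrable_mult_right[OF ift_gaussian(1)[OF \<rho>, of x 0], of "complex_of_real (\<rho> ^ DIM('a))"]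
    by (simp add: G_def)
  have iG: "ift (\<lambda>z. complex_of_real (G x z)) \<xi> = cis (2 * pi * (x \<bullet> \<xi>)) * complex_of_real (exp (- (pi * (norm \<xi>)\<^sup>2 / \<rho>\<^sup>2)))" for x \<xi>
  proof -
    have "ift (\<lambda>z. complex_of_real (G x z)) \<xi> = complex_of_real (\<rho> ^ DIM('a)) *
        ift (\<lambda>z. complex_of_real (exp (- (pi * \<rho>\<^sup>2 * (norm (z - x))\<^sup>2))) * cis (2 * pi * (z \<bullet> 0))) \<xi>"
      unfolding ift_def by (subst integral_mult_right_zero[symmetric]) (simp add: G_def mult_ac)
    then show ?thesis unfolding ift_gaussian(2)[OF \<rho>] using \<rho> by simp
  qed
  have rep: "ift V x = (LINT z|lborel. complex_of_real (G x z) * v z)" for x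
  proof -
    have "(LINT z|lborel. complex_of_real (G x z) * v z) = (LINT \<xi>|lborel. V' \<xi> * ift (\<lambda>z. complex_of_real (G x z)) \<xi>)"
      unfolding v_def by (rule ift_multiplication[OF Gint V'])
    also have "\<dots> = ift V x"
      unfolding ift_def[of V] iG V'_def
    proof (intro Bochner_Integration.integral_cong refl)
      fix \<xi> :: 'a
      have "exp (pi * (norm \<xi>)\<^sup>2 / \<rho>\<^sup>2) * exp (- (pi * (norm \<xi>)\<^sup>2 / \<rho>\<^sup>2)) = 1" by (simp flip: exp_add)
      then have "complex_of_real (exp (pi * (norm \<xi>)\<^sup>2 / \<rho>\<^sup>2)) * complex_of_real (exp (- (pi * (norm \<xi>)\<^sup>2 / \<rho>\<^sup>2))) = 1"
        by (metis of_real_mult of_real_1)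
      then show "V \<xi> * complex_of_real (if norm \<xi> \<le> \<rho> then exp (pi * (norm \<xi>)\<^sup>2 / \<rho>\<^sup>2) else 0) *
          (cis (2 * pi * (x \<bullet> \<xi>)) * complex_of_real (exp (- (pi * (norm \<xi>)\<^sup>2 / \<rho>\<^sup>2)))) = V \<xi> * cis (2 * pi * (x \<bullet> \<xi>))"
        using supp[of \<xi>] by (auto simp: mult_ac)
    qed
    finally show ?thesis by simp
  qed
  define Bv where "Bv = (LINT \<xi>|lborel. cmod (V' \<xi>))"
  have Bv: "cmod (v z) \<le> Bv" for z unfolding v_def Bv_def by (rule ift_norm_le[OF V'])
  have Gv: "integrable lborel (\<lambda>z. complex_of_real (G x z) * v z)" for x
    by (rule integrable_mult_bounded[OF Gint _ Bv]) measurable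
  define J where "J x = (\<integral>\<^sup>+z. ennreal (H x z * (cmod (v z))\<^sup>2) \<partial>lborel)" for x
  \<comment> \<open>Cauchy-Schwarz against the finite measure with density \<open>H x\<close> turns
    a bound of first order in \<open>v\<close> into one of second order.\<close>
  have CS: "(ennreal t)\<^sup>2 \<le> (ennreal c)\<^sup>2 * (ennreal (sqrt pi ^ DIM('a)) * J x)"
    if "ennreal t \<le> ennreal c * (\<integral>\<^sup>+z. ennreal (H x z * cmod (v z)) \<partial>lborel)" for t c x
  proof -
    have "(ennreal t)\<^sup>2 \<le> (ennreal c)\<^sup>2 * (\<integral>\<^sup>+z. ennreal (H x z * cmod (v z)) \<partial>lborel)\<^sup>2"
      unfolding power_mult_distrib[symmetric] by (rule power_mono[OF that]) simp
    also have "\<dots> \<le> (ennreal c)\<^sup>2 * (ennreal (sqrt pi ^ DIM('a)) * J x)"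
      unfolding HI[symmetric, of x] J_def
      by (intro mult_left_mono weighted_Cauchy_Schwarz) (auto simp: H0)
    finally show ?thesis .
  qed
  \<comment> \<open>The constant of \<open>gaussian_diff_le\<close>; being at least 1, it also
    serves the bound on \<open>ift V\<close> itself.\<close>
  define K where "K = 2 * pi * exp 2"
  have K: "K \<ge> 1"
  proof -
    have "1 * 1 \<le> (2 * pi) * exp 2" using pi_gt3 by (intro mult_mono) auto
    then show ?thesis by (simp add: K_def)
  qed
  define M where "M x = (ennreal K)\<^sup>2 * (ennreal (sqrt pi ^ DIM('a)) * J x)" for x
  show ?thesis
  proof
    show "M \<in> borel_measurable borel" unfolding M_def J_def by measurable
    show "ennreal ((cmod (ift V x))\<^sup>2) \<le> M x" for x
    proof -
      have "ennreal (cmod (ift V x)) \<le> (\<integral>\<^sup>+z. ennreal (cmod (complex_of_real (G x z) * v z)) \<partial>lborel)"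
        unfolding rep by (rule integral_norm_bound_ennreal[OF Gv])
      also have "\<dots> \<le> (\<integral>\<^sup>+z. ennreal K * ennreal (H x z * cmod (v z)) \<partial>lborel)"
      proof (rule nn_integral_mono)
        fix z
        have "1 * (\<rho>\<^sup>2 * (norm (z - x))\<^sup>2) \<le> pi * (\<rho>\<^sup>2 * (norm (z - x))\<^sup>2)"
          using pi_gt3 by (intro mult_right_mono) auto
        then have "G x z \<le> H x z"
          unfolding G_def H_def using \<rho> by (intro mult_left_mono) (auto simp: norm_minus_commute mult.assoc)
        then have "G x z * cmod (v z) \<le> H x z * cmod (v z)" by (intro mult_right_mono) auto
        also have "\<dots> \<le> K * (H x z * cmod (v z))"
          using K H0[of x z] mult_right_mono[of 1 K "H x z * cmod (v z)"] by simp
        finally show "ennreal (cmod (complex_of_real (G x z) * v z)) \<le> ennreal K * ennreal (H x z * cmod (v z))"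
          using K \<rho> by (simp add: norm_mult norm_power G_def ennreal_leI flip: ennreal_mult')
      qed
      also have "\<dots> = ennreal K * (\<integral>\<^sup>+z. ennreal (H x z * cmod (v z)) \<partial>lborel)"
        by (rule nn_integral_cmult) measurable
      finally show ?thesis
        unfolding M_def by (subst ennreal_power[symmetric]) (auto intro!: CS)
    qed
    show "ennreal ((cmod (ift V x - ift V y))\<^sup>2) \<le> ennreal ((\<rho> * norm (x - y))\<^sup>2) * M x"
      if xy: "\<rho> * norm (x - y) \<le> 1" for x y
    proof -
      define \<tau> where "\<tau> = \<rho> * norm (x - y)"
      have \<tau>: "\<tau> \<ge> 0" using \<rho> by (simp add: \<tau>_def)
      have "ift V x - ift V y = (LINT z|lborel. complex_of_real (G x z) * v z - complex_of_real (G y z) * v z)"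
        unfolding rep using Gv Gv by (rule Bochner_Integration.integral_diff[symmetric])
      then have "ennreal (cmod (ift V x - ift V y)) \<le>
         (\<integral>\<^sup>+z. ennreal (cmod (complex_of_real (G x z) * v z - complex_of_real (G y z) * v z)) \<partial>lborel)"
        using integral_norm_bound_ennreal[OF Bochner_Integration.integrable_diff[OF Gv[of x] Gv[of y]]] by simp
      also have "\<dots> \<le> (\<integral>\<^sup>+z. ennreal (K * \<tau>) * ennreal (H x z * cmod (v z)) \<partial>lborel)"
      proof (rule nn_integral_mono)
        fix z
        have "\<bar>G x z - G y z\<bar> \<le> K * \<tau> * H x z"
          using mult_left_mono[OF gaussian_diff_le[OF \<rho> xy, of z], of "\<rho> ^ DIM('a)"] \<rho>
          by (simp add: G_def H_def K_def \<tau>_def abs_mult mult_ac flip: right_diff_distrib)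
        then have "\<bar>G x z - G y z\<bar> * cmod (v z) \<le> K * \<tau> * H x z * cmod (v z)" by (intro mult_right_mono) auto
        then show "ennreal (cmod (complex_of_real (G x z) * v z - complex_of_real (G y z) * v z))
            \<le> ennreal (K * \<tau>) * ennreal (H x z * cmod (v z))"
          using K \<tau> H0 by (simp add: norm_mult ennreal_leI mult.assoc flip: left_diff_distrib of_real_diff ennreal_mult')
      qed
      also have "\<dots> = ennreal (K * \<tau>) * (\<integral>\<^sup>+z. ennreal (H x z * cmod (v z)) \<partial>lborel)"
        by (rule nn_integral_cmult) measurable
      finally have "(ennreal (cmod (ift V x - ift V y)))\<^sup>2 \<le> (ennreal (K * \<tau>))\<^sup>2 * (ennreal (sqrt pi ^ DIM('a)) * J x)"
        by (rule CS)
      also have "(ennreal (K * \<tau>))\<^sup>2 = ennreal (\<tau>\<^sup>2) * (ennreal K)\<^sup>2"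
        using K \<tau> by (simp add: ennreal_mult power_mult_distrib ennreal_power mult.commute)
      finally show ?thesis unfolding M_def \<tau>_def by (simp add: ennreal_power mult.assoc)
    qed
    \<comment> \<open>Integrating over \<open>\<mu>\<close> first leaves a Gaussian integral bounded
      by \<open>B\<close>; the rest is the squared norm of \<open>v\<close>, hence controlled by
      that of \<open>V\<close>.\<close>
    have "(\<integral>\<^sup>+x. J x \<partial>\<mu>) = (\<integral>\<^sup>+z. (\<integral>\<^sup>+x. ennreal (H x z * (cmod (v z))\<^sup>2) \<partial>\<mu>) \<partial>lborel)"
      unfolding J_def by (rule P.Fubini'[symmetric]) measurable
    also have "\<dots> = (\<integral>\<^sup>+z. (\<integral>\<^sup>+x. ennreal (H x z) \<partial>\<mu>) * ennreal ((cmod (v z))\<^sup>2) \<partial>lborel)"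
      by (intro nn_integral_cong) (simp add: ennreal_mult' H0 nn_integral_multc)
    also have "\<dots> \<le> (\<integral>\<^sup>+z. B * ennreal ((cmod (v z))\<^sup>2) \<partial>lborel)"
      using B unfolding H_def by (intro nn_integral_mono mult_right_mono) auto
    also have "\<dots> = B * (\<integral>\<^sup>+z. ennreal ((cmod (v z))\<^sup>2) \<partial>lborel)"
      by (rule nn_integral_cmult) measurable
    also have "\<dots> \<le> B * (ennreal (exp (2 * pi)) * (\<integral>\<^sup>+\<xi>. ennreal ((cmod (V \<xi>))\<^sup>2) \<partial>lborel))"
      unfolding v_def by (intro mult_left_mono order_trans[OF ift_L2_le[OF V'] V'2]) auto
    finally have J: "(\<integral>\<^sup>+x. J x \<partial>\<mu>) \<le> \<dots>" .
    have "(\<integral>\<^sup>+x. M x \<partial>\<mu>) = (ennreal K)\<^sup>2 * ennreal (sqrt pi ^ DIM('a)) * (\<integral>\<^sup>+x. J x \<partial>\<mu>)"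
      unfolding M_def mult.assoc[symmetric] by (rule nn_integral_cmult) (unfold J_def, measurable)
    also have "\<dots> \<le> (ennreal K)\<^sup>2 * ennreal (sqrt pi ^ DIM('a)) * (B * (ennreal (exp (2 * pi)) * (\<integral>\<^sup>+\<xi>. ennreal ((cmod (V \<xi>))\<^sup>2) \<partial>lborel)))"
      by (intro mult_left_mono J) auto
    also have "\<dots> = ennreal (K\<^sup>2 * sqrt pi ^ DIM('a) * exp (2 * pi)) * B * (\<integral>\<^sup>+\<xi>. ennreal ((cmod (V \<xi>))\<^sup>2) \<partial>lborel)"
      using K by (simp add: ennreal_mult ennreal_power mult_ac)
    finally show "(\<integral>\<^sup>+x. M x \<partial>\<mu>) \<le> ennreal ((2 * pi * exp 2)\<^sup>2 * sqrt pi ^ DIM('a) * exp (2 * pi)) * B * (\<integral>\<^sup>+\<xi>. ennreal ((cmod (V \<xi>))\<^sup>2) \<partial>lborel)"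
      unfolding K_def .
  qed
qed

section \<open>Upper regular measures\<close>

lemma dyadic_scale_le_one:
  fixes t :: real assumes "0 < t" "t \<le> 1"
  obtains k where "(1/2) ^ Suc k < t" "t \<le> (1/2) ^ k"
proof -
  define k where "k = (LEAST k. (1/2) ^ Suc k < t)"
  obtain m where "(1/2) ^ m < t" using real_arch_pow_inv[OF assms(1), of "1/2"] by auto
  then have "(1/2) ^ Suc m < t" using assms by (simp add: field_simps)
  then have 1: "(1/2) ^ Suc k < t" unfolding k_def by (rule LeastI)
  moreover have "t \<le> (1/2) ^ k"
  proof (cases k)
    case 0 then show ?thesis using assms by simp
  next
    case (Suc j)
    then have "\<not> (1/2) ^ Suc j < t" using not_less_Least[of j "\<lambda>k. (1/2) ^ Suc k < t"] by (auto simp: k_def)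
    then show ?thesis using Suc by simp
  qed
  ultimately show ?thesis using that by blast
qed

lemma dyadic_scale_gt_one:
  fixes t :: real assumes "1 < t"
  obtains k where "2 ^ k < t" "t \<le> 2 ^ Suc k"
proof -
  define k where "k = (LEAST k. t \<le> 2 ^ Suc k)"
  obtain m where "t < 2 ^ m" using real_arch_pow[of 2 t] by auto
  then have "t \<le> 2 ^ Suc m" using assms by simp
  then have 1: "t \<le> 2 ^ Suc k" unfolding k_def by (rule LeastI)
  moreover have "2 ^ k < t"
  proof (cases k)
    case 0 then show ?thesis using assms by simp
  next
    case (Suc j)
    then have "\<not> t \<le> 2 ^ Suc j" using not_less_Least[of j "\<lambda>k. t \<le> 2 ^ Suc k"] by (auto simp: k_def)
    then show ?thesis using Suc by simp
  qed
  ultimately show ?thesis using that by blast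
qed

lemma suminf_ennreal_geometric:
  fixes c q :: real assumes "c \<ge> 0" "0 \<le> q" "q < 1"
  shows "(\<Sum>k. ennreal (c * q ^ k)) = ennreal (c / (1 - q))"
proof -
  have "(\<lambda>k. c * q ^ k) sums (c * (1 / (1 - q)))"
    using assms by (intro sums_mult geometric_sums) auto
  then show ?thesis using assms by (intro suminf_ennreal_eq) auto
qed

text \<open>With an integer \<open>k\<close> above \<open>\<bar>p\<bar>\<close> the power is at most
  \<open>(b\<^sup>2) ^ k\<close>, and the \<open>k\<close>-th power of
  \<open>b\<^sup>2 / k \<le> exp (b\<^sup>2 / k)\<close> compares this with
  \<open>exp (b\<^sup>2)\<close> at the price \<open>k ^ k\<close>.\<close>

lemma powr_mult_exp_neg_sq_bounded:
  fixes p :: real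
  obtains K where "K > 0" "\<And>b. b \<ge> 1 \<Longrightarrow> b powr p * exp (- b\<^sup>2) \<le> K"
proof -
  obtain k :: nat where k: "\<bar>p\<bar> < real k" using reals_Archimedean2 by blast
  then have k0: "k > 0" by (cases k) auto
  show ?thesis
  proof (rule that)
  show "real k ^ k > 0" using k0 by simp
  fix b :: real assume b: "b \<ge> 1"
  have "p \<le> real (2 * k)" using k by simp
  then have "b powr p \<le> b powr real (2 * k)" using b by (intro powr_mono) auto
  also have "\<dots> = (b\<^sup>2) ^ k" using b by (subst powr_realpow) (auto simp: power_mult)
  also have "\<dots> = real k ^ k * (b\<^sup>2 / real k) ^ k" using k0 by (simp add: power_divide)
  also have "(b\<^sup>2 / real k) ^ k \<le> exp (b\<^sup>2 / real k) ^ k"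
    using exp_ge_add_one_self[of "b\<^sup>2 / real k"] by (intro power_mono) (linarith, simp)
  also have "exp (b\<^sup>2 / real k) ^ k = exp (b\<^sup>2)" using k0 by (simp flip: exp_of_nat_mult)
  finally have "b powr p \<le> real k ^ k * exp (b\<^sup>2)" by (simp add: mult_left_mono)
  then have "b powr p * exp (- b\<^sup>2) \<le> real k ^ k * exp (b\<^sup>2) * exp (- b\<^sup>2)" by (intro mult_right_mono) auto
  then show "b powr p * exp (- b\<^sup>2) \<le> real k ^ k" by (simp add: mult.assoc flip: exp_add)
qed
qed

lemma cball_sets_borel [measurable]: "cball (x::'a::metric_space) r \<in> sets borel"
  by simp

text \<open>The upper half of Ahlfors regularity. It is used for the boundary measure with
  \<open>d = n - 1\<close> and for Lebesgue measure with \<open>d = n\<close>, so the dyadic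
  estimates are proved once for both.\<close>

locale upper_regular =
  fixes \<mu> :: "'a::euclidean_space measure" and d C :: real
  assumes sets_eq [measurable_cong, simp]: "sets \<mu> = sets borel"
    and d_pos: "d > 0" and C_nonneg: "C \<ge> 0"
    and emeasure_cball_le: "\<And>x r. r > 0 \<Longrightarrow> emeasure \<mu> (cball x r) \<le> ennreal (C * r powr d)"
begin

lemma space_eq [simp]: "space \<mu> = UNIV"
  using sets_eq_imp_space_eq[OF sets_eq] by simp

sublocale sigma_finite_measure \<mu>
proof
  show "\<exists>A. countable A \<and> A \<subseteq> sets \<mu> \<and> \<Union> A = space \<mu> \<and> (\<forall>a\<in>A. emeasure \<mu> a \<noteq> \<infinity>)"
  proof (intro exI conjI)
    show "\<Union> (range (\<lambda>k. cball (0::'a) (real (Suc k)))) = space \<mu>"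
    proof -
      have "\<exists>k. x \<in> cball 0 (real (Suc k))" for x :: 'a
        using reals_Archimedean2[of "norm x"] by (metis less_imp_le lessI mem_cball_0 of_nat_less_iff order_le_less_trans order_less_trans)
      then show ?thesis by auto
    qed
    show "\<forall>a\<in>range (\<lambda>k. cball (0::'a) (real (Suc k))). emeasure \<mu> a \<noteq> \<infinity>"
    proof
      fix a assume "a \<in> range (\<lambda>k. cball (0::'a) (real (Suc k)))"
      then obtain k where "a = cball 0 (real (Suc k))" by auto
      then show "emeasure \<mu> a \<noteq> \<infinity>"
        using emeasure_cball_le[of "real (Suc k)" 0] by (auto simp: top_unique simp del: of_nat_Suc)
    qed
  qed auto
qed

text \<open>At the centre the integrand is \<open>0\<close> in both lemmas below, because \<open>0 powr a = 0\<close>.\<close>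

lemma near_integral:
  assumes "\<beta> > 0" "r > 0"
  shows "(\<integral>\<^sup>+y. indicator (cball x r) y * ennreal (norm (y - x) powr (\<beta> - d)) \<partial>\<mu>)
     \<le> ennreal (C * 2 powr \<bar>\<beta> - d\<bar> / (1 - 2 powr (- \<beta>)) * r powr \<beta>)"
proof -
  define R where "R k = r * (1/2) ^ k" for k :: nat
  have R: "R k > 0" for k using assms by (simp add: R_def)
  \<comment> \<open>The annulus \<open>k\<close> lies between the radii \<open>R k / 2\<close> and
    \<open>R k\<close>; the factor \<open>2 powr \<bar>\<beta> - d\<bar>\<close> covers both signs
    of the exponent.\<close>
  define c where "c k = 2 powr \<bar>\<beta> - d\<bar> * R k powr (\<beta> - d)" for k
  have c0: "c k \<ge> 0" for k by (simp add: c_def)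
  have "(\<integral>\<^sup>+y. indicator (cball x r) y * ennreal (norm (y - x) powr (\<beta> - d)) \<partial>\<mu>)
      \<le> (\<integral>\<^sup>+y. (\<Sum>k. ennreal (c k) * indicator (cball x (R k)) y) \<partial>\<mu>)"
  proof (rule nn_integral_mono)
    fix y
    show "indicator (cball x r) y * ennreal (norm (y - x) powr (\<beta> - d)) \<le> (\<Sum>k. ennreal (c k) * indicator (cball x (R k)) y)"
    proof (cases "y \<in> cball x r \<and> y \<noteq> x")
      case True
      define t where "t = norm (y - x) / r"
      have t: "0 < t" "t \<le> 1" using True assms by (auto simp: t_def dist_norm norm_minus_commute)
      obtain k where k: "(1/2) ^ Suc k < t" "t \<le> (1/2) ^ k" using dyadic_scale_le_one[OF t] .
      have n: "R k / 2 < norm (y - x)" "norm (y - x) \<le> R k"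
        using k assms by (auto simp: t_def R_def field_simps)
      have "norm (y - x) powr (\<beta> - d) \<le> c k"
      proof (cases "\<beta> - d \<ge> 0")
        case True
        have "norm (y - x) powr (\<beta> - d) \<le> R k powr (\<beta> - d)" using n True by (intro powr_mono2) auto
        also have "\<dots> \<le> 1 * c k"
          using mult_right_mono[OF ge_one_powr_ge_zero[of 2 "\<bar>\<beta> - d\<bar>"], of "R k powr (\<beta> - d)"] by (simp add: c_def)
        finally show ?thesis by simp
      next
        case False
        have "norm (y - x) powr (\<beta> - d) \<le> (R k / 2) powr (\<beta> - d)"
          using n False R[of k] by (intro powr_mono2') auto
        also have "\<dots> = R k powr (\<beta> - d) / 2 powr (\<beta> - d)" using R[of k] by (simp add: powr_divide)
        also have "\<dots> = 2 powr (- (\<beta> - d)) * R k powr (\<beta> - d)" by (simp only: powr_minus divide_inverse mult.commute)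
        also have "\<dots> = c k" using False by (simp add: c_def)
        finally show ?thesis .
      qed
      then have "indicator (cball x r) y * ennreal (norm (y - x) powr (\<beta> - d)) \<le> ennreal (c k) * indicator (cball x (R k)) y"
        using True n by (auto simp: dist_norm norm_minus_commute ennreal_leI)
      also have "\<dots> = (\<Sum>k\<in>{k}. ennreal (c k) * indicator (cball x (R k)) y)" by (simp only: sum.insert sum.empty finite.emptyI empty_iff not_False_eq_True add_0_right)
      also have "\<dots> \<le> (\<Sum>k. ennreal (c k) * indicator (cball x (R k)) y)"
        by (rule sum_le_suminf) auto
      finally show ?thesis .
    next
      case False
      then show ?thesis by auto
    qed
  qed
  also have "\<dots> = (\<Sum>k. (\<integral>\<^sup>+y. ennreal (c k) * indicator (cball x (R k)) y \<partial>\<mu>))"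
    by (rule nn_integral_suminf) measurable
  \<comment> \<open>Upper regularity turns the \<open>k\<close>-th term into a constant times
    \<open>R k powr \<beta>\<close>, a geometric sequence of ratio
    \<open>2 powr (- \<beta>)\<close>, which is below 1 because \<open>\<beta> > 0\<close>.\<close>
  also have "\<dots> \<le> (\<Sum>k. ennreal (C * 2 powr \<bar>\<beta> - d\<bar> * r powr \<beta> * (2 powr (- \<beta>)) ^ k))"
  proof (rule suminf_le)
    fix k
    have "(\<integral>\<^sup>+y. ennreal (c k) * indicator (cball x (R k)) y \<partial>\<mu>) = ennreal (c k) * emeasure \<mu> (cball x (R k))"
      by (rule nn_integral_cmult_indicator) simp
    also have "\<dots> \<le> ennreal (c k) * ennreal (C * R k powr d)"
      by (intro mult_left_mono emeasure_cball_le R) auto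
    also have "\<dots> = ennreal (c k * (C * R k powr d))" using C_nonneg by (simp add: ennreal_mult c0)
    also have "c k * (C * R k powr d) = C * 2 powr \<bar>\<beta> - d\<bar> * R k powr \<beta>"
      by (simp add: c_def powr_diff R[THEN less_imp_neq, symmetric])
    also have "R k powr \<beta> = r powr \<beta> * (2 powr (- \<beta>)) ^ k"
    proof -
      have "R k = r * 2 powr (- real k)" by (simp add: R_def powr_minus powr_realpow power_one_over inverse_eq_divide)
      then show ?thesis using assms by (simp add: powr_mult powr_powr powr_power mult.commute)
    qed
    finally show "(\<integral>\<^sup>+y. ennreal (c k) * indicator (cball x (R k)) y \<partial>\<mu>) \<le> ennreal (C * 2 powr \<bar>\<beta> - d\<bar> * r powr \<beta> * (2 powr (- \<beta>)) ^ k)"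
      by (simp add: mult.assoc)
  qed auto
  also have "\<dots> = ennreal (C * 2 powr \<bar>\<beta> - d\<bar> * r powr \<beta> / (1 - 2 powr (- \<beta>)))"
    using C_nonneg assms by (intro suminf_ennreal_geometric) (auto simp: powr_less_one)
  finally show ?thesis by simp
qed

lemma far_integral:
  assumes "\<beta> > 0" "r > 0"
  shows "(\<integral>\<^sup>+y. indicator (- cball x r) y * ennreal (norm (y - x) powr (- \<beta> - d)) \<partial>\<mu>)
     \<le> ennreal (C * 2 powr d / (1 - 2 powr (- \<beta>)) * r powr (- \<beta>))"
proof -
  define R where "R k = r * 2 ^ k" for k :: nat
  have R: "R k > 0" for k using assms by (simp add: R_def)
  \<comment> \<open>The integrand is taken at the inner radius \<open>R k\<close>, the measure at
    the outer radius \<open>R (Suc k)\<close>; the mismatch gives the factor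
    \<open>2 powr d\<close>.\<close>
  define c where "c k = R k powr (- \<beta> - d)" for k
  have c0: "c k \<ge> 0" for k by (simp add: c_def)
  have "(\<integral>\<^sup>+y. indicator (- cball x r) y * ennreal (norm (y - x) powr (- \<beta> - d)) \<partial>\<mu>)
      \<le> (\<integral>\<^sup>+y. (\<Sum>k. ennreal (c k) * indicator (cball x (R (Suc k))) y) \<partial>\<mu>)"
  proof (rule nn_integral_mono)
    fix y
    show "indicator (- cball x r) y * ennreal (norm (y - x) powr (- \<beta> - d)) \<le> (\<Sum>k. ennreal (c k) * indicator (cball x (R (Suc k))) y)"
    proof (cases "y \<in> cball x r")
      case False
      define t where "t = norm (y - x) / r"
      have t: "1 < t" using False assms by (auto simp: t_def dist_norm norm_minus_commute)
      obtain k where k: "2 ^ k < t" "t \<le> 2 ^ Suc k" using dyadic_scale_gt_one[OF t] .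
      have n: "R k < norm (y - x)" "norm (y - x) \<le> R (Suc k)"
        using k assms by (auto simp: t_def R_def field_simps)
      have "norm (y - x) powr (- \<beta> - d) \<le> c k"
        unfolding c_def using n R[of k] d_pos assms by (intro powr_mono2') auto
      then have "indicator (- cball x r) y * ennreal (norm (y - x) powr (- \<beta> - d)) \<le> ennreal (c k) * indicator (cball x (R (Suc k))) y"
        using False n by (auto simp: dist_norm norm_minus_commute ennreal_leI)
      also have "\<dots> = (\<Sum>k\<in>{k}. ennreal (c k) * indicator (cball x (R (Suc k))) y)" by (simp only: sum.insert sum.empty finite.emptyI empty_iff not_False_eq_True add_0_right)
      also have "\<dots> \<le> (\<Sum>k. ennreal (c k) * indicator (cball x (R (Suc k))) y)"
        by (rule sum_le_suminf) auto
      finally show ?thesis .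
    qed auto
  qed
  also have "\<dots> = (\<Sum>k. (\<integral>\<^sup>+y. ennreal (c k) * indicator (cball x (R (Suc k))) y \<partial>\<mu>))"
    by (rule nn_integral_suminf) measurable
  also have "\<dots> \<le> (\<Sum>k. ennreal (C * 2 powr d * r powr (- \<beta>) * (2 powr (- \<beta>)) ^ k))"
  proof (rule suminf_le)
    fix k
    have "(\<integral>\<^sup>+y. ennreal (c k) * indicator (cball x (R (Suc k))) y \<partial>\<mu>) = ennreal (c k) * emeasure \<mu> (cball x (R (Suc k)))"
      by (rule nn_integral_cmult_indicator) simp
    also have "\<dots> \<le> ennreal (c k) * ennreal (C * R (Suc k) powr d)"
      by (intro mult_left_mono emeasure_cball_le R) auto
    also have "\<dots> = ennreal (c k * (C * R (Suc k) powr d))" using C_nonneg by (simp add: ennreal_mult c0)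
    also have "c k * (C * R (Suc k) powr d) = c k * (C * (2 * R k) powr d)" by (simp add: R_def mult_ac)
    also have "c k * (C * (2 * R k) powr d) = C * 2 powr d * R k powr (- \<beta>)"
      using R[of k] by (simp add: c_def powr_diff powr_mult)
    also have "R k powr (- \<beta>) = r powr (- \<beta>) * (2 powr (- \<beta>)) ^ k"
    proof -
      have "R k = r * 2 powr (real k)" by (simp add: R_def powr_realpow)
      then show ?thesis using assms by (simp add: powr_mult powr_powr powr_power mult.commute)
    qed
    finally show "(\<integral>\<^sup>+y. ennreal (c k) * indicator (cball x (R (Suc k))) y \<partial>\<mu>) \<le> ennreal (C * 2 powr d * r powr (- \<beta>) * (2 powr (- \<beta>)) ^ k)"
      by (simp add: mult.assoc)
  qed auto
  also have "\<dots> = ennreal (C * 2 powr d * r powr (- \<beta>) / (1 - 2 powr (- \<beta>)))"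
    using C_nonneg assms by (intro suminf_ennreal_geometric) (auto simp: powr_less_one)
  finally show ?thesis by simp
qed

text \<open>Scaling: a Gaussian of width \<open>1 / \<rho>\<close> sees mass of order
  \<open>\<rho> powr (- d)\<close>. Inside the ball of that radius regularity suffices; outside, the
  Gaussian is traded for the power \<open>- 1 - d\<close>, the case \<open>\<beta> = 1\<close> of
  \<open>far_integral\<close>.\<close>

lemma gaussian_integral_le:
  obtains A where "A > 0"
    "\<And>\<rho> y. \<rho> > 0 \<Longrightarrow> (\<integral>\<^sup>+x. ennreal (exp (- (\<rho>\<^sup>2 * (norm (x - y))\<^sup>2))) \<partial>\<mu>) \<le> ennreal (A * \<rho> powr (- d))"
proof -
  obtain K where K: "K > 0" "\<And>b. b \<ge> 1 \<Longrightarrow> b powr (d + 1) * exp (- b\<^sup>2) \<le> K"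
    using powr_mult_exp_neg_sq_bounded[of "d + 1"] by blast
  \<comment> \<open>The summand 1 keeps \<open>A\<close> positive when \<open>C = 0\<close>.\<close>
  define A where "A = C + K * (C * 2 powr d / (1 - 2 powr (- 1))) + 1"
  have A: "A > 0" using C_nonneg K(1) by (auto simp: A_def powr_minus intro!: add_nonneg_pos)
  moreover have "(\<integral>\<^sup>+x. ennreal (exp (- (\<rho>\<^sup>2 * (norm (x - y))\<^sup>2))) \<partial>\<mu>) \<le> ennreal (A * \<rho> powr (- d))" if \<rho>: "\<rho> > 0" for \<rho> y
  proof -
    have "(\<integral>\<^sup>+x. ennreal (exp (- (\<rho>\<^sup>2 * (norm (x - y))\<^sup>2))) \<partial>\<mu>) \<le>
      (\<integral>\<^sup>+x. indicator (cball y (1/\<rho>)) x + ennreal (K * \<rho> powr (- 1 - d)) * (indicator (- cball y (1/\<rho>)) x * ennreal (norm (x - y) powr (- 1 - d))) \<partial>\<mu>)"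
    proof (rule nn_integral_mono)
      fix x
      show "ennreal (exp (- (\<rho>\<^sup>2 * (norm (x - y))\<^sup>2))) \<le> indicator (cball y (1/\<rho>)) x
        + ennreal (K * \<rho> powr (- 1 - d)) * (indicator (- cball y (1/\<rho>)) x * ennreal (norm (x - y) powr (- 1 - d)))"
      proof (cases "x \<in> cball y (1/\<rho>)")
        case False
        define b where "b = \<rho> * norm (x - y)"
        have b: "b \<ge> 1" using False \<rho> by (simp add: b_def dist_norm norm_minus_commute field_simps)
        have "exp (- b\<^sup>2) = b powr (- (d + 1)) * (b powr (d + 1) * exp (- b\<^sup>2))"
          using b by (simp add: mult.assoc[symmetric] flip: powr_add)
        also have "\<dots> \<le> b powr (- (d + 1)) * K" by (intro mult_left_mono K(2) b) auto
        also have "\<dots> = K * \<rho> powr (- 1 - d) * norm (x - y) powr (- 1 - d)"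
          using \<rho> by (simp add: b_def powr_mult algebra_simps)
        finally show ?thesis using False K(1)
          by (simp add: b_def power_mult_distrib ennreal_leI flip: ennreal_mult')
      qed simp
    qed
    also have "\<dots> = emeasure \<mu> (cball y (1/\<rho>)) + ennreal (K * \<rho> powr (- 1 - d)) * (\<integral>\<^sup>+x. indicator (- cball y (1/\<rho>)) x * ennreal (norm (x - y) powr (- 1 - d)) \<partial>\<mu>)"
    proof -
      define h where "h x = indicator (- cball y (1/\<rho>)) x * ennreal (norm (x - y) powr (- 1 - d))" for x
      have [measurable]: "h \<in> borel_measurable \<mu>" unfolding h_def by measurable
      have "(\<integral>\<^sup>+x. indicator (cball y (1/\<rho>)) x + ennreal (K * \<rho> powr (- 1 - d)) * h x \<partial>\<mu>)
          = (\<integral>\<^sup>+x. indicator (cball y (1/\<rho>)) x \<partial>\<mu>) + (\<integral>\<^sup>+x. ennreal (K * \<rho> powr (- 1 - d)) * h x \<partial>\<mu>)"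
        by (rule nn_integral_add) measurable
      also have "(\<integral>\<^sup>+x. ennreal (K * \<rho> powr (- 1 - d)) * h x \<partial>\<mu>) = ennreal (K * \<rho> powr (- 1 - d)) * (\<integral>\<^sup>+x. h x \<partial>\<mu>)"
        by (rule nn_integral_cmult) measurable
      finally show ?thesis unfolding h_def by simp
    qed
    also have "\<dots> \<le> ennreal (C * (1/\<rho>) powr d) + ennreal (K * \<rho> powr (- 1 - d)) * ennreal (C * 2 powr d / (1 - 2 powr (- 1)) * (1/\<rho>) powr (- 1))"
      using \<rho> by (intro add_mono mult_left_mono emeasure_cball_le far_integral) auto
    also have "\<dots> = ennreal (C * (1/\<rho>) powr d + (K * \<rho> powr (- 1 - d)) * (C * 2 powr d / (1 - 2 powr (- 1)) * (1/\<rho>) powr (- 1)))"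
      using K(1) C_nonneg \<rho> by (subst ennreal_plus) (auto simp: ennreal_mult powr_minus)
    also have "C * (1/\<rho>) powr d + (K * \<rho> powr (- 1 - d)) * (C * 2 powr d / (1 - 2 powr (- 1)) * (1/\<rho>) powr (- 1)) = (A - 1) * \<rho> powr (- d)"
    proof -
      have "\<rho> powr (- 1 - d) * (1/\<rho>) powr (- 1) = \<rho> powr (- d)" "(1/\<rho>) powr d = \<rho> powr (- d)"
        using \<rho> by (simp_all add: powr_divide powr_diff powr_minus divide_simps)
      then have "C * (1/\<rho>) powr d + K * (C * 2 powr d / (1 - 2 powr (- 1))) * (\<rho> powr (- 1 - d) * (1/\<rho>) powr (- 1)) = (A - 1) * \<rho> powr (- d)"
        by (simp only: A_def) (simp add: algebra_simps)
      then show ?thesis by (simp add: mult_ac)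
    qed
    also have "ennreal \<dots> \<le> ennreal (A * \<rho> powr (- d))" by (intro ennreal_leI mult_right_mono) auto
    finally show ?thesis .
  qed
  ultimately show ?thesis using that by blast
qed

end

lemma upper_regular_lborel:
  "upper_regular (lborel :: 'a::euclidean_space measure) (real DIM('a)) (unit_ball_vol (real DIM('a)))"
proof
  show "emeasure lborel (cball x r) \<le> ennreal (unit_ball_vol (real DIM('a)) * r powr real DIM('a))" if "r > 0" for x :: 'a and r
    using that by (simp add: emeasure_cball powr_realpow)
qed auto

section \<open>Surface measure of a Lipschitz domain\<close>

text \<open>An Assouad-type condition of dimension \<open>n - 1\<close>, uniform in the centre and
  in both scales. Upper regularity of the Hausdorff measure and vanishing of the Lebesgue measure
  both follow from it. Diameters are expressed by pairwise distances, so the empty set needs no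
  convention.\<close>

definition cover_number_le :: "'a::euclidean_space set \<Rightarrow> real \<Rightarrow> bool" where
  "cover_number_le F K \<longleftrightarrow> (\<forall>x r t. 0 < t \<longrightarrow> t \<le> r \<longrightarrow>
     (\<exists>\<C>. finite \<C> \<and> real (card \<C>) \<le> K * (r / t) ^ (DIM('a) - 1) \<and> F \<inter> cball x r \<subseteq> \<Union>\<C> \<and>
        (\<forall>c\<in>\<C>. \<forall>p\<in>c. \<forall>q\<in>c. dist p q \<le> t)))"

lemma cover_number_leD:
  fixes F :: "'a::euclidean_space set"
  assumes "cover_number_le F K" "0 < t" "t \<le> r"
  obtains \<C> where "finite \<C>" "real (card \<C>) \<le> K * (r / t) ^ (DIM('a) - 1)" "F \<inter> cball x r \<subseteq> \<Union>\<C>"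
    "\<forall>c\<in>\<C>. \<forall>p\<in>c. \<forall>q\<in>c. dist p q \<le> t"
proof -
  have "\<exists>\<C>. finite \<C> \<and> real (card \<C>) \<le> K * (r / t) ^ (DIM('a) - 1) \<and> F \<inter> cball x r \<subseteq> \<Union>\<C> \<and>
        (\<forall>c\<in>\<C>. \<forall>p\<in>c. \<forall>q\<in>c. dist p q \<le> t)"
    using assms(1)[unfolded cover_number_le_def] assms(2,3) by simp
  then show ?thesis using that by (elim exE conjE) simp
qed

section \<open>Covering numbers of unions, Lipschitz graphs and boundaries\<close>

lemma cover_number_le_subset:
  assumes "cover_number_le G K" "F \<subseteq> G"
  shows "cover_number_le F K"
  unfolding cover_number_le_def
proof (intro allI impI)
  fix x r t :: real and y :: 'a assume "0 < t" "t \<le> r"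
  then obtain \<C> where "finite \<C>" "real (card \<C>) \<le> K * (r / t) ^ (DIM('a) - 1)" "G \<inter> cball y r \<subseteq> \<Union>\<C>"
     "\<forall>c\<in>\<C>. \<forall>p\<in>c. \<forall>q\<in>c. dist p q \<le> t"
    using assms(1) unfolding cover_number_le_def by metis
  then show "\<exists>\<C>. finite \<C> \<and> real (card \<C>) \<le> K * (r / t) ^ (DIM('a) - 1) \<and> F \<inter> cball y r \<subseteq> \<Union>\<C> \<and>
        (\<forall>c\<in>\<C>. \<forall>p\<in>c. \<forall>q\<in>c. dist p q \<le> t)"
    using assms(2) by (intro exI[of _ \<C>]) blast
qed

lemma cover_number_le_UN:
  fixes F :: "'b \<Rightarrow> 'a::euclidean_space set"
  assumes "finite D" "\<And>i. i \<in> D \<Longrightarrow> cover_number_le (F i) (K i)"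
  shows "cover_number_le (\<Union>i\<in>D. F i) (\<Sum>i\<in>D. K i)"
  unfolding cover_number_le_def
proof (intro allI impI)
  fix r t :: real and y :: 'a assume t: "0 < t" "t \<le> r"
  define Q where "Q i \<C> \<longleftrightarrow> finite \<C> \<and> real (card \<C>) \<le> K i * (r / t) ^ (DIM('a) - 1) \<and> F i \<inter> cball y r \<subseteq> \<Union>\<C> \<and>
        (\<forall>c\<in>\<C>. \<forall>p\<in>c. \<forall>q\<in>c. dist p q \<le> t)" for i \<C>
  have "\<forall>i\<in>D. \<exists>\<C>. Q i \<C>"
    using assms(2)[unfolded cover_number_le_def] t unfolding Q_def by simp
  then obtain \<C> where "\<forall>i\<in>D. Q i (\<C> i)" using bchoice[of D Q] by blast
  note \<C> = this[unfolded Q_def, rule_format]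
  have "real (card (\<Union>i\<in>D. \<C> i)) \<le> real (\<Sum>i\<in>D. card (\<C> i))"
    using card_UN_le[OF assms(1), of \<C>] by (simp only: of_nat_le_iff)
  also have "\<dots> \<le> (\<Sum>i\<in>D. K i * (r / t) ^ (DIM('a) - 1))"
    unfolding of_nat_sum using \<C> by (intro sum_mono) auto
  finally have "real (card (\<Union>i\<in>D. \<C> i)) \<le> (\<Sum>i\<in>D. K i) * (r / t) ^ (DIM('a) - 1)"
    by (simp add: sum_distrib_right)
  moreover have "(\<Union>i\<in>D. F i) \<inter> cball y r \<subseteq> \<Union>(\<Union>i\<in>D. \<C> i)"
  proof
    fix p assume p: "p \<in> (\<Union>i\<in>D. F i) \<inter> cball y r"
    then obtain i where i: "i \<in> D" "p \<in> F i \<inter> cball y r" by blast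
    then have "p \<in> \<Union>(\<C> i)" using \<C>[OF i(1)] by (meson subsetD)
    then show "p \<in> \<Union>(\<Union>i\<in>D. \<C> i)" using i(1) by auto
  qed
  moreover have "finite (\<Union>i\<in>D. \<C> i)" using assms(1) \<C> by blast
  moreover have "\<forall>c\<in>(\<Union>i\<in>D. \<C> i). \<forall>p\<in>c. \<forall>q\<in>c. dist p q \<le> t" using \<C> by blast
  ultimately show "\<exists>\<C>. finite \<C> \<and> real (card \<C>) \<le> (\<Sum>i\<in>D. K i) * (r / t) ^ (DIM('a) - 1) \<and> (\<Union>i\<in>D. F i) \<inter> cball y r \<subseteq> \<Union>\<C> \<and>
        (\<forall>c\<in>\<C>. \<forall>p\<in>c. \<forall>q\<in>c. dist p q \<le> t)"
    by (intro exI[of _ "\<Union>i\<in>D. \<C> i"] conjI)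
qed

text \<open>The count comes from cutting the hyperplane orthogonal to \<open>e\<close> into cubes,
  since a ball projects onto a set of the same radius there. Over one cube the Lipschitz bound
  controls the height, so the piece of the graph is no larger than a multiple of the cube.\<close>

lemma cover_number_le_graph:
  fixes e :: "'a::euclidean_space" and \<gamma> :: "'a \<Rightarrow> real"
  assumes e: "norm e = 1" and lip: "L-lipschitz_on {y. y \<bullet> e = 0} \<gamma>"
  shows "\<exists>K. cover_number_le {x. x \<bullet> e = \<gamma> (x - (x \<bullet> e) *\<^sub>R e)} K"
proof -
  define G where "G = {x. x \<bullet> e = \<gamma> (x - (x \<bullet> e) *\<^sub>R e)}"
  have L: "L \<ge> 0" using lip by (rule lipschitz_on_nonneg)
  have e0: "e \<noteq> 0" using e by auto
  have sub: "subspace {y. e \<bullet> y = 0}" by (rule subspace_hyperplane)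
  obtain B where B: "B \<subseteq> {y. e \<bullet> y = 0}" "pairwise orthogonal B" "\<And>x. x \<in> B \<Longrightarrow> norm x = 1"
    "independent B" "card B = dim {y. e \<bullet> y = 0}" "span B = {y. e \<bullet> y = 0}"
    using orthonormal_basis_subspace[OF sub] by metis
  have finB: "finite B" using B(4) by (rule independent_imp_finite)
  have cardB: "card B = DIM('a) - 1" using B(5) dim_hyperplane[OF e0] by simp
  \<comment> \<open>Two points over one cube of side \<open>\<tau>\<close> have projections at
    distance at most \<open>DIM('a) * \<tau>\<close>, by adding up coordinates, and the height adds
    a factor \<open>1 + L\<close>. Side \<open>t / M\<close> therefore gives pieces of diameter at
    most \<open>t\<close>.\<close>
  define M where "M = (1 + L) * real DIM('a)"
  have M: "M \<ge> 1" using L DIM_positive[where 'a='a] unfolding M_def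
    by (metis One_nat_def Suc_leI le_add_same_cancel1 mult_mono' mult_1 of_nat_1 of_nat_le_iff zero_le_one)
  have "cover_number_le G ((5 * M) ^ (DIM('a) - 1))"
    unfolding cover_number_le_def
  proof (intro allI impI)
    fix x :: 'a and r t :: real assume t: "0 < t" "t \<le> r"
    define \<tau> where "\<tau> = t / M"
    have \<tau>: "\<tau> > 0" "\<tau> \<le> t" using t M by (auto simp: \<tau>_def field_simps mult_le_cancel_left1)
    define N where "N = \<lceil>r / \<tau>\<rceil>"
    have N: "r / \<tau> \<le> of_int N" "of_int N \<le> r / \<tau> + 1" unfolding N_def by linarith+
    have r\<tau>: "1 \<le> r / \<tau>" using \<tau> t by (simp add: field_simps)
    \<comment> \<open>Restricting to \<open>B\<close> makes the cube index an element of a finite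
      extensional function space, whose cardinality is a power.\<close>
    define key where "key p = (\<lambda>b\<in>B. \<lfloor>((p - x) \<bullet> b) / \<tau>\<rfloor>)" for p
    define cell where "cell k = {p \<in> G \<inter> cball x r. key p = k}" for k
    define \<K> where "\<K> = (\<Pi>\<^sub>E b\<in>B. {- N..N})"
    have fin: "finite \<K>" unfolding \<K>_def using finB by (intro finite_PiE) auto
    have "card \<K> = nat (2 * N + 1) ^ (DIM('a) - 1)"
      unfolding \<K>_def using finB by (simp add: card_PiE cardB)
    \<comment> \<open>\<open>2 * N + 1 \<le> 2 * (r / \<tau>) + 3\<close>, and
      \<open>1 \<le> r / \<tau>\<close> absorbs the 3.\<close>
    moreover have "real (nat (2 * N + 1)) \<le> 5 * (r / \<tau>)"
      using N r\<tau> by linarith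
    ultimately have "real (card \<K>) \<le> (5 * (r / \<tau>)) ^ (DIM('a) - 1)"
      by (simp add: power_mono)
    also have "5 * (r / \<tau>) = (5 * M) * (r / t)" by (simp add: \<tau>_def)
    finally have cK: "real (card \<K>) \<le> (5 * M) ^ (DIM('a) - 1) * (r / t) ^ (DIM('a) - 1)"
      by (simp only: power_mult_distrib)
    have cC: "real (card (cell ` \<K>)) \<le> (5 * M) ^ (DIM('a) - 1) * (r / t) ^ (DIM('a) - 1)"
      using card_image_le[OF fin, of cell] cK by linarith
    have cov: "G \<inter> cball x r \<subseteq> \<Union>(cell ` \<K>)"
    proof
      fix p assume p: "p \<in> G \<inter> cball x r"
      have "key p \<in> \<K>"
        unfolding \<K>_def key_def
      proof (rule PiE_I)
        fix b assume b: "b \<in> B"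
        have "\<bar>(p - x) \<bullet> b\<bar> \<le> norm (p - x) * norm b" by (rule Cauchy_Schwarz_ineq2)
        also have "\<dots> \<le> r" using p B(3)[OF b] by (simp add: dist_norm norm_minus_commute)
        finally have "\<bar>(p - x) \<bullet> b\<bar> / \<tau> \<le> r / \<tau>" using \<tau> by (intro divide_right_mono) auto
        also note N(1)
        finally have ab: "\<bar>((p - x) \<bullet> b) / \<tau>\<bar> \<le> of_int N"
          using \<tau> by (simp only: abs_divide abs_of_pos)
        then have "- N \<le> \<lfloor>((p - x) \<bullet> b) / \<tau>\<rfloor>" "\<lfloor>((p - x) \<bullet> b) / \<tau>\<rfloor> \<le> N"
          using abs_le_D1[OF ab] abs_le_D2[OF ab] by linarith+
        then show "(\<lambda>b\<in>B. \<lfloor>((p - x) \<bullet> b) / \<tau>\<rfloor>) b \<in> {- N..N}" using b by simp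
      qed simp
      then show "p \<in> \<Union>(cell ` \<K>)" using p by (auto simp: cell_def)
    qed
    have diam: "dist p q \<le> t" if "p \<in> cell k" "q \<in> cell k" for p q k
    proof -
      define p' q' where "p' = p - (p \<bullet> e) *\<^sub>R e" and "q' = q - (q \<bullet> e) *\<^sub>R e"
      have ee: "e \<bullet> e = 1" using e by (simp add: dot_square_norm)
      have pq0: "p' \<bullet> e = 0" "q' \<bullet> e = 0" using ee by (auto simp: p'_def q'_def inner_diff_left)
      have "p' - q' \<in> span B" unfolding B(6) using pq0 by (simp add: inner_diff_right inner_commute)
      from orthonormal_basis_expand[OF B(2) B(3) this finB]
      have "norm (p' - q') = norm (\<Sum>b\<in>B. (b \<bullet> (p' - q')) *\<^sub>R b)" by (simp add: inner_commute)
      also have "\<dots> \<le> (\<Sum>b\<in>B. \<bar>b \<bullet> (p' - q')\<bar>)"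
        by (rule order_trans[OF norm_sum]) (simp add: B(3))
      also have "\<dots> \<le> (\<Sum>b\<in>B. \<tau>)"
      proof (rule sum_mono)
        fix b assume b: "b \<in> B"
        have be: "b \<bullet> e = 0" using B(1) b by (auto simp: inner_commute)
        have "key p b = key q b" using that by (simp add: cell_def)
        then have "\<lfloor>((p - x) \<bullet> b) / \<tau>\<rfloor> = \<lfloor>((q - x) \<bullet> b) / \<tau>\<rfloor>" using b by (simp add: key_def)
        then have "\<bar>((p - x) \<bullet> b) / \<tau> - ((q - x) \<bullet> b) / \<tau>\<bar> \<le> 1" by linarith
        moreover have "((p - x) \<bullet> b) / \<tau> - ((q - x) \<bullet> b) / \<tau> = (b \<bullet> (p' - q')) / \<tau>"
          using be by (simp add: p'_def q'_def inner_diff_left inner_diff_right inner_commute diff_divide_distrib)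
        ultimately have "\<bar>(b \<bullet> (p' - q')) / \<tau>\<bar> \<le> 1" by simp
        then show "\<bar>b \<bullet> (p' - q')\<bar> \<le> \<tau>" using \<tau> by (simp add: abs_divide)
      qed
      also have "\<dots> \<le> real DIM('a) * \<tau>" using cardB \<tau> by (simp add: mult_right_mono)
      finally have d': "norm (p' - q') \<le> real DIM('a) * \<tau>" .
      have "p \<bullet> e = \<gamma> p'" "q \<bullet> e = \<gamma> q'" using that by (auto simp: cell_def G_def p'_def q'_def)
      then have "\<bar>p \<bullet> e - q \<bullet> e\<bar> \<le> L * norm (p' - q')"
        using lipschitz_onD[OF lip, of p' q'] pq0 by (simp add: dist_norm)
      moreover have "p - q = (p' - q') + (p \<bullet> e - q \<bullet> e) *\<^sub>R e" by (simp add: p'_def q'_def algebra_simps)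
      then have "norm (p - q) \<le> norm (p' - q') + \<bar>p \<bullet> e - q \<bullet> e\<bar>"
        using norm_triangle_ineq[of "p' - q'" "(p \<bullet> e - q \<bullet> e) *\<^sub>R e"] e by simp
      ultimately have "norm (p - q) \<le> (1 + L) * norm (p' - q')" by (simp add: algebra_simps)
      also have "\<dots> \<le> (1 + L) * (real DIM('a) * \<tau>)" using L d' by (intro mult_left_mono) auto
      also have "\<dots> = M * \<tau>" by (simp add: M_def)
      also have "\<dots> = t" using M by (simp add: \<tau>_def)
      finally show ?thesis by (simp add: dist_norm)
    qed
    show "\<exists>\<C>. finite \<C> \<and> real (card \<C>) \<le> (5 * M) ^ (DIM('a) - 1) * (r / t) ^ (DIM('a) - 1) \<and> G \<inter> cball x r \<subseteq> \<Union>\<C> \<and>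
        (\<forall>c\<in>\<C>. \<forall>p\<in>c. \<forall>q\<in>c. dist p q \<le> t)"
      using fin cC cov diam by (intro exI[of _ "cell ` \<K>"]) blast
  qed
  then show ?thesis unfolding G_def by blast
qed

text \<open>A boundary point lies outside the open set, so it is on or above the graph. Strictly
  above, a whole neighbourhood would miss the domain by continuity of the height function, although
  the point lies in the closure.\<close>

lemma frontier_subset_graph:
  fixes e p :: "'a::euclidean_space" and \<gamma> :: "'a \<Rightarrow> real"
  assumes "open \<Omega>" and e: "norm e = 1" and lip: "L-lipschitz_on {y. y \<bullet> e = 0} \<gamma>"
    and chart: "\<forall>x\<in>ball p r. x \<in> \<Omega> \<longleftrightarrow> x \<bullet> e < \<gamma> (x - (x \<bullet> e) *\<^sub>R e)"
  shows "frontier \<Omega> \<inter> ball p r \<subseteq> {x. x \<bullet> e = \<gamma> (x - (x \<bullet> e) *\<^sub>R e)}"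
proof
  fix x assume x: "x \<in> frontier \<Omega> \<inter> ball p r"
  define h where "h x = x \<bullet> e - \<gamma> (x - (x \<bullet> e) *\<^sub>R e)" for x
  have ee: "e \<bullet> e = 1" using e by (simp add: dot_square_norm)
  have cont: "continuous_on UNIV h"
    unfolding h_def
    by (intro continuous_intros continuous_on_compose2[OF lipschitz_on_continuous_on[OF lip]])
       (auto simp: inner_diff_left ee)
  have "x \<notin> \<Omega>" using x assms(1) by (simp add: frontier_def interior_open)
  then have "h x \<ge> 0" using chart x by (auto simp: h_def)
  moreover have "\<not> h x > 0"
  proof
    assume "h x > 0"
    have op: "open ({y. 0 < h y} \<inter> ball p r)"
      using cont by (intro open_Int open_Collect_less) auto
    have "x \<in> closure \<Omega>" using x by (simp add: frontier_def)
    moreover have "x \<in> {y. 0 < h y} \<inter> ball p r" using \<open>h x > 0\<close> x by simp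
    ultimately have "\<Omega> \<inter> ({y. 0 < h y} \<inter> ball p r) \<noteq> {}"
      using open_Int_closure_eq_empty[OF op, of \<Omega>] by blast
    then show False using chart by (auto simp: h_def)
  qed
  ultimately show "x \<in> {x. x \<bullet> e = \<gamma> (x - (x \<bullet> e) *\<^sub>R e)}" by (simp add: h_def)
qed

lemma cover_number_le_frontier:
  fixes \<Omega> :: "'a::euclidean_space set"
  assumes "bounded_lipschitz_domain \<Omega>"
  obtains K where "K \<ge> 0" "cover_number_le (frontier \<Omega>) K"
proof -
  have op: "open \<Omega>" and bd: "bounded \<Omega>"
    using assms by (auto simp: bounded_lipschitz_domain_def lipschitz_domain_def)
  have comp: "compact (frontier \<Omega>)" by (rule compact_frontier_bounded[OF bd])
  have "\<forall>p\<in>frontier \<Omega>. \<exists>r>0. \<exists>K. cover_number_le (frontier \<Omega> \<inter> ball p r) K"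
  proof
    fix p assume "p \<in> frontier \<Omega>"
    then obtain r e L and \<gamma> :: "'a \<Rightarrow> real" where *: "r > 0" "norm e = 1" "L-lipschitz_on {y. y \<bullet> e = 0} \<gamma>"
       "\<forall>x\<in>ball p r. x \<in> \<Omega> \<longleftrightarrow> x \<bullet> e < \<gamma> (x - (x \<bullet> e) *\<^sub>R e)"
      using assms unfolding bounded_lipschitz_domain_def lipschitz_domain_def by meson
    then show "\<exists>r>0. \<exists>K. cover_number_le (frontier \<Omega> \<inter> ball p r) K"
      using cover_number_le_graph[OF *(2,3)] frontier_subset_graph[OF op *(2-4)] cover_number_le_subset by blast
  qed
  then obtain R K where RK: "\<And>p. p \<in> frontier \<Omega> \<Longrightarrow> R p > 0 \<and> cover_number_le (frontier \<Omega> \<inter> ball p (R p)) (K p)"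
    by metis
  obtain D where D: "D \<subseteq> frontier \<Omega>" "finite D" "frontier \<Omega> \<subseteq> (\<Union>p\<in>D. ball p (R p))"
    by (rule compactE_image[OF comp, of "frontier \<Omega>" "\<lambda>p. ball p (R p)"]) (use RK in auto)
  have "cover_number_le (\<Union>p\<in>D. frontier \<Omega> \<inter> ball p (R p)) (\<Sum>p\<in>D. K p)"
    using D RK by (intro cover_number_le_UN) auto
  then have c: "cover_number_le (frontier \<Omega>) (\<Sum>p\<in>D. K p)"
    by (rule cover_number_le_subset) (use D(3) in blast)
  \<comment> \<open>The condition at \<open>r = t = 1\<close> bounds a cardinality by the constant,
    which is thus nonnegative.\<close>
  moreover have "(\<Sum>p\<in>D. K p) \<ge> 0"
  proof -
    obtain \<C> :: "'a set set" where "real (card \<C>) \<le> (\<Sum>p\<in>D. K p) * (1 / 1) ^ (DIM('a) - 1)"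
      using cover_number_leD[OF c, of 1 1 0] by (metis order_refl zero_less_one)
    then show ?thesis by (auto intro: order_trans[rotated])
  qed
  ultimately show ?thesis using that by blast
qed

text \<open>Sets of diameter at most \<open>t\<close> contribute at most a multiple of
  \<open>t powr d\<close> each, and there are at most \<open>K * (r / t) powr d\<close> of them; the
  product does not depend on \<open>t\<close>, hence not on \<open>\<delta>\<close>.\<close>

lemma hausdorff_outer_cball_le:
  fixes F :: "'a::euclidean_space set"
  assumes F: "cover_number_le F K" and "K \<ge> 0" "r > 0" and n: "DIM('a) \<ge> 2"
  shows "hausdorff_outer (real DIM('a) - 1) (F \<inter> cball x r)
     \<le> ennreal (K * unit_ball_vol (real DIM('a) - 1) * r powr (real DIM('a) - 1))"
  unfolding hausdorff_outer_def
proof (rule SUP_least)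
  fix \<delta> :: real assume "\<delta> \<in> {0<..}"
  define d where "d = real DIM('a) - 1"
  have d: "d > 0" using n by (simp add: d_def)
  have ubv: "unit_ball_vol d \<ge> 0" using d by (simp add: less_imp_le)
  define t where "t = min \<delta> r"
  have t: "0 < t" "t \<le> r" "t \<le> \<delta>" using \<open>\<delta> \<in> _\<close> assms(3) by (auto simp: t_def)
  obtain \<C> where \<C>: "finite \<C>" "real (card \<C>) \<le> K * (r / t) ^ (DIM('a) - 1)" "F \<inter> cball x r \<subseteq> \<Union>\<C>"
      "\<forall>c\<in>\<C>. \<forall>p\<in>c. \<forall>q\<in>c. dist p q \<le> t"
    using cover_number_leD[OF F t(1,2), of x] by blast
  obtain f where f: "bij_betw f {0..<card \<C>} \<C>" using ex_bij_betw_nat_finite[OF \<C>(1)] by blast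
  \<comment> \<open>The finite cover is continued by empty sets, which contribute 0 because their
    diameter is 0 and \<open>0 powr d = 0\<close>.\<close>
  define c where "c i = (if i < card \<C> then f i else {})" for i
  have ci: "dist p q \<le> t" if "p \<in> c i" "q \<in> c i" for i p q
  proof -
    have "i < card \<C>" using that by (auto simp: c_def split: if_splits)
    then have "f i \<in> \<C>" using bij_betwE[OF f] by simp
    then show ?thesis using \<C>(4)[rule_format, of "f i" p q] that \<open>i < card \<C>\<close> by (simp add: c_def)
  qed
  have diam: "diameter (c i) \<le> t" for i
    using ci t by (intro diameter_le) (auto simp: dist_norm)
  have bdd: "bounded (c i)" for i
    using ci[of _ i] by (auto simp: bounded_any_center bounded_def) blast
  have "hausdorff_pre d \<delta> (F \<inter> cball x r) \<le> (\<Sum>i. ennreal (unit_ball_vol d * (diameter (c i) / 2) powr d))"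
    unfolding hausdorff_pre_def
  proof (rule INF_lower, rule CollectI, intro conjI allI)
    have "\<C> = f ` {0..<card \<C>}" using f by (simp add: bij_betw_def)
    then have "\<Union>\<C> = (\<Union>i\<in>{0..<card \<C>}. f i)" by simp
    also have "\<dots> = (\<Union>i. c i)" by (auto simp: c_def split: if_splits)
    finally have "\<Union>\<C> = (\<Union>i. c i)" .
    then show "F \<inter> cball x r \<subseteq> (\<Union>i. c i)" using \<C>(3) by simp
    show "bounded (c i)" "diameter (c i) \<le> \<delta>" for i using bdd diam[of i] t by auto
  qed
  also have "\<dots> = (\<Sum>i<card \<C>. ennreal (unit_ball_vol d * (diameter (c i) / 2) powr d))"
    by (rule suminf_finite) (auto simp: c_def)
  also have "\<dots> \<le> (\<Sum>i<card \<C>. ennreal (unit_ball_vol d * t powr d))"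
  proof (intro sum_mono ennreal_leI mult_left_mono ubv powr_mono2)
    fix i
    show "diameter (c i) / 2 \<le> t" using diam[of i] t by simp
    show "0 \<le> diameter (c i) / 2" using diameter_ge_0[OF bdd[of i]] by simp
  qed (use d in auto)
  also have "\<dots> = ennreal (real (card \<C>) * (unit_ball_vol d * t powr d))"
    by (simp add: ennreal_mult' ennreal_of_nat_eq_real_of_nat)
  also have "\<dots> \<le> ennreal (K * unit_ball_vol d * r powr d)"
  proof (rule ennreal_leI)
    have dd: "(r / t) ^ (DIM('a) - 1) = (r / t) powr d"
      using t n by (subst powr_realpow[symmetric]) (auto simp: d_def of_nat_diff)
    have "real (card \<C>) * (unit_ball_vol d * t powr d) \<le> (K * (r / t) powr d) * (unit_ball_vol d * t powr d)"
      using \<C>(2) ubv unfolding dd by (intro mult_right_mono) auto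
    also have "\<dots> = K * unit_ball_vol d * r powr d"
      using t by (simp add: powr_divide)
    finally show "real (card \<C>) * (unit_ball_vol d * t powr d) \<le> K * unit_ball_vol d * r powr d" .
  qed
  finally show "hausdorff_pre (real DIM('a) - 1) \<delta> (F \<inter> cball x r)
     \<le> ennreal (K * unit_ball_vol (real DIM('a) - 1) * r powr (real DIM('a) - 1))"
    unfolding d_def .
qed

text \<open>Enlarging the pieces to balls gives at most \<open>K * (R / t) ^ (n - 1)\<close> balls
  of volume proportional to \<open>t ^ n\<close>; their total volume tends to 0 with
  \<open>t\<close>.\<close>

lemma null_sets_lborel_cover_number:
  fixes F :: "'a::euclidean_space set"
  assumes F: "cover_number_le F K" and "bounded F" "F \<in> sets borel"
  shows "F \<in> null_sets lborel"
proof -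
  obtain R where R: "R > 0" "F \<subseteq> cball 0 R" using assms(2) by (auto simp: bounded_pos subset_iff)
  define n where "n = DIM('a)"
  have n: "n \<ge> 1" by (simp add: n_def DIM_positive Suc_leI)
  have bound: "emeasure lborel F \<le> ennreal (K * R ^ (n - 1) * unit_ball_vol (real n) * t)" if t: "0 < t" "t \<le> R" for t
  proof -
    obtain \<C> where \<C>: "finite \<C>" "real (card \<C>) \<le> K * (R / t) ^ (n - 1)" "F \<inter> cball 0 R \<subseteq> \<Union>\<C>"
      "\<forall>c\<in>\<C>. \<forall>p\<in>c. \<forall>q\<in>c. dist p q \<le> t"
      using cover_number_leD[OF F t, of 0] unfolding n_def by blast
    define g where "g c = cball (SOME p. p \<in> c) t" for c :: "'a set"
    have sub: "c \<subseteq> g c" if "c \<in> \<C>" for c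
    proof
      fix x assume x: "x \<in> c"
      then have "(SOME p. p \<in> c) \<in> c" by (rule someI)
      then show "x \<in> g c" using \<C>(4) that x by (auto simp: g_def)
    qed
    have "F \<subseteq> \<Union>\<C>" using \<C>(3) R(2) by (simp add: Int_absorb2)
    also have "\<Union>\<C> \<subseteq> (\<Union>c\<in>\<C>. g c)" using sub by (intro Union_least) (meson UN_upper order_trans)
    finally have "F \<subseteq> (\<Union>c\<in>\<C>. g c)" .
    then have "emeasure lborel F \<le> emeasure lborel (\<Union>c\<in>\<C>. g c)"
      using \<C>(1) by (intro emeasure_mono) (auto simp: g_def)
    also have "\<dots> \<le> (\<Sum>c\<in>\<C>. emeasure lborel (g c))"
      using \<C>(1) by (intro emeasure_subadditive_finite) (auto simp: g_def)
    also have "\<dots> = (\<Sum>c\<in>\<C>. ennreal (unit_ball_vol (real n) * t ^ n))"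
      using t by (simp add: g_def emeasure_cball n_def)
    also have "\<dots> = ennreal (real (card \<C>) * (unit_ball_vol (real n) * t ^ n))"
      by (simp add: ennreal_mult' ennreal_of_nat_eq_real_of_nat)
    also have "\<dots> \<le> ennreal ((K * (R / t) ^ (n - 1)) * (unit_ball_vol (real n) * t ^ n))"
      using \<C>(2) t by (intro ennreal_leI mult_right_mono) (auto simp: less_imp_le)
    also have "(K * (R / t) ^ (n - 1)) * (unit_ball_vol (real n) * t ^ n) = K * R ^ (n - 1) * unit_ball_vol (real n) * t"
    proof -
      have "t ^ n = t ^ (n - 1) * t" using n by (simp add: power_eq_if)
      then show ?thesis using t by (simp add: power_divide)
    qed
    finally show ?thesis .
  qed
  define A where "A = K * R ^ (n - 1) * unit_ball_vol (real n)"
  have "(\<lambda>k. ennreal (A * (R / real (Suc k)))) \<longlonglongrightarrow> ennreal (A * 0)"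
    by (intro tendsto_ennrealI tendsto_mult tendsto_const LIMSEQ_Suc[OF lim_const_over_n])
  then have "emeasure lborel F \<le> ennreal (A * 0)"
  proof (rule tendsto_lowerbound)
    show "\<forall>\<^sub>F k in sequentially. emeasure lborel F \<le> ennreal (A * (R / real (Suc k)))"
      unfolding A_def using R by (intro always_eventually allI bound) (auto simp: field_simps)
  qed simp
  then show ?thesis using assms(3) by (auto simp: null_sets_def)
qed

text \<open>\<open>surf \<Omega>\<close> has the boundary as its underlying space. Its image on the
  whole space carries the Borel sets, so that \<open>upper_regular\<close> and Fubini apply.\<close>

definition boundary_measure :: "'a::euclidean_space set \<Rightarrow> 'a measure" where
  "boundary_measure \<Omega> = distr (surf \<Omega>) borel (\<lambda>x. x)"

section \<open>Hausdorff measure on the boundary\<close>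

lemma sets_hausdorff_measure: "sets (hausdorff_measure d :: 'a::euclidean_space measure) = sets borel"
  unfolding hausdorff_measure_def by (simp add: sets_measure_of_conv sets.sigma_sets_eq[of borel, simplified])

lemma space_hausdorff_measure: "space (hausdorff_measure d :: 'a::euclidean_space measure) = UNIV"
  unfolding hausdorff_measure_def by (simp add: space_measure_of_conv)

text \<open>If the outer measure failed to be countably additive on the Borel sets, \<open>measure_of\<close> would be the
  zero measure; the inequality holds either way, and only the inequality is needed.\<close>

lemma emeasure_hausdorff_measure_le: "emeasure (hausdorff_measure d) A \<le> hausdorff_outer d A"
  unfolding hausdorff_measure_def emeasure_measure_of_conv by simp

lemma measurable_surf:
  fixes \<Omega> :: "'a::euclidean_space set" and f :: "'a \<Rightarrow> 'b::topological_space"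
  assumes "f \<in> borel_measurable borel" shows "f \<in> borel_measurable (surf \<Omega>)"
  unfolding surf_def
  by (rule measurable_restrict_space1) (use assms in \<open>simp add: measurable_cong_sets[OF sets_hausdorff_measure]\<close>)

lemma space_surf: "space (surf \<Omega>) = frontier \<Omega>"
  by (simp add: surf_def space_restrict_space space_hausdorff_measure)

lemma nn_integral_surf:
  assumes "f \<in> borel_measurable borel"
  shows "(\<integral>\<^sup>+x. f x \<partial>surf \<Omega>) = (\<integral>\<^sup>+x. f x \<partial>boundary_measure \<Omega>)"
  unfolding boundary_measure_def using assms measurable_surf[of "\<lambda>x. x" \<Omega>] by (subst nn_integral_distr) auto

lemma emeasure_boundary_measure:
  assumes "A \<in> sets borel"
  shows "emeasure (boundary_measure \<Omega>) A = emeasure (hausdorff_measure (real DIM('a) - 1)) (A \<inter> frontier (\<Omega>::'a::euclidean_space set))"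
proof -
  have "emeasure (boundary_measure \<Omega>) A = emeasure (surf \<Omega>) (A \<inter> frontier \<Omega>)"
    unfolding boundary_measure_def using assms measurable_surf[of "\<lambda>x. x" \<Omega>]
    by (subst emeasure_distr) (auto simp: space_surf)
  also have "\<dots> = emeasure (hausdorff_measure (real DIM('a) - 1)) (A \<inter> frontier \<Omega>)"
    unfolding surf_def
    by (rule emeasure_restrict_space) (auto simp: sets_hausdorff_measure space_hausdorff_measure)
  finally show ?thesis .
qed

lemma upper_regular_boundary_measure:
  fixes \<Omega> :: "'a::euclidean_space set"
  assumes "bounded_lipschitz_domain \<Omega>" "DIM('a) \<ge> 2"
  obtains C where "upper_regular (boundary_measure \<Omega>) (real DIM('a) - 1) C"
proof -
  obtain K where K: "K \<ge> 0" "cover_number_le (frontier \<Omega>) K"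
    using cover_number_le_frontier[OF assms(1)] .
  have "upper_regular (boundary_measure \<Omega>) (real DIM('a) - 1) (K * unit_ball_vol (real DIM('a) - 1))"
  proof
    show "sets (boundary_measure \<Omega>) = sets borel" by (simp add: boundary_measure_def)
    show "0 < real DIM('a) - 1" using assms(2) by simp
    then show "0 \<le> K * unit_ball_vol (real DIM('a) - 1)" using K(1) by (simp add: less_imp_le)
    fix x :: 'a and r :: real assume r: "r > 0"
    have "emeasure (boundary_measure \<Omega>) (cball x r) \<le> hausdorff_outer (real DIM('a) - 1) (frontier \<Omega> \<inter> cball x r)"
      by (subst emeasure_boundary_measure) (auto simp: Int_commute emeasure_hausdorff_measure_le)
    also have "\<dots> \<le> ennreal (K * unit_ball_vol (real DIM('a) - 1) * r powr (real DIM('a) - 1))"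
      by (rule hausdorff_outer_cball_le[OF K(2,1) r assms(2)])
    finally show "emeasure (boundary_measure \<Omega>) (cball x r) \<le> \<dots>" .
  qed
  then show ?thesis using that by blast
qed

lemma AE_boundary_measure: "AE x in boundary_measure \<Omega>. x \<in> frontier \<Omega>"
proof (rule AE_I)
  show "emeasure (boundary_measure \<Omega>) (- frontier \<Omega>) = 0"
    by (subst emeasure_boundary_measure) auto
qed (auto simp: boundary_measure_def)

lemma frontier_null_sets:
  assumes "bounded_lipschitz_domain \<Omega>"
  shows "frontier \<Omega> \<in> null_sets lborel"
proof -
  obtain K where "cover_number_le (frontier \<Omega>) K"
    using cover_number_le_frontier[OF assms] .
  then show ?thesis
    using assms by (intro null_sets_lborel_cover_number)
      (auto simp: bounded_lipschitz_domain_def intro: compact_imp_bounded compact_frontier_bounded)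
qed

section \<open>Functionals on Lipschitz functions\<close>

text \<open>For a Lipschitz function the integrand of the seminorm is at most
  \<open>L\<^sup>2\<close> times the distance to the power \<open>\<beta> - (n - 1)\<close> with
  \<open>\<beta> = 2 - 2 * \<alpha> > 0\<close>, which \<open>near_integral\<close> handles. One
  constant serves all functions, because the continuity of the functional on Lipschitz functions is
  drawn from it.\<close>

lemma lipschitz_in_Hspace:
  fixes \<Omega> :: "'a::euclidean_space set"
  assumes dom: "bounded_lipschitz_domain \<Omega>" "DIM('a) \<ge> 2" and \<alpha>: "0 < \<alpha>" "\<alpha> < 1"
  obtains K where "K \<ge> 0"
    "\<And>f A L. f \<in> borel_measurable borel \<Longrightarrow> 0 \<le> A \<Longrightarrow> 0 \<le> L \<Longrightarrow> (\<And>P. P \<in> frontier \<Omega> \<Longrightarrow> \<bar>f P\<bar> \<le> A) \<Longrightarrow>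
       (\<And>P Q. P \<in> frontier \<Omega> \<Longrightarrow> Q \<in> frontier \<Omega> \<Longrightarrow> \<bar>f P - f Q\<bar> \<le> L * norm (P - Q)) \<Longrightarrow>
       f \<in> Hspace \<alpha> \<Omega> \<and> Hnorm \<alpha> \<Omega> f \<le> K * (A + L)"
proof -
  obtain C where reg: "upper_regular (boundary_measure \<Omega>) (real DIM('a) - 1) C"
    using upper_regular_boundary_measure[OF dom] .
  interpret upper_regular "boundary_measure \<Omega>" "real DIM('a) - 1" C by (rule reg)
  let ?\<sigma> = "boundary_measure \<Omega>"
  let ?d = "real DIM('a) - 1"
  have "bounded (frontier \<Omega>)" using dom(1) by (auto simp: bounded_lipschitz_domain_def intro: compact_imp_bounded compact_frontier_bounded)
  then obtain R where R: "R > 0" "\<And>x. x \<in> frontier \<Omega> \<Longrightarrow> norm x \<le> R" by (auto simp: bounded_pos)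
  define S where "S = C * R powr ?d"
  have S: "S \<ge> 0" using C_nonneg by (simp add: S_def)
  have tot: "emeasure ?\<sigma> UNIV \<le> ennreal S"
  proof -
    have "emeasure ?\<sigma> UNIV = emeasure ?\<sigma> (cball 0 R)"
      by (rule emeasure_eq_AE) (use AE_boundary_measure[of \<Omega>] R(2) in auto)
    then show ?thesis using emeasure_cball_le[OF R(1), of 0] by (simp add: S_def)
  qed
  define \<beta> where "\<beta> = 2 - 2 * \<alpha>"
  have \<beta>: "\<beta> > 0" using \<alpha> by (simp add: \<beta>_def)
  \<comment> \<open>The boundary lies in the ball of radius \<open>R\<close> around the origin, so
    the radius \<open>2 * R\<close> around any of its points reaches all of it; \<open>c\<close> is
    the bound of \<open>near_integral\<close> at that radius.\<close>
  define c where "c = C * 2 powr \<bar>\<beta> - ?d\<bar> / (1 - 2 powr (- \<beta>)) * (2 * R) powr \<beta>"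
  have c: "c \<ge> 0" unfolding c_def using C_nonneg \<beta> by (intro mult_nonneg_nonneg divide_nonneg_nonneg) (auto simp: powr_less_one less_imp_le)
  define K where "K = sqrt S + sqrt (c * S)"
  show ?thesis
  proof (rule that)
    show "K \<ge> 0" using S c by (simp add: K_def)
    fix f :: "'a \<Rightarrow> real" and A L
    assume f [measurable]: "f \<in> borel_measurable borel" and AL: "0 \<le> A" "0 \<le> L"
      and fA: "\<And>P. P \<in> frontier \<Omega> \<Longrightarrow> \<bar>f P\<bar> \<le> A"
      and fL: "\<And>P Q. P \<in> frontier \<Omega> \<Longrightarrow> Q \<in> frontier \<Omega> \<Longrightarrow> \<bar>f P - f Q\<bar> \<le> L * norm (P - Q)"
    have L2: "bdry_L2sq \<Omega> f \<le> ennreal (A\<^sup>2 * S)"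
    proof -
      have "bdry_L2sq \<Omega> f = (\<integral>\<^sup>+Q. ennreal ((f Q)\<^sup>2) \<partial>?\<sigma>)"
        unfolding bdry_L2sq_def by (rule nn_integral_surf) measurable
      also have "\<dots> \<le> (\<integral>\<^sup>+Q. ennreal (A\<^sup>2) \<partial>?\<sigma>)"
      proof (rule nn_integral_mono_AE, rule AE_mp[OF AE_boundary_measure AE_I2], rule impI)
        fix Q assume "Q \<in> frontier \<Omega>"
        then show "ennreal ((f Q)\<^sup>2) \<le> ennreal (A\<^sup>2)"
          using fA[of Q] AL by (intro ennreal_leI) (simp add: abs_le_square_iff[symmetric])
      qed
      also have "\<dots> = ennreal (A\<^sup>2) * emeasure ?\<sigma> UNIV" by simp
      also have "\<dots> \<le> ennreal (A\<^sup>2) * ennreal S" by (intro mult_left_mono tot) auto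
      finally show ?thesis using S by (simp add: ennreal_mult)
    qed
    have "bdry_seminormsq \<alpha> \<Omega> f = (\<integral>\<^sup>+P. \<integral>\<^sup>+Q. ennreal ((f P - f Q)\<^sup>2 / norm (P - Q) powr (?d + 2 * \<alpha>)) \<partial>?\<sigma> \<partial>?\<sigma>)"
    proof -
      have "(\<integral>\<^sup>+Q. ennreal ((f P - f Q)\<^sup>2 / norm (P - Q) powr (?d + 2 * \<alpha>)) \<partial>surf \<Omega>)
         = (\<integral>\<^sup>+Q. ennreal ((f P - f Q)\<^sup>2 / norm (P - Q) powr (?d + 2 * \<alpha>)) \<partial>?\<sigma>)" for P
        by (rule nn_integral_surf) measurable
      then show ?thesis unfolding bdry_seminormsq_def
        by (simp only:) (rule nn_integral_surf, measurable)
    qed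
    also have "\<dots> \<le> (\<integral>\<^sup>+P. ennreal (L\<^sup>2 * c) \<partial>?\<sigma>)"
    proof (rule nn_integral_mono_AE, rule AE_mp[OF AE_boundary_measure AE_I2], rule impI)
      fix P assume P: "P \<in> frontier \<Omega>"
      have "(\<integral>\<^sup>+Q. ennreal ((f P - f Q)\<^sup>2 / norm (P - Q) powr (?d + 2 * \<alpha>)) \<partial>?\<sigma>)
         \<le> (\<integral>\<^sup>+Q. ennreal (L\<^sup>2) * (indicator (cball P (2 * R)) Q * ennreal (norm (Q - P) powr (\<beta> - ?d))) \<partial>?\<sigma>)"
      proof (rule nn_integral_mono_AE, rule AE_mp[OF AE_boundary_measure AE_I2], rule impI)
        fix Q assume Q: "Q \<in> frontier \<Omega>"
        have "Q \<in> cball P (2 * R)" using R(2)[OF P] R(2)[OF Q] norm_triangle_ineq4[of P Q] by (simp add: dist_norm)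
        moreover have "(f P - f Q)\<^sup>2 / norm (P - Q) powr (?d + 2 * \<alpha>) \<le> L\<^sup>2 * norm (Q - P) powr (\<beta> - ?d)"
        proof (cases "P = Q")
          case False
          then have r: "norm (P - Q) > 0" by simp
          have "(f P - f Q)\<^sup>2 \<le> (L * norm (P - Q))\<^sup>2"
            using fL[OF P Q] AL by (simp add: abs_le_square_iff[symmetric])
          then have "(f P - f Q)\<^sup>2 / norm (P - Q) powr (?d + 2 * \<alpha>) \<le> (L * norm (P - Q))\<^sup>2 / norm (P - Q) powr (?d + 2 * \<alpha>)"
            by (intro divide_right_mono) auto
          also have "\<dots> = L\<^sup>2 * (norm (P - Q) powr 2 / norm (P - Q) powr (?d + 2 * \<alpha>))"
            using r by (simp add: power_mult_distrib powr_numeral)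
          also have "\<dots> = L\<^sup>2 * norm (P - Q) powr (2 - (?d + 2 * \<alpha>))" by (simp only: powr_diff)
          also have "2 - (?d + 2 * \<alpha>) = \<beta> - ?d" by (simp add: \<beta>_def)
          finally show ?thesis by (simp add: norm_minus_commute)
        qed simp
        ultimately show "ennreal ((f P - f Q)\<^sup>2 / norm (P - Q) powr (?d + 2 * \<alpha>)) \<le>
            ennreal (L\<^sup>2) * (indicator (cball P (2 * R)) Q * ennreal (norm (Q - P) powr (\<beta> - ?d)))"
          by (simp add: ennreal_leI flip: ennreal_mult)
      qed
      also have "\<dots> = ennreal (L\<^sup>2) * (\<integral>\<^sup>+Q. indicator (cball P (2 * R)) Q * ennreal (norm (Q - P) powr (\<beta> - ?d)) \<partial>?\<sigma>)"
        by (rule nn_integral_cmult) measurable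
      also have "\<dots> \<le> ennreal (L\<^sup>2) * ennreal c"
        unfolding c_def using R(1) \<beta> by (intro mult_left_mono near_integral) auto
      finally show "(\<integral>\<^sup>+Q. ennreal ((f P - f Q)\<^sup>2 / norm (P - Q) powr (?d + 2 * \<alpha>)) \<partial>?\<sigma>) \<le> ennreal (L\<^sup>2 * c)"
        using c by (simp add: ennreal_mult)
    qed
    also have "\<dots> = ennreal (L\<^sup>2 * c) * emeasure ?\<sigma> UNIV" by simp
    also have "\<dots> \<le> ennreal (L\<^sup>2 * c) * ennreal S" by (intro mult_left_mono tot) auto
    also have "\<dots> = ennreal (L\<^sup>2 * (c * S))" using S c by (simp add: ennreal_mult mult.assoc)
    finally have semi: "bdry_seminormsq \<alpha> \<Omega> f \<le> ennreal (L\<^sup>2 * (c * S))" .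
    have "f \<in> Hspace \<alpha> \<Omega>"
      unfolding Hspace_def using L2 semi measurable_surf[OF f, of \<Omega>]
      by (auto intro: order_le_less_trans)
    moreover have "Hnorm \<alpha> \<Omega> f \<le> K * (A + L)"
    proof -
      have "enn2real (bdry_L2sq \<Omega> f) \<le> A\<^sup>2 * S" "enn2real (bdry_seminormsq \<alpha> \<Omega> f) \<le> L\<^sup>2 * (c * S)"
        using L2 semi S c by (auto intro: enn2real_leI)
      then have "Hnorm \<alpha> \<Omega> f \<le> sqrt (A\<^sup>2 * S + L\<^sup>2 * (c * S))"
        unfolding Hnorm_def by (intro real_sqrt_le_mono add_mono)
      also have "\<dots> \<le> sqrt (A\<^sup>2 * S) + sqrt (L\<^sup>2 * (c * S))"
        using S c by (intro sqrt_add_le_add_sqrt) auto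
      also have "\<dots> = A * sqrt S + L * sqrt (c * S)" using AL by (simp add: real_sqrt_mult)
      also have "\<dots> \<le> K * (A + L)" using AL S c by (simp add: K_def algebra_simps)
      finally show ?thesis .
    qed
    ultimately show "f \<in> Hspace \<alpha> \<Omega> \<and> Hnorm \<alpha> \<Omega> f \<le> K * (A + L)" by blast
  qed
qed

text \<open>Both constants are explicit parameters because the convergence arguments let them tend
  to 0. The bounds are required on \<open>F\<close> alone, measurability on the whole space.\<close>

definition lip_on :: "'a::euclidean_space set \<Rightarrow> ('a \<Rightarrow> complex) \<Rightarrow> real \<Rightarrow> real \<Rightarrow> bool" where
  "lip_on F f A L \<longleftrightarrow> f \<in> borel_measurable borel \<and> 0 \<le> A \<and> 0 \<le> L \<and> (\<forall>P\<in>F. cmod (f P) \<le> A) \<and>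
     (\<forall>P\<in>F. \<forall>Q\<in>F. cmod (f P - f Q) \<le> L * norm (P - Q))"

text \<open>The sign is that of \<open>fourier\<close> and opposite to that of \<open>ift\<close>,
  so that integration against characters inverts \<open>ift\<close>.\<close>

definition character :: "'a::euclidean_space \<Rightarrow> 'a \<Rightarrow> complex" where
  "character \<xi> Q = cis (- (2 * pi * (Q \<bullet> \<xi>)))"

section \<open>Characters as Lipschitz functions\<close>

lemma borel_measurable_character [measurable]:
  "(\<lambda>(\<xi>, Q). character \<xi> Q) \<in> borel_measurable (borel \<Otimes>\<^sub>M borel)"
  "character \<xi> \<in> borel_measurable borel"
  "(\<lambda>\<xi>. character \<xi> Q) \<in> borel_measurable borel"
  unfolding character_def cis_conv_exp by measurable

lemma norm_character [simp]: "cmod (character \<xi> Q) = 1"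
  by (simp add: character_def)

text \<open>A chord is no longer than its arc: its length is twice the modulus of the sine of half
  the angle.\<close>

lemma norm_cis_diff_le: "cmod (cis a - cis b) \<le> \<bar>a - b\<bar>"
proof -
  have "(cmod (cis a - cis b))\<^sup>2 = (cos a - cos b)\<^sup>2 + (sin a - sin b)\<^sup>2"
    by (simp add: cmod_power2)
  also have "\<dots> = 2 - 2 * cos (a - b)"
    using sin_cos_squared_add[of a] sin_cos_squared_add[of b] by (simp add: cos_diff power2_eq_square algebra_simps)
  also have "\<dots> = (2 * sin ((a - b) / 2))\<^sup>2"
  proof -
    have "cos (2 * ((a - b) / 2)) = 1 - 2 * (sin ((a - b) / 2))\<^sup>2" by (rule cos_double_sin)
    moreover have "2 * ((a - b) / 2) = a - b" by simp
    ultimately have "cos (a - b) = 1 - 2 * (sin ((a - b) / 2))\<^sup>2" by (simp only:)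
    then show ?thesis by (simp add: power_mult_distrib)
  qed
  also have "\<dots> \<le> (a - b)\<^sup>2"
  proof -
    have "\<bar>2 * sin ((a - b) / 2)\<bar> \<le> \<bar>a - b\<bar>" using abs_sin_x_le_abs_x[of "(a - b) / 2"] by (simp add: abs_mult)
    then show ?thesis by (rule abs_le_square_iff[THEN iffD1])
  qed
  finally show ?thesis using abs_le_square_iff[of "cmod (cis a - cis b)" "a - b"] by simp
qed

lemma character_diff:
  "cmod (character \<xi> P - character \<xi> Q) \<le> 2 * pi * norm \<xi> * norm (P - Q)"
  "cmod (character \<xi> P - character \<eta> P) \<le> 2 * pi * norm P * norm (\<xi> - \<eta>)"
proof -
  have "\<bar>(P - Q) \<bullet> \<xi>\<bar> \<le> norm (P - Q) * norm \<xi>" "\<bar>P \<bullet> (\<xi> - \<eta>)\<bar> \<le> norm P * norm (\<xi> - \<eta>)"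
    by (rule Cauchy_Schwarz_ineq2)+
  then have 1: "2 * pi * \<bar>(P - Q) \<bullet> \<xi>\<bar> \<le> 2 * pi * (norm (P - Q) * norm \<xi>)"
    and 2: "2 * pi * \<bar>P \<bullet> (\<xi> - \<eta>)\<bar> \<le> 2 * pi * (norm P * norm (\<xi> - \<eta>))"
    by (auto intro: mult_left_mono)
  have "cmod (character \<xi> P - character \<xi> Q) \<le> 2 * pi * \<bar>(P - Q) \<bullet> \<xi>\<bar>"
    unfolding character_def
    by (rule order_trans[OF norm_cis_diff_le]) (simp add: inner_diff_left abs_mult abs_minus_commute flip: right_diff_distrib)
  also note 1
  finally show "cmod (character \<xi> P - character \<xi> Q) \<le> 2 * pi * norm \<xi> * norm (P - Q)" by (simp add: mult_ac)
  have "cmod (character \<xi> P - character \<eta> P) \<le> 2 * pi * \<bar>P \<bullet> (\<xi> - \<eta>)\<bar>"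
    unfolding character_def
    by (rule order_trans[OF norm_cis_diff_le]) (simp add: inner_diff_right abs_mult abs_minus_commute flip: right_diff_distrib)
  also note 2
  finally show "cmod (character \<xi> P - character \<eta> P) \<le> 2 * pi * norm P * norm (\<xi> - \<eta>)" by (simp add: mult_ac)
qed

text \<open>The difference of two characters must be small as a Lipschitz function when the
  frequencies are close. Splitting off the value at \<open>Q\<close> by multiplicativity leaves in
  each term one factor small in \<open>\<xi> - \<eta>\<close> and one small in
  \<open>P - Q\<close>.\<close>

lemma character_diff_diff:
  "cmod ((character \<xi> P - character \<eta> P) - (character \<xi> Q - character \<eta> Q))
    \<le> 2 * pi * norm (\<xi> - \<eta>) * (1 + 2 * pi * norm Q * norm \<xi>) * norm (P - Q)"
proof -
  have m: "character \<zeta> P = character \<zeta> Q * character \<zeta> (P - Q)" for \<zeta>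
    by (simp add: character_def cis_mult algebra_simps)
  have "(character \<xi> P - character \<eta> P) - (character \<xi> Q - character \<eta> Q) =
    (character \<xi> Q - character \<eta> Q) * (character \<xi> (P - Q) - character \<xi> 0)
      + character \<eta> Q * (character \<xi> (P - Q) - character \<eta> (P - Q))"
    unfolding m by (simp add: character_def algebra_simps)
  also have "cmod \<dots> \<le> (2 * pi * norm Q * norm (\<xi> - \<eta>)) * (2 * pi * norm \<xi> * norm (P - Q))
      + 1 * (2 * pi * norm (P - Q) * norm (\<xi> - \<eta>))"
    using character_diff(1)[of \<xi> "P - Q" 0]
    by (intro order_trans[OF norm_triangle_ineq] add_mono order_trans[OF norm_mult_ineq] mult_mono character_diff) auto
  finally show ?thesis by (simp add: algebra_simps)
qed

text \<open>The bound by \<open>A + L\<close> gives two things at once: continuity under Lipschitz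
  convergence and, with \<open>A = L = 0\<close>, vanishing on functions that are 0 on
  \<open>F\<close>, which expresses that the functional is supported on \<open>F\<close>.\<close>

locale lip_functional =
  fixes F :: "'a::euclidean_space set" and \<Phi> :: "('a \<Rightarrow> complex) \<Rightarrow> complex" and K R :: real
  assumes F_bounded: "\<And>P. P \<in> F \<Longrightarrow> norm P \<le> R" and R_pos: "R > 0" and K_nonneg: "K \<ge> 0"
    and \<Phi>_add: "\<And>f g A L A' L'. lip_on F f A L \<Longrightarrow> lip_on F g A' L' \<Longrightarrow> \<Phi> (\<lambda>x. f x + g x) = \<Phi> f + \<Phi> g"
    and \<Phi>_scale: "\<And>f A L c. lip_on F f A L \<Longrightarrow> \<Phi> (\<lambda>x. c * f x) = c * \<Phi> f"
    and \<Phi>_bound: "\<And>f A L. lip_on F f A L \<Longrightarrow> cmod (\<Phi> f) \<le> K * (A + L)"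
begin

lemma lip_on_add: "lip_on F f A L \<Longrightarrow> lip_on F g A' L' \<Longrightarrow> lip_on F (\<lambda>x. f x + g x) (A + A') (L + L')"
  unfolding lip_on_def
  by (auto intro!: order_trans[OF norm_triangle_ineq] add_mono borel_measurable_add
       order_trans[OF eq_refl[OF arg_cong[where f=cmod]] order_trans[OF norm_triangle_ineq add_mono]] simp: algebra_simps)

lemma lip_on_scale: "lip_on F f A L \<Longrightarrow> lip_on F (\<lambda>x. c * f x) (cmod c * A) (cmod c * L)"
  unfolding lip_on_def
  by (auto simp: norm_mult mult_left_mono mult.assoc borel_measurable_times simp flip: right_diff_distrib)

lemma \<Phi>_diff:
  assumes f: "lip_on F f A L" and g: "lip_on F g A' L'"
  shows "\<Phi> (\<lambda>x. f x - g x) = \<Phi> f - \<Phi> g"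
  using \<Phi>_add[OF f lip_on_scale[OF g, of "-1"]] \<Phi>_scale[OF g, of "-1"] by simp

lemma \<Phi>_sum:
  assumes "finite I" "\<And>i. i \<in> I \<Longrightarrow> lip_on F (f i) (A i) (L i)"
  shows "\<Phi> (\<lambda>x. \<Sum>i\<in>I. c i * f i x) = (\<Sum>i\<in>I. c i * \<Phi> (f i)) \<and> (\<exists>A' L'. lip_on F (\<lambda>x. \<Sum>i\<in>I. c i * f i x) A' L')"
  using assms
proof (induction I rule: finite_induct)
  case empty
  have z: "lip_on F (\<lambda>x. 0) 0 0" by (simp add: lip_on_def)
  then show ?case using \<Phi>_scale[OF z, of 0] by auto
next
  case (insert i I)
  then obtain A' L' where IH: "\<Phi> (\<lambda>x. \<Sum>i\<in>I. c i * f i x) = (\<Sum>i\<in>I. c i * \<Phi> (f i))" "lip_on F (\<lambda>x. \<Sum>i\<in>I. c i * f i x) A' L'"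
    by auto
  have i: "lip_on F (\<lambda>x. c i * f i x) (cmod (c i) * A i) (cmod (c i) * L i)"
    using insert.prems by (intro lip_on_scale) auto
  have "\<Phi> (\<lambda>x. c i * f i x + (\<Sum>i\<in>I. c i * f i x)) = c i * \<Phi> (f i) + (\<Sum>i\<in>I. c i * \<Phi> (f i))"
    using \<Phi>_add[OF i IH(2)] \<Phi>_scale[of "f i"] insert.prems IH(1) by auto
  then show ?case using insert.hyps lip_on_add[OF i IH(2)] by auto
qed

lemma lip_on_character: "lip_on F (character \<xi>) 1 (2 * pi * norm \<xi>)"
  unfolding lip_on_def using character_diff(1)[of \<xi>] by auto

text \<open>In each minimum the first entry grows at most linearly in the frequencies and serves as
  majorant for dominated convergence; the second tends to 0 as \<open>\<eta>\<close> tends to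
  \<open>\<xi>\<close>.\<close>

lemma lip_on_character_diff:
  "lip_on F (\<lambda>Q. character \<xi> Q - character \<eta> Q) (min 2 (2 * pi * R * norm (\<xi> - \<eta>)))
     (min (2 * pi * (norm \<xi> + norm \<eta>)) (2 * pi * norm (\<xi> - \<eta>) * (1 + 2 * pi * R * norm \<xi>)))"
  unfolding lip_on_def
proof (intro conjI ballI min.boundedI)
  show "cmod (character \<xi> P - character \<eta> P) \<le> 2" for P
    by (rule order_trans[OF norm_triangle_ineq4]) simp
  show "cmod (character \<xi> P - character \<eta> P) \<le> 2 * pi * R * norm (\<xi> - \<eta>)" if "P \<in> F" for P
    by (rule order_trans[OF character_diff(2)]) (use F_bounded[OF that] in \<open>auto intro!: mult_right_mono mult_left_mono\<close>)
next
  fix P Q assume PQ: "P \<in> F" "Q \<in> F"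
  have "cmod ((character \<xi> P - character \<xi> Q) - (character \<eta> P - character \<eta> Q)) \<le> 2 * pi * norm \<xi> * norm (P - Q) + 2 * pi * norm \<eta> * norm (P - Q)"
    by (intro order_trans[OF norm_triangle_ineq4] add_mono character_diff)
  then have 1: "cmod (character \<xi> P - character \<eta> P - (character \<xi> Q - character \<eta> Q)) \<le> 2 * pi * (norm \<xi> + norm \<eta>) * norm (P - Q)"
    by (simp add: algebra_simps)
  have "2 * pi * norm (\<xi> - \<eta>) * (1 + 2 * pi * norm Q * norm \<xi>) * norm (P - Q) \<le> 2 * pi * norm (\<xi> - \<eta>) * (1 + 2 * pi * R * norm \<xi>) * norm (P - Q)"
    using F_bounded[OF PQ(2)] by (intro mult_right_mono mult_left_mono add_left_mono) auto
  with character_diff_diff[of \<xi> P \<eta> Q]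
  have 2: "cmod (character \<xi> P - character \<eta> P - (character \<xi> Q - character \<eta> Q)) \<le> 2 * pi * norm (\<xi> - \<eta>) * (1 + 2 * pi * R * norm \<xi>) * norm (P - Q)"
    by linarith
  show "cmod (character \<xi> P - character \<eta> P - (character \<xi> Q - character \<eta> Q)) \<le>
     min (2 * pi * (norm \<xi> + norm \<eta>)) (2 * pi * norm (\<xi> - \<eta>) * (1 + 2 * pi * R * norm \<xi>)) * norm (P - Q)"
    using 1 2 by (auto simp: min_def)
qed (use R_pos in auto)

definition hat :: "'a \<Rightarrow> complex" where "hat \<xi> = \<Phi> (character \<xi>)"

lemma hat_bound: "cmod (hat \<xi>) \<le> K * (1 + 2 * pi * norm \<xi>)"
  unfolding hat_def by (rule \<Phi>_bound[OF lip_on_character])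

lemma hat_diff_bound:
  "cmod (hat \<xi> - hat \<eta>) \<le> K * (2 * pi * R * norm (\<xi> - \<eta>) + 2 * pi * norm (\<xi> - \<eta>) * (1 + 2 * pi * R * norm \<xi>))"
proof -
  have "hat \<xi> - hat \<eta> = \<Phi> (\<lambda>Q. character \<xi> Q - character \<eta> Q)"
    unfolding hat_def by (rule \<Phi>_diff[OF lip_on_character lip_on_character, symmetric])
  also have "cmod \<dots> \<le> K * (min 2 (2 * pi * R * norm (\<xi> - \<eta>)) + min (2 * pi * (norm \<xi> + norm \<eta>)) (2 * pi * norm (\<xi> - \<eta>) * (1 + 2 * pi * R * norm \<xi>)))"
    by (rule \<Phi>_bound[OF lip_on_character_diff])
  also have "\<dots> \<le> K * (2 * pi * R * norm (\<xi> - \<eta>) + 2 * pi * norm (\<xi> - \<eta>) * (1 + 2 * pi * R * norm \<xi>))"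
    using K_nonneg by (intro mult_left_mono add_mono) auto
  finally show ?thesis .
qed

lemma isCont_hat: "isCont hat \<xi>"
proof -
  have "((\<lambda>\<eta>. K * (2 * pi * R * norm (\<xi> - \<eta>) + 2 * pi * norm (\<xi> - \<eta>) * (1 + 2 * pi * R * norm \<xi>))) \<longlongrightarrow>
      K * (2 * pi * R * norm (\<xi> - \<xi>) + 2 * pi * norm (\<xi> - \<xi>) * (1 + 2 * pi * R * norm \<xi>))) (at \<xi>)"
    by (intro tendsto_intros)
  then have "((\<lambda>\<eta>. hat \<xi> - hat \<eta>) \<longlongrightarrow> 0) (at \<xi>)"
    by (intro Lim_null_comparison[OF always_eventually[OF allI[OF hat_diff_bound]]]) simp
  from tendsto_diff[OF tendsto_const[of "hat \<xi>"] this] show ?thesis by (simp add: isCont_def)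
qed

lemma borel_measurable_hat [measurable]: "hat \<in> borel_measurable borel"
  by (intro borel_measurable_continuous_onI continuous_at_imp_continuous_on ballI isCont_hat)

lemma lip_on_integral:
  assumes m: "integrable lborel m" and [measurable]: "(\<lambda>(\<xi>, Q). g \<xi> Q) \<in> borel_measurable (borel \<Otimes>\<^sub>M borel)"
    and [measurable]: "\<And>Q. (\<lambda>\<xi>. g \<xi> Q) \<in> borel_measurable borel"
    and gb: "\<And>\<xi> Q. cmod (g \<xi> Q) \<le> B" and g: "\<And>\<xi>. lip_on F (g \<xi>) (A \<xi>) (L \<xi>)"
    and A: "integrable lborel (\<lambda>\<xi>. cmod (m \<xi>) * A \<xi>)" and L: "integrable lborel (\<lambda>\<xi>. cmod (m \<xi>) * L \<xi>)"
  shows "lip_on F (\<lambda>Q. LINT \<xi>|lborel. m \<xi> * g \<xi> Q) (LINT \<xi>|lborel. cmod (m \<xi>) * A \<xi>) (LINT \<xi>|lborel. cmod (m \<xi>) * L \<xi>)"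
  unfolding lip_on_def
proof (intro conjI ballI)
  have [measurable]: "m \<in> borel_measurable borel" using m by auto
  have A0: "A \<xi> \<ge> 0" "L \<xi> \<ge> 0" for \<xi> using g[of \<xi>] by (auto simp: lip_on_def)
  show "(\<lambda>Q. LINT \<xi>|lborel. m \<xi> * g \<xi> Q) \<in> borel_measurable borel" by measurable
  show "0 \<le> (LINT \<xi>|lborel. cmod (m \<xi>) * A \<xi>)" "0 \<le> (LINT \<xi>|lborel. cmod (m \<xi>) * L \<xi>)"
    using A0 by (auto intro!: integral_nonneg_AE)
  have i: "integrable lborel (\<lambda>\<xi>. m \<xi> * g \<xi> Q)" for Q
    by (rule integrable_mult_bounded[OF m _ gb]) measurable
  fix P assume P: "P \<in> F"
  have "cmod (LINT \<xi>|lborel. m \<xi> * g \<xi> P) \<le> (LINT \<xi>|lborel. cmod (m \<xi> * g \<xi> P))" by (rule integral_norm_bound)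
  also have "\<dots> \<le> (LINT \<xi>|lborel. cmod (m \<xi>) * A \<xi>)"
    using g P unfolding lip_on_def
    by (intro integral_mono A integrable_norm i) (auto simp: norm_mult mult_left_mono)
  finally show "cmod (LINT \<xi>|lborel. m \<xi> * g \<xi> P) \<le> (LINT \<xi>|lborel. cmod (m \<xi>) * A \<xi>)" .
  fix Q assume Q: "Q \<in> F"
  have "cmod ((LINT \<xi>|lborel. m \<xi> * g \<xi> P) - (LINT \<xi>|lborel. m \<xi> * g \<xi> Q)) = cmod (LINT \<xi>|lborel. m \<xi> * g \<xi> P - m \<xi> * g \<xi> Q)"
    by (simp add: i)
  also have "\<dots> \<le> (LINT \<xi>|lborel. cmod (m \<xi> * g \<xi> P - m \<xi> * g \<xi> Q))" by (rule integral_norm_bound)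
  also have "\<dots> \<le> (LINT \<xi>|lborel. cmod (m \<xi>) * L \<xi> * norm (P - Q))"
  proof (intro integral_mono integrable_norm Bochner_Integration.integrable_diff i integrable_mult_left L)
    fix \<xi>
    have "cmod (g \<xi> P - g \<xi> Q) \<le> L \<xi> * norm (P - Q)" using g[of \<xi>] P Q by (auto simp: lip_on_def)
    then show "cmod (m \<xi> * g \<xi> P - m \<xi> * g \<xi> Q) \<le> cmod (m \<xi>) * L \<xi> * norm (P - Q)"
      by (simp add: norm_mult mult_left_mono mult.assoc flip: right_diff_distrib)
  qed
  finally show "cmod ((LINT \<xi>|lborel. m \<xi> * g \<xi> P) - (LINT \<xi>|lborel. m \<xi> * g \<xi> Q)) \<le> (LINT \<xi>|lborel. cmod (m \<xi>) * L \<xi>) * norm (P - Q)"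
    by simp
qed

text \<open>The functional is only known on individual functions, so it is moved under the integral by
  replacing the frequency with a simple function of it, where the integral becomes a finite sum.\<close>

lemma \<Phi>_integral:
  assumes m: "integrable lborel m" and m1: "integrable lborel (\<lambda>\<xi>. cmod (m \<xi>) * norm \<xi>)"
  shows "\<Phi> (\<lambda>Q. LINT \<xi>|lborel. m \<xi> * character \<xi> Q) = (LINT \<xi>|lborel. m \<xi> * hat \<xi>)"
proof -
  have [measurable]: "m \<in> borel_measurable borel" using m by auto
  \<comment> \<open>Simple approximations of the identity;
    \<open>norm (s k x) \<le> 2 * norm x\<close> lets the integrability of
    \<open>cmod (m \<xi>) * norm \<xi>\<close> pass to the approximants.\<close>
  obtain s :: "nat \<Rightarrow> 'a \<Rightarrow> 'a" where s: "\<And>k. simple_function borel (s k)" "\<And>x. (\<lambda>k. s k x) \<longlonglongrightarrow> x"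
      "\<And>k x. norm (s k x) \<le> 2 * norm x"
    using borel_measurable_implies_sequence_metric[of "\<lambda>x::'a. x" borel 0] by auto
  have [measurable]: "s k \<in> borel_measurable borel" for k by (rule borel_measurable_simple_function[OF s(1)])
  have fin: "finite (range (s k))" for k using simple_functionD(1)[OF s(1)[of k]] by simp
  define h where "h Q = (LINT \<xi>|lborel. m \<xi> * character \<xi> Q)" for Q
  define hk where "hk k Q = (LINT \<xi>|lborel. m \<xi> * character (s k \<xi>) Q)" for k Q
  have m2: "integrable lborel (\<lambda>\<xi>. cmod (m \<xi>) * (c * norm \<xi>))" for c
    using integrable_mult_right[OF m1, of c] by (simp add: mult_ac)
  have m3: "integrable lborel (\<lambda>\<xi>. cmod (m \<xi>) * (c * norm (s k \<xi>)))" if "c \<ge> 0" for c k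
  proof (rule Bochner_Integration.integrable_bound[OF m2[of "2 * c"]])
    show "AE x in lborel. norm (cmod (m x) * (c * norm (s k x))) \<le> norm (cmod (m x) * (2 * c * norm x))"
    proof (rule AE_I2)
      fix x
      have "c * norm (s k x) \<le> c * (2 * norm x)" using s(3)[of k x] that by (intro mult_left_mono)
      then have "cmod (m x) * (c * norm (s k x)) \<le> cmod (m x) * (2 * c * norm x)" by (intro mult_left_mono) auto
      then show "norm (cmod (m x) * (c * norm (s k x))) \<le> norm (cmod (m x) * (2 * c * norm x))"
        using that by (simp add: abs_mult)
    qed
  qed measurable
  have lh: "lip_on F h (LINT \<xi>|lborel. cmod (m \<xi>) * 1) (LINT \<xi>|lborel. cmod (m \<xi>) * (2 * pi * norm \<xi>))"
    unfolding h_def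
    by (rule lip_on_integral[OF m, where B=1]) (use m m2 lip_on_character in auto)
  have lhk: "lip_on F (hk k) (LINT \<xi>|lborel. cmod (m \<xi>) * 1) (LINT \<xi>|lborel. cmod (m \<xi>) * (2 * pi * norm (s k \<xi>)))" for k
    unfolding hk_def
    by (rule lip_on_integral[OF m, where B=1]) (use m m3[of "2 * pi"] lip_on_character in auto)
  \<comment> \<open>\<open>a\<close> and \<open>l\<close> are the constants of
    \<open>lip_on_character_diff\<close> for the frequencies \<open>\<xi>\<close> and
    \<open>s k \<xi>\<close>.\<close>
  define a where "a k \<xi> = min 2 (2 * pi * R * norm (\<xi> - s k \<xi>))" for k \<xi>
  define l where "l k \<xi> = min (2 * pi * (norm \<xi> + norm (s k \<xi>))) (2 * pi * norm (\<xi> - s k \<xi>) * (1 + 2 * pi * R * norm \<xi>))" for k \<xi>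
  have [measurable]: "a k \<in> borel_measurable borel" "l k \<in> borel_measurable borel" for k
    unfolding a_def l_def by measurable
  have a0: "0 \<le> a k \<xi>" "a k \<xi> \<le> 2" for k \<xi> using R_pos by (auto simp: a_def)
  have l0: "0 \<le> l k \<xi>" for k \<xi> using R_pos by (simp add: l_def)
  have l1: "l k \<xi> \<le> 6 * pi * norm \<xi>" for k \<xi>
  proof -
    have "l k \<xi> \<le> 2 * pi * (norm \<xi> + norm (s k \<xi>))" by (simp add: l_def)
    also have "\<dots> \<le> 2 * pi * (norm \<xi> + 2 * norm \<xi>)" using s(3)[of k \<xi>] by (intro mult_left_mono add_left_mono) auto
    finally show ?thesis by simp
  qed
  have ds: "(\<lambda>k. norm (\<xi> - s k \<xi>)) \<longlonglongrightarrow> 0" for \<xi>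
    using tendsto_norm[OF tendsto_diff[OF tendsto_const[of \<xi>] s(2)[of \<xi>]]] by simp
  have alim: "(\<lambda>k. a k \<xi>) \<longlonglongrightarrow> 0" for \<xi>
    using tendsto_min[OF tendsto_const[of 2] tendsto_mult[OF tendsto_const[of "2 * pi * R"] ds[of \<xi>]]] by (simp add: a_def)
  have llim: "(\<lambda>k. l k \<xi>) \<longlonglongrightarrow> 0" for \<xi>
  proof (rule tendsto_sandwich[OF _ _ tendsto_const])
    show "\<forall>\<^sub>F k in sequentially. 0 \<le> l k \<xi>" using l0 by simp
    show "\<forall>\<^sub>F k in sequentially. l k \<xi> \<le> 2 * pi * norm (\<xi> - s k \<xi>) * (1 + 2 * pi * R * norm \<xi>)" by (simp add: l_def)
    show "(\<lambda>k. 2 * pi * norm (\<xi> - s k \<xi>) * (1 + 2 * pi * R * norm \<xi>)) \<longlonglongrightarrow> 0"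
      using tendsto_mult[OF tendsto_mult[OF tendsto_const[of "2 * pi"] ds[of \<xi>]] tendsto_const[of "1 + 2 * pi * R * norm \<xi>"]] by simp
  qed
  have ai: "integrable lborel (\<lambda>\<xi>. cmod (m \<xi>) * a k \<xi>)" for k
    by (rule Bochner_Integration.integrable_bound[where f="\<lambda>\<xi>. cmod (m \<xi>) * 2"])
       (use m a0 in \<open>auto simp: abs_mult intro!: mult_left_mono\<close>)
  have li: "integrable lborel (\<lambda>\<xi>. cmod (m \<xi>) * l k \<xi>)" for k
    by (rule Bochner_Integration.integrable_bound[OF m2[of "6 * pi"]])
       (use l0 l1 in \<open>auto simp: abs_mult intro!: mult_left_mono\<close>)
  have diff: "cmod (\<Phi> h - \<Phi> (hk k)) \<le> K * ((LINT \<xi>|lborel. cmod (m \<xi>) * a k \<xi>) + (LINT \<xi>|lborel. cmod (m \<xi>) * l k \<xi>))" for k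
  proof -
    have c1: "integrable lborel (\<lambda>\<xi>. m \<xi> * character \<xi> Q)" "integrable lborel (\<lambda>\<xi>. m \<xi> * character (s k \<xi>) Q)" for Q
      by (rule integrable_mult_bounded[OF m, where B=1]; simp)+
    have "h Q - hk k Q = (LINT \<xi>|lborel. m \<xi> * (character \<xi> Q - character (s k \<xi>) Q))" for Q
      unfolding h_def hk_def right_diff_distrib using c1 by (rule Bochner_Integration.integral_diff[symmetric])
    moreover have "lip_on F (\<lambda>Q. LINT \<xi>|lborel. m \<xi> * (character \<xi> Q - character (s k \<xi>) Q))
        (LINT \<xi>|lborel. cmod (m \<xi>) * a k \<xi>) (LINT \<xi>|lborel. cmod (m \<xi>) * l k \<xi>)"
    proof (rule lip_on_integral[OF m, where B=2])
      show "cmod (character \<xi> Q - character (s k \<xi>) Q) \<le> 2" for \<xi> Q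
        by (rule order_trans[OF norm_triangle_ineq4]) simp
      show "lip_on F (\<lambda>Q. character \<xi> Q - character (s k \<xi>) Q) (a k \<xi>) (l k \<xi>)" for \<xi>
        unfolding a_def l_def by (rule lip_on_character_diff)
    qed (use ai li in auto)
    ultimately have "lip_on F (\<lambda>Q. h Q - hk k Q) (LINT \<xi>|lborel. cmod (m \<xi>) * a k \<xi>) (LINT \<xi>|lborel. cmod (m \<xi>) * l k \<xi>)"
      by simp
    from \<Phi>_bound[OF this] show ?thesis unfolding \<Phi>_diff[OF lh lhk] .
  qed
  have "(\<lambda>k. K * ((LINT \<xi>|lborel. cmod (m \<xi>) * a k \<xi>) + (LINT \<xi>|lborel. cmod (m \<xi>) * l k \<xi>))) \<longlonglongrightarrow>
     K * ((LINT \<xi>|lborel. cmod (m \<xi>) * 0) + (LINT \<xi>|lborel. cmod (m \<xi>) * 0))"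
  proof (intro tendsto_mult tendsto_const tendsto_add)
    show "(\<lambda>k. LINT \<xi>|lborel. cmod (m \<xi>) * a k \<xi>) \<longlonglongrightarrow> (LINT \<xi>|lborel. cmod (m \<xi>) * 0)"
      by (rule integral_dominated_convergence[where w="\<lambda>\<xi>. cmod (m \<xi>) * 2"])
         (use m a0 alim in \<open>auto simp: abs_mult intro!: mult_left_mono tendsto_mult_right_zero\<close>)
    show "(\<lambda>k. LINT \<xi>|lborel. cmod (m \<xi>) * l k \<xi>) \<longlonglongrightarrow> (LINT \<xi>|lborel. cmod (m \<xi>) * 0)"
      by (rule integral_dominated_convergence[where w="\<lambda>\<xi>. cmod (m \<xi>) * (6 * pi * norm \<xi>)"])
         (use m2[of "6 * pi"] l0 l1 llim in \<open>auto simp: abs_mult intro!: mult_left_mono tendsto_mult_right_zero\<close>)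
  qed
  then have "(\<lambda>k. \<Phi> h - \<Phi> (hk k)) \<longlonglongrightarrow> 0"
    by (intro Lim_null_comparison[OF always_eventually[OF allI[OF diff]]]) simp
  from tendsto_diff[OF tendsto_const[of "\<Phi> h"] this]
  have lim1: "(\<lambda>k. \<Phi> (hk k)) \<longlonglongrightarrow> \<Phi> h" by simp
  have hk_eq: "\<Phi> (hk k) = (LINT \<xi>|lborel. m \<xi> * hat (s k \<xi>))" for k
  proof -
    \<comment> \<open>\<open>c \<eta>\<close> is the mass of \<open>m\<close> on the level set of
      \<open>s k\<close> at \<open>\<eta>\<close>, which makes the integral a finite combination of
      characters.\<close>
    define c where "c \<eta> = (LINT \<xi>|lborel. m \<xi> * indicator (s k -` {\<eta>}) \<xi>)" for \<eta>
    have [measurable]: "s k -` {\<eta>} \<in> sets borel" for \<eta>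
      using measurable_sets[of "s k" borel borel "{\<eta>}"] by simp
    have ci: "integrable lborel (\<lambda>\<xi>. m \<xi> * indicator (s k -` {\<eta>}) \<xi>)" for \<eta>
      by (rule integrable_mult_bounded[OF m, where B=1]) (auto split: split_indicator)
    have expand: "(LINT \<xi>|lborel. m \<xi> * G (s k \<xi>)) = (\<Sum>\<eta>\<in>range (s k). c \<eta> * G \<eta>)" for G :: "'a \<Rightarrow> complex"
    proof -
      have "m \<xi> * G (s k \<xi>) = (\<Sum>\<eta>\<in>range (s k). m \<xi> * indicator (s k -` {\<eta>}) \<xi> * G \<eta>)" for \<xi>
      proof -
        have "(\<Sum>\<eta>\<in>range (s k). m \<xi> * indicator (s k -` {\<eta>}) \<xi> * G \<eta>) = (\<Sum>\<eta>\<in>range (s k). if s k \<xi> = \<eta> then m \<xi> * G \<eta> else 0)"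
          by (intro sum.cong refl) (simp add: indicator_def)
        also have "\<dots> = m \<xi> * G (s k \<xi>)" using fin by simp
        finally show ?thesis by simp
      qed
      then show ?thesis using ci by (simp add: c_def)
    qed
    have "\<Phi> (\<lambda>Q. \<Sum>\<eta>\<in>range (s k). c \<eta> * character \<eta> Q) = (\<Sum>\<eta>\<in>range (s k). c \<eta> * hat \<eta>)"
      unfolding hat_def using \<Phi>_sum[OF fin[of k], of character "\<lambda>_. 1" "\<lambda>\<xi>. 2 * pi * norm \<xi>" c] lip_on_character by blast
    then show ?thesis unfolding hk_def expand[of "\<lambda>\<eta>. character \<eta> _"] expand[of hat] .
  qed
  have "(\<lambda>k. LINT \<xi>|lborel. m \<xi> * hat (s k \<xi>)) \<longlonglongrightarrow> (LINT \<xi>|lborel. m \<xi> * hat \<xi>)"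
  proof (rule integral_dominated_convergence[where w="\<lambda>\<xi>. cmod (m \<xi>) * K + cmod (m \<xi>) * (4 * pi * K * norm \<xi>)"])
    show "AE \<xi> in lborel. (\<lambda>k. m \<xi> * hat (s k \<xi>)) \<longlonglongrightarrow> m \<xi> * hat \<xi>"
      by (intro AE_I2 tendsto_mult tendsto_const isCont_tendsto_compose[OF isCont_hat] s(2))
    show "AE \<xi> in lborel. cmod (m \<xi> * hat (s k \<xi>)) \<le> cmod (m \<xi>) * K + cmod (m \<xi>) * (4 * pi * K * norm \<xi>)" for k
    proof (rule AE_I2)
      fix \<xi>
      have "cmod (hat (s k \<xi>)) \<le> K * (1 + 2 * pi * norm (s k \<xi>))" by (rule hat_bound)
      also have "\<dots> \<le> K * (1 + 2 * pi * (2 * norm \<xi>))"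
        using s(3)[of k \<xi>] K_nonneg by (intro mult_left_mono add_left_mono) auto
      finally have "cmod (m \<xi>) * cmod (hat (s k \<xi>)) \<le> cmod (m \<xi>) * (K * (1 + 2 * pi * (2 * norm \<xi>)))"
        by (intro mult_left_mono) auto
      then show "cmod (m \<xi> * hat (s k \<xi>)) \<le> cmod (m \<xi>) * K + cmod (m \<xi>) * (4 * pi * K * norm \<xi>)"
        by (simp add: norm_mult algebra_simps)
    qed
    show "integrable lborel (\<lambda>\<xi>. cmod (m \<xi>) * K + cmod (m \<xi>) * (4 * pi * K * norm \<xi>))"
      using m m2[of "4 * pi * K"] by auto
  qed measurable
  with lim1 show ?thesis unfolding hk_eq h_def by (rule LIMSEQ_unique[symmetric, rotated])
qed

end

section \<open>A trace inequality\<close>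

text \<open>The terms increase geometrically until \<open>x * 2 ^ j\<close> passes 1, decrease
  geometrically afterwards, and never exceed 1. This gives two geometric series, whatever
  \<open>x\<close> and \<open>J\<close> are.\<close>

lemma two_sided_dyadic_sum_le:
  fixes x \<epsilon> :: real assumes "x > 0" "\<epsilon> > 0"
  shows "(\<Sum>j<J. min (x * 2 ^ j) (1 / (x * 2 ^ j)) powr \<epsilon>) \<le> 2 / (1 - 2 powr (- \<epsilon>))"
proof -
  define q where "q = 2 powr (- \<epsilon>)"
  have q: "0 < q" "q < 1" using assms by (auto simp: q_def powr_less_one)
  have cq: "1 / (1 - q) * q + 1 = 1 / (1 - q)" using q by (simp add: field_simps)
  have c1: "1 \<le> 1 / (1 - q)" using q by simp
  have half: "(y / 2) powr \<epsilon> = y powr \<epsilon> * q" if "y > 0" for y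
    using that by (simp add: q_def powr_divide powr_minus_divide)
  \<comment> \<open>For the induction to close, the bound is expressed by the last term
    \<open>x * 2 ^ J / 2\<close>, cut at 1; the induction step is then the identity
    \<open>cq\<close>.\<close>
  have A: "(\<Sum>j<J. if x * 2 ^ j \<le> 1 then (x * 2 ^ j) powr \<epsilon> else 0) \<le> 1 / (1 - q) * (min 1 (x * 2 ^ J / 2)) powr \<epsilon>" for J
  proof (induction J)
    case 0 then show ?case using q by simp
  next
    case (Suc J)
    define y where "y = x * 2 ^ J"
    have y: "y > 0" using assms by (simp add: y_def)
    show ?case
    proof (cases "y \<le> 1")
      case True
      have "(\<Sum>j<Suc J. if x * 2 ^ j \<le> 1 then (x * 2 ^ j) powr \<epsilon> else 0) \<le> 1 / (1 - q) * (y / 2) powr \<epsilon> + y powr \<epsilon>"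
        using Suc True y by (simp add: y_def min_def split: if_splits)
      also have "\<dots> = (1 / (1 - q) * q + 1) * y powr \<epsilon>" by (simp add: half[OF y] algebra_simps)
      also have "\<dots> = 1 / (1 - q) * y powr \<epsilon>" unfolding cq ..
      finally show ?thesis using True by (simp add: y_def min_def)
    next
      case False
      have "(\<Sum>j<Suc J. if x * 2 ^ j \<le> 1 then (x * 2 ^ j) powr \<epsilon> else 0) = (\<Sum>j<J. if x * 2 ^ j \<le> 1 then (x * 2 ^ j) powr \<epsilon> else 0)"
        using False by (simp add: y_def)
      also note Suc
      also have "1 / (1 - q) * (min 1 (x * 2 ^ J / 2)) powr \<epsilon> \<le> 1 / (1 - q) * 1"
        using q assms by (intro mult_left_mono powr_le1) auto
      finally show ?thesis using False by (simp add: y_def)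
    qed
  qed
  \<comment> \<open>The induction peels off the first term and doubles \<open>x\<close>, hence the
    general \<open>x\<close>.\<close>
  have B: "(\<Sum>j<J. if x * 2 ^ j \<le> 1 then 0 else (1 / (x * 2 ^ j)) powr \<epsilon>) \<le> 1 / (1 - q) * (min 1 (1 / x)) powr \<epsilon>"
    if "x > 0" for J x
    using that
  proof (induction J arbitrary: x)
    case 0 then show ?case using q by simp
  next
    case (Suc J)
    have IH: "(\<Sum>j<J. if x * 2 ^ Suc j \<le> 1 then 0 else (1 / (x * 2 ^ Suc j)) powr \<epsilon>) \<le> 1 / (1 - q) * (min 1 (1 / (2 * x))) powr \<epsilon>"
    proof -
      have "2 * x * 2 ^ j = x * 2 ^ Suc j" for j by simp
      then show ?thesis using Suc.IH[of "2 * x"] Suc.prems by (simp only:)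
    qed
    show ?case
    proof (cases "x \<le> 1")
      case True
      have "(\<Sum>j<Suc J. if x * 2 ^ j \<le> 1 then 0 else (1 / (x * 2 ^ j)) powr \<epsilon>) =
         (\<Sum>j<J. if x * 2 ^ Suc j \<le> 1 then 0 else (1 / (x * 2 ^ Suc j)) powr \<epsilon>)"
        using True by (subst sum.lessThan_Suc_shift) simp
      also note IH
      also have "1 / (1 - q) * (min 1 (1 / (2 * x))) powr \<epsilon> \<le> 1 / (1 - q) * 1"
        using q assms Suc.prems by (intro mult_left_mono powr_le1) auto
      finally show ?thesis using True Suc.prems by (simp add: min_def)
    next
      case False
      have "(\<Sum>j<Suc J. if x * 2 ^ j \<le> 1 then 0 else (1 / (x * 2 ^ j)) powr \<epsilon>) =
         (1 / x) powr \<epsilon> + (\<Sum>j<J. if x * 2 ^ Suc j \<le> 1 then 0 else (1 / (x * 2 ^ Suc j)) powr \<epsilon>)"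
        using False by (subst sum.lessThan_Suc_shift) simp
      also have "\<dots> \<le> (1 / x) powr \<epsilon> + 1 / (1 - q) * ((1 / x) / 2) powr \<epsilon>"
        using IH False Suc.prems by (simp add: min_def mult.commute split: if_splits)
      also have "\<dots> = (1 / (1 - q) * q + 1) * (1 / x) powr \<epsilon>" using Suc.prems by (subst half) (auto simp: algebra_simps)
      also have "\<dots> = 1 / (1 - q) * (1 / x) powr \<epsilon>" unfolding cq ..
      finally show ?thesis using False Suc.prems by (simp add: min_def)
    qed
  qed
  have le1: "1 / (1 - q) * (min 1 z) powr \<epsilon> \<le> 1 / (1 - q)" if "z \<ge> 0" for z
  proof -
    have "(min 1 z) powr \<epsilon> \<le> 1" using that assms by (intro powr_le1) auto
    then have "1 / (1 - q) * (min 1 z) powr \<epsilon> \<le> 1 / (1 - q) * 1" using q by (intro mult_left_mono) auto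
    then show ?thesis by simp
  qed
  have "(\<Sum>j<J. min (x * 2 ^ j) (1 / (x * 2 ^ j)) powr \<epsilon>) =
     (\<Sum>j<J. (if x * 2 ^ j \<le> 1 then (x * 2 ^ j) powr \<epsilon> else 0) + (if x * 2 ^ j \<le> 1 then 0 else (1 / (x * 2 ^ j)) powr \<epsilon>))"
  proof (intro sum.cong refl)
    fix j
    define y where "y = x * 2 ^ j"
    have y: "y > 0" using assms by (simp add: y_def)
    have "y \<le> 1 / y \<longleftrightarrow> y \<le> 1"
      using y mult_le_one[of y y] mult_strict_mono[of 1 y 1 y] by (auto simp: field_simps not_le[symmetric])
    then have "min y (1 / y) powr \<epsilon> = (if y \<le> 1 then y powr \<epsilon> else 0) + (if y \<le> 1 then 0 else (1 / y) powr \<epsilon>)"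
      by (auto simp: min_def)
    then show "min (x * 2 ^ j) (1 / (x * 2 ^ j)) powr \<epsilon> =
      (if x * 2 ^ j \<le> 1 then (x * 2 ^ j) powr \<epsilon> else 0) + (if x * 2 ^ j \<le> 1 then 0 else (1 / (x * 2 ^ j)) powr \<epsilon>)"
      unfolding y_def .
  qed
  also have "\<dots> \<le> 1 / (1 - q) + 1 / (1 - q)"
    unfolding sum.distrib using assms
    by (intro add_mono order_trans[OF A le1] order_trans[OF B le1]) auto
  finally show ?thesis by (simp add: q_def)
qed

lemma weighted_sum_Cauchy_Schwarz:
  fixes a l :: "'b \<Rightarrow> real"
  assumes "\<And>j. j \<in> I \<Longrightarrow> l j > 0"
  shows "(\<Sum>j\<in>I. a j)\<^sup>2 \<le> (\<Sum>j\<in>I. l j) * (\<Sum>j\<in>I. (a j)\<^sup>2 / l j)"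
proof -
  have "(\<Sum>j\<in>I. a j) = (\<Sum>j\<in>I. sqrt (l j) * (a j / sqrt (l j)))"
    using assms by (intro sum.cong refl) (metis nonzero_mult_div_cancel_left order_less_irrefl real_sqrt_gt_zero times_divide_eq_right)
  then have "(\<Sum>j\<in>I. a j)\<^sup>2 \<le> (\<Sum>j\<in>I. (sqrt (l j))\<^sup>2) * (\<Sum>j\<in>I. (a j / sqrt (l j))\<^sup>2)"
    using Cauchy_Schwarz_ineq_sum[of "\<lambda>j. sqrt (l j)" "\<lambda>j. a j / sqrt (l j)" I] by simp
  also have "(\<Sum>j\<in>I. (sqrt (l j))\<^sup>2) = (\<Sum>j\<in>I. l j)" using assms by (intro sum.cong) (auto simp: less_imp_le)
  also have "(\<Sum>j\<in>I. (a j / sqrt (l j))\<^sup>2) = (\<Sum>j\<in>I. (a j)\<^sup>2 / l j)"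
    using assms by (intro sum.cong) (auto simp: power_divide less_imp_le)
  finally show ?thesis .
qed

text \<open>A weight for Cauchy-Schwarz over the frequency scales \<open>\<rho>\<close> at a fixed
  distance \<open>r\<close>. It peaks with value 1 at \<open>\<rho> * r = 1\<close>, where the
  smoothness and the size estimate of a block change places.\<close>

definition scale_weight :: "real \<Rightarrow> real \<Rightarrow> real \<Rightarrow> real" where
  "scale_weight \<epsilon> \<rho> r = min (\<rho> * r) (1 / (\<rho> * r)) powr \<epsilon>"

context upper_regular
begin

text \<open>Where \<open>\<rho> * norm (P - Q) \<le> 1\<close> the smoothness half of
  \<open>frequency_block\<close> is used, elsewhere the size half. After division by the weight the
  remaining powers of the distance are \<open>b1 - d\<close> near the diagonal and
  \<open>- b2 - d\<close> away from it, integrable because \<open>b1\<close> and \<open>b2\<close>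
  are positive.\<close>

lemma block_trace:
  assumes \<alpha>: "0 < \<alpha>" "\<alpha> < 1/2" and d: "d = real DIM('a) - 1"
  obtains A where "A \<ge> 0"
    "\<And>\<rho> V. \<rho> > 0 \<Longrightarrow> integrable lborel V \<Longrightarrow> (\<And>\<xi>. norm \<xi> > \<rho> \<Longrightarrow> V \<xi> = 0) \<Longrightarrow>
       (\<integral>\<^sup>+P. ennreal ((cmod (ift V P))\<^sup>2) \<partial>\<mu>) \<le> ennreal (A * \<rho>) * (\<integral>\<^sup>+\<xi>. ennreal ((cmod (V \<xi>))\<^sup>2) \<partial>lborel)"
    "\<And>\<rho> V. \<rho> > 0 \<Longrightarrow> integrable lborel V \<Longrightarrow> (\<And>\<xi>. norm \<xi> > \<rho> \<Longrightarrow> V \<xi> = 0) \<Longrightarrow>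
       (\<integral>\<^sup>+P. \<integral>\<^sup>+Q. ennreal ((cmod (ift V P - ift V Q))\<^sup>2 / scale_weight \<alpha> \<rho> (norm (P - Q)) / norm (P - Q) powr (d + 2 * \<alpha>)) \<partial>\<mu> \<partial>\<mu>)
         \<le> ennreal (A * \<rho> powr (1 + 2 * \<alpha>)) * (\<integral>\<^sup>+\<xi>. ennreal ((cmod (V \<xi>))\<^sup>2) \<partial>lborel)"
proof -
  interpret P: pair_sigma_finite \<mu> \<mu> ..
  obtain G where G: "G > 0"
    "\<And>\<rho> y. \<rho> > 0 \<Longrightarrow> (\<integral>\<^sup>+x. ennreal (exp (- (\<rho>\<^sup>2 * (norm (x - y))\<^sup>2))) \<partial>\<mu>) \<le> ennreal (G * \<rho> powr (- d))"
    using gaussian_integral_le by blast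
  define K where "K = (2 * pi * exp 2)\<^sup>2 * sqrt pi ^ DIM('a) * exp (2 * pi)"
  have K: "K \<ge> 0" by (simp add: K_def)
  \<comment> \<open>The measure compensates \<open>\<rho> powr (- d)\<close> of the factor
    \<open>\<rho> ^ DIM('a)\<close>. As \<open>d\<close> is one less than the dimension, a factor
    \<open>\<rho>\<close> remains: the half derivative lost in restricting to a
    hypersurface.\<close>
  have gauss: "(\<integral>\<^sup>+x. ennreal (\<rho> ^ DIM('a) * exp (- (\<rho>\<^sup>2 * (norm (x - y))\<^sup>2))) \<partial>\<mu>) \<le> ennreal (G * \<rho>)" if \<rho>: "\<rho> > 0" for \<rho> y
  proof -
    have "(\<integral>\<^sup>+x. ennreal (\<rho> ^ DIM('a) * exp (- (\<rho>\<^sup>2 * (norm (x - y))\<^sup>2))) \<partial>\<mu>)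
        = ennreal (\<rho> ^ DIM('a)) * (\<integral>\<^sup>+x. ennreal (exp (- (\<rho>\<^sup>2 * (norm (x - y))\<^sup>2))) \<partial>\<mu>)"
      using \<rho> by (subst nn_integral_cmult[symmetric]) (auto simp: ennreal_mult)
    also have "\<dots> \<le> ennreal (\<rho> ^ DIM('a)) * ennreal (G * \<rho> powr (- d))"
      by (intro mult_left_mono G \<rho>) auto
    also have "\<dots> = ennreal (G * (\<rho> powr real DIM('a) * \<rho> powr (- d)))"
      using \<rho> G(1) by (simp add: powr_realpow mult_ac flip: ennreal_mult)
    also have "\<rho> powr real DIM('a) * \<rho> powr (- d) = \<rho>"
      using \<rho> by (simp add: d flip: powr_add)
    finally show ?thesis .
  qed
  have block: "\<exists>M. M \<in> borel_measurable borel \<and> (\<forall>x. ennreal ((cmod (ift V x))\<^sup>2) \<le> M x) \<and>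
      (\<forall>x y. \<rho> * norm (x - y) \<le> 1 \<longrightarrow> ennreal ((cmod (ift V x - ift V y))\<^sup>2) \<le> ennreal ((\<rho> * norm (x - y))\<^sup>2) * M x) \<and>
      (\<integral>\<^sup>+x. M x \<partial>\<mu>) \<le> ennreal (K * G * \<rho>) * (\<integral>\<^sup>+\<xi>. ennreal ((cmod (V \<xi>))\<^sup>2) \<partial>lborel)"
    if "\<rho> > 0" "integrable lborel V" "\<And>\<xi>. norm \<xi> > \<rho> \<Longrightarrow> V \<xi> = 0" for \<rho> V
    by (rule frequency_block[OF that(2,3,1) sigma_finite_measure_axioms sets_eq gauss[OF that(1)]])
       (use K G(1) that(1) in \<open>auto simp: K_def ennreal_mult mult_ac\<close>)
  \<comment> \<open>Near the diagonal: 2 from the squared difference, minus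
    \<open>2 * \<alpha>\<close> from the seminorm, minus \<open>\<alpha>\<close> from the weight.
    Away from it: \<open>- 2 * \<alpha>\<close> from the seminorm plus \<open>\<alpha>\<close> from
    the weight, that is \<open>- b2\<close>.\<close>
  define b1 b2 where "b1 = 2 - 3 * \<alpha>" and "b2 = \<alpha>"
  have b: "b1 > 0" "b2 > 0" using \<alpha> by (auto simp: b1_def b2_def)
  define c1 c2 where "c1 = C * 2 powr \<bar>b1 - d\<bar> / (1 - 2 powr (- b1))" and "c2 = C * 2 powr d / (1 - 2 powr (- b2))"
  have c: "c1 \<ge> 0" "c2 \<ge> 0" unfolding c1_def c2_def using b C_nonneg
    by (auto intro!: divide_nonneg_nonneg mult_nonneg_nonneg simp: powr_less_one less_imp_le)
  \<comment> \<open>Both cases in one symmetric kernel; the symmetry makes the terms with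
    \<open>M P\<close> and with \<open>M Q\<close> contribute equally.\<close>
  define k where "k \<rho> P Q = ennreal (\<rho> powr (2 - \<alpha>)) * (indicator (cball P (1/\<rho>)) Q * ennreal (norm (Q - P) powr (b1 - d)))
     + ennreal (2 * \<rho> powr \<alpha>) * (indicator (- cball P (1/\<rho>)) Q * ennreal (norm (Q - P) powr (- b2 - d)))" for \<rho> and P Q :: 'a
  have ksym: "k \<rho> P Q = k \<rho> Q P" for \<rho> P Q
    by (simp add: k_def norm_minus_commute dist_commute indicator_def)
  have km [measurable]: "(\<lambda>(P, Q). k \<rho> P Q) \<in> borel_measurable (borel \<Otimes>\<^sub>M borel)" for \<rho>
  proof -
    have [measurable]: "Measurable.pred (borel \<Otimes>\<^sub>M borel) (\<lambda>(P::'a, Q). Q \<in> cball P (1/\<rho>))"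
      unfolding mem_cball dist_norm by measurable
    show ?thesis unfolding k_def indicator_def by measurable
  qed
  have km' [measurable]: "k \<rho> P \<in> borel_measurable borel" for \<rho> P unfolding k_def by measurable
  have kint: "(\<integral>\<^sup>+Q. k \<rho> P Q \<partial>\<mu>) \<le> ennreal ((c1 + 2 * c2) * \<rho> powr (2 * \<alpha>))" if \<rho>: "\<rho> > 0" for \<rho> P
  proof -
    define h1 h2 where "h1 Q = indicator (cball P (1/\<rho>)) Q * ennreal (norm (Q - P) powr (b1 - d))"
      and "h2 Q = indicator (- cball P (1/\<rho>)) Q * ennreal (norm (Q - P) powr (- b2 - d))" for Q
    have [measurable]: "h1 \<in> borel_measurable \<mu>" "h2 \<in> borel_measurable \<mu>" unfolding h1_def h2_def by measurable
    have "(\<integral>\<^sup>+Q. k \<rho> P Q \<partial>\<mu>) = (\<integral>\<^sup>+Q. ennreal (\<rho> powr (2 - \<alpha>)) * h1 Q + ennreal (2 * \<rho> powr \<alpha>) * h2 Q \<partial>\<mu>)"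
      by (simp add: k_def h1_def h2_def)
    also have "\<dots> = (\<integral>\<^sup>+Q. ennreal (\<rho> powr (2 - \<alpha>)) * h1 Q \<partial>\<mu>) + (\<integral>\<^sup>+Q. ennreal (2 * \<rho> powr \<alpha>) * h2 Q \<partial>\<mu>)"
      by (rule nn_integral_add) measurable
    also have "\<dots> = ennreal (\<rho> powr (2 - \<alpha>)) * (\<integral>\<^sup>+Q. h1 Q \<partial>\<mu>) + ennreal (2 * \<rho> powr \<alpha>) * (\<integral>\<^sup>+Q. h2 Q \<partial>\<mu>)"
      by (subst (1 2) nn_integral_cmult) measurable
    also have "\<dots> \<le> ennreal (\<rho> powr (2 - \<alpha>)) * ennreal (c1 * (1/\<rho>) powr b1) + ennreal (2 * \<rho> powr \<alpha>) * ennreal (c2 * (1/\<rho>) powr (- b2))"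
      unfolding h1_def h2_def c1_def c2_def using \<rho> b by (intro add_mono mult_left_mono near_integral far_integral) auto
    also have "\<dots> = ennreal (c1 * (\<rho> powr (2 - \<alpha>) * (1/\<rho>) powr b1) + 2 * c2 * (\<rho> powr \<alpha> * (1/\<rho>) powr (- b2)))"
      using c by (subst ennreal_plus) (auto simp: mult_ac simp flip: ennreal_mult)
    also have "\<rho> powr (2 - \<alpha>) * (1/\<rho>) powr b1 = \<rho> powr (2 * \<alpha>)"
    proof -
      have "(1/\<rho>) powr b1 = \<rho> powr (- b1)" using \<rho> by (simp add: powr_divide powr_minus_divide)
      then show ?thesis by (simp add: b1_def flip: powr_add)
    qed
    also have "\<rho> powr \<alpha> * (1/\<rho>) powr (- b2) = \<rho> powr (2 * \<alpha>)"
    proof -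
      have "(1/\<rho>) powr (- b2) = \<rho> powr b2" using \<rho> by (simp add: powr_divide powr_minus_divide)
      then show ?thesis by (simp add: b2_def flip: powr_add)
    qed
    finally show ?thesis by (simp add: algebra_simps)
  qed
  define A where "A = K * G * (1 + 2 * (c1 + 2 * c2))"
  have KG: "K * G \<ge> 0" using K G(1) by simp
  have A_eq: "A = K * G + K * G * (2 * (c1 + 2 * c2))" by (simp add: A_def algebra_simps)
  have Kc: "K * G * (2 * (c1 + 2 * c2)) \<ge> 0" by (rule mult_nonneg_nonneg[OF KG]) (use c in auto)
  have A: "A \<ge> 0" "K * G \<le> A" using KG Kc by (auto simp only: A_eq)
  show ?thesis
  proof (rule that[OF A(1)])
    fix \<rho> :: real and V :: "'a \<Rightarrow> complex" assume \<rho>: "\<rho> > 0" and V: "integrable lborel V" "\<And>\<xi>. norm \<xi> > \<rho> \<Longrightarrow> V \<xi> = 0"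
    obtain M where M: "M \<in> borel_measurable borel" "\<And>x. ennreal ((cmod (ift V x))\<^sup>2) \<le> M x"
      "(\<integral>\<^sup>+x. M x \<partial>\<mu>) \<le> ennreal (K * G * \<rho>) * (\<integral>\<^sup>+\<xi>. ennreal ((cmod (V \<xi>))\<^sup>2) \<partial>lborel)"
      using block[OF \<rho> V] by metis
    have "(\<integral>\<^sup>+P. ennreal ((cmod (ift V P))\<^sup>2) \<partial>\<mu>) \<le> (\<integral>\<^sup>+x. M x \<partial>\<mu>)" by (intro nn_integral_mono M(2))
    also note M(3)
    also have "ennreal (K * G * \<rho>) * (\<integral>\<^sup>+\<xi>. ennreal ((cmod (V \<xi>))\<^sup>2) \<partial>lborel) \<le> ennreal (A * \<rho>) * (\<integral>\<^sup>+\<xi>. ennreal ((cmod (V \<xi>))\<^sup>2) \<partial>lborel)"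
      using A \<rho> by (intro mult_right_mono ennreal_leI) auto
    finally show "(\<integral>\<^sup>+P. ennreal ((cmod (ift V P))\<^sup>2) \<partial>\<mu>) \<le> ennreal (A * \<rho>) * (\<integral>\<^sup>+\<xi>. ennreal ((cmod (V \<xi>))\<^sup>2) \<partial>lborel)" .
  next
    fix \<rho> :: real and V :: "'a \<Rightarrow> complex" assume \<rho>: "\<rho> > 0" and V: "integrable lborel V" "\<And>\<xi>. norm \<xi> > \<rho> \<Longrightarrow> V \<xi> = 0"
    obtain M where M [measurable]: "M \<in> borel_measurable borel" and M1: "\<And>x. ennreal ((cmod (ift V x))\<^sup>2) \<le> M x"
      and M2: "\<And>x y. \<rho> * norm (x - y) \<le> 1 \<Longrightarrow> ennreal ((cmod (ift V x - ift V y))\<^sup>2) \<le> ennreal ((\<rho> * norm (x - y))\<^sup>2) * M x"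
      and M3: "(\<integral>\<^sup>+x. M x \<partial>\<mu>) \<le> ennreal (K * G * \<rho>) * (\<integral>\<^sup>+\<xi>. ennreal ((cmod (V \<xi>))\<^sup>2) \<partial>lborel)"
      using block[OF \<rho> V] by metis
    define N where "N = (\<integral>\<^sup>+\<xi>. ennreal ((cmod (V \<xi>))\<^sup>2) \<partial>lborel)"
    have pt: "ennreal ((cmod (ift V P - ift V Q))\<^sup>2 / scale_weight \<alpha> \<rho> (norm (P - Q)) / norm (P - Q) powr (d + 2 * \<alpha>))
        \<le> k \<rho> P Q * M P + k \<rho> Q P * M Q" for P Q
    proof (cases "P = Q")
      case False
      define r where "r = norm (Q - P)"
      have r: "r > 0" "r = norm (P - Q)" using False by (auto simp: r_def norm_minus_commute)
      define D where "D = (cmod (ift V P - ift V Q))\<^sup>2"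
      define x where "x = \<rho> * r"
      have x: "x > 0" using \<rho> r by (simp add: x_def)
      show ?thesis
      proof (cases "x \<le> 1")
        case True
        have xx: "x \<le> 1 / x" using x True mult_le_one[of x x] by (simp add: field_simps)
        define w where "w = 1 / x powr \<alpha> / r powr (d + 2 * \<alpha>)"
        have w0: "w \<ge> 0" by (simp add: w_def)
        have "ennreal (D / scale_weight \<alpha> \<rho> r / r powr (d + 2 * \<alpha>)) = ennreal D * ennreal w"
          using xx w0 by (simp add: scale_weight_def x_def[symmetric] min_def w_def D_def flip: ennreal_mult)
        also have "\<dots> \<le> (ennreal (x\<^sup>2) * M P) * ennreal w"
          using M2[of P Q] True unfolding D_def x_def r(2) by (intro mult_right_mono) auto
        also have "\<dots> = ennreal (x\<^sup>2 * w) * M P" using w0 by (simp add: ennreal_mult mult_ac)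
        also have "x\<^sup>2 * w = \<rho> powr (2 - \<alpha>) * r powr (b1 - d)"
        proof -
          have "x\<^sup>2 * w = x powr (2 - \<alpha>) * r powr (- (d + 2 * \<alpha>))"
          proof -
            have "x\<^sup>2 * x powr (- \<alpha>) = x powr (2 - \<alpha>)"
              using x by (simp add: powr_diff powr_minus_divide powr_numeral)
            moreover have "w = x powr (- \<alpha>) * r powr (- (d + 2 * \<alpha>))"
              by (simp only: w_def powr_minus divide_inverse mult_1)
            ultimately show ?thesis by (simp only: mult.assoc[symmetric])
          qed
          also have "\<dots> = \<rho> powr (2 - \<alpha>) * (r powr (2 - \<alpha>) * r powr (- (d + 2 * \<alpha>)))"
            using \<rho> r by (simp add: x_def powr_mult)
          also have "r powr (2 - \<alpha>) * r powr (- (d + 2 * \<alpha>)) = r powr (b1 - d)"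
            unfolding powr_add[symmetric] by (rule arg_cong[where f="\<lambda>t. r powr t"]) (simp add: b1_def)
          finally show ?thesis .
        qed
        also have "ennreal (\<rho> powr (2 - \<alpha>) * r powr (b1 - d)) \<le> k \<rho> P Q"
        proof -
          have "Q \<in> cball P (1/\<rho>)" using True \<rho> by (simp add: x_def r(2) dist_norm field_simps)
          then show ?thesis by (simp add: k_def r_def ennreal_mult)
        qed
        finally have "ennreal (D / scale_weight \<alpha> \<rho> r / r powr (d + 2 * \<alpha>)) \<le> k \<rho> P Q * M P"
          by (simp add: mult_right_mono)
        also have "\<dots> \<le> k \<rho> P Q * M P + k \<rho> Q P * M Q" by simp
        finally show ?thesis unfolding D_def r(2) .
      next
        case False
        have xx: "\<not> x \<le> 1 / x" using x False mult_strict_mono[of 1 x 1 x] by (simp add: field_simps not_le)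
        define w where "w = x powr \<alpha> / r powr (d + 2 * \<alpha>)"
        have w0: "w \<ge> 0" by (simp add: w_def)
        have "ennreal (D / scale_weight \<alpha> \<rho> r / r powr (d + 2 * \<alpha>)) = ennreal D * ennreal w"
          using xx w0 x by (simp add: scale_weight_def x_def[symmetric] min_def w_def D_def powr_divide flip: ennreal_mult)
        \<comment> \<open>At large separation the difference is bounded by the two values
          separately; this is the origin of the term with \<open>M Q\<close>.\<close>
        also have "ennreal D \<le> 2 * (M P + M Q)"
        proof -
          have "cmod (ift V P - ift V Q) \<le> cmod (ift V P) + cmod (ift V Q)" by (rule norm_triangle_ineq4)
          then have "D \<le> (cmod (ift V P) + cmod (ift V Q))\<^sup>2" unfolding D_def by (intro power_mono) auto
          also have "\<dots> \<le> 2 * ((cmod (ift V P))\<^sup>2 + (cmod (ift V Q))\<^sup>2)"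
            using sum_squares_bound[of "cmod (ift V P)" "cmod (ift V Q)"] by (simp add: power2_sum algebra_simps)
          finally have "ennreal D \<le> ennreal (2 * ((cmod (ift V P))\<^sup>2 + (cmod (ift V Q))\<^sup>2))" by (rule ennreal_leI)
          also have "\<dots> = 2 * (ennreal ((cmod (ift V P))\<^sup>2) + ennreal ((cmod (ift V Q))\<^sup>2))"
            by (simp add: ennreal_mult)
          also have "\<dots> \<le> 2 * (M P + M Q)" by (intro mult_left_mono add_mono M1) auto
          finally show ?thesis .
        qed
        also have "2 * (M P + M Q) * ennreal w = ennreal (2 * w) * M P + ennreal (2 * w) * M Q"
          using w0 by (simp add: ennreal_mult algebra_simps)
        also have "2 * w = 2 * \<rho> powr \<alpha> * r powr (- b2 - d)"
        proof -
          have "w = \<rho> powr \<alpha> * (r powr \<alpha> * r powr (- (d + 2 * \<alpha>)))"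
            using \<rho> r(1) by (simp only: w_def x_def powr_mult powr_minus divide_inverse mult.assoc)
          also have "r powr \<alpha> * r powr (- (d + 2 * \<alpha>)) = r powr (- b2 - d)"
            unfolding powr_add[symmetric] by (rule arg_cong[where f="\<lambda>t. r powr t"]) (simp add: b2_def)
          finally show ?thesis by simp
        qed
        also have "ennreal (2 * \<rho> powr \<alpha> * r powr (- b2 - d)) = k \<rho> P Q"
        proof -
          have "Q \<notin> cball P (1/\<rho>)" using False \<rho> by (simp add: x_def r(2) dist_norm field_simps)
          then show ?thesis by (simp add: k_def r_def ennreal_mult)
        qed
        finally show ?thesis unfolding D_def r(2) ksym[of \<rho> Q P] by (simp add: mult_right_mono)
      qed
    qed simp
    have inner: "(\<integral>\<^sup>+P. \<integral>\<^sup>+Q. k \<rho> P Q * M P \<partial>\<mu> \<partial>\<mu>) \<le> ennreal ((c1 + 2 * c2) * \<rho> powr (2 * \<alpha>)) * (ennreal (K * G * \<rho>) * N)"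
    proof -
      have "(\<integral>\<^sup>+P. \<integral>\<^sup>+Q. k \<rho> P Q * M P \<partial>\<mu> \<partial>\<mu>) = (\<integral>\<^sup>+P. (\<integral>\<^sup>+Q. k \<rho> P Q \<partial>\<mu>) * M P \<partial>\<mu>)"
        by (intro nn_integral_cong nn_integral_multc) measurable
      also have "\<dots> \<le> (\<integral>\<^sup>+P. ennreal ((c1 + 2 * c2) * \<rho> powr (2 * \<alpha>)) * M P \<partial>\<mu>)"
        by (intro nn_integral_mono mult_right_mono kint[OF \<rho>]) auto
      also have "\<dots> = ennreal ((c1 + 2 * c2) * \<rho> powr (2 * \<alpha>)) * (\<integral>\<^sup>+P. M P \<partial>\<mu>)"
        by (rule nn_integral_cmult) measurable
      also have "\<dots> \<le> ennreal ((c1 + 2 * c2) * \<rho> powr (2 * \<alpha>)) * (ennreal (K * G * \<rho>) * N)"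
        using M3 unfolding N_def by (intro mult_left_mono) auto
      finally show ?thesis .
    qed
    have "(\<integral>\<^sup>+P. \<integral>\<^sup>+Q. ennreal ((cmod (ift V P - ift V Q))\<^sup>2 / scale_weight \<alpha> \<rho> (norm (P - Q)) / norm (P - Q) powr (d + 2 * \<alpha>)) \<partial>\<mu> \<partial>\<mu>)
       \<le> (\<integral>\<^sup>+P. \<integral>\<^sup>+Q. k \<rho> P Q * M P + k \<rho> Q P * M Q \<partial>\<mu> \<partial>\<mu>)"
      by (intro nn_integral_mono pt)
    also have "\<dots> = (\<integral>\<^sup>+P. \<integral>\<^sup>+Q. k \<rho> P Q * M P \<partial>\<mu> \<partial>\<mu>) + (\<integral>\<^sup>+P. \<integral>\<^sup>+Q. k \<rho> Q P * M Q \<partial>\<mu> \<partial>\<mu>)"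
    proof -
      have "(\<integral>\<^sup>+Q. k \<rho> P Q * M P + k \<rho> Q P * M Q \<partial>\<mu>) = (\<integral>\<^sup>+Q. k \<rho> P Q * M P \<partial>\<mu>) + (\<integral>\<^sup>+Q. k \<rho> Q P * M Q \<partial>\<mu>)" for P
        by (rule nn_integral_add) measurable
      then show ?thesis by (simp only:) (rule nn_integral_add, measurable)
    qed
    also have "(\<integral>\<^sup>+P. \<integral>\<^sup>+Q. k \<rho> Q P * M Q \<partial>\<mu> \<partial>\<mu>) = (\<integral>\<^sup>+Q. \<integral>\<^sup>+P. k \<rho> Q P * M Q \<partial>\<mu> \<partial>\<mu>)"
      by (rule P.Fubini') measurable
    also have "(\<integral>\<^sup>+P. \<integral>\<^sup>+Q. k \<rho> P Q * M P \<partial>\<mu> \<partial>\<mu>) + (\<integral>\<^sup>+P. \<integral>\<^sup>+Q. k \<rho> P Q * M P \<partial>\<mu> \<partial>\<mu>)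
      \<le> ennreal ((c1 + 2 * c2) * \<rho> powr (2 * \<alpha>)) * (ennreal (K * G * \<rho>) * N) + ennreal ((c1 + 2 * c2) * \<rho> powr (2 * \<alpha>)) * (ennreal (K * G * \<rho>) * N)"
      by (intro add_mono inner)
    also have "\<dots> = ennreal (2 * ((c1 + 2 * c2) * \<rho> powr (2 * \<alpha>) * (K * G * \<rho>))) * N"
    proof -
      define X Y where "X = (c1 + 2 * c2) * \<rho> powr (2 * \<alpha>)" and "Y = K * G * \<rho>"
      have "X \<ge> 0" "Y \<ge> 0" using c \<rho> mult_nonneg_nonneg[OF KG, of \<rho>] by (auto simp: X_def Y_def)
      then have "ennreal (2 * (X * Y)) = 2 * (ennreal X * ennreal Y)" by (simp add: ennreal_mult)
      then show ?thesis unfolding X_def[symmetric] Y_def[symmetric] by (simp only: mult_2 mult.assoc distrib_right)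
    qed
    also have "2 * ((c1 + 2 * c2) * \<rho> powr (2 * \<alpha>) * (K * G * \<rho>)) = (K * G * (2 * (c1 + 2 * c2))) * \<rho> powr (1 + 2 * \<alpha>)"
      using \<rho> by (simp add: powr_add)
    also have "ennreal \<dots> * N \<le> ennreal (A * \<rho> powr (1 + 2 * \<alpha>)) * N"
      using KG unfolding A_eq by (intro mult_right_mono ennreal_leI) auto
    finally show "(\<integral>\<^sup>+P. \<integral>\<^sup>+Q. ennreal ((cmod (ift V P - ift V Q))\<^sup>2 / scale_weight \<alpha> \<rho> (norm (P - Q)) / norm (P - Q) powr (d + 2 * \<alpha>)) \<partial>\<mu> \<partial>\<mu>)
         \<le> ennreal (A * \<rho> powr (1 + 2 * \<alpha>)) * (\<integral>\<^sup>+\<xi>. ennreal ((cmod (V \<xi>))\<^sup>2) \<partial>lborel)" unfolding N_def .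
  qed
qed

text \<open>Restricting the frequencies to \<open>norm \<xi> \<ge> 1\<close> leaves finitely many dyadic blocks and costs nothing,
  because low frequencies are handled by the supremum norm.\<close>

lemma trace_inequality:
  assumes \<alpha>: "0 < \<alpha>" "\<alpha> < 1/2" and d: "d = real DIM('a) - 1"
  obtains A where "A \<ge> 0"
    "\<And>J W. integrable lborel W \<Longrightarrow> (\<And>\<xi>. W \<xi> \<noteq> 0 \<Longrightarrow> 1 \<le> norm \<xi> \<and> norm \<xi> < 2 ^ J) \<Longrightarrow>
       (\<integral>\<^sup>+P. ennreal ((cmod (ift W P))\<^sup>2) \<partial>\<mu>) +
       (\<integral>\<^sup>+P. \<integral>\<^sup>+Q. ennreal ((cmod (ift W P - ift W Q))\<^sup>2 / norm (P - Q) powr (d + 2 * \<alpha>)) \<partial>\<mu> \<partial>\<mu>)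
       \<le> ennreal A * (\<integral>\<^sup>+\<xi>. ennreal (norm \<xi> powr (1 + 2 * \<alpha>) * (cmod (W \<xi>))\<^sup>2) \<partial>lborel)"
proof -
  obtain A where A: "A \<ge> 0"
    and L2: "\<And>\<rho> V. \<rho> > 0 \<Longrightarrow> integrable lborel V \<Longrightarrow> (\<And>\<xi>. norm \<xi> > \<rho> \<Longrightarrow> V \<xi> = 0) \<Longrightarrow>
       (\<integral>\<^sup>+P. ennreal ((cmod (ift V P))\<^sup>2) \<partial>\<mu>) \<le> ennreal (A * \<rho>) * (\<integral>\<^sup>+\<xi>. ennreal ((cmod (V \<xi>))\<^sup>2) \<partial>lborel)"
    and semi: "\<And>\<rho> V. \<rho> > 0 \<Longrightarrow> integrable lborel V \<Longrightarrow> (\<And>\<xi>. norm \<xi> > \<rho> \<Longrightarrow> V \<xi> = 0) \<Longrightarrow>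
       (\<integral>\<^sup>+P. \<integral>\<^sup>+Q. ennreal ((cmod (ift V P - ift V Q))\<^sup>2 / scale_weight \<alpha> \<rho> (norm (P - Q)) / norm (P - Q) powr (d + 2 * \<alpha>)) \<partial>\<mu> \<partial>\<mu>)
         \<le> ennreal (A * \<rho> powr (1 + 2 * \<alpha>)) * (\<integral>\<^sup>+\<xi>. ennreal ((cmod (V \<xi>))\<^sup>2) \<partial>lborel)"
    by (rule block_trace[OF \<alpha> d]) blast
  define S where "S = 2 / (1 - 2 powr (- \<alpha>))"
  have S: "S \<ge> 0" using \<alpha> by (simp add: S_def powr_less_one less_imp_le)
  define B where "B = 2 * (S * A * 2 powr (1 + 2 * \<alpha>))"
  have B: "B \<ge> 0" using S A by (simp add: B_def)
  show ?thesis
  proof (rule that[OF B])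
    fix J and W :: "'a \<Rightarrow> complex"
    assume W: "integrable lborel W" and supp: "\<And>\<xi>. W \<xi> \<noteq> 0 \<Longrightarrow> 1 \<le> norm \<xi> \<and> norm \<xi> < 2 ^ J"
    have [measurable]: "W \<in> borel_measurable borel" using W by auto
    define \<rho> where "\<rho> j = (2::real) ^ Suc j" for j
    have \<rho>: "\<rho> j > 0" "\<rho> j \<ge> 1" for j by (auto simp: \<rho>_def simp del: power_Suc intro: one_le_power)
    \<comment> \<open>The part of \<open>W\<close> in one dyadic shell; \<open>\<rho> j\<close> is
      the outer radius of the shell.\<close>
    define V where "V j \<xi> = W \<xi> * (if 2 ^ j \<le> norm \<xi> \<and> norm \<xi> < 2 ^ Suc j then 1 else 0)" for j \<xi>
    have [measurable]: "V j \<in> borel_measurable borel" for j unfolding V_def by measurable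
    have Vi: "integrable lborel (V j)" for j
      unfolding V_def by (rule integrable_mult_bounded[OF W, where B=1]) auto
    have Vs: "V j \<xi> = 0" if "norm \<xi> > \<rho> j" for j \<xi> using that by (auto simp: V_def \<rho>_def)
    have dec: "W \<xi> = (\<Sum>j<J. V j \<xi>)" for \<xi>
    proof (cases "W \<xi> = 0")
      case False
      then have n: "1 \<le> norm \<xi>" "norm \<xi> < 2 ^ J" using supp by auto
      have "\<exists>!j. 2 ^ j \<le> norm \<xi> \<and> norm \<xi> < 2 ^ Suc j"
      proof (rule ex_ex1I)
        define k where "k = (LEAST k. norm \<xi> < 2 ^ Suc k)"
        have "norm \<xi> < 2 ^ Suc J" using n(2) by (rule less_trans) simp
        then have 1: "norm \<xi> < 2 ^ Suc k" unfolding k_def by (rule LeastI)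
        moreover have "2 ^ k \<le> norm \<xi>"
        proof (cases k)
          case 0 then show ?thesis using n by simp
        next
          case (Suc i)
          then have "\<not> norm \<xi> < 2 ^ Suc i" using not_less_Least[of i "\<lambda>k. norm \<xi> < 2 ^ Suc k"] by (auto simp: k_def)
          then show ?thesis using Suc by simp
        qed
        ultimately show "\<exists>j. 2 ^ j \<le> norm \<xi> \<and> norm \<xi> < 2 ^ Suc j" by blast
      next
        fix i j assume a: "2 ^ i \<le> norm \<xi> \<and> norm \<xi> < 2 ^ Suc i" "2 ^ j \<le> norm \<xi> \<and> norm \<xi> < 2 ^ Suc j"
        then have "(2::real) ^ i < 2 ^ Suc j" "(2::real) ^ j < 2 ^ Suc i" by linarith+
        then have "i < Suc j" "j < Suc i" by (simp_all only: power_strict_increasing_iff one_less_numeral_iff semiring_norm)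
        then show "i = j" by simp
      qed
      then obtain j where j: "2 ^ j \<le> norm \<xi> \<and> norm \<xi> < 2 ^ Suc j" "\<And>i. 2 ^ i \<le> norm \<xi> \<and> norm \<xi> < 2 ^ Suc i \<Longrightarrow> i = j"
        by blast
      have "(2::real) ^ j < 2 ^ J" using j(1) n(2) by linarith
      then have "j < J" by simp
      have "(\<Sum>i<J. V i \<xi>) = (\<Sum>i<J. if i = j then W \<xi> else 0)"
      proof (intro sum.cong refl)
        fix i
        show "V i \<xi> = (if i = j then W \<xi> else 0)"
        proof (cases "i = j")
          case True
          then show ?thesis using j(1) by (simp only: V_def if_True simp_thms mult_1_right)
        next
          case False
          then have "\<not> (2 ^ i \<le> norm \<xi> \<and> norm \<xi> < 2 ^ Suc i)" using j(2)[of i] by blast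
          then show ?thesis using False by (simp only: V_def if_False mult_zero_right)
        qed
      qed
      then show ?thesis using \<open>j < J\<close> by simp
    qed (simp add: V_def)
    have iW: "ift W P = (\<Sum>j<J. ift (V j) P)" for P
    proof -
      have "ift W P = (LINT \<xi>|lborel. (\<Sum>j<J. V j \<xi> * cis (2 * pi * (P \<bullet> \<xi>))))"
        unfolding ift_def dec sum_distrib_right ..
      also have "\<dots> = (\<Sum>j<J. ift (V j) P)"
        unfolding ift_def by (intro Bochner_Integration.integral_sum integrable_mult_cis Vi) measurable
      finally show ?thesis .
    qed
    define N where "N j = (\<integral>\<^sup>+\<xi>. ennreal ((cmod (V j \<xi>))\<^sup>2) \<partial>lborel)" for j
    define E where "E = (\<integral>\<^sup>+\<xi>. ennreal (norm \<xi> powr (1 + 2 * \<alpha>) * (cmod (W \<xi>))\<^sup>2) \<partial>lborel)"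
    \<comment> \<open>On shell \<open>j\<close> one has
      \<open>\<rho> j \<le> 2 * norm \<xi>\<close>, which costs the factor
      \<open>2 powr (1 + 2 * \<alpha>)\<close>; the disjoint shells then reassemble
      \<open>W\<close>.\<close>
    have NE: "(\<Sum>j<J. ennreal (\<rho> j powr (1 + 2 * \<alpha>)) * N j) \<le> ennreal (2 powr (1 + 2 * \<alpha>)) * E"
    proof -
      have "(\<Sum>j<J. ennreal (\<rho> j powr (1 + 2 * \<alpha>)) * N j) = (\<integral>\<^sup>+\<xi>. (\<Sum>j<J. ennreal (\<rho> j powr (1 + 2 * \<alpha>)) * ennreal ((cmod (V j \<xi>))\<^sup>2)) \<partial>lborel)"
        unfolding N_def by (subst nn_integral_sum, measurable) (intro sum.cong refl nn_integral_cmult[symmetric], measurable)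
      also have "\<dots> \<le> (\<integral>\<^sup>+\<xi>. ennreal (2 powr (1 + 2 * \<alpha>)) * ennreal (norm \<xi> powr (1 + 2 * \<alpha>) * (cmod (W \<xi>))\<^sup>2) \<partial>lborel)"
      proof (rule nn_integral_mono)
        fix \<xi>
        \<comment> \<open>One factor \<open>cmod (W \<xi>)\<close> goes into \<open>c\<close>, so
          that the first powers \<open>cmod (V j \<xi>)\<close> are to be summed, and these add up
          to \<open>cmod (W \<xi>)\<close>.\<close>
        define c where "c = 2 powr (1 + 2 * \<alpha>) * norm \<xi> powr (1 + 2 * \<alpha>) * cmod (W \<xi>)"
        have "(\<Sum>j<J. \<rho> j powr (1 + 2 * \<alpha>) * (cmod (V j \<xi>))\<^sup>2) \<le> (\<Sum>j<J. c * cmod (V j \<xi>))"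
        proof (rule sum_mono)
          fix j
          show "\<rho> j powr (1 + 2 * \<alpha>) * (cmod (V j \<xi>))\<^sup>2 \<le> c * cmod (V j \<xi>)"
          proof (cases "2 ^ j \<le> norm \<xi> \<and> norm \<xi> < 2 ^ Suc j")
            case True
            then have "\<rho> j powr (1 + 2 * \<alpha>) \<le> (2 * norm \<xi>) powr (1 + 2 * \<alpha>)"
              using \<alpha> \<rho>[of j] by (intro powr_mono2) (auto simp: \<rho>_def)
            also have "\<dots> = 2 powr (1 + 2 * \<alpha>) * norm \<xi> powr (1 + 2 * \<alpha>)" by (simp add: powr_mult)
            finally have "\<rho> j powr (1 + 2 * \<alpha>) * (cmod (W \<xi>) * cmod (W \<xi>)) \<le> 2 powr (1 + 2 * \<alpha>) * norm \<xi> powr (1 + 2 * \<alpha>) * (cmod (W \<xi>) * cmod (W \<xi>))"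
              by (rule mult_right_mono) simp
            then show ?thesis using True by (simp add: V_def c_def power2_eq_square mult.assoc)
          qed (auto simp: V_def)
        qed
        also have "\<dots> = c * (\<Sum>j<J. cmod (V j \<xi>))" by (simp add: sum_distrib_left)
        also have "(\<Sum>j<J. cmod (V j \<xi>)) = cmod (W \<xi>)"
        proof -
          have "V j \<xi> = W \<xi> * complex_of_real (if 2 ^ j \<le> norm \<xi> \<and> norm \<xi> < 2 ^ Suc j then 1 else 0)" for j by (simp add: V_def)
          then have v: "cmod (V j \<xi>) = cmod (W \<xi>) * (if 2 ^ j \<le> norm \<xi> \<and> norm \<xi> < 2 ^ Suc j then 1 else 0)" for j
            by (simp add: norm_mult)
          \<comment> \<open>\<open>z\<close> counts the shells containing \<open>\<xi>\<close>; the
            decomposition of \<open>W\<close> forces it to be 1 unless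
            \<open>W \<xi> = 0\<close>.\<close>
          define z where "z = (\<Sum>j<J. (if 2 ^ j \<le> norm \<xi> \<and> norm \<xi> < 2 ^ Suc j then 1 else 0) :: real)"
          have "W \<xi> = W \<xi> * complex_of_real z"
            using dec[of \<xi>] by (simp add: V_def z_def sum_distrib_left of_real_sum if_distrib[of complex_of_real] cong: if_cong)
          then have "W \<xi> = 0 \<or> z = 1" by (metis mult_cancel_left1 of_real_eq_1_iff)
          then show ?thesis unfolding v sum_distrib_left[symmetric] z_def[symmetric] by auto
        qed
        finally show "(\<Sum>j<J. ennreal (\<rho> j powr (1 + 2 * \<alpha>)) * ennreal ((cmod (V j \<xi>))\<^sup>2)) \<le>
            ennreal (2 powr (1 + 2 * \<alpha>)) * ennreal (norm \<xi> powr (1 + 2 * \<alpha>) * (cmod (W \<xi>))\<^sup>2)"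
          by (simp add: c_def power2_eq_square mult.assoc ennreal_leI flip: ennreal_mult)
      qed
      also have "\<dots> = ennreal (2 powr (1 + 2 * \<alpha>)) * E" unfolding E_def by (rule nn_integral_cmult) measurable
      finally show ?thesis .
    qed
    have part1: "(\<integral>\<^sup>+P. ennreal ((cmod (ift W P))\<^sup>2) \<partial>\<mu>) \<le> ennreal (S * A) * (\<Sum>j<J. ennreal (\<rho> j powr (1 + 2 * \<alpha>)) * N j)"
    proof -
      have "(\<integral>\<^sup>+P. ennreal ((cmod (ift W P))\<^sup>2) \<partial>\<mu>) \<le> (\<integral>\<^sup>+P. (\<Sum>j<J. ennreal (S * \<rho> j powr \<alpha>) * ennreal ((cmod (ift (V j) P))\<^sup>2)) \<partial>\<mu>)"
      proof (rule nn_integral_mono)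
        fix P
        have "(cmod (ift W P))\<^sup>2 \<le> (\<Sum>j<J. cmod (ift (V j) P))\<^sup>2"
          unfolding iW by (intro power_mono norm_sum) auto
        also have "\<dots> \<le> (\<Sum>j<J. \<rho> j powr (- \<alpha>)) * (\<Sum>j<J. (cmod (ift (V j) P))\<^sup>2 / \<rho> j powr (- \<alpha>))"
          by (rule weighted_sum_Cauchy_Schwarz) (use \<rho> in \<open>auto simp: less_imp_neq[symmetric]\<close>)
        also have "\<dots> \<le> S * (\<Sum>j<J. (cmod (ift (V j) P))\<^sup>2 / \<rho> j powr (- \<alpha>))"
        proof (rule mult_right_mono)
          \<comment> \<open>The weights \<open>\<rho> j powr (- \<alpha>)\<close> are two-sided
            dyadic weights at \<open>x = 2\<close>, so the sum bound \<open>S\<close> applies to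
            them.\<close>
          have "(\<Sum>j<J. \<rho> j powr (- \<alpha>)) = (\<Sum>j<J. min (2 * 2 ^ j) (1 / (2 * 2 ^ j)) powr \<alpha>)"
          proof (intro sum.cong refl)
            fix j
            have "1 / \<rho> j \<le> 1" using \<rho>[of j] by simp
            then have "min (\<rho> j) (1 / \<rho> j) = 1 / \<rho> j" using \<rho>(2)[of j] by linarith
            then have "min (2 * 2 ^ j) (1 / (2 * 2 ^ j)) = 1 / \<rho> j" by (simp add: \<rho>_def)
            then show "\<rho> j powr (- \<alpha>) = min (2 * 2 ^ j) (1 / (2 * 2 ^ j)) powr \<alpha>"
              using \<rho>[of j] by (simp add: powr_divide powr_minus_divide)
          qed
          then show "(\<Sum>j<J. \<rho> j powr (- \<alpha>)) \<le> S"
            unfolding S_def using two_sided_dyadic_sum_le[of 2 \<alpha> J] \<alpha> by simp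
        qed (auto intro!: sum_nonneg)
        also have "\<dots> = (\<Sum>j<J. S * \<rho> j powr \<alpha> * (cmod (ift (V j) P))\<^sup>2)"
          unfolding sum_distrib_left by (intro sum.cong refl) (simp add: powr_minus divide_inverse mult_ac)
        finally show "ennreal ((cmod (ift W P))\<^sup>2) \<le> (\<Sum>j<J. ennreal (S * \<rho> j powr \<alpha>) * ennreal ((cmod (ift (V j) P))\<^sup>2))"
          using S by (simp add: ennreal_leI flip: ennreal_mult)
      qed
      also have "\<dots> = (\<Sum>j<J. ennreal (S * \<rho> j powr \<alpha>) * (\<integral>\<^sup>+P. ennreal ((cmod (ift (V j) P))\<^sup>2) \<partial>\<mu>))"
        by (subst nn_integral_sum, measurable) (intro sum.cong refl nn_integral_cmult, measurable)
      also have "\<dots> \<le> (\<Sum>j<J. ennreal (S * \<rho> j powr \<alpha>) * (ennreal (A * \<rho> j) * N j))"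
        unfolding N_def by (intro sum_mono mult_left_mono L2 \<rho> Vi Vs) auto
      also have "\<dots> \<le> (\<Sum>j<J. ennreal (S * A) * (ennreal (\<rho> j powr (1 + 2 * \<alpha>)) * N j))"
      proof (rule sum_mono)
        fix j
        \<comment> \<open>Here \<open>\<rho> j \<ge> 1\<close> enters: the square norm costs the
          power \<open>1 + \<alpha>\<close>, less than the available
          \<open>1 + 2 * \<alpha>\<close>.\<close>
        have "\<rho> j powr \<alpha> * \<rho> j \<le> \<rho> j powr (1 + 2 * \<alpha>)"
        proof -
          have "\<rho> j powr \<alpha> * \<rho> j = \<rho> j powr (1 + \<alpha>)" using \<rho>[of j] by (simp add: powr_add)
          also have "\<dots> \<le> \<rho> j powr (1 + 2 * \<alpha>)" using \<rho>[of j] \<alpha> by (intro powr_mono) auto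
          finally show ?thesis .
        qed
        then have "S * A * (\<rho> j powr \<alpha> * \<rho> j) \<le> S * A * \<rho> j powr (1 + 2 * \<alpha>)" using S A by (intro mult_left_mono) auto
        then have "ennreal ((S * \<rho> j powr \<alpha>) * (A * \<rho> j)) * N j \<le> ennreal (S * A * \<rho> j powr (1 + 2 * \<alpha>)) * N j"
          by (intro mult_right_mono ennreal_leI) (simp_all add: mult_ac)
        then show "ennreal (S * \<rho> j powr \<alpha>) * (ennreal (A * \<rho> j) * N j) \<le> ennreal (S * A) * (ennreal (\<rho> j powr (1 + 2 * \<alpha>)) * N j)"
          using S A \<rho>[of j] by (simp only: mult.assoc[symmetric] ennreal_mult[symmetric] mult_nonneg_nonneg powr_ge_zero less_imp_le)
      qed
      finally show ?thesis by (simp only: sum_distrib_left)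
    qed
    have part2: "(\<integral>\<^sup>+P. \<integral>\<^sup>+Q. ennreal ((cmod (ift W P - ift W Q))\<^sup>2 / norm (P - Q) powr (d + 2 * \<alpha>)) \<partial>\<mu> \<partial>\<mu>)
       \<le> ennreal (S * A) * (\<Sum>j<J. ennreal (\<rho> j powr (1 + 2 * \<alpha>)) * N j)"
    proof -
      define D where "D j P Q = (cmod (ift (V j) P - ift (V j) Q))\<^sup>2 / scale_weight \<alpha> (\<rho> j) (norm (P - Q)) / norm (P - Q) powr (d + 2 * \<alpha>)" for j and P Q :: 'a
      have D0: "D j P Q \<ge> 0" for j P Q by (simp add: D_def scale_weight_def)
      have [measurable]: "(\<lambda>(P, Q). D j P Q) \<in> borel_measurable (borel \<Otimes>\<^sub>M borel)" "D j P \<in> borel_measurable borel" for j P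
        unfolding D_def scale_weight_def by measurable
      have "(\<integral>\<^sup>+P. \<integral>\<^sup>+Q. ennreal ((cmod (ift W P - ift W Q))\<^sup>2 / norm (P - Q) powr (d + 2 * \<alpha>)) \<partial>\<mu> \<partial>\<mu>)
        \<le> (\<integral>\<^sup>+P. \<integral>\<^sup>+Q. (\<Sum>j<J. ennreal S * ennreal (D j P Q)) \<partial>\<mu> \<partial>\<mu>)"
      proof (intro nn_integral_mono)
        fix P Q :: 'a
        define r where "r = norm (P - Q)"
        have "(cmod (ift W P - ift W Q))\<^sup>2 / r powr (d + 2 * \<alpha>) \<le> (\<Sum>j<J. S * D j P Q)"
        proof (cases "P = Q")
          case False
          then have r: "r > 0" by (simp add: r_def)
          have "(cmod (ift W P - ift W Q))\<^sup>2 \<le> (\<Sum>j<J. cmod (ift (V j) P - ift (V j) Q))\<^sup>2"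
            unfolding iW sum_subtractf[symmetric] by (intro power_mono norm_sum) auto
          \<comment> \<open>The weights are taken at the distance of the two given points; their sum
            is at most \<open>S\<close> for every distance, which keeps the constant independent of
            \<open>J\<close>.\<close>
          also have "\<dots> \<le> (\<Sum>j<J. scale_weight \<alpha> (\<rho> j) r) * (\<Sum>j<J. (cmod (ift (V j) P - ift (V j) Q))\<^sup>2 / scale_weight \<alpha> (\<rho> j) r)"
          proof (rule weighted_sum_Cauchy_Schwarz)
            fix j
            have "\<rho> j * r > 0" using \<rho>[of j] r by simp
            then have "min (\<rho> j * r) (1 / (\<rho> j * r)) > 0" by (subst min_less_iff_conj) simp
            then show "0 < scale_weight \<alpha> (\<rho> j) r" unfolding scale_weight_def powr_gt_zero by linarith
          qed
          also have "\<dots> \<le> S * (\<Sum>j<J. (cmod (ift (V j) P - ift (V j) Q))\<^sup>2 / scale_weight \<alpha> (\<rho> j) r)"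
          proof (rule mult_right_mono)
            have "(\<Sum>j<J. scale_weight \<alpha> (\<rho> j) r) = (\<Sum>j<J. min (2 * r * 2 ^ j) (1 / (2 * r * 2 ^ j)) powr \<alpha>)"
              by (simp add: scale_weight_def \<rho>_def mult_ac)
            then show "(\<Sum>j<J. scale_weight \<alpha> (\<rho> j) r) \<le> S"
              unfolding S_def using two_sided_dyadic_sum_le[of "2 * r" \<alpha> J] \<alpha> r by simp
          qed (auto intro!: sum_nonneg simp: scale_weight_def)
          finally have "(cmod (ift W P - ift W Q))\<^sup>2 / r powr (d + 2 * \<alpha>) \<le>
              S * (\<Sum>j<J. (cmod (ift (V j) P - ift (V j) Q))\<^sup>2 / scale_weight \<alpha> (\<rho> j) r) / r powr (d + 2 * \<alpha>)"
            by (rule divide_right_mono) simp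
          then show ?thesis by (simp add: D_def r_def sum_distrib_left sum_divide_distrib)
        qed (use S D0 in \<open>auto intro!: sum_nonneg\<close>)
        then show "ennreal ((cmod (ift W P - ift W Q))\<^sup>2 / norm (P - Q) powr (d + 2 * \<alpha>)) \<le> (\<Sum>j<J. ennreal S * ennreal (D j P Q))"
          using S D0 by (simp add: r_def ennreal_leI flip: ennreal_mult)
      qed
      also have "\<dots> = (\<integral>\<^sup>+P. (\<Sum>j<J. ennreal S * (\<integral>\<^sup>+Q. ennreal (D j P Q) \<partial>\<mu>)) \<partial>\<mu>)"
        by (intro nn_integral_cong, subst nn_integral_sum, measurable) (intro sum.cong refl nn_integral_cmult, measurable)
      also have "\<dots> = (\<Sum>j<J. ennreal S * (\<integral>\<^sup>+P. \<integral>\<^sup>+Q. ennreal (D j P Q) \<partial>\<mu> \<partial>\<mu>))"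
        by (subst nn_integral_sum, measurable) (intro sum.cong refl nn_integral_cmult, measurable)
      also have "\<dots> \<le> (\<Sum>j<J. ennreal S * (ennreal (A * \<rho> j powr (1 + 2 * \<alpha>)) * N j))"
        unfolding N_def D_def by (intro sum_mono mult_left_mono semi \<rho> Vi Vs) auto
      also have "\<dots> = ennreal (S * A) * (\<Sum>j<J. ennreal (\<rho> j powr (1 + 2 * \<alpha>)) * N j)"
        using S A by (simp add: sum_distrib_left ennreal_mult mult.assoc)
      finally show ?thesis .
    qed
    have "(\<integral>\<^sup>+P. ennreal ((cmod (ift W P))\<^sup>2) \<partial>\<mu>) + (\<integral>\<^sup>+P. \<integral>\<^sup>+Q. ennreal ((cmod (ift W P - ift W Q))\<^sup>2 / norm (P - Q) powr (d + 2 * \<alpha>)) \<partial>\<mu> \<partial>\<mu>)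
      \<le> ennreal (S * A) * (ennreal (2 powr (1 + 2 * \<alpha>)) * E) + ennreal (S * A) * (ennreal (2 powr (1 + 2 * \<alpha>)) * E)"
      by (intro add_mono order_trans[OF part1] order_trans[OF part2] mult_left_mono NE) auto
    also have "\<dots> = ennreal B * E"
    proof -
      have "ennreal B = 2 * (ennreal (S * A) * ennreal (2 powr (1 + 2 * \<alpha>)))"
        unfolding B_def using S A by (simp add: ennreal_mult)
      then show ?thesis by (simp only: mult_2 mult.assoc distrib_right)
    qed
    finally show "(\<integral>\<^sup>+P. ennreal ((cmod (ift W P))\<^sup>2) \<partial>\<mu>) + (\<integral>\<^sup>+P. \<integral>\<^sup>+Q. ennreal ((cmod (ift W P - ift W Q))\<^sup>2 / norm (P - Q) powr (d + 2 * \<alpha>)) \<partial>\<mu> \<partial>\<mu>)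
       \<le> ennreal B * (\<integral>\<^sup>+\<xi>. ennreal (norm \<xi> powr (1 + 2 * \<alpha>) * (cmod (W \<xi>))\<^sup>2) \<partial>lborel)" unfolding E_def .
  qed
qed

end

section \<open>Regularised Riesz kernels\<close>

text \<open>On the line \<open>near_integral\<close> with \<open>\<beta> = q\<close> handles the
  singularity at 0; at infinity the Gaussian is traded for \<open>t powr (- 2)\<close>.\<close>

lemma integrable_powr_exp_neg_sq:
  fixes q c :: real assumes "q > 0" "c > 0"
  shows "integrable lborel (\<lambda>t. indicator {0<..} t * (t powr (q - 1) * exp (- (c * t\<^sup>2))))"
proof -
  interpret upper_regular "lborel :: real measure" 1 "unit_ball_vol 1"
    using upper_regular_lborel[where 'a=real] by simp
  define a where "a = sqrt c"
  have a: "a > 0" "a\<^sup>2 = c" using assms by (auto simp: a_def)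
  obtain K where K: "K > 0" "\<And>b. b \<ge> 1 \<Longrightarrow> b powr (q + 1) * exp (- b\<^sup>2) \<le> K"
    using powr_mult_exp_neg_sq_bounded[of "q + 1"] by blast
  define K' where "K' = K * a powr (- (q + 1))"
  have K': "K' \<ge> 0" using K(1) by (simp add: K'_def)
  have "(\<integral>\<^sup>+t. ennreal (norm (indicator {0<..} t * (t powr (q - 1) * exp (- (c * t\<^sup>2))))) \<partial>lborel)
    \<le> (\<integral>\<^sup>+(t::real). indicator (cball 0 (1/a)) t * ennreal (norm (t - 0) powr (q - 1))
       + ennreal K' * (indicator (- cball 0 (1/a)) t * ennreal (norm (t - 0) powr (- 1 - 1))) \<partial>lborel)"
  proof (rule nn_integral_mono)
    fix t :: real
    show "ennreal (norm (indicator {0<..} t * (t powr (q - 1) * exp (- (c * t\<^sup>2))))) \<le>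
       indicator (cball 0 (1/a)) t * ennreal (norm (t - 0) powr (q - 1))
       + ennreal K' * (indicator (- cball 0 (1/a)) t * ennreal (norm (t - 0) powr (- 1 - 1)))"
    proof (cases "t > 0")
      case True
      show ?thesis
      proof (cases "t \<le> 1/a")
        case le: True
        have "t powr (q - 1) * exp (- (c * t\<^sup>2)) \<le> t powr (q - 1) * 1"
          using assms by (intro mult_left_mono) auto
        then show ?thesis using True le by (simp add: dist_real_def ennreal_leI)
      next
        case False
        define b where "b = a * t"
        have b: "b \<ge> 1" using False a by (simp add: b_def field_simps)
        have "t powr (q - 1) * exp (- (c * t\<^sup>2)) = a powr (- (q + 1)) * t powr (- 2) * (b powr (q + 1) * exp (- b\<^sup>2))"
        proof -
          have "b powr (q + 1) = a powr (q + 1) * t powr (q + 1)" using a True by (simp add: b_def powr_mult)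
          then have "a powr (- (q + 1)) * t powr (- 2) * (b powr (q + 1) * exp (- b\<^sup>2)) =
              (a powr (- (q + 1)) * a powr (q + 1)) * (t powr (- 2) * t powr (q + 1)) * exp (- b\<^sup>2)"
            by (simp only: mult_ac)
          also have "a powr (- (q + 1)) * a powr (q + 1) = 1" using a by (simp flip: powr_add)
          also have "t powr (- 2) * t powr (q + 1) = t powr (q - 1)" by (simp flip: powr_add)
          finally have "a powr (- (q + 1)) * t powr (- 2) * (b powr (q + 1) * exp (- b\<^sup>2)) = t powr (q - 1) * exp (- b\<^sup>2)"
            by (simp only: mult_1)
          moreover have "b\<^sup>2 = c * t\<^sup>2" using a by (simp add: b_def power_mult_distrib)
          ultimately show ?thesis by (simp only:)
        qed
        also have "\<dots> \<le> a powr (- (q + 1)) * t powr (- 2) * K" by (intro mult_left_mono K b) auto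
        finally have "t powr (q - 1) * exp (- (c * t\<^sup>2)) \<le> K' * t powr (- 2)" by (simp add: K'_def mult_ac)
        then show ?thesis using True False K' by (simp add: dist_real_def ennreal_leI flip: ennreal_mult)
      qed
    qed simp
  qed
  also have "\<dots> = (\<integral>\<^sup>+(t::real). indicator (cball 0 (1/a)) t * ennreal (norm (t - 0) powr (q - 1)) \<partial>lborel)
     + ennreal K' * (\<integral>\<^sup>+(t::real). indicator (- cball 0 (1/a)) t * ennreal (norm (t - 0) powr (- 1 - 1)) \<partial>lborel)"
    by (subst nn_integral_add, measurable, subst nn_integral_cmult) measurable
  also have "\<dots> < \<infinity>"
    using near_integral[of q "1/a" 0] far_integral[of 1 "1/a" 0] assms a
    by (auto simp: ennreal_mult_less_top ennreal_add_less_top intro: order_le_less_trans)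
  finally show ?thesis by (subst integrable_iff_bounded) simp
qed

text \<open>Near 0 the Gaussian in \<open>1 / t\<close> beats every power; at infinity
  \<open>t powr (- p - 1)\<close> is integrable by itself.\<close>

lemma integrable_powr_exp_neg_inverse_sq:
  fixes p :: real assumes "p > 0"
  shows "integrable lborel (\<lambda>t. indicator {0<..} t * (t powr (- p - 1) * exp (- (pi * (1 / t)\<^sup>2))))"
proof -
  interpret upper_regular "lborel :: real measure" 1 "unit_ball_vol 1"
    using upper_regular_lborel[where 'a=real] by simp
  obtain K where K: "K > 0" "\<And>b. b \<ge> 1 \<Longrightarrow> b powr (p + 1) * exp (- b\<^sup>2) \<le> K"
    using powr_mult_exp_neg_sq_bounded[of "p + 1"] by blast
  have "(\<integral>\<^sup>+t. ennreal (norm (indicator {0<..} t * (t powr (- p - 1) * exp (- (pi * (1 / t)\<^sup>2))))) \<partial>lborel)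
    \<le> (\<integral>\<^sup>+(t::real). ennreal K * indicator (cball 0 1) t
       + (indicator (- cball 0 1) t * ennreal (norm (t - 0) powr (- p - 1))) \<partial>lborel)"
  proof (rule nn_integral_mono)
    fix t :: real
    show "ennreal (norm (indicator {0<..} t * (t powr (- p - 1) * exp (- (pi * (1 / t)\<^sup>2))))) \<le>
       ennreal K * indicator (cball 0 1) t + (indicator (- cball 0 1) t * ennreal (norm (t - 0) powr (- p - 1)))"
    proof (cases "t > 0")
      case True
      show ?thesis
      proof (cases "t \<le> 1")
        case le: True
        have "1 * (1 / t)\<^sup>2 \<le> pi * (1 / t)\<^sup>2" using pi_gt3 by (intro mult_right_mono) auto
        then have "t powr (- p - 1) * exp (- (pi * (1 / t)\<^sup>2)) \<le> (1 / t) powr (p + 1) * exp (- (1 / t)\<^sup>2)"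
          using True by (intro mult_mono) (auto simp: powr_divide powr_minus_divide powr_diff powr_add)
        also have "\<dots> \<le> K" using True le by (intro K) auto
        finally show ?thesis using True le by (simp add: dist_real_def ennreal_leI)
      next
        case False
        have "t powr (- p - 1) * exp (- (pi * (1 / t)\<^sup>2)) \<le> t powr (- p - 1) * 1"
          by (intro mult_left_mono) auto
        then show ?thesis using True False by (simp add: dist_real_def ennreal_leI)
      qed
    qed simp
  qed
  also have "\<dots> = (\<integral>\<^sup>+t. ennreal K * indicator (cball (0::real) 1) t \<partial>lborel)
     + (\<integral>\<^sup>+(t::real). indicator (- cball 0 1) t * ennreal (norm (t - 0) powr (- p - 1)) \<partial>lborel)"
    by (rule nn_integral_add) measurable
  also have "\<dots> < \<infinity>"
    using far_integral[of p 1 0] assms emeasure_cball_le[of 1 0]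
    by (auto simp: nn_integral_cmult_indicator ennreal_mult_less_top ennreal_add_less_top intro: order_le_less_trans)
  finally show ?thesis by (subst integrable_iff_bounded) simp
qed

text \<open>For \<open>q > 0\<close> this is \<open>Gamma (q / 2) / (2 * pi powr (q / 2))\<close>.
  Up to this factor, \<open>r powr (- q)\<close> is the integral of the Gaussians
  \<open>exp (- (pi * t\<^sup>2 * r\<^sup>2))\<close> over all scales.\<close>

definition riesz_scale :: "real \<Rightarrow> real" where
  "riesz_scale q = (LINT t|lborel. indicator {0<..} t * (t powr (q - 1) * exp (- (pi * t\<^sup>2))))"

text \<open>Large \<open>t\<close> are the narrow Gaussians, which produce the singularity at
  \<open>r = 0\<close>; keeping only \<open>t < T\<close> removes it.\<close>

definition riesz_cutoff :: "real \<Rightarrow> real \<Rightarrow> real \<Rightarrow> real" where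
  "riesz_cutoff q T r = (LINT t|lborel. indicator {0<..<T} t * (t powr (q - 1) * exp (- (pi * t\<^sup>2 * r\<^sup>2))))"

lemma integral_pos_Ioi:
  fixes f :: "real \<Rightarrow> real"
  assumes f: "integrable lborel (\<lambda>t. indicator {0<..} t * f t)" and pos: "\<And>t. t > 0 \<Longrightarrow> f t > 0"
  shows "(LINT t|lborel. indicator {0<..} t * f t) > 0"
proof -
  have nn: "AE t in lborel. 0 \<le> indicator {0<..} t * f t"
    using pos by (auto simp: indicator_def less_imp_le)
  have "(LINT t|lborel. indicator {0<..} t * f t) \<noteq> 0"
  proof
    assume "(LINT t|lborel. indicator {0<..} t * f t) = 0"
    then have "AE t in lborel. indicator {0<..} t * f t = 0"
      using integral_nonneg_eq_0_iff_AE[OF f nn] by simp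
    then have "AE t in lborel. t \<notin> {0<..<1::real}"
      by eventually_elim (use pos in \<open>fastforce simp: indicator_def\<close>)
    then have "emeasure lborel {0<..<1::real} = 0"
      by (subst (asm) AE_iff_null_sets[symmetric]) auto
    then show False by simp
  qed
  then show ?thesis using integral_nonneg_AE[OF nn] by linarith
qed

lemma riesz_scale_pos: "q > 0 \<Longrightarrow> riesz_scale q > 0"
  unfolding riesz_scale_def using integrable_powr_exp_neg_sq[of q pi] by (intro integral_pos_Ioi) auto

lemma riesz_scale_radial:
  assumes "q > 0" "r > 0"
  shows "(LINT t|lborel. indicator {0<..} t * (t powr (q - 1) * exp (- (pi * t\<^sup>2 * r\<^sup>2)))) = riesz_scale q * r powr (- q)"
proof -
  have "(LINT t|lborel. indicator {0<..} t * (t powr (q - 1) * exp (- (pi * t\<^sup>2 * r\<^sup>2)))) =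
     \<bar>1/r\<bar> *\<^sub>R (LINT t|lborel. indicator {0<..} (0 + 1/r * t) * ((0 + 1/r * t) powr (q - 1) * exp (- (pi * (0 + 1/r * t)\<^sup>2 * r\<^sup>2))))"
    by (rule lborel_integral_real_affine) (use assms in auto)
  also have "\<dots> = 1/r * (LINT t|lborel. (1/r) powr (q - 1) * (indicator {0<..} t * (t powr (q - 1) * exp (- (pi * t\<^sup>2)))))"
  proof -
    have "indicator {0<..} (0 + 1/r * t) * ((0 + 1/r * t) powr (q - 1) * exp (- (pi * (0 + 1/r * t)\<^sup>2 * r\<^sup>2)))
       = (1/r) powr (q - 1) * (indicator {0<..} t * (t powr (q - 1) * exp (- (pi * t\<^sup>2))))" for t
      using assms by (auto simp: indicator_def powr_divide power_divide zero_less_divide_iff)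
    then show ?thesis using assms by simp
  qed
  also have "\<dots> = 1/r * (1/r) powr (q - 1) * riesz_scale q" by (simp add: riesz_scale_def)
  also have "1/r * (1/r) powr (q - 1) = r powr (- q)"
    using assms by (simp add: powr_divide powr_diff powr_minus_divide)
  finally show ?thesis by (simp add: mult.commute)
qed

text \<open>On a bounded range of \<open>t\<close> the function \<open>exp (- t\<^sup>2)\<close> is
  bounded below, so a multiple of it dominates any of these Gaussians. The case \<open>r = 0\<close>
  is included and is used for integrating the weighted symbol.\<close>

lemma integrable_riesz_cutoff:
  assumes "q > 0"
  shows "integrable lborel (\<lambda>t. indicator {0<..<T} t * (t powr (q - 1) * exp (- (pi * t\<^sup>2 * r\<^sup>2))))"
proof (rule Bochner_Integration.integrable_bound)
  have "integrable lborel (\<lambda>t. indicator {0<..} t * (t powr (q - 1) * exp (- (1 * t\<^sup>2))))"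
    using assms by (intro integrable_powr_exp_neg_sq) auto
  then show "integrable lborel (\<lambda>t. exp (T\<^sup>2) * (indicator {0<..} t * (t powr (q - 1) * exp (- (1 * t\<^sup>2)))))"
    by (rule integrable_mult_right)
  show "AE t in lborel. norm (indicator {0<..<T} t * (t powr (q - 1) * exp (- (pi * t\<^sup>2 * r\<^sup>2))))
     \<le> norm (exp (T\<^sup>2) * (indicator {0<..} t * (t powr (q - 1) * exp (- (1 * t\<^sup>2)))))"
  proof (rule AE_I2)
    fix t
    have "exp (- (pi * t\<^sup>2 * r\<^sup>2)) \<le> exp (T\<^sup>2) * exp (- (1 * t\<^sup>2))" if "0 < t" "t < T"
    proof -
      have "t\<^sup>2 \<le> T\<^sup>2" using that by (intro power_mono) auto
      then have "1 \<le> exp (T\<^sup>2) * exp (- (1 * t\<^sup>2))" by (simp flip: exp_add)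
      moreover have "exp (- (pi * t\<^sup>2 * r\<^sup>2)) \<le> 1" by simp
      ultimately show ?thesis by linarith
    qed
    then have "t powr (q - 1) * exp (- (pi * t\<^sup>2 * r\<^sup>2)) \<le> t powr (q - 1) * (exp (T\<^sup>2) * exp (- (1 * t\<^sup>2)))" if "0 < t" "t < T"
      using that by (intro mult_left_mono) auto
    then show "norm (indicator {0<..<T} t * (t powr (q - 1) * exp (- (pi * t\<^sup>2 * r\<^sup>2))))
     \<le> norm (exp (T\<^sup>2) * (indicator {0<..} t * (t powr (q - 1) * exp (- (1 * t\<^sup>2)))))"
      by (simp add: indicator_def abs_mult mult_ac)
  qed
qed measurable

text \<open>At distances of at least \<open>a > 0\<close> the discarded scales
  \<open>t \<ge> k\<close> are uniformly small. The same \<open>e k\<close> bounds values and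
  slopes, so that the truncated kernels converge as Lipschitz functions.\<close>

lemma riesz_cutoff_tail:
  assumes q: "q > 0" and a: "a > 0"
  obtains e where "e \<longlonglongrightarrow> 0" "\<And>k. e k \<ge> 0"
    "\<And>k r. r \<ge> a \<Longrightarrow> \<bar>riesz_scale q * r powr (- q) - riesz_cutoff q (real k) r\<bar> \<le> e k"
    "\<And>k r r'. r \<ge> a \<Longrightarrow> r' \<ge> a \<Longrightarrow>
      \<bar>(riesz_scale q * r powr (- q) - riesz_cutoff q (real k) r) - (riesz_scale q * r' powr (- q) - riesz_cutoff q (real k) r')\<bar> \<le> e k * \<bar>r - r'\<bar>"
proof -
  \<comment> \<open>The first summand is for the values, the second for the slopes: differentiating
    the Gaussian in \<open>r\<close> brings out one more power of \<open>t\<close>.\<close>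
  define f where "f t = indicator {0<..} t * (t powr (q - 1) * exp (- (2 * a\<^sup>2 * t\<^sup>2))) + 2 * pi * (indicator {0<..} t * (t powr ((q + 1) - 1) * exp (- (2 * a\<^sup>2 * t\<^sup>2))))" for t :: real
  have f0: "f t \<ge> 0" for t by (simp add: f_def)
  have fi: "integrable lborel f"
    unfolding f_def using q a
    by (intro Bochner_Integration.integrable_add integrable_mult_right integrable_powr_exp_neg_sq) auto
  define g where "g k t = indicator {real k..} t * f t" for k t
  have [measurable]: "f \<in> borel_measurable borel" using fi by auto
  have [measurable]: "g k \<in> borel_measurable borel" for k unfolding g_def by measurable
  have gi: "integrable lborel (g k)" for k
    by (rule Bochner_Integration.integrable_bound[OF fi]) (auto simp: g_def indicator_def)
  define e where "e k = (LINT t|lborel. g k t)" for k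
  have g0: "g k t \<ge> 0" for k t using f0 by (simp add: g_def)
  have e0: "e k \<ge> 0" for k unfolding e_def using g0 by (intro integral_nonneg_AE) auto
  have elim: "e \<longlonglongrightarrow> 0"
  proof -
    have "e \<longlonglongrightarrow> (LINT (t::real)|lborel. (0::real))"
      unfolding e_def
    proof (rule integral_dominated_convergence[OF _ _ fi])
      show "AE t in lborel. (\<lambda>k. g k t) \<longlonglongrightarrow> 0"
      proof (rule AE_I2)
        fix t
        obtain N where N: "t < real N" using reals_Archimedean2 by blast
        have "\<forall>\<^sub>F k in sequentially. g k t = 0"
          using eventually_ge_at_top[of N] by eventually_elim (use N in \<open>auto simp: g_def indicator_def\<close>)
        then show "(\<lambda>k. g k t) \<longlonglongrightarrow> 0" by (rule tendsto_eventually)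
      qed
    qed (use gi f0 in \<open>auto simp: g_def indicator_def\<close>)
    then show ?thesis by simp
  qed
  define h where "h r t = t powr (q - 1) * exp (- (pi * t\<^sup>2 * r\<^sup>2))" for r t :: real
  have hm [measurable]: "h r \<in> borel_measurable borel" for r unfolding h_def by measurable
  have hi: "integrable lborel (\<lambda>t. indicator {0<..} t * h r t)" if "r > 0" for r
    unfolding h_def using integrable_powr_exp_neg_sq[of q "pi * r\<^sup>2"] q that by (simp add: mult_ac)
  have hT: "integrable lborel (\<lambda>t. indicator {0<..<real k} t * h r t)" for k r
    unfolding h_def by (rule integrable_riesz_cutoff[OF q])
  have hk: "integrable lborel (\<lambda>t. indicator {0<..} t * indicator {real k..} t * h r t)" if "r > 0" for k r
    by (rule Bochner_Integration.integrable_bound[OF hi[OF that]]) (auto simp: indicator_def)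
  have tail: "riesz_scale q * r powr (- q) - riesz_cutoff q (real k) r = (LINT t|lborel. indicator {0<..} t * indicator {real k..} t * h r t)"
    if "r > 0" for r k
  proof -
    have "riesz_scale q * r powr (- q) - riesz_cutoff q (real k) r =
       (LINT t|lborel. indicator {0<..} t * h r t - indicator {0<..<real k} t * h r t)"
      unfolding riesz_scale_radial[OF q that, symmetric] riesz_cutoff_def h_def[symmetric]
      by (rule Bochner_Integration.integral_diff[OF hi[OF that] hT, symmetric])
    also have "\<dots> = (LINT t|lborel. indicator {0<..} t * indicator {real k..} t * h r t)"
      by (intro Bochner_Integration.integral_cong refl) (auto simp: indicator_def)
    finally show ?thesis .
  qed
  show ?thesis
  proof (rule that[OF elim e0])
    fix k r assume r: "r \<ge> a"
    then have r0: "r > 0" using a by simp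
    have "\<bar>LINT t|lborel. indicator {0<..} t * indicator {real k..} t * h r t\<bar> \<le> (LINT t|lborel. \<bar>indicator {0<..} t * indicator {real k..} t * h r t\<bar>)"
      by (rule integral_abs_bound)
    also have "\<dots> \<le> e k"
      unfolding e_def
    proof (rule integral_mono[OF _ gi])
      show "integrable lborel (\<lambda>t. \<bar>indicator {0<..} t * indicator {real k..} t * h r t\<bar>)" by (rule integrable_abs[OF hk[OF r0]])
      fix t :: real
      show "\<bar>indicator {0<..} t * indicator {real k..} t * h r t\<bar> \<le> g k t"
      proof (cases "0 < t \<and> real k \<le> t")
        case True
        have "2 * a\<^sup>2 * t\<^sup>2 \<le> pi * r\<^sup>2 * t\<^sup>2" using r a pi_gt3 by (intro mult_right_mono mult_mono power_mono) auto
        then have "h r t \<le> t powr (q - 1) * exp (- (2 * a\<^sup>2 * t\<^sup>2))"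
          unfolding h_def by (intro mult_left_mono) (auto simp: mult_ac)
        also have "\<dots> \<le> f t" using True by (simp add: f_def)
        finally show ?thesis using True by (simp add: g_def h_def)
      next
        case False
        then have z: "indicator {0<..} t * indicator {real k..} t = (0::real)" by (auto simp: indicator_def)
        show ?thesis unfolding z using g0[of k t] by simp
      qed
    qed
    finally show "\<bar>riesz_scale q * r powr (- q) - riesz_cutoff q (real k) r\<bar> \<le> e k" unfolding tail[OF r0] .
  next
    fix k r r' assume r: "r \<ge> a" "r' \<ge> a"
    then have r0: "r > 0" "r' > 0" using a by auto
    have "\<bar>(riesz_scale q * r powr (- q) - riesz_cutoff q (real k) r) - (riesz_scale q * r' powr (- q) - riesz_cutoff q (real k) r')\<bar>
      = \<bar>LINT t|lborel. indicator {0<..} t * indicator {real k..} t * h r t - indicator {0<..} t * indicator {real k..} t * h r' t\<bar>"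
      unfolding tail[OF r0(1)] tail[OF r0(2)] using hk r0 by (subst Bochner_Integration.integral_diff) auto
    also have "\<dots> \<le> (LINT t|lborel. \<bar>indicator {0<..} t * indicator {real k..} t * h r t - indicator {0<..} t * indicator {real k..} t * h r' t\<bar>)"
      by (rule integral_abs_bound)
    also have "\<dots> \<le> (LINT t|lborel. g k t * \<bar>r - r'\<bar>)"
    proof (rule integral_mono)
      show "integrable lborel (\<lambda>t. \<bar>indicator {0<..} t * indicator {real k..} t * h r t - indicator {0<..} t * indicator {real k..} t * h r' t\<bar>)"
        by (intro integrable_abs Bochner_Integration.integrable_diff hk r0)
      show "integrable lborel (\<lambda>t. g k t * \<bar>r - r'\<bar>)" by (intro integrable_mult_left gi)
      fix t :: real
      show "\<bar>indicator {0<..} t * indicator {real k..} t * h r t - indicator {0<..} t * indicator {real k..} t * h r' t\<bar> \<le> g k t * \<bar>r - r'\<bar>"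
      proof (cases "0 < t \<and> real k \<le> t")
        case True
        then have t: "t > 0" by simp
        have "\<bar>exp (- (pi * (t * r)\<^sup>2)) - exp (- (pi * (t * r')\<^sup>2))\<bar> \<le> 2 * pi * \<bar>t * r - t * r'\<bar> * exp (- (2 * (t * a)\<^sup>2))"
          using t r a by (intro exp_neg_sq_diff_le) auto
        then have "t powr (q - 1) * \<bar>exp (- (pi * (t * r)\<^sup>2)) - exp (- (pi * (t * r')\<^sup>2))\<bar> \<le>
           t powr (q - 1) * (2 * pi * \<bar>t * r - t * r'\<bar> * exp (- (2 * (t * a)\<^sup>2)))"
          by (intro mult_left_mono) auto
        also have "\<dots> = 2 * pi * (t powr (q - 1) * t) * exp (- (2 * a\<^sup>2 * t\<^sup>2)) * \<bar>r - r'\<bar>"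
        proof -
          have "\<bar>t * r - t * r'\<bar> = t * \<bar>r - r'\<bar>" using t by (simp add: abs_mult flip: right_diff_distrib)
          then show ?thesis by (simp add: power_mult_distrib mult_ac)
        qed
        also have "t powr (q - 1) * t = t powr ((q + 1) - 1)" using t by (simp add: powr_diff)
        also have "2 * pi * t powr ((q + 1) - 1) * exp (- (2 * a\<^sup>2 * t\<^sup>2)) * \<bar>r - r'\<bar> \<le> f t * \<bar>r - r'\<bar>"
          using t by (intro mult_right_mono) (auto simp: f_def)
        finally have "t powr (q - 1) * \<bar>exp (- (pi * (t * r)\<^sup>2)) - exp (- (pi * (t * r')\<^sup>2))\<bar> \<le> f t * \<bar>r - r'\<bar>" .
        moreover have "\<bar>h r t - h r' t\<bar> = t powr (q - 1) * \<bar>exp (- (pi * (t * r)\<^sup>2)) - exp (- (pi * (t * r')\<^sup>2))\<bar>"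
          by (simp add: h_def abs_mult power_mult_distrib mult.assoc flip: right_diff_distrib)
        ultimately show ?thesis using True by (simp add: g_def)
      next
        case False
        then have z: "indicator {0<..} t * indicator {real k..} t = (0::real)" by (auto simp: indicator_def)
        show ?thesis unfolding z using g0[of k t] by simp
      qed
    qed
    also have "\<dots> = e k * \<bar>r - r'\<bar>" by (simp add: e_def)
    finally show "\<bar>(riesz_scale q * r powr (- q) - riesz_cutoff q (real k) r) - (riesz_scale q * r' powr (- q) - riesz_cutoff q (real k) r')\<bar> \<le> e k * \<bar>r - r'\<bar>" .
  qed
qed

text \<open>Substituting \<open>1 / t\<close> for \<open>t\<close> identifies this with
  \<open>riesz_scale p\<close>; the form here is the one that arises on the frequency side.\<close>

definition symbol_scale :: "real \<Rightarrow> real" where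
  "symbol_scale p = (LINT t|lborel. indicator {0<..} t * (t powr (- p - 1) * exp (- (pi * (1 / t)\<^sup>2))))"

text \<open>The transform of a Gaussian of width \<open>1 / t\<close> carries the factor
  \<open>t powr (- n)\<close>, which turns the weight \<open>t powr (q - 1)\<close> of
  \<open>riesz_cutoff\<close> with \<open>q = n - p\<close> into
  \<open>t powr (- p - 1)\<close>.\<close>

definition symbol_cutoff :: "real \<Rightarrow> real \<Rightarrow> 'a::euclidean_space \<Rightarrow> real" where
  "symbol_cutoff p T \<xi> = (LINT t|lborel. indicator {0<..<T} t * (t powr (- p - 1) * exp (- (pi * (1 / t)\<^sup>2 * (norm \<xi>)\<^sup>2))))"

lemma symbol_scale_nonneg: "symbol_scale p \<ge> 0"
  unfolding symbol_scale_def by (intro integral_nonneg_AE) auto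

lemma symbol_radial:
  assumes "p > 0" "r > 0"
  shows "integrable lborel (\<lambda>t. indicator {0<..} t * (t powr (- p - 1) * exp (- (pi * (1 / t)\<^sup>2 * r\<^sup>2))))"
    and "(LINT t|lborel. indicator {0<..} t * (t powr (- p - 1) * exp (- (pi * (1 / t)\<^sup>2 * r\<^sup>2)))) = symbol_scale p * r powr (- p)"
proof -
  define f where "f t = indicator {0<..} t * (t powr (- p - 1) * exp (- (pi * (1 / t)\<^sup>2)))" for t :: real
  have fi: "integrable lborel f" unfolding f_def by (rule integrable_powr_exp_neg_inverse_sq[OF assms(1)])
  have eq: "f (0 + 1/r * t) = (1/r) powr (- p - 1) * (indicator {0<..} t * (t powr (- p - 1) * exp (- (pi * (1 / t)\<^sup>2 * r\<^sup>2))))" for t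
    using assms by (auto simp: f_def indicator_def powr_divide power_divide zero_less_divide_iff power_mult_distrib)
  have "integrable lborel (\<lambda>t. f (0 + 1/r * t))" using fi assms by (intro lborel_integrable_real_affine) auto
  then have "integrable lborel (\<lambda>t. r powr (- p - 1) * f (0 + 1/r * t))" by (rule integrable_mult_right)
  moreover have rr: "r powr (- p - 1) * (1/r) powr (- p - 1) = 1" using assms by (simp add: powr_divide)
  ultimately show i: "integrable lborel (\<lambda>t. indicator {0<..} t * (t powr (- p - 1) * exp (- (pi * (1 / t)\<^sup>2 * r\<^sup>2))))"
    unfolding eq mult.assoc[symmetric, of "r powr (- p - 1)"] by simp
  have "symbol_scale p = \<bar>1/r\<bar> *\<^sub>R (LINT t|lborel. f (0 + 1/r * t))"
    unfolding symbol_scale_def f_def[symmetric] by (rule lborel_integral_real_affine) (use assms in auto)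
  also have "\<dots> = 1/r * (1/r) powr (- p - 1) * (LINT t|lborel. indicator {0<..} t * (t powr (- p - 1) * exp (- (pi * (1 / t)\<^sup>2 * r\<^sup>2))))"
    unfolding eq using assms by simp
  also have "1/r * (1/r) powr (- p - 1) = r powr p"
    using assms by (simp add: powr_divide powr_diff powr_minus_divide)
  finally have "symbol_scale p * r powr (- p) = r powr p * r powr (- p) * (LINT t|lborel. indicator {0<..} t * (t powr (- p - 1) * exp (- (pi * (1 / t)\<^sup>2 * r\<^sup>2))))"
    by simp
  then show "(LINT t|lborel. indicator {0<..} t * (t powr (- p - 1) * exp (- (pi * (1 / t)\<^sup>2 * r\<^sup>2)))) = symbol_scale p * r powr (- p)"
    using assms by (simp flip: powr_add)
qed

section \<open>Convergence and integrability of the truncated symbol\<close>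

lemma symbol_cutoff_measurable [measurable]: "symbol_cutoff p T \<in> borel_measurable borel"
  unfolding symbol_cutoff_def[abs_def] by measurable

lemma symbol_cutoff_nonneg: "symbol_cutoff p T \<xi> \<ge> 0"
  unfolding symbol_cutoff_def by (intro integral_nonneg_AE) auto

text \<open>At \<open>\<xi> = 0\<close> the Gaussian factor is 1 and, for \<open>T > 0\<close>, the
  power is not integrable at 0; this frequency is excluded here and is a null set later.\<close>

lemma integrable_symbol_cutoff_slice:
  assumes "p > 0" "\<xi> \<noteq> 0"
  shows "integrable lborel (\<lambda>t. indicator {0<..<T} t * (t powr (- p - 1) * exp (- (pi * (1 / t)\<^sup>2 * (norm \<xi>)\<^sup>2))))"
  by (rule Bochner_Integration.integrable_bound[OF symbol_radial(1)[of p "norm \<xi>"]])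
     (use assms in \<open>auto simp: indicator_def\<close>)

lemma symbol_cutoff_le:
  assumes "p > 0" "\<xi> \<noteq> 0"
  shows "symbol_cutoff p T \<xi> \<le> symbol_scale p * norm \<xi> powr (- p)"
proof -
  have r: "norm \<xi> > 0" using assms by simp
  show ?thesis
    unfolding symbol_radial(2)[OF assms(1) r, symmetric] symbol_cutoff_def
    by (rule integral_mono[OF integrable_symbol_cutoff_slice[OF assms] symbol_radial(1)[OF assms(1) r]])
       (auto simp: indicator_def)
qed

lemma symbol_cutoff_LIMSEQ:
  assumes "p > 0" "\<xi> \<noteq> 0"
  shows "(\<lambda>k. symbol_cutoff p (real k) \<xi>) \<longlonglongrightarrow> symbol_scale p * norm \<xi> powr (- p)"
proof -
  have r: "norm \<xi> > 0" using assms by simp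
  show ?thesis
    unfolding symbol_radial(2)[OF assms(1) r, symmetric] symbol_cutoff_def
  proof (rule integral_dominated_convergence[OF _ _ symbol_radial(1)[OF assms(1) r]])
    show "AE t in lborel. (\<lambda>k. indicator {0<..<real k} t * (t powr (- p - 1) * exp (- (pi * (1 / t)\<^sup>2 * (norm \<xi>)\<^sup>2))))
       \<longlonglongrightarrow> indicator {0<..} t * (t powr (- p - 1) * exp (- (pi * (1 / t)\<^sup>2 * (norm \<xi>)\<^sup>2)))"
    proof (rule AE_I2, rule tendsto_eventually)
      fix t :: real
      obtain N where N: "t < real N" using reals_Archimedean2 by blast
      show "\<forall>\<^sub>F k in sequentially. indicator {0<..<real k} t * (t powr (- p - 1) * exp (- (pi * (1 / t)\<^sup>2 * (norm \<xi>)\<^sup>2)))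
         = indicator {0<..} t * (t powr (- p - 1) * exp (- (pi * (1 / t)\<^sup>2 * (norm \<xi>)\<^sup>2)))"
        using eventually_ge_at_top[of N] by eventually_elim (use N in \<open>auto simp: indicator_def\<close>)
    qed
  qed (auto simp: indicator_def)
qed

lemma nn_integral_scaled_gaussian:
  fixes c t :: real assumes "c > 0" "t > 0"
  shows "(\<integral>\<^sup>+\<xi>. ennreal (exp (- (c * (1 / t)\<^sup>2 * (norm (\<xi>::'a::euclidean_space))\<^sup>2))) \<partial>lborel) = ennreal (sqrt (pi / c) ^ DIM('a) * t powr real DIM('a))"
proof -
  have "c * (1 / t)\<^sup>2 > 0" using assms by simp
  from nn_integral_gaussian(1)[OF this, of "0::'a"]
  have "(\<integral>\<^sup>+\<xi>. ennreal (exp (- (c * (1 / t)\<^sup>2 * (norm (\<xi>::'a))\<^sup>2))) \<partial>lborel) = ennreal (sqrt (pi / (c * (1 / t)\<^sup>2)) ^ DIM('a))" by simp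
  also have "sqrt (pi / (c * (1 / t)\<^sup>2)) = sqrt (pi / c) * t"
    using assms by (simp add: power_divide real_sqrt_mult real_sqrt_divide)
  finally show ?thesis using assms by (simp add: power_mult_distrib powr_realpow)
qed

text \<open>The weight \<open>norm \<xi>\<close> is absorbed into the Gaussian by \<open>x \<le> exp (x^2)\<close>, since \<open>pi - 1 > 1\<close>.\<close>

lemma nn_integral_symbol_weight:
  fixes T :: real assumes p: "0 < p" "p < real DIM('a::euclidean_space)"
  shows "(\<integral>\<^sup>+t. \<integral>\<^sup>+\<xi>. ennreal (indicator {0<..<T} t * (t powr (- p - 1) * exp (- (pi * (1 / t)\<^sup>2 * (norm (\<xi>::'a))\<^sup>2)))) * ennreal (1 + norm \<xi>) \<partial>lborel \<partial>lborel) < \<infinity>"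
proof -
  define n where "n = real DIM('a)"
  define c where "c = sqrt (pi / (pi - 1)) ^ DIM('a)"
  have c: "c \<ge> 0" using pi_gt3 by (simp add: c_def)
  have "(\<integral>\<^sup>+t. \<integral>\<^sup>+\<xi>. ennreal (indicator {0<..<T} t * (t powr (- p - 1) * exp (- (pi * (1 / t)\<^sup>2 * (norm (\<xi>::'a))\<^sup>2)))) * ennreal (1 + norm \<xi>) \<partial>lborel \<partial>lborel)
    \<le> (\<integral>\<^sup>+t. ennreal ((1 + T) * c * (indicator {0<..<T} t * (t powr ((n - p) - 1) * exp (- (pi * t\<^sup>2 * 0\<^sup>2))))) \<partial>lborel)"
  proof (rule nn_integral_mono)
    fix t :: real
    show "(\<integral>\<^sup>+\<xi>. ennreal (indicator {0<..<T} t * (t powr (- p - 1) * exp (- (pi * (1 / t)\<^sup>2 * (norm (\<xi>::'a))\<^sup>2)))) * ennreal (1 + norm \<xi>) \<partial>lborel)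
      \<le> ennreal ((1 + T) * c * (indicator {0<..<T} t * (t powr ((n - p) - 1) * exp (- (pi * t\<^sup>2 * 0\<^sup>2)))))"
    proof (cases "0 < t \<and> t < T")
      case True
      then have t: "t > 0" "t < T" by auto
      have "(\<integral>\<^sup>+\<xi>. ennreal (indicator {0<..<T} t * (t powr (- p - 1) * exp (- (pi * (1 / t)\<^sup>2 * (norm (\<xi>::'a))\<^sup>2)))) * ennreal (1 + norm \<xi>) \<partial>lborel)
        \<le> (\<integral>\<^sup>+\<xi>. ennreal ((1 + T) * t powr (- p - 1)) * ennreal (exp (- ((pi - 1) * (1 / t)\<^sup>2 * (norm (\<xi>::'a))\<^sup>2))) \<partial>lborel)"
      proof (rule nn_integral_mono)
        fix \<xi> :: 'a
        \<comment> \<open>In the scaled frequency \<open>x\<close> both 1 and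
          \<open>norm \<xi> = t * x\<close> are at most multiples of \<open>exp (x\<^sup>2)\<close>,
          the second because \<open>t < T\<close>; a Gaussian with constant \<open>pi - 1\<close> is
          left.\<close>
        define x where "x = norm \<xi> / t"
        have x: "x \<ge> 0" "norm \<xi> = t * x" using t by (auto simp: x_def)
        have e: "1 + x\<^sup>2 \<le> exp (x\<^sup>2)" by (rule exp_ge_add_one_self)
        have "x \<le> 1 + x\<^sup>2" using sum_squares_ge_zero[of "x - 1/2" 0] by (simp add: power2_eq_square algebra_simps)
        then have "x \<le> exp (x\<^sup>2)" using e by linarith
        then have "1 + norm \<xi> \<le> exp (x\<^sup>2) + T * exp (x\<^sup>2)"
          unfolding x(2) using t x e by (intro add_mono mult_mono) auto
        then have "exp (- (pi * x\<^sup>2)) * (1 + norm \<xi>) \<le> exp (- (pi * x\<^sup>2)) * ((1 + T) * exp (x\<^sup>2))"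
          by (intro mult_left_mono) (auto simp: algebra_simps)
        also have "\<dots> = (1 + T) * exp (- ((pi - 1) * x\<^sup>2))" by (simp add: algebra_simps flip: exp_add)
        finally have "t powr (- p - 1) * (exp (- (pi * x\<^sup>2)) * (1 + norm \<xi>)) \<le> t powr (- p - 1) * ((1 + T) * exp (- ((pi - 1) * x\<^sup>2)))"
          by (rule mult_left_mono) simp
        moreover have "x\<^sup>2 = (1 / t)\<^sup>2 * (norm \<xi>)\<^sup>2" by (simp add: x_def power_divide)
        ultimately show "ennreal (indicator {0<..<T} t * (t powr (- p - 1) * exp (- (pi * (1 / t)\<^sup>2 * (norm \<xi>)\<^sup>2)))) * ennreal (1 + norm \<xi>)
           \<le> ennreal ((1 + T) * t powr (- p - 1)) * ennreal (exp (- ((pi - 1) * (1 / t)\<^sup>2 * (norm \<xi>)\<^sup>2)))"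
          using True by (simp add: mult_ac ennreal_leI del: ennreal_plus flip: ennreal_mult)
      qed
      also have "\<dots> = ennreal ((1 + T) * t powr (- p - 1)) * ennreal (c * t powr n)"
        using t pi_gt3 unfolding c_def n_def
        by (subst nn_integral_cmult, measurable, subst nn_integral_scaled_gaussian) auto
      also have "\<dots> = ennreal ((1 + T) * c * (t powr (- p - 1) * t powr n))"
        using t c by (simp add: mult_ac flip: ennreal_mult)
      also have "t powr (- p - 1) * t powr n = t powr ((n - p) - 1)" unfolding powr_add[symmetric] by (simp add: algebra_simps)
      finally show ?thesis using True by simp
    qed simp
  qed
  \<comment> \<open>The remaining power \<open>t powr ((n - p) - 1)\<close> is integrable at 0
    because \<open>p < n\<close>; it is the integrand of \<open>riesz_cutoff\<close> at
    \<open>r = 0\<close>.\<close>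
  also have "\<dots> = ennreal (LINT t|lborel. (1 + T) * c * (indicator {0<..<T} t * (t powr ((n - p) - 1) * exp (- (pi * t\<^sup>2 * 0\<^sup>2)))))"
  proof (rule nn_integral_eq_integral)
    show "integrable lborel (\<lambda>t. (1 + T) * c * (indicator {0<..<T} t * (t powr ((n - p) - 1) * exp (- (pi * t\<^sup>2 * 0\<^sup>2)))))"
      using p by (intro integrable_mult_right integrable_riesz_cutoff) (simp add: n_def)
    show "AE t in lborel. 0 \<le> (1 + T) * c * (indicator {0<..<T} t * (t powr ((n - p) - 1) * exp (- (pi * t\<^sup>2 * 0\<^sup>2))))"
      using c by (intro AE_I2) (auto simp: indicator_def)
  qed
  also have "\<dots> < \<infinity>" by simp
  finally show ?thesis .
qed

text \<open>Tonelli and the preceding bound. The weight \<open>1 + norm \<xi>\<close> is what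
  \<open>\<Phi>_integral\<close> asks of a coefficient function.\<close>

lemma symbol_cutoff_integrable:
  assumes p: "0 < p" "p < real DIM('a::euclidean_space)"
  shows "integrable lborel (\<lambda>\<xi>::'a. symbol_cutoff p T \<xi> * (1 + norm \<xi>))"
proof -
  define h where "h t \<xi> = indicator {0<..<T} t * (t powr (- p - 1) * exp (- (pi * (1 / t)\<^sup>2 * (norm (\<xi>::'a))\<^sup>2)))" for t \<xi>
  have h0: "h t \<xi> \<ge> 0" for t \<xi> by (simp add: h_def)
  have [measurable]: "(\<lambda>(t, \<xi>). h t \<xi>) \<in> borel_measurable (borel \<Otimes>\<^sub>M borel)" "(\<lambda>t. h t \<xi>) \<in> borel_measurable borel" for \<xi>
    unfolding h_def by measurable
  have "(\<integral>\<^sup>+\<xi>. ennreal (norm (symbol_cutoff p T \<xi> * (1 + norm (\<xi>::'a)))) \<partial>lborel) \<le> (\<integral>\<^sup>+\<xi>. \<integral>\<^sup>+t. ennreal (h t \<xi>) * ennreal (1 + norm \<xi>) \<partial>lborel \<partial>lborel)"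
  proof (rule nn_integral_mono_AE, rule AE_mp[OF AE_lborel_singleton[of 0] AE_I2], rule impI)
    fix \<xi> :: 'a assume "\<xi> \<noteq> 0"
    then have E: "ennreal (symbol_cutoff p T \<xi>) = (\<integral>\<^sup>+t. ennreal (h t \<xi>) \<partial>lborel)"
      unfolding symbol_cutoff_def h_def
      by (intro nn_integral_eq_integral[symmetric] integrable_symbol_cutoff_slice p) auto
    have "ennreal (symbol_cutoff p T \<xi> * (1 + norm \<xi>)) = ennreal (symbol_cutoff p T \<xi>) * ennreal (1 + norm \<xi>)"
      by (rule ennreal_mult[OF symbol_cutoff_nonneg]) simp
    also have "\<dots> = (\<integral>\<^sup>+t. ennreal (h t \<xi>) * ennreal (1 + norm \<xi>) \<partial>lborel)"
      unfolding E by (rule nn_integral_multc[symmetric]) measurable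
    finally have "ennreal (symbol_cutoff p T \<xi> * (1 + norm \<xi>)) = (\<integral>\<^sup>+t. ennreal (h t \<xi>) * ennreal (1 + norm \<xi>) \<partial>lborel)" .
    then show "ennreal (norm (symbol_cutoff p T \<xi> * (1 + norm \<xi>))) \<le> (\<integral>\<^sup>+t. ennreal (h t \<xi>) * ennreal (1 + norm \<xi>) \<partial>lborel)"
      using symbol_cutoff_nonneg[of p T \<xi>] by (simp add: abs_mult)
  qed
  also have "\<dots> = (\<integral>\<^sup>+t. \<integral>\<^sup>+\<xi>. ennreal (h t \<xi>) * ennreal (1 + norm \<xi>) \<partial>lborel \<partial>lborel)"
    by (rule lborel_pair.Fubini') measurable
  also have "\<dots> < \<infinity>" unfolding h_def by (rule nn_integral_symbol_weight[OF p])
  finally show ?thesis by (subst integrable_iff_bounded) simp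
qed

text \<open>Scale by scale this is the Gaussian transform; the weighted bound above justifies
  exchanging the scale integral with the frequency integral.\<close>

lemma riesz_cutoff_eq_ift:
  fixes x :: "'a::euclidean_space"
  assumes p: "0 < p" "p < real DIM('a)"
  shows "ift (\<lambda>\<xi>. complex_of_real (symbol_cutoff p T \<xi>)) x = complex_of_real (riesz_cutoff (real DIM('a) - p) T (norm x))"
proof -
  define h where "h t \<xi> = indicator {0<..<T} t * (t powr (- p - 1) * exp (- (pi * (1 / t)\<^sup>2 * (norm (\<xi>::'a))\<^sup>2)))" for t \<xi>
  have h0: "h t \<xi> \<ge> 0" for t \<xi> by (simp add: h_def)
  have [measurable]: "(\<lambda>(t, \<xi>). h t \<xi>) \<in> borel_measurable (borel \<Otimes>\<^sub>M borel)" "(\<lambda>t. h t \<xi>) \<in> borel_measurable borel" "h t \<in> borel_measurable borel" for \<xi> t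
    unfolding h_def by measurable
  define g where "g t \<xi> = complex_of_real (h t \<xi>) * cis (2 * pi * (x \<bullet> \<xi>))" for t \<xi>
  have [measurable]: "(\<lambda>(t, \<xi>). g t \<xi>) \<in> borel_measurable (borel \<Otimes>\<^sub>M borel)" unfolding g_def by measurable
  have gi: "integrable (lborel \<Otimes>\<^sub>M lborel) (\<lambda>(t, \<xi>). g t \<xi>)"
  proof (subst integrable_iff_bounded, intro conjI)
    show "(\<lambda>(t, \<xi>). g t \<xi>) \<in> borel_measurable (lborel \<Otimes>\<^sub>M lborel)" by measurable
    have "(\<integral>\<^sup>+z. ennreal (norm (case z of (t, \<xi>) \<Rightarrow> g t \<xi>)) \<partial>(lborel \<Otimes>\<^sub>M lborel)) = (\<integral>\<^sup>+t. \<integral>\<^sup>+\<xi>. ennreal (h t \<xi>) \<partial>lborel \<partial>lborel)"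
      by (subst lborel.nn_integral_fst[symmetric]) (auto simp: g_def norm_mult h0)
    also have "\<dots> \<le> (\<integral>\<^sup>+t. \<integral>\<^sup>+\<xi>. ennreal (h t \<xi>) * ennreal (1 + norm \<xi>) \<partial>lborel \<partial>lborel)"
    proof (intro nn_integral_mono)
      fix t \<xi>
      have "h t \<xi> * 1 \<le> h t \<xi> * (1 + norm \<xi>)" using h0 by (intro mult_left_mono) auto
      then show "ennreal (h t \<xi>) \<le> ennreal (h t \<xi>) * ennreal (1 + norm \<xi>)"
        using h0[of t \<xi>] by (simp add: ennreal_leI del: ennreal_plus flip: ennreal_mult)
    qed
    also have "\<dots> < \<infinity>" unfolding h_def by (rule nn_integral_symbol_weight[OF p])
    finally show "(\<integral>\<^sup>+z. ennreal (norm (case z of (t, \<xi>) \<Rightarrow> g t \<xi>)) \<partial>(lborel \<Otimes>\<^sub>M lborel)) < \<infinity>" .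
  qed
  have "ift (\<lambda>\<xi>. complex_of_real (symbol_cutoff p T \<xi>)) x = (LINT \<xi>|lborel. LINT t|lborel. g t \<xi>)"
    unfolding ift_def
  proof (intro Bochner_Integration.integral_cong refl)
    fix \<xi> :: 'a
    have "(LINT t|lborel. g t \<xi>) = (LINT t|lborel. complex_of_real (h t \<xi>)) * cis (2 * pi * (x \<bullet> \<xi>))"
      unfolding g_def by simp
    also have "(LINT t|lborel. complex_of_real (h t \<xi>)) = complex_of_real (LINT t|lborel. h t \<xi>)" by (rule integral_complex_of_real)
    finally show "complex_of_real (symbol_cutoff p T \<xi>) * cis (2 * pi * (x \<bullet> \<xi>)) = (LINT t|lborel. g t \<xi>)"
      by (simp only: symbol_cutoff_def h_def)
  qed
  also have "\<dots> = (LINT t|lborel. LINT \<xi>|lborel. g t \<xi>)" by (rule lborel_pair.Fubini_integral[OF gi])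
  also have "\<dots> = (LINT t|lborel. complex_of_real (indicator {0<..<T} t * (t powr ((real DIM('a) - p) - 1) * exp (- (pi * t\<^sup>2 * (norm x)\<^sup>2)))))"
  proof (intro Bochner_Integration.integral_cong refl)
    fix t :: real
    show "(LINT \<xi>|lborel. g t \<xi>) = complex_of_real (indicator {0<..<T} t * (t powr ((real DIM('a) - p) - 1) * exp (- (pi * t\<^sup>2 * (norm x)\<^sup>2))))"
    proof (cases "0 < t \<and> t < T")
      case True
      then have t: "t > 0" by simp
      have "(LINT \<xi>|lborel. g t \<xi>) = (LINT \<xi>|lborel. complex_of_real (t powr (- p - 1)) * (complex_of_real (exp (- (pi * (1 / t)\<^sup>2 * (norm \<xi>)\<^sup>2))) * cis (2 * pi * (\<xi> \<bullet> x))))"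
        using True by (intro Bochner_Integration.integral_cong refl) (simp add: g_def h_def inner_commute)
      also have "\<dots> = complex_of_real (t powr (- p - 1)) * complex_of_real (exp (- (pi * (norm x)\<^sup>2 / (1 / t)\<^sup>2)) / (1 / t) ^ DIM('a))"
        using gaussian_fourier[of "1 / t" x] t by (simp add: has_bochner_integral_iff)
      also have "\<dots> = complex_of_real (t powr (- p - 1) * t powr real DIM('a) * exp (- (pi * t\<^sup>2 * (norm x)\<^sup>2)))"
        using t by (simp add: power_divide powr_realpow mult_ac)
      also have "t powr (- p - 1) * t powr real DIM('a) = t powr ((real DIM('a) - p) - 1)" unfolding powr_add[symmetric] by (simp add: algebra_simps)
      finally show ?thesis using True by simp
    next
      case False
      then have "g t \<xi> = 0" for \<xi> by (auto simp: g_def h_def indicator_def)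
      then show ?thesis using False by (auto simp: indicator_def)
    qed
  qed
  also have "\<dots> = complex_of_real (riesz_cutoff (real DIM('a) - p) T (norm x))"
    unfolding riesz_cutoff_def by (rule integral_complex_of_real)
  finally show ?thesis .
qed

section \<open>Limits of inverse Fourier transforms\<close>

lemma le_ennreal_sqrt:
  assumes "y\<^sup>2 \<le> ennreal X" "X \<ge> 0"
  shows "y \<le> ennreal (sqrt X)"
proof (cases y)
  case (real r)
  then have "r\<^sup>2 \<le> X" using assms by (simp add: ennreal_power)
  then show ?thesis using real by (simp add: ennreal_leI real_le_rsqrt)
next
  case top
  then show ?thesis using assms by (simp add: top_unique)
qed

lemma nn_integral_norm_mult_le:
  fixes f g :: "'b \<Rightarrow> complex"
  assumes [measurable]: "f \<in> borel_measurable M" "g \<in> borel_measurable M"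
    and "(\<integral>\<^sup>+x. ennreal ((cmod (f x))\<^sup>2) \<partial>M) \<le> ennreal X" "(\<integral>\<^sup>+x. ennreal ((cmod (g x))\<^sup>2) \<partial>M) \<le> ennreal Y" "0 \<le> X" "0 \<le> Y"
  shows "(\<integral>\<^sup>+x. ennreal (cmod (f x) * cmod (g x)) \<partial>M) \<le> ennreal (sqrt (X * Y))"
proof (rule le_ennreal_sqrt)
  have "(\<integral>\<^sup>+x. ennreal (cmod (f x)) * ennreal (cmod (g x)) \<partial>M)\<^sup>2 \<le> (\<integral>\<^sup>+x. (ennreal (cmod (f x)))\<^sup>2 \<partial>M) * (\<integral>\<^sup>+x. (ennreal (cmod (g x)))\<^sup>2 \<partial>M)"
    by (rule Cauchy_Schwarz_nn_integral) measurable
  also have "\<dots> \<le> ennreal X * ennreal Y" using assms by (intro mult_mono) (auto simp: ennreal_power)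
  finally show "(\<integral>\<^sup>+x. ennreal (cmod (f x) * cmod (g x)) \<partial>M)\<^sup>2 \<le> ennreal (X * Y)"
    using assms by (simp add: ennreal_mult)
qed (use assms in simp)

text \<open>The cut at 1 is adapted to the later \<open>w\<close>, which is integrable at small and
  square integrable at large frequencies.\<close>

definition low :: "('a::euclidean_space \<Rightarrow> complex) \<Rightarrow> 'a \<Rightarrow> complex" where
  "low v \<xi> = (if norm \<xi> < 1 then v \<xi> else 0)"

definition high :: "('a::euclidean_space \<Rightarrow> complex) \<Rightarrow> 'a \<Rightarrow> complex" where
  "high v \<xi> = (if norm \<xi> < 1 then 0 else v \<xi>)"

lemma low_high_measurable [measurable]:
  assumes [measurable]: "v \<in> borel_measurable borel"
  shows "low v \<in> borel_measurable borel" "high v \<in> borel_measurable borel"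
  unfolding low_def[abs_def] high_def[abs_def] by measurable

lemma low_high_integrable:
  assumes v: "integrable lborel v"
  shows "integrable lborel (low v)" "integrable lborel (high v)"
proof -
  have [measurable]: "v \<in> borel_measurable borel" using v by auto
  show "integrable lborel (low v)" "integrable lborel (high v)"
    by (rule Bochner_Integration.integrable_bound[OF v]; (auto simp: low_def high_def)?)+
qed

lemma ift_low_high:
  assumes v: "integrable lborel v"
  shows "ift v x = ift (low v) x + ift (high v) x"
proof -
  have "ift (low v) x + ift (high v) x = (LINT \<xi>|lborel. low v \<xi> * cis (2 * pi * (x \<bullet> \<xi>)) + high v \<xi> * cis (2 * pi * (x \<bullet> \<xi>)))"
    unfolding ift_def using low_high_integrable[OF v]
    by (intro Bochner_Integration.integral_add[symmetric] integrable_mult_cis) auto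
  also have "\<dots> = ift v x" unfolding ift_def
    by (intro Bochner_Integration.integral_cong refl) (simp add: low_def high_def)
  finally show ?thesis by simp
qed

text \<open>The low part has a bounded inverse transform and is paired with the integral of
  \<open>cmod (g x)\<close>; the high part has a square integrable one and is paired by
  Cauchy-Schwarz.\<close>

lemma ift_weighted_L1:
  assumes v: "integrable lborel v" and [measurable]: "g \<in> borel_measurable borel"
    and A: "(LINT \<xi>|lborel. cmod (low v \<xi>)) \<le> A" and B: "(\<integral>\<^sup>+\<xi>. ennreal ((cmod (high v \<xi>))\<^sup>2) \<partial>lborel) \<le> ennreal B" "0 \<le> B"
    and G1: "(\<integral>\<^sup>+x. ennreal (cmod (g x)) \<partial>lborel) \<le> ennreal G1" "0 \<le> G1" and G2: "(\<integral>\<^sup>+x. ennreal ((cmod (g x))\<^sup>2) \<partial>lborel) \<le> ennreal G2" "0 \<le> G2"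
  shows "(\<integral>\<^sup>+x. ennreal (cmod (ift v x) * cmod (g x)) \<partial>lborel) \<le> ennreal (A * G1 + sqrt (B * G2))"
proof -
  have [measurable]: "v \<in> borel_measurable borel" using v by auto
  have "0 \<le> (LINT \<xi>|lborel. cmod (low v \<xi>))" by (intro integral_nonneg_AE) auto
  then have A0: "0 \<le> A" using A by linarith
  have "(\<integral>\<^sup>+x. ennreal (cmod (ift v x) * cmod (g x)) \<partial>lborel) \<le> (\<integral>\<^sup>+x. ennreal A * ennreal (cmod (g x)) + ennreal (cmod (ift (high v) x) * cmod (g x)) \<partial>lborel)"
  proof (rule nn_integral_mono)
    fix x
    have "cmod (ift v x) \<le> cmod (ift (low v) x) + cmod (ift (high v) x)"
      unfolding ift_low_high[OF v] by (rule norm_triangle_ineq)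
    also have "cmod (ift (low v) x) \<le> A" using ift_norm_le[OF low_high_integrable(1)[OF v]] A by (rule order_trans)
    finally have "cmod (ift v x) * cmod (g x) \<le> (A + cmod (ift (high v) x)) * cmod (g x)" by (intro mult_right_mono) auto
    then have "cmod (ift v x) * cmod (g x) \<le> A * cmod (g x) + cmod (ift (high v) x) * cmod (g x)" by (simp add: algebra_simps)
    from ennreal_leI[OF this] show "ennreal (cmod (ift v x) * cmod (g x)) \<le> ennreal A * ennreal (cmod (g x)) + ennreal (cmod (ift (high v) x) * cmod (g x))"
      using A0 by (simp add: ennreal_mult)
  qed
  also have "\<dots> = ennreal A * (\<integral>\<^sup>+x. ennreal (cmod (g x)) \<partial>lborel) + (\<integral>\<^sup>+x. ennreal (cmod (ift (high v) x) * cmod (g x)) \<partial>lborel)"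
    by (subst nn_integral_add, measurable, subst nn_integral_cmult) measurable
  also have "\<dots> \<le> ennreal A * ennreal G1 + ennreal (sqrt (B * G2))"
  proof (intro add_mono mult_left_mono G1 nn_integral_norm_mult_le G2 B)
    show "(\<integral>\<^sup>+x. ennreal ((cmod (ift (high v) x))\<^sup>2) \<partial>lborel) \<le> ennreal B"
      using ift_L2_le[OF low_high_integrable(2)[OF v]] B(1) by (rule order_trans)
  qed auto
  also have "\<dots> = ennreal (A * G1 + sqrt (B * G2))" using A0 G1 G2 B by (simp add: ennreal_mult)
  finally show ?thesis .
qed

text \<open>\<open>w\<close> need be neither integrable nor square integrable, so its inverse Fourier transform \<open>U\<close> is only
  available as the pointwise limit of those of the truncations \<open>v k\<close>.\<close>

locale ift_limit =
  fixes w :: "'a::euclidean_space \<Rightarrow> complex" and v :: "nat \<Rightarrow> 'a \<Rightarrow> complex" and U :: "'a \<Rightarrow> complex"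
  assumes w [measurable]: "w \<in> borel_measurable borel" and U [measurable]: "U \<in> borel_measurable borel"
    and v: "\<And>k. integrable lborel (v k)"
    and v_le: "AE \<xi> in lborel. \<forall>k. cmod (v k \<xi>) \<le> cmod (w \<xi>)"
    and v_lim: "AE \<xi> in lborel. (\<lambda>k. v k \<xi>) \<longlonglongrightarrow> w \<xi>"
    and w_low: "integrable lborel (low w)" and w_high: "integrable lborel (\<lambda>\<xi>. (cmod (high w \<xi>))\<^sup>2)"
    and U_lim: "AE x in lborel. (\<lambda>k. ift (v k) x) \<longlonglongrightarrow> U x"
begin

lemma v_measurable [measurable]: "v k \<in> borel_measurable borel" using v by auto

text \<open>Each \<open>ift (v k)\<close> is a bounded function plus a square integrable one, with
  bounds depending on \<open>w\<close> alone; Fatou's lemma passes them to \<open>U\<close>.\<close>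

lemma local_square_integrable:
  assumes [measurable]: "S \<in> sets borel" and S: "emeasure lborel S < \<infinity>"
  shows "(\<integral>\<^sup>+x. ennreal ((cmod (U x))\<^sup>2 * indicator S x) \<partial>lborel) < \<infinity>"
proof -
  define A where "A = (LINT \<xi>|lborel. cmod (low w \<xi>))"
  have bound: "(\<integral>\<^sup>+x. ennreal ((cmod (ift (v k) x))\<^sup>2 * indicator S x) \<partial>lborel) \<le> ennreal (2 * A\<^sup>2) * emeasure lborel S + 2 * (\<integral>\<^sup>+\<xi>. ennreal ((cmod (high w \<xi>))\<^sup>2) \<partial>lborel)" for k
  proof -
    have lowA: "cmod (ift (low (v k)) x) \<le> A" for x
    proof (rule order_trans[OF ift_norm_le[OF low_high_integrable(1)[OF v]]])
      show "(LINT \<xi>|lborel. cmod (low (v k) \<xi>)) \<le> A" unfolding A_def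
      proof (rule integral_mono_AE)
        show "AE \<xi> in lborel. cmod (low (v k) \<xi>) \<le> cmod (low w \<xi>)"
          using v_le by eventually_elim (auto simp: low_def)
      qed (use low_high_integrable(1)[OF v] w_low in \<open>auto intro: integrable_norm\<close>)
    qed
    have "(\<integral>\<^sup>+x. ennreal ((cmod (ift (v k) x))\<^sup>2 * indicator S x) \<partial>lborel) \<le> (\<integral>\<^sup>+x. ennreal (2 * A\<^sup>2) * indicator S x + 2 * ennreal ((cmod (ift (high (v k)) x))\<^sup>2) \<partial>lborel)"
    proof (rule nn_integral_mono)
      fix x
      define a b where "a = cmod (ift (low (v k)) x)" and "b = cmod (ift (high (v k)) x)"
      have ab: "0 \<le> a" "a \<le> A" "0 \<le> b" using lowA[of x] by (auto simp: a_def b_def)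
      have "cmod (ift (v k) x) \<le> a + b" unfolding ift_low_high[OF v] a_def b_def by (rule norm_triangle_ineq)
      then have "(cmod (ift (v k) x))\<^sup>2 \<le> (a + b)\<^sup>2" by (intro power_mono) auto
      also have "\<dots> \<le> 2 * a\<^sup>2 + 2 * b\<^sup>2" using sum_squares_bound[of a b] by (simp add: power2_sum)
      also have "\<dots> \<le> 2 * A\<^sup>2 + 2 * b\<^sup>2" using ab by (intro add_mono mult_left_mono power_mono) auto
      finally have *: "ennreal ((cmod (ift (v k) x))\<^sup>2) \<le> ennreal (2 * A\<^sup>2 + 2 * b\<^sup>2)" by (rule ennreal_leI)
      have "ennreal (2 * A\<^sup>2 + 2 * b\<^sup>2) = ennreal (2 * A\<^sup>2) + 2 * ennreal (b\<^sup>2)"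
        by (subst ennreal_plus) (auto simp: ennreal_mult)
      then show "ennreal ((cmod (ift (v k) x))\<^sup>2 * indicator S x) \<le> ennreal (2 * A\<^sup>2) * indicator S x + 2 * ennreal ((cmod (ift (high (v k)) x))\<^sup>2)"
        using * by (simp add: b_def split: split_indicator)
    qed
    also have "\<dots> = ennreal (2 * A\<^sup>2) * emeasure lborel S + 2 * (\<integral>\<^sup>+x. ennreal ((cmod (ift (high (v k)) x))\<^sup>2) \<partial>lborel)"
      by (subst nn_integral_add, measurable, subst nn_integral_cmult_indicator, simp, subst nn_integral_cmult) measurable
    also have "\<dots> \<le> ennreal (2 * A\<^sup>2) * emeasure lborel S + 2 * (\<integral>\<^sup>+\<xi>. ennreal ((cmod (high w \<xi>))\<^sup>2) \<partial>lborel)"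
    proof (intro add_left_mono mult_left_mono order_trans[OF ift_L2_le[OF low_high_integrable(2)[OF v]]] nn_integral_mono_AE)
      show "AE \<xi> in lborel. ennreal ((cmod (high (v k) \<xi>))\<^sup>2) \<le> ennreal ((cmod (high w \<xi>))\<^sup>2)"
        using v_le by eventually_elim (auto simp: high_def intro!: ennreal_leI power_mono)
    qed auto
    finally show ?thesis .
  qed
  have "(\<integral>\<^sup>+x. ennreal ((cmod (U x))\<^sup>2 * indicator S x) \<partial>lborel) = (\<integral>\<^sup>+x. liminf (\<lambda>k. ennreal ((cmod (ift (v k) x))\<^sup>2 * indicator S x)) \<partial>lborel)"
  proof (rule nn_integral_cong_AE)
    show "AE x in lborel. ennreal ((cmod (U x))\<^sup>2 * indicator S x) = liminf (\<lambda>k. ennreal ((cmod (ift (v k) x))\<^sup>2 * indicator S x))"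
      using U_lim by eventually_elim
        (intro lim_imp_Liminf[symmetric] tendsto_ennrealI tendsto_mult tendsto_power tendsto_norm tendsto_const, auto)
  qed
  also have "\<dots> \<le> liminf (\<lambda>k. \<integral>\<^sup>+x. ennreal ((cmod (ift (v k) x))\<^sup>2 * indicator S x) \<partial>lborel)"
    by (rule nn_integral_liminf) measurable
  also have "\<dots> \<le> ennreal (2 * A\<^sup>2) * emeasure lborel S + 2 * (\<integral>\<^sup>+\<xi>. ennreal ((cmod (high w \<xi>))\<^sup>2) \<partial>lborel)"
    using bound by (intro Liminf_le) auto
  also have "\<dots> < \<infinity>"
  proof -
    have "(\<integral>\<^sup>+\<xi>. ennreal ((cmod (high w \<xi>))\<^sup>2) \<partial>lborel) < \<infinity>"
      using w_high by (simp add: integrable_iff_bounded)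
    then show ?thesis using S by (auto simp: ennreal_mult_less_top ennreal_add_less_top)
  qed
  finally show ?thesis .
qed

text \<open>Since there is no transform of \<open>w\<close> to compare with, the
  \<open>ift (v k)\<close> are shown to be Cauchy in the integral norm weighted by \<open>g\<close>;
  Fatou's lemma in one of the two indices then brings in \<open>U\<close>.\<close>

lemma pairing_LIMSEQ:
  assumes g: "integrable lborel g" and g2: "integrable lborel (\<lambda>x. (cmod (g x))\<^sup>2)"
  shows "integrable lborel (\<lambda>x. U x * g x)"
    and "(\<lambda>k. LINT x|lborel. ift (v k) x * g x) \<longlonglongrightarrow> (LINT x|lborel. U x * g x)"
proof -
  have [measurable]: "g \<in> borel_measurable borel" using g by auto
  define G1 G2 where "G1 = (LINT x|lborel. cmod (g x))" and "G2 = (LINT x|lborel. (cmod (g x))\<^sup>2)"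
  have G: "0 \<le> G1" "0 \<le> G2" unfolding G1_def G2_def by (auto intro!: integral_nonneg_AE)
  have G1: "(\<integral>\<^sup>+x. ennreal (cmod (g x)) \<partial>lborel) \<le> ennreal G1" and G2: "(\<integral>\<^sup>+x. ennreal ((cmod (g x))\<^sup>2) \<partial>lborel) \<le> ennreal G2"
    unfolding G1_def G2_def using g g2 by (auto simp: nn_integral_eq_integral)
  define a where "a k = (LINT \<xi>|lborel. cmod (low (\<lambda>\<xi>. w \<xi> - v k \<xi>) \<xi>))" for k
  define b where "b k = (LINT \<xi>|lborel. (cmod (high (\<lambda>\<xi>. w \<xi> - v k \<xi>) \<xi>))\<^sup>2)" for k
  have d_le: "AE \<xi> in lborel. \<forall>k. cmod (w \<xi> - v k \<xi>) \<le> 2 * cmod (w \<xi>)"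
    using v_le
  proof eventually_elim
    case (elim \<xi>)
    show ?case
    proof
      fix k
      have "cmod (w \<xi> - v k \<xi>) \<le> cmod (w \<xi>) + cmod (v k \<xi>)" by (rule norm_triangle_ineq4)
      with elim[rule_format, of k] show "cmod (w \<xi> - v k \<xi>) \<le> 2 * cmod (w \<xi>)" by linarith
    qed
  qed
  have d_lim: "AE \<xi> in lborel. (\<lambda>k. cmod (w \<xi> - v k \<xi>)) \<longlonglongrightarrow> 0"
    using v_lim
  proof eventually_elim
    case (elim \<xi>)
    have "(\<lambda>k. cmod (w \<xi> - v k \<xi>)) \<longlonglongrightarrow> cmod (w \<xi> - w \<xi>)" by (intro tendsto_intros elim)
    then show ?case by simp
  qed
  have ai: "integrable lborel (\<lambda>\<xi>. cmod (low (\<lambda>\<xi>. w \<xi> - v k \<xi>) \<xi>))" for k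
  proof (rule Bochner_Integration.integrable_bound[where f="\<lambda>\<xi>. 2 * cmod (low w \<xi>)"])
    show "AE \<xi> in lborel. norm (cmod (low (\<lambda>\<xi>. w \<xi> - v k \<xi>) \<xi>)) \<le> norm (2 * cmod (low w \<xi>))"
      using d_le by eventually_elim (auto simp: low_def)
  qed (use w_low in auto)
  have bi: "integrable lborel (\<lambda>\<xi>. (cmod (high (\<lambda>\<xi>. w \<xi> - v k \<xi>) \<xi>))\<^sup>2)" for k
  proof (rule Bochner_Integration.integrable_bound[where f="\<lambda>\<xi>. 4 * (cmod (high w \<xi>))\<^sup>2"])
    show "AE \<xi> in lborel. norm ((cmod (high (\<lambda>\<xi>. w \<xi> - v k \<xi>) \<xi>))\<^sup>2) \<le> norm (4 * (cmod (high w \<xi>))\<^sup>2)"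
      using d_le
    proof eventually_elim
      case (elim \<xi>)
      have "(cmod (w \<xi> - v k \<xi>))\<^sup>2 \<le> (2 * cmod (w \<xi>))\<^sup>2" using elim by (intro power_mono) auto
      then show ?case by (auto simp: high_def power_mult_distrib)
    qed
  qed (use w_high in auto)
  have alim: "a \<longlonglongrightarrow> 0"
  proof -
    have "a \<longlonglongrightarrow> (LINT (\<xi>::'a)|lborel. (0::real))"
      unfolding a_def
    proof (rule integral_dominated_convergence[where w="\<lambda>\<xi>. 2 * cmod (low w \<xi>)"])
      show "AE \<xi> in lborel. (\<lambda>k. cmod (low (\<lambda>\<xi>. w \<xi> - v k \<xi>) \<xi>)) \<longlonglongrightarrow> 0"
        using d_lim
      proof eventually_elim
        case (elim \<xi>)
        then show ?case by (cases "norm \<xi> < 1") (simp_all add: low_def)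
      qed
      show "AE \<xi> in lborel. norm (cmod (low (\<lambda>\<xi>. w \<xi> - v k \<xi>) \<xi>)) \<le> 2 * cmod (low w \<xi>)" for k
        using d_le by eventually_elim (auto simp: low_def)
    qed (use w_low in auto)
    then show ?thesis by simp
  qed
  have blim: "b \<longlonglongrightarrow> 0"
  proof -
    have "b \<longlonglongrightarrow> (LINT (\<xi>::'a)|lborel. (0::real))"
      unfolding b_def
    proof (rule integral_dominated_convergence[where w="\<lambda>\<xi>. 4 * (cmod (high w \<xi>))\<^sup>2"])
      show "AE \<xi> in lborel. (\<lambda>k. (cmod (high (\<lambda>\<xi>. w \<xi> - v k \<xi>) \<xi>))\<^sup>2) \<longlonglongrightarrow> 0"
        using d_lim
      proof eventually_elim
        case (elim \<xi>)
        from tendsto_power[OF elim, of 2] show ?case by (cases "norm \<xi> < 1") (simp_all add: high_def)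
      qed
      show "AE \<xi> in lborel. norm ((cmod (high (\<lambda>\<xi>. w \<xi> - v k \<xi>) \<xi>))\<^sup>2) \<le> 4 * (cmod (high w \<xi>))\<^sup>2" for k
        using d_le
      proof eventually_elim
        case (elim \<xi>)
        have "(cmod (w \<xi> - v k \<xi>))\<^sup>2 \<le> (2 * cmod (w \<xi>))\<^sup>2" using elim by (intro power_mono) auto
        then show ?case by (auto simp: high_def power_mult_distrib)
      qed
    qed (use w_high in auto)
    then show ?thesis by simp
  qed
  have b0: "b k \<ge> 0" for k unfolding b_def by (intro integral_nonneg_AE) auto
  have idiff: "ift (v l) x - ift (v k) x = ift (\<lambda>\<xi>. v l \<xi> - v k \<xi>) x" for k l x
    unfolding ift_def left_diff_distrib using v
    by (intro Bochner_Integration.integral_diff[symmetric] integrable_mult_cis) auto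
  \<comment> \<open>Both truncations are compared with \<open>w\<close>: the low parts add, and for
    the high parts the square of a sum costs the factors 2.\<close>
  have kl: "(\<integral>\<^sup>+x. ennreal (cmod (ift (v l) x - ift (v k) x) * cmod (g x)) \<partial>lborel) \<le> ennreal ((a l + a k) * G1 + sqrt ((2 * b l + 2 * b k) * G2))" for k l
    unfolding idiff
  proof (rule ift_weighted_L1[OF _ _ _ _ _ G1 G(1) G2 G(2)])
    show "integrable lborel (\<lambda>\<xi>. v l \<xi> - v k \<xi>)" using v by auto
    have "(LINT \<xi>|lborel. cmod (low (\<lambda>\<xi>. v l \<xi> - v k \<xi>) \<xi>)) \<le> (LINT \<xi>|lborel. cmod (low (\<lambda>\<xi>. w \<xi> - v l \<xi>) \<xi>) + cmod (low (\<lambda>\<xi>. w \<xi> - v k \<xi>) \<xi>))"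
    proof (rule integral_mono)
      show "integrable lborel (\<lambda>\<xi>. cmod (low (\<lambda>\<xi>. v l \<xi> - v k \<xi>) \<xi>))"
        using v by (intro integrable_norm low_high_integrable) auto
      fix \<xi>
      show "cmod (low (\<lambda>\<xi>. v l \<xi> - v k \<xi>) \<xi>) \<le> cmod (low (\<lambda>\<xi>. w \<xi> - v l \<xi>) \<xi>) + cmod (low (\<lambda>\<xi>. w \<xi> - v k \<xi>) \<xi>)"
        using norm_triangle_ineq4[of "w \<xi> - v k \<xi>" "w \<xi> - v l \<xi>"] by (simp add: low_def)
    qed (use ai in auto)
    then show "(LINT \<xi>|lborel. cmod (low (\<lambda>\<xi>. v l \<xi> - v k \<xi>) \<xi>)) \<le> a l + a k" using ai by (simp add: a_def)
    have "(\<integral>\<^sup>+\<xi>. ennreal ((cmod (high (\<lambda>\<xi>. v l \<xi> - v k \<xi>) \<xi>))\<^sup>2) \<partial>lborel) \<le>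
       (\<integral>\<^sup>+\<xi>. ennreal (2 * (cmod (high (\<lambda>\<xi>. w \<xi> - v l \<xi>) \<xi>))\<^sup>2 + 2 * (cmod (high (\<lambda>\<xi>. w \<xi> - v k \<xi>) \<xi>))\<^sup>2) \<partial>lborel)"
    proof (intro nn_integral_mono ennreal_leI)
      fix \<xi>
      define c d where "c = cmod (w \<xi> - v l \<xi>)" and "d = cmod (w \<xi> - v k \<xi>)"
      have "cmod (v l \<xi> - v k \<xi>) \<le> c + d"
        using norm_triangle_ineq4[of "w \<xi> - v k \<xi>" "w \<xi> - v l \<xi>"] by (simp add: c_def d_def)
      then have "(cmod (v l \<xi> - v k \<xi>))\<^sup>2 \<le> (c + d)\<^sup>2" by (intro power_mono) auto
      also have "\<dots> \<le> 2 * c\<^sup>2 + 2 * d\<^sup>2" using sum_squares_bound[of c d] by (simp add: power2_sum)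
      finally show "(cmod (high (\<lambda>\<xi>. v l \<xi> - v k \<xi>) \<xi>))\<^sup>2 \<le> 2 * (cmod (high (\<lambda>\<xi>. w \<xi> - v l \<xi>) \<xi>))\<^sup>2 + 2 * (cmod (high (\<lambda>\<xi>. w \<xi> - v k \<xi>) \<xi>))\<^sup>2"
        by (simp add: high_def c_def d_def)
    qed
    also have "\<dots> = ennreal (LINT \<xi>|lborel. 2 * (cmod (high (\<lambda>\<xi>. w \<xi> - v l \<xi>) \<xi>))\<^sup>2 + 2 * (cmod (high (\<lambda>\<xi>. w \<xi> - v k \<xi>) \<xi>))\<^sup>2)"
      by (rule nn_integral_eq_integral) (use bi in auto)
    also have "\<dots> = ennreal (2 * b l + 2 * b k)" using bi by (simp add: b_def)
    finally show "(\<integral>\<^sup>+\<xi>. ennreal ((cmod (high (\<lambda>\<xi>. v l \<xi> - v k \<xi>) \<xi>))\<^sup>2) \<partial>lborel) \<le> ennreal (2 * b l + 2 * b k)" .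
  qed (use b0 in auto)
  define e where "e k = a k * G1 + sqrt (2 * b k * G2)" for k
  have elim: "e \<longlonglongrightarrow> 0"
  proof -
    have "e \<longlonglongrightarrow> 0 * G1 + sqrt (2 * 0 * G2)"
      unfolding e_def by (intro tendsto_intros alim blim)
    then show ?thesis by simp
  qed
  \<comment> \<open>Fatou's lemma in \<open>l\<close>: the contributions \<open>a l\<close> and
    \<open>b l\<close> vanish in the limit, those of \<open>k\<close> remain.\<close>
  have Uk: "(\<integral>\<^sup>+x. ennreal (cmod (U x - ift (v k) x) * cmod (g x)) \<partial>lborel) \<le> ennreal (e k)" for k
  proof -
    have "(\<integral>\<^sup>+x. ennreal (cmod (U x - ift (v k) x) * cmod (g x)) \<partial>lborel) = (\<integral>\<^sup>+x. liminf (\<lambda>l. ennreal (cmod (ift (v l) x - ift (v k) x) * cmod (g x))) \<partial>lborel)"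
    proof (rule nn_integral_cong_AE)
      show "AE x in lborel. ennreal (cmod (U x - ift (v k) x) * cmod (g x)) = liminf (\<lambda>l. ennreal (cmod (ift (v l) x - ift (v k) x) * cmod (g x)))"
        using U_lim by eventually_elim
          (intro lim_imp_Liminf[symmetric] tendsto_ennrealI tendsto_mult tendsto_norm tendsto_diff tendsto_const, auto)
    qed
    also have "\<dots> \<le> liminf (\<lambda>l. \<integral>\<^sup>+x. ennreal (cmod (ift (v l) x - ift (v k) x) * cmod (g x)) \<partial>lborel)"
      by (rule nn_integral_liminf) measurable
    also have "\<dots> \<le> liminf (\<lambda>l. ennreal ((a l + a k) * G1 + sqrt ((2 * b l + 2 * b k) * G2)))"
      by (intro Liminf_mono always_eventually allI kl)
    also have "\<dots> = ennreal ((0 + a k) * G1 + sqrt ((2 * 0 + 2 * b k) * G2))"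
      by (intro lim_imp_Liminf tendsto_ennrealI tendsto_intros alim blim) simp
    finally show ?thesis by (simp add: e_def)
  qed
  have vi: "integrable lborel (\<lambda>x. ift (v k) x * g x)" for k
  proof -
    have "integrable lborel (\<lambda>x. g x * ift (v k) x)"
      by (rule integrable_mult_bounded[OF g, where B="LINT \<xi>|lborel. cmod (v k \<xi>)"]) (auto intro: ift_norm_le v)
    then show ?thesis by (simp only: mult.commute)
  qed
  have di: "integrable lborel (\<lambda>x. (U x - ift (v k) x) * g x)" for k
    unfolding integrable_iff_bounded using Uk[of k] by (auto simp: norm_mult intro: order_le_less_trans)
  have "integrable lborel (\<lambda>x. (U x - ift (v 0) x) * g x + ift (v 0) x * g x)"
    by (intro Bochner_Integration.integrable_add di vi)
  then show Ui: "integrable lborel (\<lambda>x. U x * g x)" by (simp add: algebra_simps)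
  have bd: "cmod ((LINT x|lborel. U x * g x) - (LINT x|lborel. ift (v k) x * g x)) \<le> \<bar>e k\<bar>" for k
  proof -
    have "(LINT x|lborel. U x * g x) - (LINT x|lborel. ift (v k) x * g x) = (LINT x|lborel. (U x - ift (v k) x) * g x)"
      using Ui vi[of k] by (simp add: algebra_simps)
    then have "ennreal (cmod ((LINT x|lborel. U x * g x) - (LINT x|lborel. ift (v k) x * g x))) \<le> (\<integral>\<^sup>+x. ennreal (cmod ((U x - ift (v k) x) * g x)) \<partial>lborel)"
      using integral_norm_bound_ennreal[OF di[of k]] by simp
    also have "\<dots> \<le> ennreal \<bar>e k\<bar>"
      using order_trans[OF Uk[of k] ennreal_leI[OF abs_ge_self[of "e k"]]] by (simp only: norm_mult)
    finally show ?thesis by simp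
  qed
  have e1: "(\<lambda>k. \<bar>e k\<bar>) \<longlonglongrightarrow> 0" using tendsto_rabs[OF elim] by simp
  have "(\<lambda>k. (LINT x|lborel. U x * g x) - (LINT x|lborel. ift (v k) x * g x)) \<longlonglongrightarrow> 0"
    by (rule Lim_null_comparison[OF always_eventually[OF allI[OF bd]] e1])
  from tendsto_diff[OF tendsto_const[of "LINT x|lborel. U x * g x"] this]
  show "(\<lambda>k. LINT x|lborel. ift (v k) x * g x) \<longlonglongrightarrow> (LINT x|lborel. U x * g x)" by simp
qed

end

section \<open>Test functions\<close>

text \<open>Integration by parts from translation invariance: the difference quotients of
  \<open>H\<close>, the function times the exponential, have integral 0, and so has their limit, the
  derivative \<open>D\<close> of \<open>H\<close> along \<open>b\<close>.\<close>

lemma ift_derivative: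
  fixes g :: "'a::euclidean_space \<Rightarrow> real"
  assumes diff: "\<And>x. g differentiable (at x)"
    and cont: "continuous_on UNIV (\<lambda>x. frechet_derivative g (at x) b)"
    and C: "compact C" "\<And>x. x \<notin> C \<Longrightarrow> g x = 0" "\<And>x. x \<notin> C \<Longrightarrow> frechet_derivative g (at x) b = 0"
  shows "ift (\<lambda>x. complex_of_real (frechet_derivative g (at x) b)) \<xi> =
     - (2 * pi * (\<xi> \<bullet> b) * \<i>) * ift (\<lambda>x. complex_of_real (g x)) \<xi>"
proof -
  define g' where "g' x = frechet_derivative g (at x) b" for x
  have gc: "continuous_on UNIV g"
    using diff by (intro continuous_at_imp_continuous_on ballI differentiable_imp_continuous_within) auto
  define c where "c x = cis (2 * pi * (\<xi> \<bullet> x))" for x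
  have cc: "continuous_on UNIV c" unfolding c_def cis_conv_exp by (intro continuous_intros)
  define H where "H x = complex_of_real (g x) * c x" for x
  define D where "D x = complex_of_real (g' x) * c x + complex_of_real (g x) * (2 * pi * (\<xi> \<bullet> b) * \<i> * c x)" for x
  have Hc: "continuous_on UNIV H" unfolding H_def by (intro continuous_intros gc cc)
  have Dc: "continuous_on UNIV D" unfolding D_def g'_def by (intro continuous_intros gc cc cont)
  have [measurable]: "H \<in> borel_measurable borel" "D \<in> borel_measurable borel"
    using Hc Dc by (auto intro: borel_measurable_continuous_onI)
  have H0: "H x = 0" "D x = 0" if "x \<notin> C" for x using C(2,3)[OF that] by (auto simp: H_def D_def g'_def)
  obtain R where R: "R > 0" "\<And>x. x \<in> C \<Longrightarrow> norm x \<le> R" using compact_imp_bounded[OF C(1)] by (auto simp: bounded_pos)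
  have bounded_cs: "\<exists>B. \<forall>x. norm (f x) \<le> B" if "continuous_on UNIV f" "\<And>x. x \<notin> C \<Longrightarrow> f x = 0" for f :: "'a \<Rightarrow> complex"
  proof -
    have "compact (f ` C)" using C(1) that(1) by (intro compact_continuous_image) (auto intro: continuous_on_subset)
    then obtain B where "B > 0" "\<And>x. x \<in> C \<Longrightarrow> norm (f x) \<le> B" using compact_imp_bounded[of "f ` C"] by (auto simp: bounded_pos)
    then have "norm (f x) \<le> B" for x using that(2)[of x] by (cases "x \<in> C") auto
    then show ?thesis by blast
  qed
  have int_cs: "integrable lborel f" if fc: "continuous_on UNIV f" and f0: "\<And>x. x \<notin> C \<Longrightarrow> f x = 0" for f :: "'a \<Rightarrow> complex"
  proof -
    obtain B where B: "\<forall>x. norm (f x) \<le> B" using bounded_cs[OF fc f0] by blast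
    have [measurable]: "f \<in> borel_measurable borel" using fc by (rule borel_measurable_continuous_onI)
    have ib: "integrable lborel (\<lambda>x. B * indicator C x)"
      using emeasure_compact_finite[OF C(1)] C(1) by (intro integrable_mult_right integrable_real_indicator) (auto intro: borel_compact)
    show ?thesis
      by (rule Bochner_Integration.integrable_bound[OF ib]) (use B f0 in \<open>auto simp: indicator_def intro: order_trans[OF _ abs_ge_self]\<close>)
  qed
  obtain B where B: "\<And>x. norm (D x) \<le> B" using bounded_cs[OF Dc H0(2)] by blast
  have B0: "B \<ge> 0" using B[of 0] norm_ge_zero order_trans by blast
  have der: "((\<lambda>t. H (x + t *\<^sub>R b)) has_vector_derivative D (x + t *\<^sub>R b)) (at t)" for x t
  proof -
    have "(g has_derivative frechet_derivative g (at (x + t *\<^sub>R b))) (at (x + t *\<^sub>R b))"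
      using diff frechet_derivative_works by blast
    moreover have "((\<lambda>t. x + t *\<^sub>R b) has_derivative (\<lambda>h. h *\<^sub>R b)) (at t)"
      by (auto intro!: derivative_eq_intros)
    ultimately have "((\<lambda>t. g (x + t *\<^sub>R b)) has_derivative (\<lambda>h. frechet_derivative g (at (x + t *\<^sub>R b)) (h *\<^sub>R b))) (at t)"
      by (rule has_derivative_compose[rotated])
    moreover have "frechet_derivative g (at (x + t *\<^sub>R b)) (h *\<^sub>R b) = h * g' (x + t *\<^sub>R b)" for h
      using linear_frechet_derivative[OF diff[of "x + t *\<^sub>R b"]] by (simp add: g'_def linear_scale)
    ultimately have 1: "((\<lambda>t. g (x + t *\<^sub>R b)) has_vector_derivative g' (x + t *\<^sub>R b)) (at t)"
      by (simp add: has_vector_derivative_def)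
    have "((\<lambda>t. \<i> * complex_of_real (2 * pi * (\<xi> \<bullet> (x + t *\<^sub>R b)))) has_vector_derivative (\<i> * complex_of_real (2 * pi * (\<xi> \<bullet> b)))) (at t)"
      by (auto intro!: derivative_eq_intros simp: has_vector_derivative_def inner_add_right scaleR_conv_of_real algebra_simps)
    then have "(exp \<circ> (\<lambda>t. \<i> * complex_of_real (2 * pi * (\<xi> \<bullet> (x + t *\<^sub>R b)))) has_vector_derivative
       \<i> * complex_of_real (2 * pi * (\<xi> \<bullet> b)) * exp (\<i> * complex_of_real (2 * pi * (\<xi> \<bullet> (x + t *\<^sub>R b))))) (at t)"
      by (rule field_vector_diff_chain_at) (rule DERIV_exp)
    then have "((\<lambda>t. c (x + t *\<^sub>R b)) has_vector_derivative (\<i> * complex_of_real (2 * pi * (\<xi> \<bullet> b)) * c (x + t *\<^sub>R b))) (at t)"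
      by (simp add: c_def cis_conv_exp o_def)
    from has_vector_derivative_mult[OF has_vector_derivative_of_real[OF 1[folded has_real_derivative_iff_has_vector_derivative], where 'a=complex] this]
    show ?thesis unfolding H_def D_def by (simp add: algebra_simps)
  qed
  define a where "a k = 1 / real (Suc k)" for k
  have a: "0 < a k" "a k \<le> 1" for k by (auto simp: a_def)
  have a0: "a \<longlonglongrightarrow> 0" unfolding a_def by (rule LIMSEQ_Suc[OF lim_1_over_n])
  define q where "q k x = (H (x + a k *\<^sub>R b) - H x) / complex_of_real (a k)" for k x
  have Hi: "integrable lborel H" by (rule int_cs[OF Hc H0(1)])
  have Hs: "integrable lborel (\<lambda>x. H (x + a k *\<^sub>R b))" "(LINT x|lborel. H (x + a k *\<^sub>R b)) = (LINT x|lborel. H x)" for k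
    using lborel_integrable_affine[OF Hi, of 1 "a k *\<^sub>R b"] lborel_integral_affine[of H 1 "a k *\<^sub>R b"] by (simp_all add: add.commute)
  have q0: "(LINT x|lborel. q k x) = 0" for k
    unfolding q_def using Hi Hs[of k] by simp
  have mean: "norm (H (x + t *\<^sub>R b) - H x) \<le> B * t" if "t > 0" for x t
  proof -
    have "norm (H (x + t *\<^sub>R b) - H (x + 0 *\<^sub>R b)) \<le> B * norm (t - 0)"
    proof (rule differentiable_bound[where S="{0..t}" and f="\<lambda>t. H (x + t *\<^sub>R b)" and f'="\<lambda>s h. h *\<^sub>R D (x + s *\<^sub>R b)"])
      fix s
      show "((\<lambda>t. H (x + t *\<^sub>R b)) has_derivative (\<lambda>h. h *\<^sub>R D (x + s *\<^sub>R b))) (at s within {0..t})"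
        using der[of x s] by (simp add: has_vector_derivative_def has_derivative_at_withinI)
      show "onorm (\<lambda>h. h *\<^sub>R D (x + s *\<^sub>R b)) \<le> B"
      proof (rule onorm_le)
        fix h :: real
        have "\<bar>h\<bar> * norm (D (x + s *\<^sub>R b)) \<le> \<bar>h\<bar> * B" by (intro mult_left_mono B) simp
        then show "norm (h *\<^sub>R D (x + s *\<^sub>R b)) \<le> B * norm h" by (simp add: mult.commute)
      qed
    qed (use that in auto)
    then show ?thesis using that by simp
  qed
  \<comment> \<open>Since \<open>a k \<le> 1\<close>, the shifts move the support by at most
    \<open>norm b\<close>; all quotients live on one ball, where \<open>mean\<close> bounds them by
    \<open>B\<close>.\<close>
  have "(\<lambda>k. LINT x|lborel. q k x) \<longlonglongrightarrow> (LINT x|lborel. D x)"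
  proof (rule integral_dominated_convergence[where w="\<lambda>x. B * indicator (cball 0 (R + norm b)) x"])
    show "integrable lborel (\<lambda>x. B * indicator (cball 0 (R + norm b)) (x::'a))"
      using emeasure_lborel_cball_finite by (intro integrable_mult_right integrable_real_indicator) auto
    show "AE x in lborel. (\<lambda>k. q k x) \<longlonglongrightarrow> D x"
    proof (rule AE_I2)
      fix x
      have "((\<lambda>t. H (x + t *\<^sub>R b)) has_vector_derivative D x) (at 0)" using der[of x 0] by simp
      then have "((\<lambda>h. norm (H (x + (0 + h) *\<^sub>R b) - H (x + 0 *\<^sub>R b) - h *\<^sub>R D x) / norm h) \<longlongrightarrow> 0) (at 0)"
        unfolding has_vector_derivative_def has_derivative_at by (rule conjunct2)
      moreover have "filterlim a (at 0) sequentially"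
        unfolding filterlim_at using a0 a(1) by (auto intro!: always_eventually simp: less_imp_neq[symmetric])
      ultimately have "(\<lambda>k. norm (H (x + (0 + a k) *\<^sub>R b) - H (x + 0 *\<^sub>R b) - a k *\<^sub>R D x) / norm (a k)) \<longlonglongrightarrow> 0"
        by (rule filterlim_compose)
      moreover have "norm (H (x + (0 + a k) *\<^sub>R b) - H (x + 0 *\<^sub>R b) - a k *\<^sub>R D x) / norm (a k) = norm (q k x - D x)" for k
      proof -
        have "q k x - D x = (H (x + a k *\<^sub>R b) - H x - a k *\<^sub>R D x) / complex_of_real (a k)"
          using a(1)[of k] by (simp add: q_def scaleR_conv_of_real diff_divide_distrib)
        then show ?thesis by (simp add: norm_divide)
      qed
      ultimately have "(\<lambda>k. norm (q k x - D x)) \<longlonglongrightarrow> 0" by simp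
      then show "(\<lambda>k. q k x) \<longlonglongrightarrow> D x" by (simp only: tendsto_norm_zero_iff LIM_zero_iff)
    qed
    show "AE x in lborel. norm (q k x) \<le> B * indicator (cball 0 (R + norm b)) x" for k
    proof (rule AE_I2)
      fix x
      show "norm (q k x) \<le> B * indicator (cball 0 (R + norm b)) x"
      proof (cases "x \<in> cball 0 (R + norm b)")
        case True
        then show ?thesis using mean[OF a(1), of x k] a(1)[of k] by (simp add: q_def norm_divide divide_le_eq)
      next
        case False
        then have n: "norm x > R + norm b" by simp
        have "x \<notin> C" using R(2)[of x] n norm_ge_zero[of b] by linarith
        moreover have "x + a k *\<^sub>R b \<notin> C"
        proof
          assume "x + a k *\<^sub>R b \<in> C"
          then have "norm (x + a k *\<^sub>R b) \<le> R" by (rule R(2))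
          moreover have "norm x - norm (a k *\<^sub>R b) \<le> norm (x + a k *\<^sub>R b)" by (rule norm_diff_ineq)
          moreover have "norm (a k *\<^sub>R b) \<le> norm b" using a[of k] by (simp add: mult_left_le_one_le)
          ultimately show False using n by linarith
        qed
        ultimately show ?thesis using False H0 by (simp add: q_def)
      qed
    qed
  qed (unfold q_def, measurable)
  then have "(\<lambda>k::nat. 0) \<longlonglongrightarrow> (LINT x|lborel. D x)" unfolding q0 .
  from LIMSEQ_unique[OF tendsto_const this] have D0: "(LINT x|lborel. D x) = 0" by (rule sym)
  have i1: "integrable lborel (\<lambda>x. complex_of_real (g' x) * c x)"
    using C(3) by (intro int_cs continuous_intros cc) (auto simp: g'_def cont)
  have i2: "integrable lborel (\<lambda>x. complex_of_real (g x) * c x)"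
    using C(2) by (intro int_cs continuous_intros cc gc) auto
  have "(LINT x|lborel. D x) = (LINT x|lborel. complex_of_real (g' x) * c x) + (2 * pi * (\<xi> \<bullet> b) * \<i>) * (LINT x|lborel. complex_of_real (g x) * c x)"
  proof -
    have "D x = complex_of_real (g' x) * c x + (2 * pi * (\<xi> \<bullet> b) * \<i>) * (complex_of_real (g x) * c x)" for x
      by (simp add: D_def mult_ac)
    then show ?thesis using i1 i2 by simp
  qed
  with D0 show ?thesis
    unfolding ift_def c_def[symmetric] g'_def[symmetric] by (simp add: add_eq_0_iff2)
qed

text \<open>A derivative along \<open>b\<close> multiplies the transform by
  \<open>2 * pi * (\<xi> \<bullet> b)\<close> up to a factor of modulus 1. As the class
  \<open>S\<close> is closed under derivatives, the induction hypothesis applies to the derivative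
  in place of the function.\<close>

lemma ift_decay:
  fixes g :: "'a::euclidean_space \<Rightarrow> real"
  assumes S: "g \<in> S" "\<And>g x. g \<in> S \<Longrightarrow> g differentiable (at x)"
      "\<And>g v. g \<in> S \<Longrightarrow> (\<lambda>x. frechet_derivative g (at x) v) \<in> S"
    and C: "compact C" "\<And>x. x \<notin> C \<Longrightarrow> g x = 0"
  shows "\<exists>B. \<forall>\<xi>. cmod (ift (\<lambda>x. complex_of_real (g x)) \<xi>) * \<bar>\<xi> \<bullet> b\<bar> ^ k \<le> B"
  using S(1) C(2)
proof (induction k arbitrary: g)
  case (0 g)
  have "cmod (ift (\<lambda>x. complex_of_real (g x)) \<xi>) * \<bar>\<xi> \<bullet> b\<bar> ^ 0 \<le> (LINT x|lborel. cmod (complex_of_real (g x)))" for \<xi>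
  proof -
    have "continuous_on UNIV g"
      using S(2)[OF 0(1)] by (intro continuous_at_imp_continuous_on ballI differentiable_imp_continuous_within) auto
    then have "integrable lborel (\<lambda>x. indicator C x *\<^sub>R g x)"
      using C(1) by (intro borel_integrable_compact) (auto intro: continuous_on_subset)
    also have "(\<lambda>x. indicator C x *\<^sub>R g x) = g" using 0(2) by (auto simp: indicator_def fun_eq_iff)
    finally show ?thesis using ift_norm_le[of "\<lambda>x. complex_of_real (g x)" \<xi>] by auto
  qed
  then show ?case by blast
next
  case (Suc k g)
  define g' where "g' x = frechet_derivative g (at x) b" for x
  have g'S: "g' \<in> S" unfolding g'_def by (rule S(3)[OF Suc.prems(1)])
  \<comment> \<open>The complement of \<open>C\<close> is open and the function is 0 on it, so the
    derivative vanishes there as well.\<close>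
  have g'0: "g' x = 0" if "x \<notin> C" for x
  proof -
    have "(g has_derivative (\<lambda>_. 0)) (at x)"
    proof (rule has_derivative_transform_within_open[of "\<lambda>_. 0" _ _ _ "- C"])
      show "open (- C)" using C(1) by (simp add: compact_imp_closed open_Compl)
    qed (use that Suc.prems(2) in auto)
    then have "frechet_derivative g (at x) = (\<lambda>_. 0)" by (rule frechet_derivative_at[symmetric])
    then show ?thesis by (simp add: g'_def)
  qed
  obtain B where B: "\<And>\<xi>. cmod (ift (\<lambda>x. complex_of_real (g' x)) \<xi>) * \<bar>\<xi> \<bullet> b\<bar> ^ k \<le> B"
    using Suc.IH[OF g'S g'0] by blast
  have eq: "ift (\<lambda>x. complex_of_real (g' x)) \<xi> = - (2 * pi * (\<xi> \<bullet> b) * \<i>) * ift (\<lambda>x. complex_of_real (g x)) \<xi>" for \<xi>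
    unfolding g'_def
  proof (rule ift_derivative[OF S(2)[OF Suc.prems(1)] _ C(1) Suc.prems(2)])
    show "continuous_on UNIV (\<lambda>x. frechet_derivative g (at x) b)"
      using S(2)[OF g'S] unfolding g'_def[symmetric]
      by (intro continuous_at_imp_continuous_on ballI differentiable_imp_continuous_within) auto
    show "frechet_derivative g (at x) b = 0" if "x \<notin> C" for x using g'0[OF that] by (simp add: g'_def)
  qed
  have "cmod (ift (\<lambda>x. complex_of_real (g x)) \<xi>) * \<bar>\<xi> \<bullet> b\<bar> ^ Suc k \<le> B" for \<xi>
  proof -
    define z where "z = cmod (ift (\<lambda>x. complex_of_real (g x)) \<xi>) * \<bar>\<xi> \<bullet> b\<bar> ^ Suc k"
    have "z \<ge> 0" by (simp add: z_def)
    then have "1 * z \<le> (2 * pi) * z" using pi_gt3 by (intro mult_right_mono) auto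
    also have "(2 * pi) * z = cmod (ift (\<lambda>x. complex_of_real (g' x)) \<xi>) * \<bar>\<xi> \<bullet> b\<bar> ^ k"
      unfolding eq z_def by (simp add: norm_mult mult_ac)
    also have "\<dots> \<le> B" by (rule B)
    finally show ?thesis by (simp add: z_def)
  qed
  then show ?case by blast
qed

text \<open>The power is one more than the dimension, the case \<open>\<beta> = 1\<close> of
  \<open>far_integral\<close>; the bound \<open>A\<close> serves the unit ball.\<close>

lemma integrable_of_decay:
  fixes f :: "'a::euclidean_space \<Rightarrow> real"
  assumes [measurable]: "f \<in> borel_measurable borel" and b: "\<And>x. \<bar>f x\<bar> \<le> A" "\<And>x. \<bar>f x\<bar> * norm x ^ Suc DIM('a) \<le> B"
  shows "integrable lborel f"
proof -
  interpret upper_regular "lborel :: 'a measure" "real DIM('a)" "unit_ball_vol (real DIM('a))"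
    by (rule upper_regular_lborel)
  have B: "A \<ge> 0" "B \<ge> 0"
    using b(1)[of 0] b(2)[of 0] by (auto intro: order_trans[OF abs_ge_zero] order_trans[rotated])
  have "(\<integral>\<^sup>+x. ennreal (norm (f x)) \<partial>lborel) \<le> (\<integral>\<^sup>+(x::'a). ennreal A * indicator (cball 0 1) x +
      ennreal B * (indicator (- cball 0 1) x * ennreal (norm (x - 0) powr (- 1 - real DIM('a)))) \<partial>lborel)"
  proof (rule nn_integral_mono)
    fix x :: 'a
    show "ennreal (norm (f x)) \<le> ennreal A * indicator (cball 0 1) x +
      ennreal B * (indicator (- cball 0 1) x * ennreal (norm (x - 0) powr (- 1 - real DIM('a))))"
    proof (cases "norm x \<le> 1")
      case True
      then show ?thesis using b(1)[of x] by (simp add: ennreal_leI)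
    next
      case False
      then have n: "norm x > 0" by linarith
      have "norm x powr (- 1 - real DIM('a)) = 1 / norm x ^ Suc DIM('a)"
      proof -
        have "norm x powr (- 1 - real DIM('a)) = norm x powr (- real (Suc DIM('a)))" by simp
        also have "\<dots> = 1 / norm x ^ Suc DIM('a)" unfolding powr_minus_divide powr_realpow[OF n] ..
        finally show ?thesis .
      qed
      then have "\<bar>f x\<bar> \<le> B * norm x powr (- 1 - real DIM('a))"
        using b(2)[of x] n by (simp add: pos_le_divide_eq del: power_Suc)
      then show ?thesis using False B by (simp add: ennreal_leI flip: ennreal_mult)
    qed
  qed
  also have "\<dots> = ennreal A * emeasure lborel (cball (0::'a) 1) + ennreal B * (\<integral>\<^sup>+x. indicator (- cball 0 1) x * ennreal (norm ((x::'a) - 0) powr (- 1 - real DIM('a))) \<partial>lborel)"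
    by (subst nn_integral_add, measurable, subst nn_integral_cmult_indicator, simp, subst nn_integral_cmult) measurable
  also have "\<dots> < \<infinity>"
    using far_integral[of 1 1 0] emeasure_lborel_cball_finite[of "0::'a" 1]
    by (auto simp: ennreal_mult_less_top ennreal_add_less_top intro: order_le_less_trans)
  finally show ?thesis by (simp add: integrable_iff_bounded)
qed

locale test_function =
  fixes \<psi> :: "'a::euclidean_space \<Rightarrow> real"
  assumes test: "test_fun UNIV \<psi>"
begin

definition f :: "'a \<Rightarrow> complex" where "f x = complex_of_real (\<psi> x)"

lemma smooth_class:
  "\<exists>S. \<psi> \<in> S \<and> (\<forall>g\<in>S. \<forall>x. g differentiable (at x)) \<and> (\<forall>g\<in>S. \<forall>v. (\<lambda>x. frechet_derivative g (at x) v) \<in> S)"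
  using test by (simp only: test_fun_def smooth_fun_def)

lemma \<psi>_continuous: "continuous_on UNIV \<psi>"
proof -
  obtain S where S0: "\<psi> \<in> S" "\<forall>g\<in>S. \<forall>x. g differentiable (at x)"
    "\<forall>g\<in>S. \<forall>v. (\<lambda>x. frechet_derivative g (at x) v) \<in> S"
    using smooth_class by (elim exE conjE) (rule that)
  have "\<psi> differentiable (at x)" for x by (rule S0(2)[rule_format, OF S0(1)])
  then show ?thesis by (intro continuous_at_imp_continuous_on ballI differentiable_imp_continuous_within) auto
qed

lemma f_continuous: "continuous_on UNIV f"
  unfolding f_def by (intro continuous_intros \<psi>_continuous)

lemma f_measurable [measurable]: "f \<in> borel_measurable borel"
  by (rule borel_measurable_continuous_onI[OF f_continuous])

lemma compact_support: "compact (tsupport \<psi>)" using test by (simp add: test_fun_def)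

lemma f_zero: "x \<notin> tsupport \<psi> \<Longrightarrow> f x = 0"
  using closure_subset[of "{x. \<psi> x \<noteq> 0}"] by (auto simp: tsupport_def f_def)

lemma f_integrable: "integrable lborel f"
proof -
  have "integrable lborel (\<lambda>x. indicator (tsupport \<psi>) x *\<^sub>R f x)"
    using compact_support f_continuous by (intro borel_integrable_compact) (auto intro: continuous_on_subset)
  also have "(\<lambda>x. indicator (tsupport \<psi>) x *\<^sub>R f x) = f" using f_zero by (auto simp: indicator_def fun_eq_iff)
  finally show ?thesis .
qed

lemma f_bounded: obtains B where "\<And>x. cmod (f x) \<le> B"
proof -
  have "compact (f ` tsupport \<psi>)" using compact_support f_continuous by (intro compact_continuous_image) (auto intro: continuous_on_subset)
  then obtain B where B: "B > 0" "\<And>x. x \<in> tsupport \<psi> \<Longrightarrow> norm (f x) \<le> B" using compact_imp_bounded[of "f ` tsupport \<psi>"] by (auto simp: bounded_pos)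
  have "cmod (f x) \<le> B" for x using B f_zero[of x] by (cases "x \<in> tsupport \<psi>") auto
  then show ?thesis using that by blast
qed

text \<open>The norm is at most \<open>DIM('a)\<close> times the largest coordinate, so the decay
  along the finitely many basis vectors suffices.\<close>

lemma ift_f_decay: "\<exists>B. \<forall>\<xi>. cmod (ift f \<xi>) * norm \<xi> ^ N \<le> B"
proof -
  obtain S where S0: "\<psi> \<in> S" "\<forall>g\<in>S. \<forall>x. g differentiable (at x)"
    "\<forall>g\<in>S. \<forall>v. (\<lambda>x. frechet_derivative g (at x) v) \<in> S"
    using smooth_class by (elim exE conjE) (rule that)
  note S = S0(1) S0(2)[rule_format] S0(3)[rule_format]
  have z: "\<psi> x = 0" if "x \<notin> tsupport \<psi>" for x using f_zero[OF that] by (simp add: f_def)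
  have "\<forall>b. \<exists>B. \<forall>\<xi>. cmod (ift f \<xi>) * \<bar>\<xi> \<bullet> b\<bar> ^ N \<le> B"
  proof
    fix b
    show "\<exists>B. \<forall>\<xi>. cmod (ift f \<xi>) * \<bar>\<xi> \<bullet> b\<bar> ^ N \<le> B"
      unfolding f_def[abs_def] by (rule ift_decay[OF S compact_support z])
  qed
  then obtain B where B: "\<And>b \<xi>. cmod (ift f \<xi>) * \<bar>\<xi> \<bullet> b\<bar> ^ N \<le> B b" by metis
  have "cmod (ift f \<xi>) * norm \<xi> ^ N \<le> real DIM('a) ^ N * (\<Sum>b\<in>Basis. B b)" for \<xi>
  proof -
    have "Max ((\<lambda>c. \<bar>\<xi> \<bullet> c\<bar>) ` Basis) \<in> (\<lambda>c. \<bar>\<xi> \<bullet> c\<bar>) ` Basis" by (rule Max_in) auto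
    then obtain b where b: "Max ((\<lambda>c. \<bar>\<xi> \<bullet> c\<bar>) ` Basis) = \<bar>\<xi> \<bullet> b\<bar>" "b \<in> Basis" by (rule imageE)
    have b': "\<bar>\<xi> \<bullet> c\<bar> \<le> \<bar>\<xi> \<bullet> b\<bar>" if "c \<in> Basis" for c
      unfolding b(1)[symmetric] using that by (intro Max_ge) auto
    have "norm \<xi> \<le> (\<Sum>c\<in>Basis. \<bar>\<xi> \<bullet> c\<bar>)" by (rule norm_le_l1)
    also have "\<dots> \<le> (\<Sum>c\<in>(Basis::'a set). \<bar>\<xi> \<bullet> b\<bar>)" by (intro sum_mono b')
    finally have "norm \<xi> ^ N \<le> (real DIM('a) * \<bar>\<xi> \<bullet> b\<bar>) ^ N" by (intro power_mono) auto
    then have "cmod (ift f \<xi>) * norm \<xi> ^ N \<le> cmod (ift f \<xi>) * (real DIM('a) * \<bar>\<xi> \<bullet> b\<bar>) ^ N" by (intro mult_left_mono) auto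
    also have "\<dots> = real DIM('a) ^ N * (cmod (ift f \<xi>) * \<bar>\<xi> \<bullet> b\<bar> ^ N)" by (simp add: power_mult_distrib)
    also have "\<dots> \<le> real DIM('a) ^ N * B b" by (intro mult_left_mono B) auto
    also have "B b \<le> (\<Sum>b\<in>Basis. B b)"
    proof (rule member_le_sum[OF b(2)])
      show "0 \<le> B c" for c using B[of 0 c] by (rule order_trans[rotated]) simp
    qed simp
    finally show ?thesis by (simp add: mult_left_mono)
  qed
  then show ?thesis by blast
qed

text \<open>The first two are what \<open>\<Phi>_integral\<close> asks for, the first and the third
  what \<open>pairing_LIMSEQ\<close> asks for.\<close>

lemma ift_f_integrable:
  "integrable lborel (ift f)" "integrable lborel (\<lambda>\<xi>. cmod (ift f \<xi>) * norm \<xi>)" "integrable lborel (\<lambda>\<xi>. (cmod (ift f \<xi>))\<^sup>2)"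
proof -
  let ?n = "DIM('a)"
  have [measurable]: "ift f \<in> borel_measurable borel" by measurable
  obtain B0 where B0: "\<And>\<xi>. cmod (ift f \<xi>) * norm \<xi> ^ 0 \<le> B0" using ift_f_decay[of 0] by (elim exE) (rule that, blast)
  obtain B1 where B1: "\<And>\<xi>. cmod (ift f \<xi>) * norm \<xi> ^ 1 \<le> B1" using ift_f_decay[of 1] by blast
  obtain B2 where B2: "\<And>\<xi>. cmod (ift f \<xi>) * norm \<xi> ^ Suc ?n \<le> B2" using ift_f_decay[of "Suc ?n"] by blast
  obtain B3 where B3: "\<And>\<xi>. cmod (ift f \<xi>) * norm \<xi> ^ Suc (Suc ?n) \<le> B3" using ift_f_decay[of "Suc (Suc ?n)"] by blast
  have n: "integrable lborel (\<lambda>\<xi>. cmod (ift f \<xi>))"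
    by (rule integrable_of_decay[where A=B0 and B=B2]) (use B0 B2 in auto)
  then show "integrable lborel (ift f)" by (subst integrable_norm_iff[symmetric]) auto
  show "integrable lborel (\<lambda>\<xi>. cmod (ift f \<xi>) * norm \<xi>)"
    by (rule integrable_of_decay[where A=B1 and B=B3]) (use B1 B3 in \<open>auto simp: mult.assoc\<close>)
  show "integrable lborel (\<lambda>\<xi>. (cmod (ift f \<xi>))\<^sup>2)"
  proof (rule Bochner_Integration.integrable_bound[where f="\<lambda>\<xi>. B0 * cmod (ift f \<xi>)"])
    show "AE \<xi> in lborel. norm ((cmod (ift f \<xi>))\<^sup>2) \<le> norm (B0 * cmod (ift f \<xi>))"
    proof (rule AE_I2)
      fix \<xi>
      have "cmod (ift f \<xi>) * cmod (ift f \<xi>) \<le> B0 * cmod (ift f \<xi>)" using B0[of \<xi>] by (intro mult_right_mono) auto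
      then show "norm ((cmod (ift f \<xi>))\<^sup>2) \<le> norm (B0 * cmod (ift f \<xi>))"
        by (simp add: power2_eq_square)
    qed
  qed (use n in auto)
qed

lemma fourier_f: "fourier (\<lambda>y. complex_of_real (\<psi> y)) \<xi> = cnj (ift f \<xi>)"
proof -
  have "fourier (\<lambda>y. complex_of_real (\<psi> y)) \<xi> = (LINT x|lborel. f x * cis (- 2 * pi * (x \<bullet> \<xi>)))"
    unfolding fourier_def f_def[symmetric] by (rule integral_completion) measurable
  also have "\<dots> = (LINT x|lborel. cnj (f x * cis (2 * pi * (\<xi> \<bullet> x))))"
    by (intro Bochner_Integration.integral_cong refl) (simp add: f_def cis_cnj inner_commute)
  also have "\<dots> = cnj (ift f \<xi>)" unfolding ift_def by (rule Bochner_Integration.integral_cnj)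
  finally show ?thesis .
qed

lemma inversion: "(LINT \<xi>|lborel. ift f \<xi> * character \<xi> Q) = f Q"
proof -
  obtain B where B: "\<And>x. cmod (f x) \<le> B" using f_bounded by blast
  have "(LINT \<xi>|lborel. cis (- (2 * pi * (\<xi> \<bullet> Q))) * ift f \<xi>) = f Q"
    using f_continuous by (intro ift_inversion[OF f_integrable ift_f_integrable(1) _ B]) (auto simp: continuous_on_eq_continuous_at)
  then show ?thesis by (simp add: character_def inner_commute mult.commute)
qed

lemma ift_fourier_f: "ift (\<lambda>x. cnj (ift f x)) \<xi> = f \<xi>"
proof -
  have "ift (\<lambda>x. cnj (ift f x)) \<xi> = (LINT x|lborel. cnj (ift f x * character x \<xi>))"
    unfolding ift_def by (intro Bochner_Integration.integral_cong refl) (simp add: character_def cis_cnj)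
  also have "\<dots> = cnj (f \<xi>)" by (subst Bochner_Integration.integral_cnj) (simp only: inversion)
  finally show ?thesis by (simp add: f_def)
qed

end

section \<open>Energy of the boundary functional\<close>

text \<open>Elements of the dual space act on real functions while characters are complex; this is
  the complex linear extension.\<close>

definition complexify :: "(('a \<Rightarrow> real) \<Rightarrow> real) \<Rightarrow> ('a \<Rightarrow> complex) \<Rightarrow> complex" where
  "complexify \<phi> f = complex_of_real (\<phi> (\<lambda>Q. Re (f Q))) + \<i> * complex_of_real (\<phi> (\<lambda>Q. Im (f Q)))"

text \<open>Real and imaginary parts do not increase distances, so the two integrals in the complex
  trace inequality bound the two parts of \<open>Hnorm\<close>.\<close>

lemma Hnorm_ift_le:
  fixes \<Omega> :: "'a::euclidean_space set"
  assumes dom: "bounded_lipschitz_domain \<Omega>" "DIM('a) \<ge> 2" and \<alpha>: "0 < \<alpha>" "\<alpha> < 1/2"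
  obtains A where "A \<ge> 0"
    "\<And>J W r. integrable lborel W \<Longrightarrow> (\<And>\<xi>. W \<xi> \<noteq> 0 \<Longrightarrow> 1 \<le> norm \<xi> \<and> norm \<xi> < 2 ^ J) \<Longrightarrow>
       (\<integral>\<^sup>+\<xi>. ennreal (norm \<xi> powr (1 + 2 * \<alpha>) * (cmod (W \<xi>))\<^sup>2) \<partial>lborel) \<le> ennreal r \<Longrightarrow> 0 \<le> r \<Longrightarrow>
       Hnorm \<alpha> \<Omega> (\<lambda>P. Re (ift W P)) \<le> A * sqrt r \<and> Hnorm \<alpha> \<Omega> (\<lambda>P. Im (ift W P)) \<le> A * sqrt r"
proof -
  let ?\<sigma> = "boundary_measure \<Omega>" and ?d = "real DIM('a) - 1"
  obtain C where reg: "upper_regular ?\<sigma> ?d C" using upper_regular_boundary_measure[OF dom] .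
  interpret upper_regular ?\<sigma> ?d C by (rule reg)
  obtain A where A: "A \<ge> 0"
    and tr: "\<And>J W. integrable lborel W \<Longrightarrow> (\<And>\<xi>. W \<xi> \<noteq> 0 \<Longrightarrow> 1 \<le> norm \<xi> \<and> norm \<xi> < 2 ^ J) \<Longrightarrow>
       (\<integral>\<^sup>+P. ennreal ((cmod (ift W P))\<^sup>2) \<partial>?\<sigma>) +
       (\<integral>\<^sup>+P. \<integral>\<^sup>+Q. ennreal ((cmod (ift W P - ift W Q))\<^sup>2 / norm (P - Q) powr (?d + 2 * \<alpha>)) \<partial>?\<sigma> \<partial>?\<sigma>)
       \<le> ennreal A * (\<integral>\<^sup>+\<xi>. ennreal (norm \<xi> powr (1 + 2 * \<alpha>) * (cmod (W \<xi>))\<^sup>2) \<partial>lborel)"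
    by (rule trace_inequality[OF \<alpha> refl]) blast
  show ?thesis
  proof (rule that[of "sqrt A"])
    show "sqrt A \<ge> 0" using A by simp
    fix J and W :: "'a \<Rightarrow> complex" and r
    assume W: "integrable lborel W" and supp: "\<And>\<xi>. W \<xi> \<noteq> 0 \<Longrightarrow> 1 \<le> norm \<xi> \<and> norm \<xi> < 2 ^ J"
      and r: "(\<integral>\<^sup>+\<xi>. ennreal (norm \<xi> powr (1 + 2 * \<alpha>) * (cmod (W \<xi>))\<^sup>2) \<partial>lborel) \<le> ennreal r" "0 \<le> r"
    have [measurable]: "W \<in> borel_measurable borel" using W by auto
    define L where "L = (\<integral>\<^sup>+P. ennreal ((cmod (ift W P))\<^sup>2) \<partial>?\<sigma>)"
    define S where "S = (\<integral>\<^sup>+P. \<integral>\<^sup>+Q. ennreal ((cmod (ift W P - ift W Q))\<^sup>2 / norm (P - Q) powr (?d + 2 * \<alpha>)) \<partial>?\<sigma> \<partial>?\<sigma>)"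
    have LS: "L + S \<le> ennreal (A * r)"
    proof -
      have "L + S \<le> ennreal A * (\<integral>\<^sup>+\<xi>. ennreal (norm \<xi> powr (1 + 2 * \<alpha>) * (cmod (W \<xi>))\<^sup>2) \<partial>lborel)"
        unfolding L_def S_def by (rule tr[OF W supp])
      also have "\<dots> \<le> ennreal A * ennreal r" by (intro mult_left_mono r) auto
      finally show ?thesis using A r by (simp add: ennreal_mult)
    qed
    \<comment> \<open>\<open>p\<close> stands for \<open>Re\<close> and for
      \<open>Im\<close>.\<close>
    have *: "Hnorm \<alpha> \<Omega> (\<lambda>P. p (ift W P)) \<le> sqrt A * sqrt r"
      if p: "\<And>z w. \<bar>p z - p w\<bar> \<le> cmod (z - w)" "\<And>z. \<bar>p z\<bar> \<le> cmod z" and [measurable]: "p \<in> borel_measurable borel" for p :: "complex \<Rightarrow> real"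
    proof -
      have 1: "bdry_L2sq \<Omega> (\<lambda>P. p (ift W P)) \<le> L"
      proof -
        have "bdry_L2sq \<Omega> (\<lambda>P. p (ift W P)) = (\<integral>\<^sup>+Q. ennreal ((p (ift W Q))\<^sup>2) \<partial>?\<sigma>)"
          unfolding bdry_L2sq_def by (rule nn_integral_surf) measurable
        also have "\<dots> \<le> L" unfolding L_def
          using p(2) by (intro nn_integral_mono ennreal_leI) (simp add: abs_le_square_iff[symmetric])
        finally show ?thesis .
      qed
      have 2: "bdry_seminormsq \<alpha> \<Omega> (\<lambda>P. p (ift W P)) \<le> S"
      proof -
        have i: "(\<integral>\<^sup>+Q. ennreal ((p (ift W P) - p (ift W Q))\<^sup>2 / norm (P - Q) powr (?d + 2 * \<alpha>)) \<partial>surf \<Omega>)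
           = (\<integral>\<^sup>+Q. ennreal ((p (ift W P) - p (ift W Q))\<^sup>2 / norm (P - Q) powr (?d + 2 * \<alpha>)) \<partial>?\<sigma>)" for P
          by (rule nn_integral_surf) measurable
        have "bdry_seminormsq \<alpha> \<Omega> (\<lambda>P. p (ift W P)) = (\<integral>\<^sup>+P. \<integral>\<^sup>+Q. ennreal ((p (ift W P) - p (ift W Q))\<^sup>2 / norm (P - Q) powr (?d + 2 * \<alpha>)) \<partial>?\<sigma> \<partial>?\<sigma>)"
          unfolding bdry_seminormsq_def i by (rule nn_integral_surf) measurable
        also have "\<dots> \<le> S" unfolding S_def
          using p(1) by (intro nn_integral_mono ennreal_leI divide_right_mono) (auto simp: abs_le_square_iff[symmetric])
        finally show ?thesis .
      qed
      have le: "bdry_L2sq \<Omega> (\<lambda>P. p (ift W P)) + bdry_seminormsq \<alpha> \<Omega> (\<lambda>P. p (ift W P)) \<le> ennreal (A * r)"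
        using add_mono[OF 1 2] LS by (rule order_trans)
      have fin: "bdry_L2sq \<Omega> (\<lambda>P. p (ift W P)) + bdry_seminormsq \<alpha> \<Omega> (\<lambda>P. p (ift W P)) < top"
        by (rule order_le_less_trans[OF le ennreal_less_top])
      have "A * r \<ge> 0" using A r by simp
      with le have "enn2real (bdry_L2sq \<Omega> (\<lambda>P. p (ift W P)) + bdry_seminormsq \<alpha> \<Omega> (\<lambda>P. p (ift W P))) \<le> A * r"
        by (intro enn2real_leI)
      then have "enn2real (bdry_L2sq \<Omega> (\<lambda>P. p (ift W P))) + enn2real (bdry_seminormsq \<alpha> \<Omega> (\<lambda>P. p (ift W P))) \<le> A * r"
        using fin by (subst enn2real_plus[symmetric]) (auto simp: ennreal_add_less_top)
      then show ?thesis unfolding Hnorm_def real_sqrt_mult[symmetric] by (rule real_sqrt_le_mono)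
    qed
    have "\<bar>Re z - Re w\<bar> \<le> cmod (z - w)" "\<bar>Im z - Im w\<bar> \<le> cmod (z - w)" for z w
      using abs_Re_le_cmod[of "z - w"] abs_Im_le_cmod[of "z - w"] by auto
    then show "Hnorm \<alpha> \<Omega> (\<lambda>P. Re (ift W P)) \<le> sqrt A * sqrt r \<and> Hnorm \<alpha> \<Omega> (\<lambda>P. Im (ift W P)) \<le> sqrt A * sqrt r"
      by (intro conjI *) (auto intro: abs_Re_le_cmod abs_Im_le_cmod)
  qed
qed

text \<open>What the proof retains of the given functional on the boundary: linearity, continuity on Lipschitz functions
  and finite energy. The bound on \<open>hat\<close> makes low frequencies harmless, so the energy only
  involves \<open>norm \<xi> \<ge> 1\<close>.\<close>

locale energy_functional = lip_functional F \<Phi> K R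
  for F :: "'a::euclidean_space set" and \<Phi> K R +
  fixes s :: real
  assumes s: "0 < s" "2 * s < real DIM('a)"
    and F_closed: "closed F" and F_null: "F \<in> null_sets lborel"
    and energy: "(\<integral>\<^sup>+\<xi>. ennreal (norm \<xi> powr (- (2 * s)) * (cmod (hat \<xi>))\<^sup>2) * indicator (- ball 0 1) \<xi> \<partial>lborel) < \<infinity>"

text \<open>Membership in the dual space is converted into the data used afterwards. The range of
  \<open>s\<close> gives \<open>0 < \<alpha> < 1/2\<close>, as the trace inequality demands, and
  together with \<open>DIM('a) \<ge> 2\<close> also \<open>2 * s < DIM('a)\<close>.\<close>

lemma energy_functional_of_Hdual:
  fixes \<Omega> :: "'a::euclidean_space set" and s :: real
  assumes n: "DIM('a) \<ge> 2" and dom: "bounded_lipschitz_domain \<Omega>" and s: "1/2 < s" "s < 1"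
    and \<phi>: "\<phi> \<in> Hdual (s - 1/2) \<Omega>"
  obtains K R where "energy_functional (frontier \<Omega>) (complexify \<phi>) K R s"
proof -
  let ?F = "frontier \<Omega>"
  define \<alpha> where "\<alpha> = s - 1/2"
  have \<alpha>: "0 < \<alpha>" "\<alpha> < 1/2" "\<alpha> < 1" "1 + 2 * \<alpha> = 2 * s" using s by (auto simp: \<alpha>_def)
  have comp: "compact ?F" using dom by (auto simp: bounded_lipschitz_domain_def intro: compact_frontier_bounded)
  then have "bounded ?F" by (rule compact_imp_bounded)
  then obtain R where R: "R > 0" "\<And>x. x \<in> ?F \<Longrightarrow> norm x \<le> R" by (auto simp: bounded_pos)
  obtain K1 where K1: "K1 \<ge> 0"
    "\<And>f A L. f \<in> borel_measurable borel \<Longrightarrow> 0 \<le> A \<Longrightarrow> 0 \<le> L \<Longrightarrow> (\<And>P. P \<in> ?F \<Longrightarrow> \<bar>f P\<bar> \<le> A) \<Longrightarrow>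
       (\<And>P Q. P \<in> ?F \<Longrightarrow> Q \<in> ?F \<Longrightarrow> \<bar>f P - f Q\<bar> \<le> L * norm (P - Q)) \<Longrightarrow>
       f \<in> Hspace \<alpha> \<Omega> \<and> Hnorm \<alpha> \<Omega> f \<le> K1 * (A + L)"
    by (rule lipschitz_in_Hspace[OF dom n \<alpha>(1,3)]) blast
  have add: "\<And>f g. f \<in> Hspace \<alpha> \<Omega> \<Longrightarrow> g \<in> Hspace \<alpha> \<Omega> \<Longrightarrow> \<phi> (\<lambda>x. f x + g x) = \<phi> f + \<phi> g"
    and scale: "\<And>f c. f \<in> Hspace \<alpha> \<Omega> \<Longrightarrow> \<phi> (\<lambda>x. c * f x) = c * \<phi> f"
    using \<phi> by (auto simp: Hdual_def \<alpha>_def)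
  have "\<exists>C. \<forall>f\<in>Hspace \<alpha> \<Omega>. \<bar>\<phi> f\<bar> \<le> C * Hnorm \<alpha> \<Omega> f"
    using \<phi> by (simp add: Hdual_def \<alpha>_def)
  then obtain C0 where C0: "\<forall>f\<in>Hspace \<alpha> \<Omega>. \<bar>\<phi> f\<bar> \<le> C0 * Hnorm \<alpha> \<Omega> f" by (rule exE)
  \<comment> \<open>The constant in the definition of the dual comes without a sign; its absolute
    value makes the bound monotone.\<close>
  define C where "C = \<bar>C0\<bar>"
  have C: "C \<ge> 0" by (simp add: C_def)
  have \<phi>_bound: "\<bar>\<phi> f\<bar> \<le> C * Hnorm \<alpha> \<Omega> f" if "f \<in> Hspace \<alpha> \<Omega>" for f
  proof -
    have "Hnorm \<alpha> \<Omega> f \<ge> 0" by (simp add: Hnorm_def)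
    then have "C0 * Hnorm \<alpha> \<Omega> f \<le> C * Hnorm \<alpha> \<Omega> f" by (intro mult_right_mono) (auto simp: C_def)
    then show ?thesis using C0 that by fastforce
  qed
  have mem: "(\<lambda>Q. Re (f Q)) \<in> Hspace \<alpha> \<Omega> \<and> Hnorm \<alpha> \<Omega> (\<lambda>Q. Re (f Q)) \<le> K1 * (A + L)"
    "(\<lambda>Q. Im (f Q)) \<in> Hspace \<alpha> \<Omega> \<and> Hnorm \<alpha> \<Omega> (\<lambda>Q. Im (f Q)) \<le> K1 * (A + L)" if "lip_on ?F f A L" for f A L
  proof -
    have f: "f \<in> borel_measurable borel" "0 \<le> A" "0 \<le> L" "\<And>P. P \<in> ?F \<Longrightarrow> cmod (f P) \<le> A"
      "\<And>P Q. P \<in> ?F \<Longrightarrow> Q \<in> ?F \<Longrightarrow> cmod (f P - f Q) \<le> L * norm (P - Q)"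
      using that by (auto simp: lip_on_def)
    have ReD: "\<bar>Re (f P) - Re (f Q)\<bar> \<le> cmod (f P - f Q)" "\<bar>Im (f P) - Im (f Q)\<bar> \<le> cmod (f P - f Q)" for P Q
      using abs_Re_le_cmod[of "f P - f Q"] abs_Im_le_cmod[of "f P - f Q"] by auto
    note [measurable] = f(1)
    show "(\<lambda>Q. Re (f Q)) \<in> Hspace \<alpha> \<Omega> \<and> Hnorm \<alpha> \<Omega> (\<lambda>Q. Re (f Q)) \<le> K1 * (A + L)"
      by (rule K1(2)) (auto intro: f order_trans[OF abs_Re_le_cmod] order_trans[OF ReD(1)])
    show "(\<lambda>Q. Im (f Q)) \<in> Hspace \<alpha> \<Omega> \<and> Hnorm \<alpha> \<Omega> (\<lambda>Q. Im (f Q)) \<le> K1 * (A + L)"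
      by (rule K1(2)) (auto intro: f order_trans[OF abs_Im_le_cmod] order_trans[OF ReD(2)])
  qed
  \<comment> \<open>Scalar multiples are placed in \<open>Hspace\<close> through \<open>mem\<close>,
    applied to the scaled complex Lipschitz function.\<close>
  have sc: "(\<lambda>x. c * f x) \<in> Hspace \<alpha> \<Omega>" if "(\<lambda>x. f x) = (\<lambda>x. Re (g x)) \<or> (\<lambda>x. f x) = (\<lambda>x. Im (g x))" "lip_on ?F g A L" for c :: real and f g A L
  proof -
    have "lip_on ?F (\<lambda>x. complex_of_real c * g x) (\<bar>c\<bar> * A) (\<bar>c\<bar> * L)"
      using that(2) unfolding lip_on_def
      by (auto simp: norm_mult mult_left_mono mult.assoc simp flip: right_diff_distrib)
    from mem[OF this] show ?thesis using that(1) by (auto dest: fun_cong)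
  qed
  have lipf: "lip_functional ?F (complexify \<phi>) (2 * C * K1) R"
  proof
    show "0 \<le> 2 * C * K1" using C K1(1) by simp
    fix f g :: "'a \<Rightarrow> complex" and A L A' L'
    assume f: "lip_on ?F f A L" and g: "lip_on ?F g A' L'"
    show "complexify \<phi> (\<lambda>x. f x + g x) = complexify \<phi> f + complexify \<phi> g"
      unfolding complexify_def using mem(1)[OF f] mem(2)[OF f] mem(1)[OF g] mem(2)[OF g] by (simp add: add algebra_simps)
  next
    fix f :: "'a \<Rightarrow> complex" and A L c
    assume f: "lip_on ?F f A L"
    have m: "(\<lambda>x. r * Re (f x)) \<in> Hspace \<alpha> \<Omega>" "(\<lambda>x. r * Im (f x)) \<in> Hspace \<alpha> \<Omega>" for r
      by (rule sc[OF _ f], simp)+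
    have "\<phi> (\<lambda>x. Re (c * f x)) = \<phi> (\<lambda>x. Re c * Re (f x) + (- Im c) * Im (f x))"
      "\<phi> (\<lambda>x. Im (c * f x)) = \<phi> (\<lambda>x. Re c * Im (f x) + Im c * Re (f x))"
      by (simp_all add: algebra_simps)
    then have "\<phi> (\<lambda>x. Re (c * f x)) = Re c * \<phi> (\<lambda>x. Re (f x)) + (- Im c) * \<phi> (\<lambda>x. Im (f x))"
      "\<phi> (\<lambda>x. Im (c * f x)) = Re c * \<phi> (\<lambda>x. Im (f x)) + Im c * \<phi> (\<lambda>x. Re (f x))"
      unfolding add[OF m(1)[of "Re c"] m(2)[of "- Im c"]] add[OF m(2)[of "Re c"] m(1)[of "Im c"]]
        scale[OF conjunct1[OF mem(1)[OF f]]] scale[OF conjunct1[OF mem(2)[OF f]]] by (simp_all only:)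
    then show "complexify \<phi> (\<lambda>x. c * f x) = c * complexify \<phi> f"
      unfolding complexify_def by (simp add: complex_eq_iff)
  next
    fix f :: "'a \<Rightarrow> complex" and A L
    assume f: "lip_on ?F f A L"
    have "cmod (complexify \<phi> f) \<le> \<bar>\<phi> (\<lambda>Q. Re (f Q))\<bar> + \<bar>\<phi> (\<lambda>Q. Im (f Q))\<bar>"
      unfolding complexify_def by (rule order_trans[OF norm_triangle_ineq]) (simp add: norm_mult)
    also have "\<dots> \<le> C * (K1 * (A + L)) + C * (K1 * (A + L))"
      using mem[OF f] C by (intro add_mono order_trans[OF \<phi>_bound] mult_left_mono) auto
    finally show "cmod (complexify \<phi> f) \<le> 2 * C * K1 * (A + L)" by (simp add: algebra_simps)
  qed (use R in auto)
  interpret lip_functional ?F "complexify \<phi>" "2 * C * K1" R by (rule lipf)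
  obtain T where T: "T \<ge> 0"
    "\<And>J W r. integrable lborel W \<Longrightarrow> (\<And>\<xi>. W \<xi> \<noteq> 0 \<Longrightarrow> 1 \<le> norm \<xi> \<and> norm \<xi> < 2 ^ J) \<Longrightarrow>
       (\<integral>\<^sup>+\<xi>. ennreal (norm \<xi> powr (1 + 2 * \<alpha>) * (cmod (W \<xi>))\<^sup>2) \<partial>lborel) \<le> ennreal r \<Longrightarrow> 0 \<le> r \<Longrightarrow>
       Hnorm \<alpha> \<Omega> (\<lambda>P. Re (ift W P)) \<le> T * sqrt r \<and> Hnorm \<alpha> \<Omega> (\<lambda>P. Im (ift W P)) \<le> T * sqrt r"
    by (rule Hnorm_ift_le[OF dom n \<alpha>(1,2)]) blast
  define E where "E J \<xi> = (if 1 \<le> norm \<xi> \<and> norm \<xi> < 2 ^ J then norm \<xi> powr (- (2 * s)) * (cmod (hat \<xi>))\<^sup>2 else 0)" for J :: nat and \<xi>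
  have [measurable]: "E J \<in> borel_measurable borel" for J unfolding E_def by measurable
  have E0: "E J \<xi> \<ge> 0" for J \<xi> by (simp add: E_def)
  define B where "B = (2 * C * T)\<^sup>2"
  text \<open>Testing the functional against the function whose transform is its own weighted transform turns the energy
    into a value of the functional, which the trace inequality bounds by the square root of the energy.\<close>
  have bound: "(\<integral>\<^sup>+\<xi>. ennreal (E J \<xi>) \<partial>lborel) \<le> ennreal B" for J
  proof -
    \<comment> \<open>The weighted conjugate of \<open>hat\<close> on the shell, so that
      \<open>m \<xi> * hat \<xi>\<close> is the energy density.\<close>
    define m where "m \<xi> = complex_of_real (if 1 \<le> norm \<xi> \<and> norm \<xi> < 2 ^ J then norm \<xi> powr (- (2 * s)) else 0) * cnj (hat \<xi>)" for \<xi>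
    have [measurable]: "m \<in> borel_measurable borel" unfolding m_def by measurable
    have mE: "m \<xi> * hat \<xi> = complex_of_real (E J \<xi>)" for \<xi>
      by (simp add: m_def E_def complex_norm_square[symmetric] mult_ac flip: of_real_power)
    define M where "M = 2 * C * K1 * (1 + 2 * pi * 2 ^ J)"
    have hatM: "cmod (hat \<xi>) \<le> M" if "norm \<xi> < 2 ^ J" for \<xi>
      unfolding M_def using that C K1(1) by (intro order_trans[OF hat_bound] mult_left_mono add_left_mono) auto
    have M0: "M \<ge> 0" unfolding M_def using C K1(1) by simp
    have mM: "cmod (m \<xi>) \<le> M * indicator (cball 0 (2 ^ J)) \<xi>" for \<xi>
    proof (cases "1 \<le> norm \<xi> \<and> norm \<xi> < 2 ^ J")
      case True
      have "norm \<xi> powr (- (2 * s)) \<le> norm \<xi> powr 0" using True s by (intro powr_mono) auto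
      then have "norm \<xi> powr (- (2 * s)) \<le> 1" using True by (auto split: if_splits)
      then have "norm \<xi> powr (- (2 * s)) * cmod (hat \<xi>) \<le> 1 * M" using True hatM by (intro mult_mono) auto
      then show ?thesis using True by (simp add: m_def norm_mult)
    next
      case False
      then have "m \<xi> = 0" by (auto simp: m_def)
      then show ?thesis using M0 by simp
    qed
    have ib: "integrable lborel (\<lambda>\<xi>. M * indicator (cball 0 (2 ^ J)) (\<xi>::'a))"
      using emeasure_lborel_cball_finite by (intro integrable_mult_right integrable_real_indicator) auto
    have mi: "integrable lborel m"
      by (rule Bochner_Integration.integrable_bound[OF ib]) (use mM M0 in auto)
    have mi1: "integrable lborel (\<lambda>\<xi>. cmod (m \<xi>) * norm \<xi>)"
    proof (rule Bochner_Integration.integrable_bound[where f="\<lambda>\<xi>. 2 ^ J * cmod (m \<xi>)"])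
      show "AE \<xi> in lborel. norm (cmod (m \<xi>) * norm \<xi>) \<le> norm (2 ^ J * cmod (m \<xi>))"
      proof (rule AE_I2)
        fix \<xi>
        have "m \<xi> = 0 \<or> norm \<xi> \<le> 2 ^ J" by (auto simp: m_def)
        then show "norm (cmod (m \<xi>) * norm \<xi>) \<le> norm (2 ^ J * cmod (m \<xi>))"
          by (auto simp: abs_mult mult.commute[of "2 ^ J"] intro: mult_left_mono)
      qed
    qed (use mi in auto)
    define h where "h Q = (LINT \<xi>|lborel. m \<xi> * character \<xi> Q)" for Q
    have lh: "lip_on ?F h (LINT \<xi>|lborel. cmod (m \<xi>) * 1) (LINT \<xi>|lborel. cmod (m \<xi>) * (2 * pi * norm \<xi>))"
      unfolding h_def
    proof (rule lip_on_integral[OF mi, where B=1])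
      show "integrable lborel (\<lambda>\<xi>. cmod (m \<xi>) * (2 * pi * norm \<xi>))"
        using integrable_mult_right[OF mi1, of "2 * pi"] by (simp add: mult_ac)
    qed (use mi lip_on_character in auto)
    define r where "r = (LINT \<xi>|lborel. E J \<xi>)"
    have Ei: "integrable lborel (E J)"
    proof -
      have "integrable lborel (\<lambda>\<xi>. m \<xi> * (if norm \<xi> < 2 ^ J then hat \<xi> else 0))"
        by (rule integrable_mult_bounded[OF mi, where B=M]) (use hatM M0 in auto)
      moreover have "m \<xi> * (if norm \<xi> < 2 ^ J then hat \<xi> else 0) = complex_of_real (E J \<xi>)" for \<xi>
        unfolding mE[symmetric] by (simp add: m_def)
      ultimately show ?thesis by (simp only: complex_of_real_integrable_eq)
    qed
    have r0: "r \<ge> 0" unfolding r_def using E0 by (intro integral_nonneg_AE) auto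
    have er: "(\<integral>\<^sup>+\<xi>. ennreal (E J \<xi>) \<partial>lborel) = ennreal r"
      unfolding r_def by (rule nn_integral_eq_integral[OF Ei]) (simp add: E0)
    have \<Phi>h: "complexify \<phi> h = complex_of_real r"
      unfolding h_def \<Phi>_integral[OF mi mi1] mE r_def by (rule integral_complex_of_real)
    \<comment> \<open>Characters and \<open>ift\<close> have opposite signs; the reflection matches
      them and preserves the norms.\<close>
    define W where "W \<xi> = m (- \<xi>)" for \<xi>
    have [measurable]: "W \<in> borel_measurable borel" unfolding W_def by measurable
    have Wi: "integrable lborel W"
      using lborel_integrable_affine[OF mi, of "-1" 0] by (simp add: W_def[abs_def])
    have hW: "h Q = ift W Q" for Q
    proof -
      have "h Q = \<bar>-1\<bar> ^ DIM('a) *\<^sub>R (LINT \<xi>|lborel. m (0 + (-1) *\<^sub>R \<xi>) * character (0 + (-1) *\<^sub>R \<xi>) Q)"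
        unfolding h_def by (rule lborel_integral_affine) auto
      then show ?thesis by (simp add: ift_def W_def character_def)
    qed
    have We: "(\<integral>\<^sup>+\<xi>. ennreal (norm \<xi> powr (1 + 2 * \<alpha>) * (cmod (W \<xi>))\<^sup>2) \<partial>lborel) \<le> ennreal r"
    proof -
      have "(\<integral>\<^sup>+\<xi>. ennreal (norm \<xi> powr (1 + 2 * \<alpha>) * (cmod (W \<xi>))\<^sup>2) \<partial>lborel) = (\<integral>\<^sup>+\<xi>. ennreal (norm (0 - \<xi>) powr (1 + 2 * \<alpha>) * (cmod (m (0 - \<xi>)))\<^sup>2) \<partial>lborel)"
        by (simp add: W_def)
      also have "\<dots> = (\<integral>\<^sup>+\<xi>. ennreal (norm \<xi> powr (1 + 2 * \<alpha>) * (cmod (m \<xi>))\<^sup>2) \<partial>lborel)"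
        by (rule nn_integral_lborel_shift(2)) measurable
      also have "\<dots> = (\<integral>\<^sup>+\<xi>. ennreal (E J \<xi>) \<partial>lborel)"
      proof (rule nn_integral_cong)
        fix \<xi> :: 'a
        \<comment> \<open>The two factors \<open>norm \<xi> powr (- (2 * s))\<close> coming from the
          square of \<open>m\<close>, against the Sobolev weight
          \<open>norm \<xi> powr (2 * s)\<close>, leave the energy density again.\<close>
        have "norm \<xi> powr (2 * s) * (norm \<xi> powr (- (2 * s)))\<^sup>2 = norm \<xi> powr (- (2 * s))" if "norm \<xi> \<ge> 1"
        proof -
          have "norm \<xi> powr (2 * s) * (norm \<xi> powr (- (2 * s)) * norm \<xi> powr (- (2 * s))) = norm \<xi> powr (2 * s + (- (2 * s) + - (2 * s)))"
            by (simp only: powr_add)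
          then show ?thesis by (simp add: power2_eq_square)
        qed
        then show "ennreal (norm \<xi> powr (1 + 2 * \<alpha>) * (cmod (m \<xi>))\<^sup>2) = ennreal (E J \<xi>)"
          unfolding \<alpha>(4) by (auto simp: m_def E_def norm_mult power_mult_distrib mult.assoc[symmetric])
      qed
      finally show ?thesis using er by simp
    qed
    have Ws: "1 \<le> norm \<xi> \<and> norm \<xi> < 2 ^ J" if "W \<xi> \<noteq> 0" for \<xi>
      using that by (auto simp: W_def m_def split: if_splits)
    have "r = cmod (complexify \<phi> h)" using r0 by (simp add: \<Phi>h)
    also have "\<dots> \<le> \<bar>\<phi> (\<lambda>Q. Re (h Q))\<bar> + \<bar>\<phi> (\<lambda>Q. Im (h Q))\<bar>"
      unfolding complexify_def by (rule order_trans[OF norm_triangle_ineq]) (simp add: norm_mult)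
    also have "\<dots> \<le> C * (T * sqrt r) + C * (T * sqrt r)"
    proof (intro add_mono)
      have t: "Hnorm \<alpha> \<Omega> (\<lambda>P. Re (h P)) \<le> T * sqrt r \<and> Hnorm \<alpha> \<Omega> (\<lambda>P. Im (h P)) \<le> T * sqrt r"
        unfolding hW by (rule T(2)[OF Wi Ws We r0])
      show "\<bar>\<phi> (\<lambda>Q. Re (h Q))\<bar> \<le> C * (T * sqrt r)" "\<bar>\<phi> (\<lambda>Q. Im (h Q))\<bar> \<le> C * (T * sqrt r)"
        using mem[OF lh] t C by (auto intro!: order_trans[OF \<phi>_bound] mult_left_mono)
    qed
    finally have "r \<le> (2 * C * T) * sqrt r" by simp
    \<comment> \<open>Division by \<open>sqrt r\<close> is possible because \<open>r\<close> is a
      real number: the density on the shell was shown to be integrable.\<close>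
    then have "sqrt r * sqrt r \<le> (2 * C * T) * sqrt r" using r0 by simp
    then have "sqrt r \<le> 2 * C * T \<or> r = 0"
      using r0 mult_right_le_imp_le[of "sqrt r" "sqrt r" "2 * C * T"] by fastforce
    moreover have "2 * C * T \<ge> 0" using C T(1) by simp
    ultimately have "sqrt r \<le> 2 * C * T" by auto
    then have "(sqrt r)\<^sup>2 \<le> B" unfolding B_def using r0 by (intro power_mono) auto
    then show ?thesis unfolding er using r0 by (intro ennreal_leI) simp
  qed
  \<comment> \<open>At each frequency the truncated density eventually equals the full one, so
    Fatou's lemma removes the shell.\<close>
  have "(\<integral>\<^sup>+\<xi>. ennreal (norm \<xi> powr (- (2 * s)) * (cmod (hat \<xi>))\<^sup>2) * indicator (- ball 0 1) \<xi> \<partial>lborel) = (\<integral>\<^sup>+\<xi>. liminf (\<lambda>J. ennreal (E J \<xi>)) \<partial>lborel)"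
  proof (rule nn_integral_cong)
    fix \<xi> :: 'a
    obtain N where N: "norm \<xi> < 2 ^ N" using real_arch_pow[of 2 "norm \<xi>"] by auto
    have "\<forall>\<^sub>F J in sequentially. ennreal (E J \<xi>) = ennreal (norm \<xi> powr (- (2 * s)) * (cmod (hat \<xi>))\<^sup>2) * indicator (- ball 0 1) \<xi>"
      using eventually_ge_at_top[of N]
    proof eventually_elim
      case (elim J)
      have "norm \<xi> < 2 ^ J" using N power_increasing[OF elim, of "2::real"] by linarith
      then show ?case by (auto simp: E_def indicator_def)
    qed
    then have "(\<lambda>J. ennreal (E J \<xi>)) \<longlonglongrightarrow> ennreal (norm \<xi> powr (- (2 * s)) * (cmod (hat \<xi>))\<^sup>2) * indicator (- ball 0 1) \<xi>"
      by (rule tendsto_eventually)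
    then show "ennreal (norm \<xi> powr (- (2 * s)) * (cmod (hat \<xi>))\<^sup>2) * indicator (- ball 0 1) \<xi> = liminf (\<lambda>J. ennreal (E J \<xi>))"
      by (intro lim_imp_Liminf[symmetric]) auto
  qed
  also have "\<dots> \<le> liminf (\<lambda>J. \<integral>\<^sup>+\<xi>. ennreal (E J \<xi>) \<partial>lborel)"
    by (rule nn_integral_liminf) measurable
  also have "\<dots> \<le> ennreal B" using bound by (intro Liminf_le) auto
  also have "\<dots> < \<infinity>" by simp
  finally have en: "(\<integral>\<^sup>+\<xi>. ennreal (norm \<xi> powr (- (2 * s)) * (cmod (hat \<xi>))\<^sup>2) * indicator (- ball 0 1) \<xi> \<partial>lborel) < \<infinity>" .
  have "energy_functional ?F (complexify \<phi>) (2 * C * K1) R s"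
  proof
    show "0 < s" "2 * s < real DIM('a)" using s n by auto
    show "closed ?F" "?F \<in> null_sets lborel" using frontier_null_sets[OF dom] by auto
  qed (rule en)
  then show ?thesis by (rule that)
qed

section \<open>The potential and its transform\<close>

context energy_functional
begin

lemma integrable_norm_powr_ball: "integrable lborel (\<lambda>\<xi>::'a. indicator (cball 0 1) \<xi> * norm \<xi> powr (- (2 * s)))"
proof -
  interpret upper_regular "lborel :: 'a measure" "real DIM('a)" "unit_ball_vol (real DIM('a))"
    by (rule upper_regular_lborel)
  define \<beta> where "\<beta> = real DIM('a) - 2 * s"
  have \<beta>: "\<beta> > 0" "\<beta> - real DIM('a) = - (2 * s)" using s by (auto simp: \<beta>_def)
  have "(\<integral>\<^sup>+\<xi>. ennreal (norm (indicator (cball 0 1) \<xi> * norm (\<xi>::'a) powr (- (2 * s)))) \<partial>lborel) =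
    (\<integral>\<^sup>+\<xi>. indicator (cball 0 1) \<xi> * ennreal (norm ((\<xi>::'a) - 0) powr (\<beta> - real DIM('a))) \<partial>lborel)"
    unfolding \<beta>(2) by (intro nn_integral_cong) (simp add: indicator_def)
  also have "\<dots> < \<infinity>" using near_integral[OF \<beta>(1), of 1 0] by (auto intro: order_le_less_trans)
  finally show ?thesis by (simp add: integrable_iff_bounded)
qed

text \<open>Below 1 the bound on \<open>hat\<close> and \<open>2 * s < DIM('a)\<close> suffice;
  above 1 this is the energy hypothesis.\<close>

lemma energy_integrable: "integrable lborel (\<lambda>\<xi>. norm \<xi> powr (- (2 * s)) * (cmod (hat \<xi>))\<^sup>2)"
proof -
  define B where "B = (K * (1 + 2 * pi))\<^sup>2"
  have 1: "integrable lborel (\<lambda>\<xi>. B * (indicator (cball 0 1) \<xi> * norm (\<xi>::'a) powr (- (2 * s))))"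
    by (intro integrable_mult_right integrable_norm_powr_ball)
  have 2: "integrable lborel (\<lambda>\<xi>. norm \<xi> powr (- (2 * s)) * (cmod (hat \<xi>))\<^sup>2 * indicator (- ball 0 1) \<xi>)"
    unfolding integrable_iff_bounded
  proof (intro conjI)
    have "(\<integral>\<^sup>+\<xi>. ennreal (norm (norm \<xi> powr (- (2 * s)) * (cmod (hat \<xi>))\<^sup>2 * indicator (- ball 0 1) \<xi>)) \<partial>lborel)
       = (\<integral>\<^sup>+\<xi>. ennreal (norm \<xi> powr (- (2 * s)) * (cmod (hat \<xi>))\<^sup>2) * indicator (- ball 0 1) \<xi> \<partial>lborel)"
      by (intro nn_integral_cong) (simp add: indicator_def)
    then show "(\<integral>\<^sup>+\<xi>. ennreal (norm (norm \<xi> powr (- (2 * s)) * (cmod (hat \<xi>))\<^sup>2 * indicator (- ball 0 1) \<xi>)) \<partial>lborel) < \<infinity>"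
      using energy by simp
  qed measurable
  show ?thesis
  proof (rule Bochner_Integration.integrable_bound[OF Bochner_Integration.integrable_add[OF 1 2]])
    show "AE \<xi> in lborel. norm (norm \<xi> powr (- (2 * s)) * (cmod (hat \<xi>))\<^sup>2)
      \<le> norm (B * (indicator (cball 0 1) \<xi> * norm \<xi> powr (- (2 * s))) + norm \<xi> powr (- (2 * s)) * (cmod (hat \<xi>))\<^sup>2 * indicator (- ball 0 1) \<xi>)"
    proof (rule AE_I2)
      fix \<xi> :: 'a
      have B0: "B \<ge> 0" by (simp add: B_def)
      show "norm (norm \<xi> powr (- (2 * s)) * (cmod (hat \<xi>))\<^sup>2)
        \<le> norm (B * (indicator (cball 0 1) \<xi> * norm \<xi> powr (- (2 * s))) + norm \<xi> powr (- (2 * s)) * (cmod (hat \<xi>))\<^sup>2 * indicator (- ball 0 1) \<xi>)"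
      proof (cases "norm \<xi> < 1")
        case True
        have "cmod (hat \<xi>) \<le> K * (1 + 2 * pi)"
          using True K_nonneg by (intro order_trans[OF hat_bound] mult_left_mono add_left_mono) auto
        then have "(cmod (hat \<xi>))\<^sup>2 \<le> B" unfolding B_def by (intro power_mono) auto
        then have "norm \<xi> powr (- (2 * s)) * (cmod (hat \<xi>))\<^sup>2 \<le> norm \<xi> powr (- (2 * s)) * B" by (intro mult_left_mono) auto
        then show ?thesis using True B0 by (simp add: mult.commute)
      next
        case False
        then have eq: "norm \<xi> powr (- (2 * s)) * (cmod (hat \<xi>))\<^sup>2 * indicator (- ball 0 1) \<xi> = norm \<xi> powr (- (2 * s)) * (cmod (hat \<xi>))\<^sup>2" by simp
        have "0 \<le> B * (indicator (cball 0 1) \<xi> * norm \<xi> powr (- (2 * s)))" using B0 by simp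
        then show ?thesis unfolding eq by simp
      qed
    qed
  qed measurable
qed

lemma cutoff_integrable:
  "integrable lborel (\<lambda>\<xi>::'a. symbol_cutoff (2 * s) T \<xi>)"
  "integrable lborel (\<lambda>\<xi>::'a. complex_of_real (symbol_cutoff (2 * s) T \<xi>))"
  "integrable lborel (\<lambda>\<xi>::'a. symbol_cutoff (2 * s) T \<xi> * norm \<xi>)"
proof -
  have i: "integrable lborel (\<lambda>\<xi>::'a. symbol_cutoff (2 * s) T \<xi> * (1 + norm \<xi>))"
    using s by (intro symbol_cutoff_integrable) auto
  show r: "integrable lborel (\<lambda>\<xi>::'a. symbol_cutoff (2 * s) T \<xi>)"
  proof (rule Bochner_Integration.integrable_bound[OF i])
    show "AE \<xi> in lborel. norm (symbol_cutoff (2 * s) T (\<xi>::'a)) \<le> norm (symbol_cutoff (2 * s) T \<xi> * (1 + norm \<xi>))"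
    proof (rule AE_I2)
      fix \<xi> :: 'a
      have "norm (symbol_cutoff (2 * s) T \<xi>) * 1 \<le> norm (symbol_cutoff (2 * s) T \<xi>) * (1 + norm \<xi>)" by (intro mult_left_mono) auto
      then show "norm (symbol_cutoff (2 * s) T \<xi>) \<le> norm (symbol_cutoff (2 * s) T \<xi> * (1 + norm \<xi>))" by (simp add: abs_mult)
    qed
  qed measurable
  from r show "integrable lborel (\<lambda>\<xi>::'a. complex_of_real (symbol_cutoff (2 * s) T \<xi>))" by simp
  show "integrable lborel (\<lambda>\<xi>::'a. symbol_cutoff (2 * s) T \<xi> * norm \<xi>)"
    by (rule Bochner_Integration.integrable_bound[OF i]) (use symbol_cutoff_nonneg in \<open>auto simp: abs_mult intro!: mult_left_mono\<close>)
qed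

lemma cutoff_hat_integrable: "integrable lborel (\<lambda>\<xi>. complex_of_real (symbol_cutoff (2 * s) T \<xi>) * hat \<xi>)"
proof (rule Bochner_Integration.integrable_bound[where f="\<lambda>\<xi>. K * (symbol_cutoff (2 * s) T \<xi> + 2 * pi * (symbol_cutoff (2 * s) T \<xi> * norm \<xi>))"])
  show "integrable lborel (\<lambda>\<xi>::'a. K * (symbol_cutoff (2 * s) T \<xi> + 2 * pi * (symbol_cutoff (2 * s) T \<xi> * norm \<xi>)))"
    by (intro integrable_mult_right Bochner_Integration.integrable_add cutoff_integrable)
  show "AE \<xi> in lborel. norm (complex_of_real (symbol_cutoff (2 * s) T \<xi>) * hat \<xi>) \<le> norm (K * (symbol_cutoff (2 * s) T \<xi> + 2 * pi * (symbol_cutoff (2 * s) T \<xi> * norm \<xi>)))"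
  proof (rule AE_I2)
    fix \<xi> :: 'a
    have "symbol_cutoff (2 * s) T \<xi> * cmod (hat \<xi>) \<le> symbol_cutoff (2 * s) T \<xi> * (K * (1 + 2 * pi * norm \<xi>))"
      by (intro mult_left_mono hat_bound symbol_cutoff_nonneg)
    also have "\<dots> = K * (symbol_cutoff (2 * s) T \<xi> + 2 * pi * (symbol_cutoff (2 * s) T \<xi> * norm \<xi>))" by (simp add: algebra_simps)
    finally show "norm (complex_of_real (symbol_cutoff (2 * s) T \<xi>) * hat \<xi>) \<le> norm (K * (symbol_cutoff (2 * s) T \<xi> + 2 * pi * (symbol_cutoff (2 * s) T \<xi> * norm \<xi>)))"
      using symbol_cutoff_nonneg[of "2 * s" T \<xi>] by (simp add: norm_mult)
  qed
qed measurable

text \<open>With the phase \<open>cis (2 * pi * (x \<bullet> \<xi>))\<close> in the coefficient, the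
  superposition of characters is the truncated kernel centred at \<open>x\<close>, and
  \<open>\<Phi>_integral\<close> exchanges the functional with the integral.\<close>

lemma cutoff_potential:
  defines "q \<equiv> real DIM('a) - 2 * s"
  shows "ift (\<lambda>\<xi>. complex_of_real (symbol_cutoff (2 * s) T \<xi>) * hat \<xi>) x = \<Phi> (\<lambda>Q. complex_of_real (riesz_cutoff q T (norm (x - Q))))"
    and "\<exists>A L. lip_on F (\<lambda>Q. complex_of_real (riesz_cutoff q T (norm (x - Q)))) A L"
proof -
  define m where "m \<xi> = complex_of_real (symbol_cutoff (2 * s) T \<xi>) * cis (2 * pi * (x \<bullet> \<xi>))" for \<xi> :: 'a
  have m: "integrable lborel m"
    unfolding m_def by (rule integrable_mult_cis[OF cutoff_integrable(2)]) measurable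
  have m_norm: "cmod (m \<xi>) = symbol_cutoff (2 * s) T \<xi>" for \<xi>
    using symbol_cutoff_nonneg[of "2 * s" T \<xi>] by (simp add: m_def norm_mult)
  have m1: "integrable lborel (\<lambda>\<xi>. cmod (m \<xi>) * norm \<xi>)" unfolding m_norm by (rule cutoff_integrable(3))
  have eq: "(\<lambda>Q. LINT \<xi>|lborel. m \<xi> * character \<xi> Q) = (\<lambda>Q. complex_of_real (riesz_cutoff q T (norm (x - Q))))"
  proof
    fix Q
    have "(LINT \<xi>|lborel. m \<xi> * character \<xi> Q) = ift (\<lambda>\<xi>. complex_of_real (symbol_cutoff (2 * s) T \<xi>)) (x - Q)"
      unfolding ift_def
      by (intro Bochner_Integration.integral_cong refl)
         (simp add: m_def character_def mult.assoc cis_mult inner_diff_left algebra_simps)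
    also have "\<dots> = complex_of_real (riesz_cutoff q T (norm (x - Q)))"
      unfolding q_def using s by (intro riesz_cutoff_eq_ift) auto
    finally show "(LINT \<xi>|lborel. m \<xi> * character \<xi> Q) = complex_of_real (riesz_cutoff q T (norm (x - Q)))" .
  qed
  have "ift (\<lambda>\<xi>. complex_of_real (symbol_cutoff (2 * s) T \<xi>) * hat \<xi>) x = (LINT \<xi>|lborel. m \<xi> * hat \<xi>)"
    unfolding ift_def m_def by (intro Bochner_Integration.integral_cong refl) (simp add: mult_ac)
  also have "\<dots> = \<Phi> (\<lambda>Q. complex_of_real (riesz_cutoff q T (norm (x - Q))))"
    unfolding \<Phi>_integral[OF m m1, symmetric] eq ..
  finally show "ift (\<lambda>\<xi>. complex_of_real (symbol_cutoff (2 * s) T \<xi>) * hat \<xi>) x = \<Phi> (\<lambda>Q. complex_of_real (riesz_cutoff q T (norm (x - Q))))" .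
  have "lip_on F (\<lambda>Q. LINT \<xi>|lborel. m \<xi> * character \<xi> Q) (LINT \<xi>|lborel. cmod (m \<xi>) * 1) (LINT \<xi>|lborel. cmod (m \<xi>) * (2 * pi * norm \<xi>))"
  proof (rule lip_on_integral[OF m, where B=1])
    show "integrable lborel (\<lambda>\<xi>. cmod (m \<xi>) * (2 * pi * norm \<xi>))"
      using integrable_mult_right[OF m1, of "2 * pi"] by (simp add: mult_ac)
  qed (use m lip_on_character in auto)
  then show "\<exists>A L. lip_on F (\<lambda>Q. complex_of_real (riesz_cutoff q T (norm (x - Q)))) A L" unfolding eq by blast
qed

text \<open>A point off the closed set \<open>F\<close> has positive distance from it, so
  \<open>riesz_cutoff_tail\<close> gives convergence of the kernels as Lipschitz functions on
  \<open>F\<close>. The limit kernel is itself Lipschitz there, being a truncated kernel plus its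
  tail.\<close>

lemma
  defines "q \<equiv> real DIM('a) - 2 * s"
  assumes x: "x \<notin> F"
  shows cutoff_potential_LIMSEQ: "(\<lambda>k. ift (\<lambda>\<xi>. complex_of_real (symbol_cutoff (2 * s) (real k) \<xi>) * hat \<xi>) x)
     \<longlonglongrightarrow> complex_of_real (riesz_scale q) * \<Phi> (\<lambda>Q. complex_of_real (norm (x - Q) powr (- q)))"
    and lip_on_kernel: "\<exists>A L. lip_on F (\<lambda>Q. complex_of_real (norm (x - Q) powr (- q))) A L"
proof -
  have q: "q > 0" using s by (simp add: q_def)
  obtain a where a: "a > 0" "\<forall>Q\<in>F. a \<le> dist x Q" using separate_point_closed[OF F_closed x] by auto
  obtain e where e: "e \<longlonglongrightarrow> 0" "\<And>k. e k \<ge> 0"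
    "\<And>k r. r \<ge> a \<Longrightarrow> \<bar>riesz_scale q * r powr (- q) - riesz_cutoff q (real k) r\<bar> \<le> e k"
    "\<And>k r r'. r \<ge> a \<Longrightarrow> r' \<ge> a \<Longrightarrow>
      \<bar>(riesz_scale q * r powr (- q) - riesz_cutoff q (real k) r) - (riesz_scale q * r' powr (- q) - riesz_cutoff q (real k) r')\<bar> \<le> e k * \<bar>r - r'\<bar>"
    by (rule riesz_cutoff_tail[OF q a(1)]) blast
  define c where "c k Q = complex_of_real (riesz_cutoff q (real k) (norm (x - Q)))" for k Q
  define g where "g Q = complex_of_real (riesz_scale q * norm (x - Q) powr (- q))" for Q
  have c: "\<exists>A L. lip_on F (c k) A L" for k
    using cutoff_potential(2)[of "real k" x] unfolding c_def q_def by simp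
  have [measurable]: "c k \<in> borel_measurable borel" for k using c[of k] by (auto simp: lip_on_def)
  have [measurable]: "g \<in> borel_measurable borel" unfolding g_def by measurable
  have d: "lip_on F (\<lambda>Q. g Q - c k Q) (e k) (e k)" for k
    unfolding lip_on_def
  proof (intro conjI ballI)
    fix P assume P: "P \<in> F"
    have nP: "a \<le> norm (x - P)" using a(2) P by (simp add: dist_norm)
    show "cmod (g P - c k P) \<le> e k"
      using e(3)[OF nP, of k] unfolding g_def c_def of_real_diff[symmetric] norm_of_real .
    fix Q assume Q: "Q \<in> F"
    have nQ: "a \<le> norm (x - Q)" using a(2) Q by (simp add: dist_norm)
    have "cmod (g P - c k P - (g Q - c k Q)) \<le> e k * \<bar>norm (x - P) - norm (x - Q)\<bar>"
      using e(4)[OF nP nQ, of k] unfolding g_def c_def of_real_diff[symmetric] norm_of_real .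
    also have "\<bar>norm (x - P) - norm (x - Q)\<bar> \<le> norm (P - Q)"
      using norm_triangle_ineq3[of "x - P" "x - Q"] by (simp add: norm_minus_commute)
    finally show "cmod (g P - c k P - (g Q - c k Q)) \<le> e k * norm (P - Q)"
      using e(2)[of k] by (simp add: mult_left_mono)
  qed (use e(2) in auto)
  have g: "lip_on F g A L \<and> \<Phi> g = \<Phi> (\<lambda>Q. g Q - c k Q) + \<Phi> (c k)" if "lip_on F (c k) A' L'" "A = e k + A'" "L = e k + L'" for k A L A' L'
    using lip_on_add[OF d[of k] that(1)] \<Phi>_add[OF d[of k] that(1)] that by simp
  have gl: "\<exists>A L. lip_on F g A L" using c[of 0] g by blast
  have bd: "cmod (\<Phi> g - \<Phi> (c k)) \<le> K * (e k + e k)" for k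
  proof -
    obtain A' L' where "lip_on F (c k) A' L'" using c by blast
    then have "\<Phi> g - \<Phi> (c k) = \<Phi> (\<lambda>Q. g Q - c k Q)" using g[of k A' L'] by simp
    then show ?thesis using \<Phi>_bound[OF d[of k]] by simp
  qed
  have "(\<lambda>k. K * (e k + e k)) \<longlonglongrightarrow> K * (0 + 0)" by (intro tendsto_intros e(1))
  then have e0: "(\<lambda>k. K * (e k + e k)) \<longlonglongrightarrow> 0" by simp
  have "(\<lambda>k. \<Phi> g - \<Phi> (c k)) \<longlonglongrightarrow> 0"
    by (rule Lim_null_comparison[OF always_eventually[OF allI[OF bd]] e0])
  from tendsto_diff[OF tendsto_const[of "\<Phi> g"] this] have lim: "(\<lambda>k. \<Phi> (c k)) \<longlonglongrightarrow> \<Phi> g" by simp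
  obtain A L where gAL: "lip_on F g A L" using gl by blast
  then have "\<Phi> (\<lambda>Q. complex_of_real (1 / riesz_scale q) * g Q) = complex_of_real (1 / riesz_scale q) * \<Phi> g" by (rule \<Phi>_scale)
  moreover have gQ: "complex_of_real (1 / riesz_scale q) * g Q = complex_of_real (norm (x - Q) powr (- q))" for Q
    using riesz_scale_pos[OF q] by (simp add: g_def)
  ultimately have "\<Phi> g = complex_of_real (riesz_scale q) * \<Phi> (\<lambda>Q. complex_of_real (norm (x - Q) powr (- q)))"
    using riesz_scale_pos[OF q] by simp
  moreover have "\<Phi> (c k) = ift (\<lambda>\<xi>. complex_of_real (symbol_cutoff (2 * s) (real k) \<xi>) * hat \<xi>) x" for k
    using cutoff_potential(1)[of "real k" x] unfolding c_def q_def by simp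
  ultimately show "(\<lambda>k. ift (\<lambda>\<xi>. complex_of_real (symbol_cutoff (2 * s) (real k) \<xi>) * hat \<xi>) x)
     \<longlonglongrightarrow> complex_of_real (riesz_scale q) * \<Phi> (\<lambda>Q. complex_of_real (norm (x - Q) powr (- q)))" using lim by simp
  show "\<exists>A L. lip_on F (\<lambda>Q. complex_of_real (norm (x - Q) powr (- q))) A L"
    using lip_on_scale[OF gAL, of "complex_of_real (1 / riesz_scale q)"] unfolding gQ by blast
qed

text \<open>The potential is prescribed off \<open>F\<close> only. As \<open>F\<close> is a null
  set, its values there do not affect integrals over the completed Lebesgue measure, and the proof
  works with the Borel version \<open>U\<close>.\<close>

lemma potential_frac_harmonic:
  fixes u :: "'a \<Rightarrow> real" and rc :: real
  assumes u: "\<And>x. x \<notin> F \<Longrightarrow> complex_of_real (u x) = complex_of_real rc * \<Phi> (\<lambda>Q. complex_of_real (norm (x - Q) powr (- (real DIM('a) - 2 * s))))"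
  shows "frac_harmonic_in s u (- F)"
proof -
  define q where "q = real DIM('a) - 2 * s"
  have q: "q > 0" using s by (simp add: q_def)
  \<comment> \<open>\<open>lam\<close> compares the given constant with that of the Gaussian
    representation of the kernel; the frequency side of the representation contributes
    \<open>symbol_scale (2 * s)\<close>, hence \<open>\<kappa>\<close>.\<close>
  define lam where "lam = rc / riesz_scale q"
  define \<kappa> where "\<kappa> = lam * symbol_scale (2 * s)"
  define w where "w \<xi> = complex_of_real (\<kappa> * norm \<xi> powr (- (2 * s))) * hat \<xi>" for \<xi>
  define v where "v k \<xi> = complex_of_real lam * (complex_of_real (symbol_cutoff (2 * s) (real k) \<xi>) * hat \<xi>)" for k :: nat and \<xi>
  have [measurable]: "w \<in> borel_measurable borel" unfolding w_def by measurable
  have vi: "integrable lborel (v k)" for k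
    unfolding v_def by (rule integrable_mult_right[OF cutoff_hat_integrable])
  have [measurable]: "v k \<in> borel_measurable borel" for k using vi by auto
  have F_borel [measurable]: "F \<in> sets borel" using F_closed by (rule borel_closed)
  have AE_F: "AE x in lborel. x \<notin> F" using F_null by (rule AE_not_in)
  define U where "U x = (if x \<in> F then 0 else complex_of_real (u x))" for x
  \<comment> \<open>Setting the sequence to 0 on \<open>F\<close> makes it converge everywhere, so
    that \<open>U\<close> is Borel measurable as a pointwise limit.\<close>
  have U_lim: "(\<lambda>k. if x \<in> F then 0 else ift (v k) x) \<longlonglongrightarrow> U x" for x
  proof (cases "x \<in> F")
    case False
    have "ift (v k) x = complex_of_real lam * ift (\<lambda>\<xi>. complex_of_real (symbol_cutoff (2 * s) (real k) \<xi>) * hat \<xi>) x" for k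
      unfolding ift_def v_def by (subst integral_mult_right_zero[symmetric]) (simp add: mult.assoc)
    moreover have "complex_of_real lam * (complex_of_real (riesz_scale q) * \<Phi> (\<lambda>Q. complex_of_real (norm (x - Q) powr (- q)))) = U x"
      using False riesz_scale_pos[OF q] u[OF False] by (simp add: U_def lam_def q_def)
    ultimately show ?thesis
      using tendsto_mult[OF tendsto_const[of "complex_of_real lam"] cutoff_potential_LIMSEQ[OF False]] False
      by (simp add: q_def)
  qed (simp add: U_def)
  have U_meas [measurable]: "U \<in> borel_measurable borel"
    by (rule borel_measurable_LIMSEQ_metric[OF _ U_lim]) measurable
  have low_w: "integrable lborel (low w)"
  proof (rule Bochner_Integration.integrable_bound[where f="\<lambda>\<xi>. (\<bar>\<kappa>\<bar> * (K * (1 + 2 * pi))) * (indicator (cball 0 1) \<xi> * norm \<xi> powr (- (2 * s)))"])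
    show "integrable lborel (\<lambda>\<xi>::'a. (\<bar>\<kappa>\<bar> * (K * (1 + 2 * pi))) * (indicator (cball 0 1) \<xi> * norm \<xi> powr (- (2 * s))))"
      by (intro integrable_mult_right integrable_norm_powr_ball)
    show "AE \<xi> in lborel. norm (low w \<xi>) \<le> norm ((\<bar>\<kappa>\<bar> * (K * (1 + 2 * pi))) * (indicator (cball 0 1) \<xi> * norm \<xi> powr (- (2 * s))))"
    proof (rule AE_I2)
      fix \<xi> :: 'a
      show "norm (low w \<xi>) \<le> norm ((\<bar>\<kappa>\<bar> * (K * (1 + 2 * pi))) * (indicator (cball 0 1) \<xi> * norm \<xi> powr (- (2 * s))))"
      proof (cases "norm \<xi> < 1")
        case True
        have "cmod (hat \<xi>) \<le> K * (1 + 2 * pi)"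
          using True K_nonneg by (intro order_trans[OF hat_bound] mult_left_mono add_left_mono) auto
        then have "\<bar>\<kappa>\<bar> * norm \<xi> powr (- (2 * s)) * cmod (hat \<xi>) \<le> \<bar>\<kappa>\<bar> * norm \<xi> powr (- (2 * s)) * (K * (1 + 2 * pi))"
          by (intro mult_left_mono) auto
        then show ?thesis using True K_nonneg by (simp add: low_def w_def norm_mult abs_mult mult_ac)
      qed (simp add: low_def)
    qed
  qed measurable
  have high_w: "integrable lborel (\<lambda>\<xi>. (cmod (high w \<xi>))\<^sup>2)"
  proof (rule Bochner_Integration.integrable_bound[where f="\<lambda>\<xi>. \<kappa>\<^sup>2 * (norm \<xi> powr (- (2 * s)) * (cmod (hat \<xi>))\<^sup>2)"])
    show "integrable lborel (\<lambda>\<xi>. \<kappa>\<^sup>2 * (norm \<xi> powr (- (2 * s)) * (cmod (hat \<xi>))\<^sup>2))"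
      by (intro integrable_mult_right energy_integrable)
    show "AE \<xi> in lborel. norm ((cmod (high w \<xi>))\<^sup>2) \<le> norm (\<kappa>\<^sup>2 * (norm \<xi> powr (- (2 * s)) * (cmod (hat \<xi>))\<^sup>2))"
    proof (rule AE_I2)
      fix \<xi> :: 'a
      show "norm ((cmod (high w \<xi>))\<^sup>2) \<le> norm (\<kappa>\<^sup>2 * (norm \<xi> powr (- (2 * s)) * (cmod (hat \<xi>))\<^sup>2))"
      proof (cases "norm \<xi> < 1")
        case False
        define t where "t = norm \<xi> powr (- (2 * s))"
        have "t \<le> norm \<xi> powr 0" unfolding t_def using False s by (intro powr_mono) auto
        then have "t \<le> 1" "0 \<le> t" using False by (auto simp: t_def split: if_splits)
        \<comment> \<open>At frequencies of norm at least 1 the multiplier is at most 1 and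
          dominates its square, so finite energy gives square integrability.\<close>
        then have "t\<^sup>2 \<le> t" by (simp add: power2_eq_square mult_left_le_one_le)
        then have "\<kappa>\<^sup>2 * (t\<^sup>2 * (cmod (hat \<xi>))\<^sup>2) \<le> \<kappa>\<^sup>2 * (t * (cmod (hat \<xi>))\<^sup>2)"
          by (intro mult_left_mono mult_right_mono) auto
        moreover have "(cmod (high w \<xi>))\<^sup>2 = \<kappa>\<^sup>2 * (t\<^sup>2 * (cmod (hat \<xi>))\<^sup>2)"
          using False by (simp add: high_def w_def t_def norm_mult power_mult_distrib mult.assoc)
        ultimately show ?thesis using \<open>0 \<le> t\<close> by (simp add: t_def abs_mult)
      qed (simp add: high_def)
    qed
  qed measurable
  interpret L: ift_limit w v U
  proof
    show "AE \<xi> in lborel. \<forall>k. cmod (v k \<xi>) \<le> cmod (w \<xi>)"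
    proof (rule AE_mp[OF AE_lborel_singleton[of 0] AE_I2], intro impI allI)
      fix \<xi> :: 'a and k assume "\<xi> \<noteq> 0"
      then have "symbol_cutoff (2 * s) (real k) \<xi> \<le> symbol_scale (2 * s) * norm \<xi> powr (- (2 * s))"
        using s by (intro symbol_cutoff_le) auto
      then have "\<bar>lam\<bar> * symbol_cutoff (2 * s) (real k) \<xi> * cmod (hat \<xi>) \<le> \<bar>lam\<bar> * (symbol_scale (2 * s) * norm \<xi> powr (- (2 * s))) * cmod (hat \<xi>)"
        by (intro mult_left_mono mult_right_mono) auto
      then show "cmod (v k \<xi>) \<le> cmod (w \<xi>)"
        using symbol_cutoff_nonneg[of "2 * s" "real k" \<xi>] symbol_scale_nonneg[of "2 * s"]
        by (simp add: v_def w_def \<kappa>_def norm_mult abs_mult mult.assoc)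
    qed
    show "AE \<xi> in lborel. (\<lambda>k. v k \<xi>) \<longlonglongrightarrow> w \<xi>"
    proof (rule AE_mp[OF AE_lborel_singleton[of 0] AE_I2], intro impI)
      fix \<xi> :: 'a assume "\<xi> \<noteq> 0"
      then have "(\<lambda>k. symbol_cutoff (2 * s) (real k) \<xi>) \<longlonglongrightarrow> symbol_scale (2 * s) * norm \<xi> powr (- (2 * s))"
        using s by (intro symbol_cutoff_LIMSEQ) auto
      then have "(\<lambda>k. v k \<xi>) \<longlonglongrightarrow> complex_of_real lam * (complex_of_real (symbol_scale (2 * s) * norm \<xi> powr (- (2 * s))) * hat \<xi>)"
        unfolding v_def by (intro tendsto_intros)
      then show "(\<lambda>k. v k \<xi>) \<longlonglongrightarrow> w \<xi>" by (simp add: w_def \<kappa>_def mult.assoc)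
    qed
    show "AE x in lborel. (\<lambda>k. ift (v k) x) \<longlonglongrightarrow> U x"
      using AE_F
    proof eventually_elim
      case (elim x)
      then show ?case using U_lim[of x] by simp
    qed
  qed (use vi low_w high_w in auto)
  have F_leb: "F \<in> null_sets lebesgue" using F_null by (rule null_sets_completionI)
  have AE_leb: "AE x in lebesgue. x \<notin> F" using F_leb by (rule AE_not_in)
  \<comment> \<open>A preimage under \<open>u\<close> differs from the Borel preimage under the real
    part of \<open>U\<close> only inside the null set \<open>F\<close>.\<close>
  have u_meas: "u \<in> borel_measurable lebesgue"
  proof (rule measurableI)
    fix A :: "real set" assume A: "A \<in> sets borel"
    have 1: "(\<lambda>x. Re (U x)) -` A - F \<in> sets lebesgue"
    proof -
      have "(\<lambda>x. Re (U x)) -` A \<in> sets borel" using measurable_sets[of "\<lambda>x. Re (U x)" borel borel A] A by simp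
      then have "(\<lambda>x. Re (U x)) -` A - F \<in> sets lborel" using F_borel by auto
      then show ?thesis by (rule sets_completionI_sets)
    qed
    have "u -` A \<inter> F \<in> null_sets lebesgue"
      by (rule null_sets_completion_subset[OF _ F_leb]) auto
    then have 2: "u -` A \<inter> F \<in> sets lebesgue" by auto
    have eq: "u -` A \<inter> space lebesgue = ((\<lambda>x. Re (U x)) -` A - F) \<union> (u -` A \<inter> F)" by (auto simp: U_def)
    show "u -` A \<inter> space lebesgue \<in> sets lebesgue" unfolding eq by (rule sets.Un[OF 1 2])
  qed simp
  have Hdot: "Hdot s u w"
    unfolding Hdot_def
  proof (intro conjI allI impI)
    show "u \<in> borel_measurable lebesgue" by (rule u_meas)
    fix S :: "'a set" assume S: "compact S"
    have "(\<integral>\<^sup>+x. ennreal ((u x)\<^sup>2 * indicator S x) \<partial>lebesgue) = (\<integral>\<^sup>+x. ennreal ((cmod (U x))\<^sup>2 * indicator S x) \<partial>lebesgue)"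
      by (rule nn_integral_cong_AE) (use AE_leb in eventually_elim, simp add: U_def)
    also have "\<dots> = (\<integral>\<^sup>+x. ennreal ((cmod (U x))\<^sup>2 * indicator S x) \<partial>lborel)" by (rule nn_integral_completion)
    also have "\<dots> < \<infinity>"
      using S emeasure_compact_finite[OF S] by (intro L.local_square_integrable) (auto intro: borel_compact)
    finally show "(\<integral>\<^sup>+x. ennreal ((u x)\<^sup>2 * indicator S x) \<partial>lebesgue) < \<infinity>" .
  next
    have "(\<integral>\<^sup>+\<xi>. ennreal (norm \<xi> powr (2 * s) * (cmod (w \<xi>))\<^sup>2) \<partial>lebesgue) = (\<integral>\<^sup>+\<xi>. ennreal (norm \<xi> powr (2 * s) * (cmod (w \<xi>))\<^sup>2) \<partial>lborel)"
      by (rule nn_integral_completion)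
    also have "\<dots> = (\<integral>\<^sup>+\<xi>. ennreal (norm (\<kappa>\<^sup>2 * (norm \<xi> powr (- (2 * s)) * (cmod (hat \<xi>))\<^sup>2))) \<partial>lborel)"
    proof (rule nn_integral_cong)
      fix \<xi> :: 'a
      show "ennreal (norm \<xi> powr (2 * s) * (cmod (w \<xi>))\<^sup>2) = ennreal (norm (\<kappa>\<^sup>2 * (norm \<xi> powr (- (2 * s)) * (cmod (hat \<xi>))\<^sup>2)))"
      proof (cases "\<xi> = 0")
        case False
        define a b where "a = norm \<xi> powr (2 * s)" and "b = norm \<xi> powr (- (2 * s))"
        have ab: "a * b = 1" "b \<ge> 0" using False by (auto simp: a_def b_def simp flip: powr_add)
        have "a * (cmod (w \<xi>))\<^sup>2 = \<kappa>\<^sup>2 * ((a * b) * b * (cmod (hat \<xi>))\<^sup>2)"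
          by (simp add: w_def b_def norm_mult power_mult_distrib power2_eq_square[of "norm \<xi> powr _"] mult_ac)
        also have "\<dots> = \<kappa>\<^sup>2 * (b * (cmod (hat \<xi>))\<^sup>2)" unfolding ab(1) by simp
        also have "\<dots> = norm (\<kappa>\<^sup>2 * (b * (cmod (hat \<xi>))\<^sup>2))" using ab(2) by simp
        finally show ?thesis unfolding a_def b_def by (rule arg_cong)
      qed simp
    qed
    also have "\<dots> < \<infinity>" using integrable_mult_right[OF energy_integrable, of "\<kappa>\<^sup>2"] by (simp only: integrable_iff_bounded)
    finally show "(\<integral>\<^sup>+\<xi>. ennreal (norm \<xi> powr (2 * s) * (cmod (w \<xi>))\<^sup>2) \<partial>lebesgue) < \<infinity>" .
  next
    show "is_fourier_of u w"
      unfolding is_fourier_of_def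
    proof (intro conjI allI impI)
      show "w \<in> borel_measurable lebesgue" by (rule measurable_completion) measurable
    next
      fix \<psi> :: "'a \<Rightarrow> real" assume "test_fun UNIV \<psi>"
      then interpret T: test_function \<psi> by unfold_locales
      let ?g = "\<lambda>x. cnj (ift T.f x)"
      note fm = T.f_measurable
      have g: "integrable lborel ?g" "integrable lborel (\<lambda>x. (cmod (?g x))\<^sup>2)" using T.ift_f_integrable by auto
      note P = L.pairing_LIMSEQ[OF g]
      \<comment> \<open>For the integrable truncations the identity defining the transform is the
        multiplication formula. The limit in \<open>k\<close> is then taken on both sides, by
        \<open>pairing_LIMSEQ\<close> in space and by dominated convergence in frequency.\<close>
      have mult: "(LINT x|lborel. ift (v k) x * ?g x) = (LINT \<xi>|lborel. v k \<xi> * T.f \<xi>)" for k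
        using ift_multiplication[OF g(1) vi[of k]] unfolding T.ift_fourier_f by (simp add: mult.commute)
      obtain B where B: "\<And>x. cmod (T.f x) \<le> B" using T.f_bounded by blast
      have f2: "integrable lborel (\<lambda>x. (cmod (T.f x))\<^sup>2)"
      proof (rule Bochner_Integration.integrable_bound[where f="\<lambda>x. B * cmod (T.f x)"])
        show "AE x in lborel. norm ((cmod (T.f x))\<^sup>2) \<le> norm (B * cmod (T.f x))"
        proof (rule AE_I2)
          fix x
          have "cmod (T.f x) * cmod (T.f x) \<le> B * cmod (T.f x)" using B[of x] by (intro mult_right_mono) auto
          then show "norm ((cmod (T.f x))\<^sup>2) \<le> norm (B * cmod (T.f x))" by (simp add: power2_eq_square)
        qed
      qed (use T.f_integrable in auto)
      \<comment> \<open>Majorant for the pairing: the low part of \<open>w\<close> against the bound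
        of the test function, the high part by comparing a product with the sum of squares.\<close>
      define D where "D \<xi> = B * cmod (low w \<xi>) + (cmod (high w \<xi>))\<^sup>2 + (cmod (T.f \<xi>))\<^sup>2" for \<xi>
      have Di: "integrable lborel D" unfolding D_def using low_w high_w f2 by auto
      have D: "cmod (w \<xi>) * cmod (T.f \<xi>) \<le> D \<xi>" for \<xi>
      proof (cases "norm \<xi> < 1")
        case True
        have "cmod (w \<xi>) * cmod (T.f \<xi>) \<le> cmod (w \<xi>) * B" by (intro mult_left_mono B) auto
        then show ?thesis using True by (simp add: D_def low_def high_def mult.commute add_increasing2)
      next
        case False
        have "2 * (cmod (w \<xi>) * cmod (T.f \<xi>)) \<le> (cmod (w \<xi>))\<^sup>2 + (cmod (T.f \<xi>))\<^sup>2"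
          using sum_squares_bound[of "cmod (w \<xi>)" "cmod (T.f \<xi>)"] by (simp add: mult.assoc)
        moreover have "0 \<le> cmod (w \<xi>) * cmod (T.f \<xi>)" by simp
        ultimately have "cmod (w \<xi>) * cmod (T.f \<xi>) \<le> (cmod (w \<xi>))\<^sup>2 + (cmod (T.f \<xi>))\<^sup>2" by linarith
        then show ?thesis using False by (simp add: D_def low_def high_def)
      qed
      have wf: "integrable lborel (\<lambda>\<xi>. w \<xi> * T.f \<xi>)"
        by (rule Bochner_Integration.integrable_bound[OF Di]) (use D fm in \<open>auto simp: norm_mult intro: order_trans[OF _ abs_ge_self]\<close>)
      have "(\<lambda>k. LINT \<xi>|lborel. v k \<xi> * T.f \<xi>) \<longlonglongrightarrow> (LINT \<xi>|lborel. w \<xi> * T.f \<xi>)"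
      proof (rule integral_dominated_convergence[OF _ _ Di])
        show "AE \<xi> in lborel. (\<lambda>k. v k \<xi> * T.f \<xi>) \<longlonglongrightarrow> w \<xi> * T.f \<xi>"
          using L.v_lim by eventually_elim (intro tendsto_mult tendsto_const)
        show "AE \<xi> in lborel. norm (v k \<xi> * T.f \<xi>) \<le> D \<xi>" for k
          using L.v_le
        proof eventually_elim
          case (elim \<xi>)
          then have "cmod (v k \<xi>) * cmod (T.f \<xi>) \<le> cmod (w \<xi>) * cmod (T.f \<xi>)" by (intro mult_right_mono) auto
          then show ?case using D[of \<xi>] by (simp add: norm_mult)
        qed
      qed (use fm in auto)
      then have eq: "(LINT x|lborel. U x * ?g x) = (LINT \<xi>|lborel. w \<xi> * T.f \<xi>)"
        using P(2) unfolding mult by (rule LIMSEQ_unique[rotated])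
      have four: "fourier (\<lambda>y. complex_of_real (\<psi> y)) x = ?g x" for x by (rule T.fourier_f)
      have Ug_meas: "(\<lambda>x. U x * ?g x) \<in> borel_measurable lborel" using fm by measurable
      have ug_meas: "(\<lambda>x. complex_of_real (u x) * ?g x) \<in> borel_measurable lebesgue"
      proof -
        have "?g \<in> borel_measurable lebesgue" by (rule measurable_completion) (use fm in measurable)
        then show ?thesis using u_meas by measurable
      qed
      have AEe: "AE x in lebesgue. complex_of_real (u x) * ?g x = U x * ?g x"
        using AE_leb by eventually_elim (simp add: U_def)
      have "integrable lebesgue (\<lambda>x. U x * ?g x)" using P(1) integrable_completion[OF Ug_meas] by simp
      then show "integrable lebesgue (\<lambda>x. complex_of_real (u x) * fourier (\<lambda>y. complex_of_real (\<psi> y)) x)"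
        unfolding four using integrable_cong_AE[OF ug_meas measurable_completion[OF Ug_meas] AEe] by simp
      have wf_meas: "(\<lambda>\<xi>. w \<xi> * complex_of_real (\<psi> \<xi>)) \<in> borel_measurable lborel"
        using wf unfolding T.f_def by auto
      show "integrable lebesgue (\<lambda>\<xi>. w \<xi> * complex_of_real (\<psi> \<xi>))"
        using wf integrable_completion[OF wf_meas] unfolding T.f_def by simp
      have "(LINT x|lebesgue. complex_of_real (u x) * ?g x) = (LINT x|lebesgue. U x * ?g x)"
        by (rule integral_cong_AE[OF ug_meas measurable_completion[OF Ug_meas] AEe])
      also have "\<dots> = (LINT x|lborel. U x * ?g x)" by (rule integral_completion[OF Ug_meas])
      also have "\<dots> = (LINT \<xi>|lborel. w \<xi> * T.f \<xi>)" by (rule eq)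
      also have "\<dots> = (LINT \<xi>|lebesgue. w \<xi> * complex_of_real (\<psi> \<xi>))"
        unfolding T.f_def by (rule integral_completion[OF wf_meas, symmetric])
      finally show "(LINT x|lebesgue. complex_of_real (u x) * fourier (\<lambda>y. complex_of_real (\<psi> y)) x) = (LINT \<xi>|lebesgue. w \<xi> * complex_of_real (\<psi> \<xi>))"
        unfolding four .
    qed
  qed
  have "(LINT \<xi>|lebesgue. complex_of_real (norm \<xi> powr (2 * s)) * w \<xi> * cnj (fourier (\<lambda>y. complex_of_real (\<psi> y)) \<xi>)) = 0"
    if \<psi>: "test_fun (- F) \<psi>" for \<psi>
  proof -
    have "test_fun UNIV \<psi>" using \<psi> by (simp add: test_fun_def)
    then interpret T: test_function \<psi> by unfold_locales
    note fm = T.f_measurable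
    have "(LINT \<xi>|lebesgue. complex_of_real (norm \<xi> powr (2 * s)) * w \<xi> * cnj (fourier (\<lambda>y. complex_of_real (\<psi> y)) \<xi>))
       = (LINT \<xi>|lborel. complex_of_real (norm \<xi> powr (2 * s)) * w \<xi> * ift T.f \<xi>)"
      unfolding T.fourier_f complex_cnj_cnj by (rule integral_completion) (use fm in measurable)
    \<comment> \<open>The two powers cancel except at the origin, where \<open>0 powr a = 0\<close>;
      hence the equality almost everywhere.\<close>
    also have "\<dots> = (LINT \<xi>|lborel. complex_of_real \<kappa> * (ift T.f \<xi> * hat \<xi>))"
    proof (rule integral_cong_AE)
      show "AE \<xi> in lborel. complex_of_real (norm \<xi> powr (2 * s)) * w \<xi> * ift T.f \<xi> = complex_of_real \<kappa> * (ift T.f \<xi> * hat \<xi>)"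
      proof (rule AE_mp[OF AE_lborel_singleton[of 0] AE_I2], intro impI)
        fix \<xi> :: 'a assume "\<xi> \<noteq> 0"
        then have "norm \<xi> powr (2 * s) * norm \<xi> powr (- (2 * s)) = 1" by (simp flip: powr_add)
        then have e: "complex_of_real (norm \<xi> powr (2 * s)) * complex_of_real (norm \<xi> powr (- (2 * s))) = 1"
          by (metis of_real_mult of_real_1)
        have "complex_of_real (norm \<xi> powr (2 * s)) * w \<xi> * ift T.f \<xi> =
          (complex_of_real (norm \<xi> powr (2 * s)) * complex_of_real (norm \<xi> powr (- (2 * s)))) * (complex_of_real \<kappa> * (ift T.f \<xi> * hat \<xi>))"
          by (simp only: w_def of_real_mult mult_ac)
        then show "complex_of_real (norm \<xi> powr (2 * s)) * w \<xi> * ift T.f \<xi> = complex_of_real \<kappa> * (ift T.f \<xi> * hat \<xi>)"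
          unfolding e by simp
      qed
    qed (use fm in measurable)
    also have "\<dots> = complex_of_real \<kappa> * \<Phi> (\<lambda>Q. LINT \<xi>|lborel. ift T.f \<xi> * character \<xi> Q)"
      unfolding \<Phi>_integral[OF T.ift_f_integrable(1,2)] by simp
    also have "\<Phi> (\<lambda>Q. LINT \<xi>|lborel. ift T.f \<xi> * character \<xi> Q) = 0"
    proof -
      have "T.f P = 0" if "P \<in> F" for P using \<psi> that by (intro T.f_zero) (auto simp: test_fun_def)
      \<comment> \<open>The Lipschitz data are measured on \<open>F\<close>, where the test function
        vanishes, so both constants are 0.\<close>
      then have "lip_on F T.f 0 0" using fm by (simp add: lip_on_def)
      from \<Phi>_bound[OF this] have "\<Phi> T.f = 0" by simp
      then show ?thesis unfolding T.inversion by simp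
    qed
    finally show ?thesis by simp
  qed
  then show ?thesis unfolding frac_harmonic_in_def using Hdot by blast
qed

end

theorem theorem4p3:
  fixes \<Omega> :: "'a::euclidean_space set" and s :: real
    and \<phi> :: "('a \<Rightarrow> real) \<Rightarrow> real" and u :: "'a \<Rightarrow> real"
  assumes "DIM('a) \<ge> 2"
    and "bounded_lipschitz_domain \<Omega>"
    and "1/2 < s" and "s < 1"
    and "\<phi> \<in> Hdual (s - 1/2) \<Omega>"
    and "\<forall>x. x \<notin> frontier \<Omega> \<longrightarrow> u x = \<phi> (\<lambda>Q. riesz_kernel s (x - Q))"
  shows "frac_harmonic_in s u (- frontier \<Omega>)"
proof -
  obtain K R where "energy_functional (frontier \<Omega>) (complexify \<phi>) K R s"
    using energy_functional_of_Hdual[OF assms(1-5)] by blast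
  then interpret energy_functional "frontier \<Omega>" "complexify \<phi>" K R s .
  define k where "k x Q = complex_of_real (norm (x - Q) powr (- (real DIM('a) - 2 * s)))" for x Q :: 'a
  show ?thesis
  proof (rule potential_frac_harmonic)
    fix x assume x: "x \<notin> frontier \<Omega>"
    obtain A L where l: "lip_on (frontier \<Omega>) (k x) A L" using lip_on_kernel[OF x] unfolding k_def by blast
    define rc where "rc = riesz_const DIM('a) s"
    \<comment> \<open>The kernel is real, so its imaginary part is the zero function, whose image
      under \<open>\<phi>\<close> is needed to evaluate \<open>complexify \<phi>\<close>.\<close>
    have "lip_on (frontier \<Omega>) (\<lambda>Q. 0) 0 0" by (simp add: lip_on_def)
    from \<Phi>_bound[OF this] have "complexify \<phi> (\<lambda>Q. 0) = 0" by simp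
    then have z: "\<phi> (\<lambda>Q. 0) = 0" by (simp add: complexify_def complex_eq_iff)
    have "complexify \<phi> (\<lambda>Q. complex_of_real rc * k x Q) = complex_of_real rc * complexify \<phi> (k x)"
      by (rule \<Phi>_scale[OF l])
    moreover have "complexify \<phi> (\<lambda>Q. complex_of_real rc * k x Q) = complex_of_real (u x)"
      using assms(6) x by (simp add: complexify_def k_def rc_def riesz_kernel_def z)
    ultimately show "complex_of_real (u x) = complex_of_real (riesz_const DIM('a) s) * complexify \<phi> (\<lambda>Q. complex_of_real (norm (x - Q) powr (- (real DIM('a) - 2 * s))))"
      unfolding k_def[abs_def] rc_def by simp
  qed
qed

end
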